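(* Let $N\ge1$ and let $\phi:\mathbb{P}^N\to\mathbb{P}^N$ be a morphism defined over $\overline{\mathbb{Q}}$ of degree $d\ge2$. Let $D$ be a nonzero effective divisor on $\mathbb{P}^N$ defined over $\overline{\mathbb{Q}}$, and for $n\ge 0$ let $D^{(n)}_{\mathrm{nc}}$ be the normal-crossings part of $(\phi^{(n)})^*(D)$. Let $$c_n=\frac{\deg D^{(n)}_{\mathrm{nc}}-(N+1)}{\deg(D)\cdot d^n},$$ and let $k$ be a number field that contains the fields of definition of $\phi$, $D$ and $D^{(n)}_{\mathrm{nc}}$. Assume Vojta's conjecture for the divisor $D^{(n)}_{\mathrm{nc}}$ on $\mathbb{P}^N$. Then for any $P\in\mathbb{P}^N(k)$, any finite set $S\subset M_k$, and any $\epsilon>0$, the set $$\left\{\phi^{(m)}(P):\ \frac{\sum_{v\notin S}\lambda_v(D,\phi^{(m)}(P))}{\deg(D)\cdot h(\phi^{(m)}(P))}\le c_n-\epsilon\right\}$$ is not Zariski-dense in $\mathbb{P}^N$. In particular, if $c_n>0$ for some $n$ (for which this assumption on Vojta's conjecture and $k$ holds) and $S$ contains the archimedean places, then $\mathcal{O}_\phi(P)\cap(\mathbb{P}^N\setminus D)(R_S)$ is not Zariski-dense.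
   Context: Iterates and orbits: $\phi^{(m)}$ is the $m$-fold composition of $\phi$ with itself ($\phi^{(0)}=\mathrm{id}$), and $\mathcal{O}_\phi(P)=\{\phi^{(m)}(P):m=0,1,2,\ldots\}$. The degree of $\phi$ is the common degree of the homogeneous polynomials (without common factor) defining it. Heights: For a number field $k$, $M_k$ is the set of its places; for $v\in M_k$, $|\cdot|_v$ is the $\frac{[k_v:\mathbb{Q}_v]}{[k:\mathbb{Q}]}$-th power of the extension of the normalized absolute value on $\mathbb{Q}$, and $v(x)=-\log|x|_v$ (with $v(0)=+\infty$). The Weil height is $h([x_0:\cdots:x_N])=\sum_{v\in M_k}\log\max_i|x_i|_v$. If an effective divisor $D$ on $\mathbb{P}^N$ defined over $k$ is given by a homogeneous polynomial $F$ with coefficients in the ring of integers of $k$ (fix one choice of $F$), the local height is $\lambda_v(D,[x_0:\cdots:x_N])=v(F(x_0,\ldots,x_N))-\deg(D)\min_i v(x_i)$ (equal to $+\infty$ on $|D|$). Quotients of heights are considered only at points of positive height outside $|D|$. Integral points: for a finite set $S\subset M_k$ containing all archimedean places, with ring of $S$-integers $R_S$, $(\mathbb{P}^N\setminus D)(R_S)$ denotes any $(S,D)$-integral set, i.e. any set of the form $\{P\in(\mathbb{P}^N\setminus D)(k):\lambda_v(D,P)\le c'_v\text{ for all }v\notin S\}$ with constants $c'_v$, almost all equal to $0$. Normal crossings: a divisor is normal-crossings if near each point it is defined by $x_1\cdots x_k=0$ where $x_1,\ldots,x_k$ is part of a local (analytic) coordinate system; in particular each irreducible component has multiplicity $1$.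 A normal-crossings part $E_{\mathrm{nc}}$ of an effective divisor $E$ is a normal-crossings subdivisor of $E$ over $\overline{\mathbb{Q}}$ (i.e. $E-E_{\mathrm{nc}}$ effective) of highest possible degree; fix one if there are several. Vojta's conjecture on $\mathbb{P}^N$ for a normal-crossings divisor $E$: for every number field $k$ over which $E$ is defined, every finite set $S\subset M_k$ and every $\epsilon>0$, there exist a finite union $Z_\epsilon$ of hypersurfaces and a constant $C$ such that $\sum_{v\in S}\lambda_v(E,P)<(N+1+\epsilon)h(P)+C$ for all $P\in\mathbb{P}^N(k)\setminus Z_\epsilon$. *)

theory Defs
  imports
    "HOL-Analysis.Infinite_Sum"
    "HOL-Library.Extended_Real"
    "HOL-Library.Poly_Mapping"
    "HOL-Algebra.Algebraic_Closure_Type"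
    "HOL-Algebra.Embedded_Algebras"
    "HOL-Algebra.QuotRing"
begin

section \<open>Polynomials and forms\<close>

text \<open>
  A monomial is a finitely supported exponent function, so a polynomial in the variables
  \<open>x\<^sub>0, x\<^sub>1, \<dots>\<close> is a finitely supported map from monomials to coefficients; the ring
  operations and divisibility are those of \<^theory>\<open>HOL-Library.Poly_Mapping\<close>.
\<close>

type_synonym mpoly = "(nat \<Rightarrow>\<^sub>0 nat) \<Rightarrow>\<^sub>0 complex"

definition poly_const :: "complex \<Rightarrow> mpoly" where
  "poly_const c = Poly_Mapping.single 0 c"

definition poly_var :: "nat \<Rightarrow> mpoly" where
  "poly_var i = Poly_Mapping.single (Poly_Mapping.single i 1) 1"

definition poly_eval :: "mpoly \<Rightarrow> (nat \<Rightarrow> complex) \<Rightarrow> complex" where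
  "poly_eval F x =
     (\<Sum>m\<in>Poly_Mapping.keys F. Poly_Mapping.lookup F m *
        (\<Prod>i\<in>Poly_Mapping.keys m. x i ^ Poly_Mapping.lookup m i))"

definition poly_subst :: "mpoly \<Rightarrow> (nat \<Rightarrow> mpoly) \<Rightarrow> mpoly" where
  "poly_subst F f =
     (\<Sum>m\<in>Poly_Mapping.keys F. poly_const (Poly_Mapping.lookup F m) *
        (\<Prod>i\<in>Poly_Mapping.keys m. f i ^ Poly_Mapping.lookup m i))"

text \<open>
  \<open>forms N K e\<close>: homogeneous polynomials of degree \<open>e\<close> in \<open>x\<^sub>0, \<dots>, x\<^sub>N\<close> with
  coefficients in \<open>K\<close>, including the zero polynomial.
\<close>

definition forms :: "nat \<Rightarrow> complex set \<Rightarrow> nat \<Rightarrow> mpoly set" where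
  "forms N K e =
     {F. \<forall>m\<in>Poly_Mapping.keys F. Poly_Mapping.lookup F m \<in> K \<and>
        Poly_Mapping.keys m \<subseteq> {..N} \<and>
        (\<Sum>i\<in>Poly_Mapping.keys m. Poly_Mapping.lookup m i) = e}"

abbreviation Qbar :: "complex set" where
  "Qbar \<equiv> {z. algebraic z}"


section \<open>Projective space\<close>

definition cone :: "nat \<Rightarrow> complex set \<Rightarrow> (nat \<Rightarrow> complex) set" where
  "cone N K = {x. (\<forall>i\<le>N. x i \<in> K) \<and> (\<forall>i>N. x i = 0) \<and> (\<exists>i\<le>N. x i \<noteq> 0)}"

text \<open>
  A point is the set of all its complex homogeneous coordinate vectors, so that
  \<open>proj_space N K\<close> is literally a subset of \<open>proj_space N L\<close> for \<open>K \<subseteq> L\<close>.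
\<close>

type_synonym point = "(nat \<Rightarrow> complex) set"

definition proj_point :: "(nat \<Rightarrow> complex) \<Rightarrow> point" where
  "proj_point x = {(\<lambda>i. c * x i) | c. c \<noteq> 0}"

definition proj_space :: "nat \<Rightarrow> complex set \<Rightarrow> point set" where
  "proj_space N K = proj_point ` cone N K"

definition hom_coords :: "nat \<Rightarrow> complex set \<Rightarrow> point \<Rightarrow> (nat \<Rightarrow> complex)" where
  "hom_coords N K P = (SOME x. x \<in> cone N K \<and> x \<in> P)"

definition zero_locus :: "nat \<Rightarrow> mpoly set \<Rightarrow> point set" where
  "zero_locus N T = {P \<in> proj_space N Qbar. \<forall>F\<in>T. \<forall>x\<in>P. poly_eval F x = 0}"

definition zariski_closed :: "nat \<Rightarrow> point set \<Rightarrow> bool" where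
  "zariski_closed N V \<longleftrightarrow> (\<exists>T. T \<subseteq> (\<Union>e. forms N Qbar e) \<and> V = zero_locus N T)"

definition zariski_dense :: "nat \<Rightarrow> point set \<Rightarrow> bool" where
  "zariski_dense N A \<longleftrightarrow>
     (\<forall>V. zariski_closed N V \<and> A \<subseteq> V \<longrightarrow> V = proj_space N Qbar)"


section \<open>Morphisms\<close>

text \<open>
  A morphism of degree \<open>d\<close> is given by forms \<open>f 0, \<dots>, f N\<close> of degree \<open>d\<close> without
  common zero. For \<open>N \<ge> 1\<close> such forms have no common factor, as any nonconstant form
  has a zero.
\<close>

definition proj_morphism :: "nat \<Rightarrow> complex set \<Rightarrow> nat \<Rightarrow> (nat \<Rightarrow> mpoly) \<Rightarrow> bool" where
  "proj_morphism N K d f \<longleftrightarrow>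
     (\<forall>i\<le>N. f i \<in> forms N K d) \<and>
     (\<forall>x\<in>cone N Qbar. \<exists>i\<le>N. poly_eval (f i) x \<noteq> 0)"

definition proj_map :: "nat \<Rightarrow> (nat \<Rightarrow> mpoly) \<Rightarrow> point \<Rightarrow> point" where
  "proj_map N f P =
     {(\<lambda>i. if i \<le> N then c * poly_eval (f i) x else 0) | c x. c \<noteq> 0 \<and> x \<in> P}"

definition orbit :: "nat \<Rightarrow> (nat \<Rightarrow> mpoly) \<Rightarrow> point \<Rightarrow> point set" where
  "orbit N f P = {(proj_map N f ^^ m) P | m. True}"

primrec iterate_forms :: "(nat \<Rightarrow> mpoly) \<Rightarrow> nat \<Rightarrow> (nat \<Rightarrow> mpoly)" where
  "iterate_forms f 0 = poly_var"
| "iterate_forms f (Suc n) = (\<lambda>i. poly_subst (f i) (iterate_forms f n))"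


section \<open>Effective divisors\<close>

text \<open>
  An effective divisor on projective space is represented by a form defining it, i.e. a
  nonzero form, which is unique up to a nonzero constant. The degree is that of the form,
  sums of divisors are products of forms, and the zero divisor is given by constants.
  Consequently \<open>E - E'\<close> is effective iff the form of \<open>E'\<close> divides the form of \<open>E\<close>, and the
  pullback under a morphism is obtained by substituting its defining forms.
\<close>

definition div_form :: "nat \<Rightarrow> complex set \<Rightarrow> nat \<Rightarrow> mpoly \<Rightarrow> bool" where
  "div_form N K e F \<longleftrightarrow> F \<in> forms N K e \<and> F \<noteq> 0"

definition same_divisor :: "mpoly \<Rightarrow> mpoly \<Rightarrow> bool" where
  "same_divisor F G \<longleftrightarrow> (\<exists>c. c \<noteq> 0 \<and> G = poly_const c * F)"

definition div_support :: "nat \<Rightarrow> mpoly \<Rightarrow> point set" where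
  "div_support N F = zero_locus N {F}"

definition div_pullback :: "(nat \<Rightarrow> mpoly) \<Rightarrow> mpoly \<Rightarrow> mpoly" where
  "div_pullback f F = poly_subst F f"


section \<open>Normal crossings\<close>

text \<open>
  Points of complex affine \<open>N\<close>-space are functions of which only the values at
  \<open>0, \<dots>, N - 1\<close> matter.
\<close>

definition polydisc :: "nat \<Rightarrow> (nat \<Rightarrow> complex) \<Rightarrow> real \<Rightarrow> (nat \<Rightarrow> complex) set" where
  "polydisc N p r = {y. \<forall>j<N. cmod (y j - p j) < r}"

definition analytic_near :: "nat \<Rightarrow> ((nat \<Rightarrow> complex) \<Rightarrow> complex) \<Rightarrow> (nat \<Rightarrow> complex) \<Rightarrow> bool" where
  "analytic_near N g p \<longleftrightarrow>
     (\<exists>a r. r > 0 \<and> (\<forall>y\<in>polydisc N p r.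
        ((\<lambda>m :: nat \<Rightarrow>\<^sub>0 nat. a m * (\<Prod>j<N. (y j - p j) ^ Poly_Mapping.lookup m j))
           has_sum g y) {m. Poly_Mapping.keys m \<subseteq> {..<N}}))"

text \<open>
  An analytic coordinate system at \<open>p\<close>: a germ of a biholomorphic map sending \<open>p\<close> to the
  origin, \<open>w\<close> being its inverse.
\<close>

definition analytic_coords ::
    "nat \<Rightarrow> (nat \<Rightarrow> (nat \<Rightarrow> complex) \<Rightarrow> complex) \<Rightarrow> (nat \<Rightarrow> complex) \<Rightarrow> bool" where
  "analytic_coords N x p \<longleftrightarrow>
     (\<forall>j<N. analytic_near N (x j) p \<and> x j p = 0) \<and>
     (\<exists>w r. r > 0 \<and> (\<forall>j<N. analytic_near N (w j) (\<lambda>_. 0)) \<and>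
        (\<forall>y\<in>polydisc N p r. \<forall>j<N. w j (\<lambda>i. x i y) = y j) \<and>
        (\<forall>t\<in>polydisc N (\<lambda>_. 0) r. \<forall>j<N. x j (\<lambda>i. w i t) = t j))"

definition nc_equation_at :: "nat \<Rightarrow> ((nat \<Rightarrow> complex) \<Rightarrow> complex) \<Rightarrow> (nat \<Rightarrow> complex) \<Rightarrow> bool" where
  "nc_equation_at N g p \<longleftrightarrow>
     (\<exists>x u s r. analytic_coords N x p \<and> s \<le> N \<and>
        analytic_near N u p \<and> u p \<noteq> 0 \<and> r > 0 \<and>
        (\<forall>y\<in>polydisc N p r. g y = u y * (\<Prod>j<s. x j y)))"

text \<open>The standard chart \<open>x\<^sub>i \<noteq> 0\<close> of projective \<open>N\<close>-space and its inverse.\<close>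

definition chart_coords :: "nat \<Rightarrow> (nat \<Rightarrow> complex) \<Rightarrow> (nat \<Rightarrow> complex)" where
  "chart_coords i a = (\<lambda>j. (if j < i then a j else a (Suc j)) / a i)"

definition chart_inv :: "nat \<Rightarrow> (nat \<Rightarrow> complex) \<Rightarrow> (nat \<Rightarrow> complex)" where
  "chart_inv i y = (\<lambda>j. if j < i then y j else if j = i then 1 else y (j - 1))"

definition normal_crossings :: "nat \<Rightarrow> mpoly \<Rightarrow> bool" where
  "normal_crossings N G \<longleftrightarrow>
     (\<forall>a\<in>cone N UNIV. \<forall>i\<le>N. a i \<noteq> 0 \<longrightarrow>
        nc_equation_at N (\<lambda>y. poly_eval G (chart_inv i y)) (chart_coords i a))"

definition nc_subdivisor :: "nat \<Rightarrow> mpoly \<Rightarrow> nat \<Rightarrow> mpoly \<Rightarrow> bool" where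
  "nc_subdivisor N E e G \<longleftrightarrow> div_form N Qbar e G \<and> G dvd E \<and> normal_crossings N G"

definition nc_part :: "nat \<Rightarrow> mpoly \<Rightarrow> nat \<Rightarrow> mpoly \<Rightarrow> bool" where
  "nc_part N E e G \<longleftrightarrow>
     nc_subdivisor N E e G \<and> (\<forall>e' G'. nc_subdivisor N E e' G' \<longrightarrow> e' \<le> e)"


section \<open>Number fields and places\<close>

text \<open>Number fields are taken inside the complex numbers.\<close>

abbreviation complex_ring :: "complex ring" where
  "complex_ring \<equiv> ring_of_type_algebra"

definition number_field :: "complex set \<Rightarrow> bool" where
  "number_field k \<longleftrightarrow>
     subfield k complex_ring \<and> ring.finite_dimension complex_ring \<rat> k"

definition field_degree :: "complex set \<Rightarrow> nat" where
  "field_degree k = ring.dim complex_ring \<rat> k"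

definition ring_of_integers :: "complex set \<Rightarrow> complex set" where
  "ring_of_integers k = {x \<in> k. algebraic_int x}"

definition absolute_value_on :: "complex set \<Rightarrow> (complex \<Rightarrow> real) \<Rightarrow> bool" where
  "absolute_value_on k v \<longleftrightarrow>
     (\<forall>x\<in>k. v x \<ge> 0 \<and> (v x = 0 \<longleftrightarrow> x = 0)) \<and>
     (\<forall>x\<in>k. \<forall>y\<in>k. v (x * y) = v x * v y \<and> v (x + y) \<le> v x + v y)"

definition extends_usual :: "(complex \<Rightarrow> real) \<Rightarrow> bool" where
  "extends_usual v \<longleftrightarrow> (\<forall>x\<in>\<rat>. v x = cmod x)"

text \<open>
  The values on the nonzero integers determine a multiplicative function on the nonzero
  rationals.
\<close>

definition extends_padic :: "nat \<Rightarrow> (complex \<Rightarrow> real) \<Rightarrow> bool" where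
  "extends_padic p v \<longleftrightarrow>
     (\<forall>m::int. m \<noteq> 0 \<longrightarrow> v (of_int m) = 1 / real p ^ multiplicity (int p) m)"

text \<open>
  Each place is represented by its unique absolute value extending a normalized absolute
  value of the rationals, set to \<open>0\<close> outside \<open>k\<close>.
\<close>

definition places :: "complex set \<Rightarrow> (complex \<Rightarrow> real) set" where
  "places k = {v. absolute_value_on k v \<and> (\<forall>x. x \<notin> k \<longrightarrow> v x = 0) \<and>
                  (extends_usual v \<or> (\<exists>p. Factorial_Ring.prime p \<and> extends_padic p v))}"

definition archimedean_places :: "complex set \<Rightarrow> (complex \<Rightarrow> real) set" where
  "archimedean_places k = {v \<in> places k. extends_usual v}"

text \<open>
  The completion of \<open>k\<close> at \<open>v\<close> is the ring of Cauchy sequences modulo the ideal of null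
  sequences; the closure of the rationals in it is the completion of \<open>\<rat>\<close> at the place
  below \<open>v\<close>.
\<close>

definition cauchy_ring :: "complex set \<Rightarrow> (complex \<Rightarrow> real) \<Rightarrow> (nat \<Rightarrow> complex) ring" where
  "cauchy_ring k v =
     \<lparr> carrier = {s. (\<forall>n. s n \<in> k) \<and>
                    (\<forall>\<delta>>0. \<exists>M. \<forall>m\<ge>M. \<forall>n\<ge>M. v (s m - s n) < \<delta>)},
       monoid.mult = (\<lambda>s t n. s n * t n),
       one = (\<lambda>_. 1),
       zero = (\<lambda>_. 0),
       add = (\<lambda>s t n. s n + t n) \<rparr>"

definition null_ideal :: "complex set \<Rightarrow> (complex \<Rightarrow> real) \<Rightarrow> (nat \<Rightarrow> complex) set" where
  "null_ideal k v = {s \<in> carrier (cauchy_ring k v). (\<lambda>n. v (s n)) \<longlonglongrightarrow> 0}"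

definition completion :: "complex set \<Rightarrow> (complex \<Rightarrow> real) \<Rightarrow> (nat \<Rightarrow> complex) set ring" where
  "completion k v = cauchy_ring k v Quot null_ideal k v"

definition completion_Rats :: "complex set \<Rightarrow> (complex \<Rightarrow> real) \<Rightarrow> (nat \<Rightarrow> complex) set set" where
  "completion_Rats k v =
     {null_ideal k v +>\<^bsub>cauchy_ring k v\<^esub> s | s. s \<in> carrier (cauchy_ring k v) \<and> (\<forall>n. s n \<in> \<rat>)}"

definition local_degree :: "complex set \<Rightarrow> (complex \<Rightarrow> real) \<Rightarrow> nat" where
  "local_degree k v =
     ring.dim (completion k v) (completion_Rats k v) (carrier (completion k v))"


section \<open>Heights\<close>

definition norm_abs :: "complex set \<Rightarrow> (complex \<Rightarrow> real) \<Rightarrow> complex \<Rightarrow> real" where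
  "norm_abs k v x = v x powr (real (local_degree k v) / real (field_degree k))"

definition place_val :: "complex set \<Rightarrow> (complex \<Rightarrow> real) \<Rightarrow> complex \<Rightarrow> ereal" where
  "place_val k v x = (if x = 0 then \<infinity> else ereal (- ln (norm_abs k v x)))"

text \<open>
  The Weil height and the local height below do not depend on the homogeneous coordinates
  chosen by \<open>hom_coords\<close>. All but finitely many of the terms of the sums over places are \<open>0\<close>.
\<close>

definition weil_height :: "nat \<Rightarrow> complex set \<Rightarrow> point \<Rightarrow> real" where
  "weil_height N k P =
     (\<Sum>\<^sub>\<infinity>v\<in>places k. ln (Max ((\<lambda>i. norm_abs k v (hom_coords N k P i)) ` {..N})))"

text \<open>
  The local height of the divisor given by the form \<open>F\<close> of degree \<open>e\<close>, for this choice of \<open>F\<close>.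
\<close>

definition local_height ::
    "nat \<Rightarrow> complex set \<Rightarrow> nat \<Rightarrow> mpoly \<Rightarrow> (complex \<Rightarrow> real) \<Rightarrow> point \<Rightarrow> ereal" where
  "local_height N k e F v P =
     place_val k v (poly_eval F (hom_coords N k P))
       - ereal (real e) * Min ((\<lambda>i. place_val k v (hom_coords N k P i)) ` {..N})"

definition integral_set ::
    "nat \<Rightarrow> complex set \<Rightarrow> (complex \<Rightarrow> real) set \<Rightarrow> nat \<Rightarrow> mpoly \<Rightarrow> point set \<Rightarrow> bool" where
  "integral_set N k S e F A \<longleftrightarrow>
     (\<exists>c. finite {v \<in> places k - S. c v \<noteq> 0} \<and>
        A = {P \<in> proj_space N k - div_support N F.
               \<forall>v\<in>places k - S. local_height N k e F v P \<le> ereal (c v)})"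


section \<open>Vojta's conjecture for a divisor on projective space\<close>

text \<open>
  Here \<open>E\<close> is any form of degree \<open>e\<close> defining the divisor. For each number field over which
  the divisor is defined, the inequality refers to a form \<open>E'\<close> with integral coefficients
  defining the same divisor; another choice of \<open>E'\<close> only changes the constant \<open>C\<close>.
\<close>

definition vojta_conjecture :: "nat \<Rightarrow> nat \<Rightarrow> mpoly \<Rightarrow> bool" where
  "vojta_conjecture N e E \<longleftrightarrow>
     (\<forall>k E' S \<epsilon>.
        number_field k \<and> div_form N (ring_of_integers k) e E' \<and> same_divisor E E' \<and>
        finite S \<and> S \<subseteq> places k \<and> \<epsilon> > 0 \<longrightarrow>
        (\<exists>\<H> C. finite \<H> \<and> (\<forall>H\<in>\<H>. \<exists>b\<ge>1. div_form N Qbar b H) \<and>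
           (\<forall>P\<in>proj_space N k - (\<Union>H\<in>\<H>. div_support N H).
              (\<Sum>v\<in>S. local_height N k e E' v P)
                < ereal ((real N + 1 + \<epsilon>) * weil_height N k P + C))))"

end

theory Submission
  imports Defs "Jordan_Normal_Form.Char_Poly"
begin

text \<open>
  Write \<open>Q = \<phi>\<^sup>n(R)\<close> with \<open>R\<close> in the orbit. The local heights of \<open>D\<close> at \<open>Q\<close> are those of
  \<open>(\<phi>\<^sup>n)\<^sup>*D\<close> at \<open>R\<close> up to bounded errors that vanish at almost all places, hence they are at least
  those of \<open>D\<^sub>n\<^sub>c\<close> at \<open>R\<close>. By the product formula all local heights of \<open>D\<^sub>n\<^sub>c\<close> at \<open>R\<close> sum to
  \<open>deg(D\<^sub>n\<^sub>c) h(R)\<close>, and Vojta's conjecture bounds the part coming from \<open>S\<close>. Since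
  \<open>h(Q) \<le> d\<^sup>n h(R) + O(1)\<close>, an upper bound \<open>c - \<epsilon>\<close> for the quotient bounds \<open>h(R)\<close>, so by
  Northcott's theorem only finitely many \<open>R\<close> outside the exceptional hypersurfaces remain. The
  images of these hypersurfaces under \<open>\<phi>\<^sup>n\<close> again lie in hypersurfaces.

  The lower bound for the size of \<open>\<phi>\<^sup>n(R)\<close> needs the projective Nullstellensatz. The product formula
  is obtained by comparing, place by place, the local degree with the embeddings of the number field
  into the field of algebraic numbers on which an absolute value of \<open>\<rat>\<close> has been extended.
\<close>

subsection \<open>Linear algebra over subfields of the complex numbers\<close>

text \<open>The statement measures places through completions, \<open>local_degree\<close> being a
  dimension over the closure of the rationals, while the estimates are easier for embeddings of
  \<open>k\<close> into one large field. The bridge is a squeeze: each place has local degree at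
  least the number of embeddings that induce it, and the local degrees over one place of the
  rationals sum to at most the number of all embeddings. One absolute value on \<open>Qbar\<close>
  has to serve all embeddings, which is why the p-adic ones are extended to \<open>Qbar\<close> by
  Zorn's lemma and not one finite extension at a time. Local heights make sense only for
  coefficients in \<open>k\<close>. So two facts obtained over larger fields, the Nullstellensatz
  identities over \<open>Qbar\<close> and the divisibility of the pullback over the complex numbers,
  are brought down to \<open>k\<close> by solving linear systems. The sign of c - \<epsilon>
  matters, since an upper bound for h(Q) is multiplied by it. When it is negative, the lower bound
  for local heights of an effective divisor already bounds h(Q).\<close>

locale cfield =
  fixes K :: "complex set"
  assumes zero [simp, intro]: "0 \<in> K" and one [simp, intro]: "1 \<in> K"
    and add [intro]: "\<And>x y. x \<in> K \<Longrightarrow> y \<in> K \<Longrightarrow> x + y \<in> K"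
    and mult [intro]: "\<And>x y. x \<in> K \<Longrightarrow> y \<in> K \<Longrightarrow> x * y \<in> K"
    and uminus [intro]: "\<And>x. x \<in> K \<Longrightarrow> - x \<in> K"
    and inverse [intro]: "\<And>x. x \<in> K \<Longrightarrow> inverse x \<in> K"
begin

lemma diff [intro]: "x \<in> K \<Longrightarrow> y \<in> K \<Longrightarrow> x - y \<in> K"
  using add[of x "- y"] uminus[of y] by simp

lemma divide [intro]: "x \<in> K \<Longrightarrow> y \<in> K \<Longrightarrow> x / y \<in> K"
  by (simp add: divide_inverse mult inverse)

lemma power [intro]: "x \<in> K \<Longrightarrow> x ^ n \<in> K"
  by (induction n) auto

lemma sum [intro]: "(\<And>i. i \<in> I \<Longrightarrow> f i \<in> K) \<Longrightarrow> (\<Sum>i\<in>I. f i) \<in> K"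
  by (induction I rule: infinite_finite_induct) auto

lemma prod [intro]: "(\<And>i. i \<in> I \<Longrightarrow> f i \<in> K) \<Longrightarrow> (\<Prod>i\<in>I. f i) \<in> K"
  by (induction I rule: infinite_finite_induct) auto

lemma of_nat [simp, intro]: "of_nat n \<in> K"
  by (induction n) auto

lemma of_int [simp, intro]: "of_int n \<in> K"
  by (cases n) (auto simp: uminus simp del: of_nat_Suc)

lemma Rats_subset: "\<rat> \<subseteq> K"
proof
  fix x :: complex assume "x \<in> \<rat>"
  then obtain a b where "x = of_int a / of_int b" by (auto elim!: Rats_cases'[of x])
  then show "x \<in> K" by auto
qed

lemma poly [intro]: "(\<And>i. coeff p i \<in> K) \<Longrightarrow> x \<in> K \<Longrightarrow> poly p x \<in> K"
  unfolding poly_altdef by auto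

text \<open>Gaussian elimination on the finite set of equations. A nonzero coefficient at
  \<open>j0\<close> in the equation \<open>e0\<close> removes the unknown \<open>j0\<close> from all
  other equations; its value \<open>t\<close> is read off at the end. Index sets of arbitrary type
  allow monomials, embeddings or pairs as unknowns.\<close>

lemma homogeneous_solution:
  fixes A :: "'e \<Rightarrow> 'j \<Rightarrow> complex"
  assumes "finite E" "finite J" "card E < card J" "\<And>e j. e \<in> E \<Longrightarrow> j \<in> J \<Longrightarrow> A e j \<in> K"
  shows "\<exists>y. (\<forall>j\<in>J. y j \<in> K) \<and> (\<exists>j\<in>J. y j \<noteq> 0) \<and> (\<forall>e\<in>E. (\<Sum>j\<in>J. A e j * y j) = 0)"
  using assms
proof (induction E arbitrary: A J rule: finite_induct)
  case empty
  then obtain j where "j \<in> J" by fastforce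
  then show ?case by (intro exI[of _ "\<lambda>_. 1"]) auto
next
  case (insert e0 E A J)
  show ?case
  proof (cases "\<forall>j\<in>J. A e0 j = 0")
    case True
    obtain y where "(\<forall>j\<in>J. y j \<in> K) \<and> (\<exists>j\<in>J. y j \<noteq> 0) \<and> (\<forall>e\<in>E. (\<Sum>j\<in>J. A e j * y j) = 0)"
      using insert.IH[of J A] insert.prems insert.hyps by auto
    with True show ?thesis by (intro exI[of _ y]) auto
  next
    case False
    then obtain j0 where j0: "j0 \<in> J" "A e0 j0 \<noteq> 0" by blast
    define J' where "J' = J - {j0}"
    have J: "J = insert j0 J'" "j0 \<notin> J'" "finite J'" using j0 insert.prems by (auto simp: J'_def)
    have c: "card E < card J'" using insert.prems insert.hyps J by simp
    define A' where "A' = (\<lambda>e j. A e j - A e j0 / A e0 j0 * A e0 j)"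
    have "A' e j \<in> K" if "e \<in> E" "j \<in> J'" for e j
      using that insert.prems(3) J unfolding A'_def by (intro diff mult divide) auto
    then obtain y where y: "\<forall>j\<in>J'. y j \<in> K" "\<exists>j\<in>J'. y j \<noteq> 0" "\<forall>e\<in>E. (\<Sum>j\<in>J'. A' e j * y j) = 0"
      using insert.IH[of J' A'] c J by auto
    define t where "t = - (\<Sum>j\<in>J'. A e0 j * y j) / A e0 j0"
    define y' where "y' = y(j0 := t)"
    have sum_y': "(\<Sum>j\<in>J. A e j * y' j) = A e j0 * t + (\<Sum>j\<in>J'. A e j * y j)" for e
    proof -
      have "(\<Sum>j\<in>J'. A e j * y' j) = (\<Sum>j\<in>J'. A e j * y j)"
        using J by (intro sum.cong) (auto simp: y'_def)
      then show ?thesis using J by (simp add: y'_def)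
    qed
    have "t \<in> K" unfolding t_def using y insert.prems(3) J by (intro divide uminus sum mult) auto
    moreover have "(\<Sum>j\<in>J. A e j * y' j) = 0" if e: "e \<in> insert e0 E" for e
    proof (cases "e = e0")
      case True
      then show ?thesis using j0 by (simp add: sum_y' t_def)
    next
      case False
      then have "0 = (\<Sum>j\<in>J'. A' e j * y j)" using e y by auto
      also have "\<dots> = (\<Sum>j\<in>J'. A e j * y j) - A e j0 / A e0 j0 * (\<Sum>j\<in>J'. A e0 j * y j)"
        by (simp add: A'_def algebra_simps sum_subtractf sum_distrib_left)
      finally show ?thesis by (simp add: sum_y' t_def)
    qed
    moreover have "\<exists>j\<in>J. y' j \<noteq> 0" using y(2) J by (metis fun_upd_apply insertI2 y'_def)
    moreover have "\<forall>j\<in>J. y' j \<in> K" using y(1) J \<open>t \<in> K\<close> by (simp add: y'_def)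
    ultimately show ?thesis by blast
  qed
qed

text \<open>The induction runs over the unknowns and not over the equations, because
  \<open>E\<close> may be infinite: later the equations are indexed by all exponent vectors. The
  complex solution \<open>z\<close> guarantees consistency, which the elimination preserves since
  \<open>z\<close> still solves the reduced system.\<close>

lemma solution_descent:
  fixes A :: "'e \<Rightarrow> 'j \<Rightarrow> complex"
  assumes "finite J" "\<And>e j. e \<in> E \<Longrightarrow> j \<in> J \<Longrightarrow> A e j \<in> K" "\<And>e. e \<in> E \<Longrightarrow> b e \<in> K"
    and "\<And>e. e \<in> E \<Longrightarrow> (\<Sum>j\<in>J. A e j * z j) = b e"
  shows "\<exists>y. (\<forall>j\<in>J. y j \<in> K) \<and> (\<forall>e\<in>E. (\<Sum>j\<in>J. A e j * y j) = b e)"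
  using assms
proof (induction J arbitrary: A b rule: finite_induct)
  case empty
  then show ?case by simp
next
  case (insert j1 J A b)
  show ?case
  proof (cases "\<forall>e\<in>E. A e j1 = 0")
    case True
    have "(\<Sum>j\<in>J. A e j * z j) = b e" if "e \<in> E" for e
      using insert.prems(3)[OF that] insert.hyps True that by simp
    then obtain y where y: "(\<forall>j\<in>J. y j \<in> K) \<and> (\<forall>e\<in>E. (\<Sum>j\<in>J. A e j * y j) = b e)"
      using insert.IH[of A b] insert.prems(1,2) by blast
    have "(\<Sum>j\<in>J. A e j * (y(j1 := 0)) j) = (\<Sum>j\<in>J. A e j * y j)" for e
      using insert.hyps by (intro sum.cong) auto
    with True y insert.hyps show ?thesis by (intro exI[of _ "y(j1 := 0)"]) auto
  next
    case False
    then obtain e1 where e1: "e1 \<in> E" "A e1 j1 \<noteq> 0" by blast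
    define r where "r = (\<lambda>e. A e j1 / A e1 j1)"
    have r: "r e \<in> K" if "e \<in> E" for e using that insert.prems(1) e1 unfolding r_def by auto
    define A' where "A' = (\<lambda>e j. A e j - r e * A e1 j)"
    define b' where "b' = (\<lambda>e. b e - r e * b e1)"
    have "A' e j \<in> K" if "e \<in> E" "j \<in> J" for e j
      using that insert.prems(1) e1 r unfolding A'_def by (intro diff mult) auto
    moreover have "b' e \<in> K" if "e \<in> E" for e
      using that insert.prems(2) e1 r unfolding b'_def by auto
    moreover have "(\<Sum>j\<in>J. A' e j * z j) = b' e" if e: "e \<in> E" for e
    proof -
      have "(\<Sum>j\<in>J. A' e j * z j) = (\<Sum>j\<in>J. A e j * z j) - r e * (\<Sum>j\<in>J. A e1 j * z j)"
        by (simp add: A'_def algebra_simps sum_subtractf sum_distrib_left)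
      moreover have "A e j1 * z j1 + (\<Sum>j\<in>J. A e j * z j) = b e" "A e1 j1 * z j1 + (\<Sum>j\<in>J. A e1 j * z j) = b e1"
        using insert.prems(3)[OF e] insert.prems(3)[OF e1(1)] insert.hyps by auto
      moreover have "A e j1 = r e * A e1 j1" using e1 by (simp add: r_def)
      ultimately have "(\<Sum>j\<in>J. A' e j * z j) = b e - r e * A e1 j1 * z j1 - r e * (b e1 - A e1 j1 * z j1)"
        by (metis add_diff_cancel_left')
      then show ?thesis unfolding b'_def by (simp add: algebra_simps)
    qed
    ultimately obtain y where y: "\<forall>j\<in>J. y j \<in> K" "\<forall>e\<in>E. (\<Sum>j\<in>J. A' e j * y j) = b' e"
      using insert.IH[of A' b'] by blast
    define t where "t = (b e1 - (\<Sum>j\<in>J. A e1 j * y j)) / A e1 j1"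
    have "t \<in> K" unfolding t_def using y(1) insert.prems(1,2) e1 by (intro divide diff sum mult) auto
    moreover have "A e j1 * t + (\<Sum>j\<in>J. A e j * y j) = b e" if e: "e \<in> E" for e
    proof -
      have "(\<Sum>j\<in>J. A e j * y j) - r e * (\<Sum>j\<in>J. A e1 j * y j) = b e - r e * b e1"
        using y(2) e by (simp add: A'_def b'_def algebra_simps sum_subtractf sum_distrib_left)
      moreover have "A e j1 * t = r e * (b e1 - (\<Sum>j\<in>J. A e1 j * y j))"
        using e1 by (simp add: r_def t_def)
      ultimately have "(\<Sum>j\<in>J. A e j * y j) = b e - r e * b e1 + r e * (\<Sum>j\<in>J. A e1 j * y j)"
        "A e j1 * t = r e * (b e1 - (\<Sum>j\<in>J. A e1 j * y j))" by (simp_all only: diff_eq_eq)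
      then show ?thesis by (simp add: right_diff_distrib)
    qed
    moreover have "(\<Sum>j\<in>J. A e j * (y(j1 := t)) j) = (\<Sum>j\<in>J. A e j * y j)" for e
      using insert.hyps by (intro sum.cong) auto
    ultimately have "\<forall>e\<in>E. (\<Sum>j\<in>insert j1 J. A e j * (y(j1 := t)) j) = b e"
      using insert.hyps by simp
    then show ?thesis using y(1) \<open>t \<in> K\<close> by (intro exI[of _ "y(j1 := t)"]) simp
  qed
qed

end

lemma cfield_Rats: "cfield \<rat>"
  by unfold_locales auto


subsection \<open>Integral elements\<close>

text \<open>Integrality over a subring is developed once and used twice: over \<open>\<int>\<close>
  it describes algebraic integers, over \<open>\<rat>\<close> algebraic numbers. Both closure
  properties then come from the same module argument.\<close>

locale csubring =
  fixes R :: "complex set"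
  assumes zero [simp, intro]: "0 \<in> R" and one [simp, intro]: "1 \<in> R"
    and add [intro]: "\<And>x y. x \<in> R \<Longrightarrow> y \<in> R \<Longrightarrow> x + y \<in> R"
    and mult [intro]: "\<And>x y. x \<in> R \<Longrightarrow> y \<in> R \<Longrightarrow> x * y \<in> R"
    and uminus [intro]: "\<And>x. x \<in> R \<Longrightarrow> - x \<in> R"
begin

lemma diff [intro]: "x \<in> R \<Longrightarrow> y \<in> R \<Longrightarrow> x - y \<in> R"
  using add[of x "- y"] uminus[of y] by simp

lemma sum [intro]: "(\<And>i. i \<in> I \<Longrightarrow> f i \<in> R) \<Longrightarrow> (\<Sum>i\<in>I. f i) \<in> R"
  by (induction I rule: infinite_finite_induct) auto

lemma prod [intro]: "(\<And>i. i \<in> I \<Longrightarrow> f i \<in> R) \<Longrightarrow> (\<Prod>i\<in>I. f i) \<in> R"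
  by (induction I rule: infinite_finite_induct) auto

lemma det_mem:
  assumes "A \<in> carrier_mat n n" "\<And>i j. i < n \<Longrightarrow> j < n \<Longrightarrow> A $$ (i, j) \<in> R"
  shows "det A \<in> R"
proof -
  have "signof p * (\<Prod>i = 0..<n. A $$ (i, p i)) \<in> R" if "p permutes {0..<n}" for p
  proof -
    have "(\<Prod>i = 0..<n. A $$ (i, p i)) \<in> R"
      using assms(2) that by (intro prod) (auto simp: permutes_in_image)
    then show ?thesis by (auto simp: sign_def)
  qed
  then show ?thesis unfolding det_def'[OF assms(1)] by auto
qed

lemma coeff_mult_mem:
  assumes "\<And>i. coeff p i \<in> R" "\<And>i. coeff q i \<in> R"
  shows "coeff (p * q) i \<in> R"
  unfolding coeff_mult using assms by auto

lemma coeff_prod_mem: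
  assumes "\<And>j i. j \<in> I \<Longrightarrow> coeff (f j) i \<in> R"
  shows "coeff (\<Prod>j\<in>I. f j) i \<in> R"
  using assms by (induction I arbitrary: i rule: infinite_finite_induct) (auto intro!: coeff_mult_mem)

lemma coeff_char_poly_mem:
  assumes A: "A \<in> carrier_mat n n" and "\<And>i j. i < n \<Longrightarrow> j < n \<Longrightarrow> A $$ (i, j) \<in> R"
  shows "coeff (char_poly A) i \<in> R"
proof -
  have *: "char_poly_matrix A \<in> carrier_mat n n" using A by simp
  have e: "coeff (char_poly_matrix A $$ (i, j)) l \<in> R" if "i < n" "j < n" for i j l
    using that A assms(2) by (auto simp: char_poly_matrix_def coeff_pCons split: nat.splits)
  have "coeff (signof p * (\<Prod>i = 0..<n. char_poly_matrix A $$ (i, p i))) l \<in> R"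
    if "p permutes {0..<n}" for p l
  proof -
    have "coeff (\<Prod>i = 0..<n. char_poly_matrix A $$ (i, p i)) l \<in> R"
      using e that by (intro coeff_prod_mem) (auto simp: permutes_in_image)
    then show ?thesis by (auto simp: sign_def)
  qed
  then show ?thesis unfolding char_poly_def det_def'[OF *] coeff_sum by auto
qed

text \<open>The determinant trick.\<close>

lemma integral_if_stable:
  assumes B: "finite B" "b \<in> B" "b \<noteq> 0"
    and M: "\<And>x. x \<in> B \<Longrightarrow> \<exists>M. (\<forall>z\<in>B. M z \<in> R) \<and> y * x = (\<Sum>z\<in>B. M z * z)"
  shows "\<exists>p. lead_coeff p = 1 \<and> (\<forall>i. coeff p i \<in> R) \<and> poly p y = 0"
proof -
  obtain n :: nat and e where n: "n = card B" "bij_betw e {0..<n} B"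
    using B ex_bij_betw_nat_finite by blast
  from M obtain M where M: "\<And>x z. x \<in> B \<Longrightarrow> z \<in> B \<Longrightarrow> M x z \<in> R" "\<And>x. x \<in> B \<Longrightarrow> y * x = (\<Sum>z\<in>B. M x z * z)"
    by metis
  have eB: "e i \<in> B" if "i < n" for i using n(2) that by (auto simp: bij_betw_def)
  define A where "A = mat n n (\<lambda>(i, j). M (e i) (e j))"
  have A: "A \<in> carrier_mat n n" by (simp add: A_def)
  define w where "w = vec n e"
  obtain i0 where i0: "i0 < n" "e i0 = b" using n(2) B by (auto simp: bij_betw_def)
  have "A *\<^sub>v w = y \<cdot>\<^sub>v w"
  proof (rule eq_vecI)
    fix i assume i: "i < dim_vec (y \<cdot>\<^sub>v w)"
    then have i: "i < n" by (simp add: w_def)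
    have "(A *\<^sub>v w) $ i = (\<Sum>j = 0..<n. M (e i) (e j) * e j)"
      using i by (simp add: A_def w_def scalar_prod_def)
    also have "\<dots> = (\<Sum>z\<in>B. M (e i) z * z)"
      by (rule sum.reindex_bij_betw[OF n(2)])
    also have "\<dots> = y * e i" using M(2) eB i by simp
    finally show "(A *\<^sub>v w) $ i = (y \<cdot>\<^sub>v w) $ i" using i by (simp add: w_def)
  qed (simp add: A_def w_def)
  moreover have "w \<noteq> 0\<^sub>v n"
  proof
    assume "w = 0\<^sub>v n"
    then have "w $ i0 = 0" using i0 by simp
    then show False using i0 B by (simp add: w_def)
  qed
  ultimately have "eigenvalue A y" unfolding eigenvalue_def eigenvector_def
    using A by (intro exI[of _ w]) (auto simp: w_def)
  then have "poly (char_poly A) y = 0" using eigenvalue_root_char_poly[OF A] by simp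
  moreover have "lead_coeff (char_poly A) = 1" using degree_monic_char_poly[OF A] by simp
  moreover have "coeff (char_poly A) i \<in> R" for i
    using A M(1) eB by (intro coeff_char_poly_mem) (auto simp: A_def)
  ultimately show ?thesis by blast
qed

definition rspan :: "complex set \<Rightarrow> complex set" where
  "rspan B = {\<Sum>z\<in>B. M z * z | M. \<forall>z\<in>B. M z \<in> R}"

lemma rspan_add: "x \<in> rspan B \<Longrightarrow> y \<in> rspan B \<Longrightarrow> x + y \<in> rspan B"
  unfolding rspan_def by (clarsimp, rule_tac x = "\<lambda>z. M z + Ma z" in exI) (auto simp: sum.distrib algebra_simps)

lemma rspan_smult: "x \<in> rspan B \<Longrightarrow> r \<in> R \<Longrightarrow> r * x \<in> rspan B"
  unfolding rspan_def by (clarsimp, rule_tac x = "\<lambda>z. r * M z" in exI) (auto simp: sum_distrib_left mult_ac)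

lemma rspan_0: "0 \<in> rspan B"
  unfolding rspan_def by (clarsimp, rule_tac x = "\<lambda>z. 0" in exI) auto

lemma rspan_sum: "(\<And>i. i \<in> I \<Longrightarrow> f i \<in> rspan B) \<Longrightarrow> (\<Sum>i\<in>I. f i) \<in> rspan B"
  by (induction I rule: infinite_finite_induct) (auto intro: rspan_add rspan_0)

lemma rspan_base:
  assumes "finite B" "x \<in> B" shows "x \<in> rspan B"
  unfolding rspan_def using assms
  by (clarsimp, rule_tac x = "\<lambda>z. if z = x then 1 else 0" in exI) (simp add: if_distrib[of "\<lambda>c. c * _"] cong: if_cong)

lemma rspan_times_stable:
  assumes "\<And>b. b \<in> B \<Longrightarrow> x * b \<in> rspan B" "w \<in> rspan B"
  shows "x * w \<in> rspan B"
proof -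
  obtain M where M: "w = (\<Sum>z\<in>B. M z * z)" "\<forall>z\<in>B. M z \<in> R" using assms(2) by (auto simp: rspan_def)
  have "x * w = (\<Sum>z\<in>B. M z * (x * z))" by (simp add: M sum_distrib_left mult_ac)
  also have "\<dots> \<in> rspan B" using M(2) assms(1) by (intro rspan_sum rspan_smult[of "x * _"]) auto
  finally show ?thesis .
qed

definition integral :: "complex \<Rightarrow> bool" where
  "integral x \<longleftrightarrow> (\<exists>p. lead_coeff p = 1 \<and> (\<forall>i. coeff p i \<in> R) \<and> poly p x = 0)"

lemma integral_degree_pos:
  assumes "lead_coeff p = 1" "poly p (x::complex) = 0" shows "degree p > 0"
proof (rule ccontr)
  assume "\<not> degree p > 0"
  then obtain c where "p = [:c:]" by (auto elim: degree_eq_zeroE)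
  then show False using assms by simp
qed

text \<open>The monomials \<open>x ^ i * y ^ j\<close> with exponents below the degrees of the two
  monic equations generate a module that contains 1 and is stable under both factors, hence under
  their sum and product. This is the module to which the determinant trick is applied.\<close>

lemma integral_stable_pair:
  assumes "integral x" "integral y"
  obtains B where "finite B" "1 \<in> B" "\<And>b. b \<in> B \<Longrightarrow> x * b \<in> rspan B" "\<And>b. b \<in> B \<Longrightarrow> y * b \<in> rspan B"
proof -
  obtain p where p: "lead_coeff p = 1" "\<forall>i. coeff p i \<in> R" "poly p x = 0" using assms by (auto simp: integral_def)
  obtain q where q: "lead_coeff q = 1" "\<forall>i. coeff q i \<in> R" "poly q y = 0" using assms by (auto simp: integral_def)
  define a b where "a = degree p" and "b = degree q"
  define B where "B = (\<lambda>(i, j). x ^ i * y ^ j) ` ({..<a} \<times> {..<b})"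
  have pos: "a > 0" "b > 0" using integral_degree_pos p q by (auto simp: a_def b_def)
  have B: "x ^ i * y ^ j \<in> rspan B" if "i < a" "j < b" for i j
    using that by (intro rspan_base) (auto simp: B_def)
  have xa: "x ^ a = - (\<Sum>i<a. coeff p i * x ^ i)"
    using p unfolding poly_altdef a_def
    by (simp add: lessThan_Suc_atMost[symmetric] eq_neg_iff_add_eq_0 add.commute)
  have yb: "y ^ b = - (\<Sum>i<b. coeff q i * y ^ i)"
    using q unfolding poly_altdef b_def
    by (simp add: lessThan_Suc_atMost[symmetric] eq_neg_iff_add_eq_0 add.commute)
  show ?thesis
  proof
    show "finite B" by (simp add: B_def)
    show "1 \<in> B" using pos unfolding B_def by (intro image_eqI[of _ _ "(0, 0)"]) auto
  next
    fix w assume "w \<in> B"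
    then obtain i j where ij: "w = x ^ i * y ^ j" "i < a" "j < b" by (auto simp: B_def)
    show "x * w \<in> rspan B"
    proof (cases "Suc i < a")
      case True
      then show ?thesis using B[of "Suc i" j] ij by (simp add: mult_ac)
    next
      case False
      then have "x * w = x ^ a * y ^ j" using ij by (metis Suc_lessI mult.assoc power_Suc)
      also have "\<dots> = (\<Sum>i<a. (- coeff p i) * (x ^ i * y ^ j))"
        by (simp add: xa sum_distrib_right sum_distrib_left sum_negf mult_ac)
      finally show ?thesis using p(2) B ij by (auto intro!: rspan_sum rspan_smult[of "x ^ _ * y ^ _"] simp del: mult_minus_left)
    qed
    show "y * w \<in> rspan B"
    proof (cases "Suc j < b")
      case True
      then show ?thesis using B[of i "Suc j"] ij by (simp add: mult_ac)
    next
      case False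
      then have "y * w = y ^ b * x ^ i" using ij by (metis Suc_lessI mult.assoc mult.commute power_Suc)
      also have "\<dots> = (\<Sum>j<b. (- coeff q j) * (x ^ i * y ^ j))"
        by (simp add: yb sum_distrib_right sum_distrib_left sum_negf mult_ac)
      finally show ?thesis using q(2) B ij by (auto intro!: rspan_sum rspan_smult[of "x ^ _ * y ^ _"] simp del: mult_minus_left)
    qed
  qed
qed

lemma integral_if_rspan_stable:
  assumes "finite B" "1 \<in> B" "\<And>b. b \<in> B \<Longrightarrow> y * b \<in> rspan B"
  shows "integral y"
proof -
  have "\<exists>M. (\<forall>z\<in>B. M z \<in> R) \<and> y * x = (\<Sum>z\<in>B. M z * z)" if "x \<in> B" for x
    using assms(3)[OF that] unfolding rspan_def by blast
  then show ?thesis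
    unfolding integral_def using assms(1,2) by (intro integral_if_stable[of B 1 y]) auto
qed

lemma integral_add: assumes "integral x" "integral y" shows "integral (x + y)"
proof -
  obtain B where B: "finite B" "1 \<in> B" "\<And>b. b \<in> B \<Longrightarrow> x * b \<in> rspan B" "\<And>b. b \<in> B \<Longrightarrow> y * b \<in> rspan B"
    using integral_stable_pair[OF assms] by blast
  then show ?thesis
    by (intro integral_if_rspan_stable[OF B(1,2)]) (auto simp: distrib_right intro: rspan_add)
qed

lemma integral_mult: assumes "integral x" "integral y" shows "integral (x * y)"
proof -
  obtain B where B: "finite B" "1 \<in> B" "\<And>b. b \<in> B \<Longrightarrow> x * b \<in> rspan B" "\<And>b. b \<in> B \<Longrightarrow> y * b \<in> rspan B"
    using integral_stable_pair[OF assms] by blast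
  then show ?thesis
    by (intro integral_if_rspan_stable[OF B(1,2)]) (auto simp: mult.assoc intro: rspan_times_stable)
qed

end

lemma csubring_Ints: "csubring \<int>"
  by unfold_locales auto

lemma csubring_Rats: "csubring \<rat>"
  by unfold_locales auto

lemma algebraic_int_iff_integral: "algebraic_int x \<longleftrightarrow> csubring.integral \<int> x"
  by (auto simp: csubring.integral_def[OF csubring_Ints] algebraic_int.simps)

lemma algebraic_int_add: "algebraic_int x \<Longrightarrow> algebraic_int y \<Longrightarrow> algebraic_int (x + y)" for x y :: complex
  by (simp add: algebraic_int_iff_integral csubring.integral_add[OF csubring_Ints])

lemma algebraic_int_mult: "algebraic_int x \<Longrightarrow> algebraic_int y \<Longrightarrow> algebraic_int (x * y)" for x y :: complex
  by (simp add: algebraic_int_iff_integral csubring.integral_mult[OF csubring_Ints])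

text \<open>Over a field every nonzero polynomial can be made monic, so algebraic and integral
  coincide, and \<open>Qbar\<close> inherits closure under sums and products from
  \<open>integral_add\<close> and \<open>integral_mult\<close>.\<close>

lemma algebraic_iff_integral: "algebraic x \<longleftrightarrow> csubring.integral \<rat> x"
proof -
  have "csubring.integral \<rat> x" if p: "\<forall>i. coeff p i \<in> \<rat>" "p \<noteq> 0" "poly p x = 0" for p
    unfolding csubring.integral_def[OF csubring_Rats]
    using p by (intro exI[of _ "Polynomial.smult (inverse (lead_coeff p)) p"]) auto
  then show ?thesis
    by (auto simp: algebraic_altdef csubring.integral_def[OF csubring_Rats])
qed

lemma cfield_Qbar: "cfield Qbar"
proof
  fix x y :: complex
  assume "x \<in> Qbar" "y \<in> Qbar"
  then show "x + y \<in> Qbar" "x * y \<in> Qbar"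
    by (auto simp: algebraic_iff_integral csubring.integral_add[OF csubring_Rats] csubring.integral_mult[OF csubring_Rats])
qed auto

subsection \<open>Existence of extensions of p-adic absolute values\<close>

definition ultrametric_on :: "complex set \<Rightarrow> (complex \<Rightarrow> real) \<Rightarrow> bool" where
  "ultrametric_on K r \<longleftrightarrow> (\<forall>x\<in>K. \<forall>y\<in>K. r (x + y) \<le> max (r x) (r y))"

text \<open>Multiplicativity is asked only for squares. This is what the infimum over p-adic
  divisibility bounds satisfies, and together with submultiplicativity it gives
  \<open>r (f ^ m) = r f ^ m\<close>. The value 0 outside \<open>K\<close> makes equality on
  \<open>K\<close> equality of functions.\<close>

definition power_seminorm :: "complex set \<Rightarrow> (complex \<Rightarrow> real) \<Rightarrow> bool" where
  "power_seminorm K r \<longleftrightarrow> (\<forall>x\<in>K. r x \<ge> 0) \<and> (\<forall>x. x \<notin> K \<longrightarrow> r x = 0) \<and> ultrametric_on K r \<and>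
     (\<forall>x\<in>K. \<forall>y\<in>K. r (x * y) \<le> r x * r y) \<and> (\<forall>x\<in>K. r (x * x) = r x * r x) \<and> r 0 = 0 \<and> r 1 = 1"

lemma real_le_if_le_product_eps:
  fixes a b c :: real
  assumes "a \<ge> 0" "b \<ge> 0" "\<And>\<epsilon>. \<epsilon> > 0 \<Longrightarrow> c \<le> (a + \<epsilon>) * (b + \<epsilon>)"
  shows "c \<le> a * b"
proof (rule tendsto_lowerbound[of "\<lambda>\<epsilon>. (a + \<epsilon>) * (b + \<epsilon>)" _ "at_right 0"])
  have "((\<lambda>\<epsilon>. (a + \<epsilon>) * (b + \<epsilon>)) \<longlongrightarrow> (a + 0) * (b + 0)) (at_right 0)" by (intro tendsto_intros)
  then show "((\<lambda>\<epsilon>. (a + \<epsilon>) * (b + \<epsilon>)) \<longlongrightarrow> a * b) (at_right 0)" by simp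
  show "\<forall>\<^sub>F \<epsilon> in at_right 0. c \<le> (a + \<epsilon>) * (b + \<epsilon>)"
    by (rule eventually_mono[OF eventually_at_right_less]) (use assms(3) in auto)
qed auto

text \<open>In a chain one member can be chosen close to the infimum at two points at once
  (\<open>both\<close>); the axioms that involve two elements then pass to the infimum up to an
  arbitrary \<epsilon>.\<close>

lemma power_seminorm_chain_Inf:
  assumes K: "cfield K" and C: "C \<noteq> {}" "\<And>r. r \<in> C \<Longrightarrow> power_seminorm K r"
    and chain: "\<And>r s. r \<in> C \<Longrightarrow> s \<in> C \<Longrightarrow> (\<forall>x. r x \<le> s x) \<or> (\<forall>x. s x \<le> r x)"
  shows "power_seminorm K (\<lambda>x. INF r\<in>C. r x)"
proof -
  interpret cfield K by fact
  define u where "u = (\<lambda>x. INF r\<in>C. r x)"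
  have nn: "r x \<ge> 0" if "r \<in> C" for r x using C(2)[OF that] by (cases "x \<in> K") (auto simp: power_seminorm_def)
  have bdd: "bdd_below ((\<lambda>r. r x) ` C)" for x using nn by (intro bdd_belowI[of _ 0]) auto
  have le: "u x \<le> r x" if "r \<in> C" for r x unfolding u_def by (rule cINF_lower[OF bdd that])
  have ge: "c \<le> u x" if "\<And>r. r \<in> C \<Longrightarrow> c \<le> r x" for c x
    unfolding u_def using C(1) that by (intro cINF_greatest) auto
  have u0: "u x \<ge> 0" for x using nn by (intro ge) auto
  have eps: "\<exists>r\<in>C. r x < u x + \<epsilon>" if "\<epsilon> > 0" for x \<epsilon>
    using cINF_less_iff[OF C(1) bdd, of x "u x + \<epsilon>"] that by (auto simp: u_def)
  have both: "\<exists>r\<in>C. r x < u x + \<epsilon> \<and> r y < u y + \<epsilon>" if \<epsilon>: "\<epsilon> > 0" for x y \<epsilon>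
  proof -
    obtain r where "r \<in> C" "r x < u x + \<epsilon>" using eps[OF \<epsilon>] by blast
    moreover obtain s where "s \<in> C" "s y < u y + \<epsilon>" using eps[OF \<epsilon>] by blast
    ultimately show ?thesis using chain[of r s] by (metis le_less_trans)
  qed
  have um: "u (x + y) \<le> max (u x) (u y)" if "x \<in> K" "y \<in> K" for x y
  proof (rule field_le_epsilon)
    fix \<epsilon> :: real assume "\<epsilon> > 0"
    then obtain r where r: "r \<in> C" "r x < u x + \<epsilon>" "r y < u y + \<epsilon>" using both by blast
    have "u (x + y) \<le> r (x + y)" using r le by simp
    also have "\<dots> \<le> max (r x) (r y)" using C(2)[OF r(1)] that by (auto simp: power_seminorm_def ultrametric_on_def)
    finally show "u (x + y) \<le> max (u x) (u y) + \<epsilon>" using r by auto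
  qed
  have mult: "u (x * y) \<le> u x * u y" if "x \<in> K" "y \<in> K" for x y
  proof (rule real_le_if_le_product_eps[OF u0 u0])
    fix \<epsilon> :: real assume "\<epsilon> > 0"
    then obtain r where r: "r \<in> C" "r x < u x + \<epsilon>" "r y < u y + \<epsilon>" using both by blast
    have "u (x * y) \<le> r (x * y)" using r le by simp
    also have "\<dots> \<le> r x * r y" using C(2)[OF r(1)] that by (auto simp: power_seminorm_def)
    also have "\<dots> \<le> (u x + \<epsilon>) * (u y + \<epsilon>)" using r nn[OF r(1)] u0[of x] \<open>\<epsilon> > 0\<close> by (intro mult_mono) auto
    finally show "u (x * y) \<le> (u x + \<epsilon>) * (u y + \<epsilon>)" .
  qed
  have sq: "u (x * x) = u x * u x" if "x \<in> K" for x
  proof (rule antisym[OF mult[OF that that] ge])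
    fix r assume r: "r \<in> C"
    have "u x * u x \<le> r x * r x" using le[OF r] u0 nn[OF r] by (intro mult_mono) auto
    also have "\<dots> = r (x * x)" using C(2)[OF r] that by (auto simp: power_seminorm_def)
    finally show "u x * u x \<le> r (x * x)" .
  qed
  have const: "u x = c" if "\<And>r. r \<in> C \<Longrightarrow> r x = c" for x c
  proof -
    have "(\<lambda>r. r x) ` C = {c}" using C(1) that by auto
    then show ?thesis by (simp add: u_def)
  qed
  have "u x = 0" if "x \<notin> K" for x using C(2) that by (intro const) (auto simp: power_seminorm_def)
  moreover have "u 0 = 0" "u 1 = 1" using C(2) by (intro const; auto simp: power_seminorm_def)+
  ultimately show ?thesis
    unfolding power_seminorm_def u_def[symmetric] ultrametric_on_def
    using um mult sq u0 by (intro conjI ballI allI impI) simp_all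
qed

text \<open>Smoothing at \<open>f\<close>: the new seminorm is the limit of
  \<open>r (x * f ^ m) / r f ^ m\<close>, which decreases by submultiplicativity. A shift of the
  index shows that \<open>f\<close> has become multiplicative for it. Power-multiplicativity of
  \<open>r\<close> keeps the value 1 at 1.\<close>

lemma power_seminorm_smoothing:
  assumes K: "cfield K" and r: "power_seminorm K r" and f: "f \<in> K" "r f > 0"
  obtains s where "power_seminorm K s" "\<And>x. s x \<le> r x" "\<And>x. x \<in> K \<Longrightarrow> s (x * f) = s x * r f"
proof -
  interpret cfield K by fact
  have rK: "\<And>x. x \<in> K \<Longrightarrow> r x \<ge> 0" "\<And>x. x \<notin> K \<Longrightarrow> r x = 0" "\<And>x y. x \<in> K \<Longrightarrow> y \<in> K \<Longrightarrow> r (x * y) \<le> r x * r y"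
    "\<And>x y. x \<in> K \<Longrightarrow> y \<in> K \<Longrightarrow> r (x + y) \<le> max (r x) (r y)"
    "\<And>x. x \<in> K \<Longrightarrow> r (x * x) = r x * r x" "r 0 = 0" "r 1 = 1"
    using r by (auto simp: power_seminorm_def ultrametric_on_def)
  have r0: "r x \<ge> 0" for x using rK(1,2) by (cases "x \<in> K") auto
  define g where "g = (\<lambda>x m. r (x * f ^ m) / r f ^ m)"
  have gdec: "decseq (g x)" if "x \<in> K" for x
  proof (rule decseq_SucI)
    fix m
    have "r (x * f ^ Suc m) = r ((x * f ^ m) * f)" by (simp add: mult_ac)
    also have "\<dots> \<le> r (x * f ^ m) * r f" using that f by (intro rK(3)) auto
    finally show "g x (Suc m) \<le> g x m" using f by (simp add: g_def field_simps)
  qed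
  have g0: "g x m \<ge> 0" for x m using r0 f by (simp add: g_def)
  define s where "s = (\<lambda>x. if x \<in> K then lim (g x) else 0)"
  have lim: "g x \<longlonglongrightarrow> s x" if x: "x \<in> K" for x
  proof -
    obtain L where "g x \<longlonglongrightarrow> L" by (rule decseq_convergent[OF gdec[OF x], of 0]) (use g0 in auto)
    then show ?thesis using x by (simp add: s_def limI)
  qed
  have s0: "s x \<ge> 0" for x
    using LIMSEQ_le_const[OF lim, of x 0] g0 by (cases "x \<in> K") (auto simp: s_def)
  have sle: "s x \<le> r x" for x
  proof (cases "x \<in> K")
    case True
    have "s x \<le> g x 0" by (rule decseq_ge[OF gdec lim]) fact+
    then show ?thesis by (simp add: g_def)
  qed (simp add: s_def rK)
  have sf: "s (x * f) = s x * r f" if "x \<in> K" for x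
  proof (rule LIMSEQ_unique[OF lim])
    show "x * f \<in> K" using that f by auto
    have "(\<lambda>m. g x (Suc m) * r f) \<longlonglongrightarrow> s x * r f" by (intro tendsto_intros LIMSEQ_Suc lim that)
    moreover have "g x (Suc m) * r f = g (x * f) m" for m using f by (simp add: g_def mult_ac)
    ultimately show "g (x * f) \<longlonglongrightarrow> s x * r f" by simp
  qed
  have um: "s (x + y) \<le> max (s x) (s y)" if "x \<in> K" "y \<in> K" for x y
  proof (rule LIMSEQ_le[OF lim])
    show "(\<lambda>m. max (g x m) (g y m)) \<longlonglongrightarrow> max (s x) (s y)" by (intro tendsto_intros lim that)
    have "g (x + y) m \<le> max (g x m) (g y m)" for m
    proof -
      have "r (x * f ^ m + y * f ^ m) \<le> max (r (x * f ^ m)) (r (y * f ^ m))" using that f by (intro rK(4)) auto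
      then have "r (x * f ^ m + y * f ^ m) / r f ^ m \<le> max (r (x * f ^ m)) (r (y * f ^ m)) / r f ^ m"
        using f by (intro divide_right_mono) auto
      moreover have "r f ^ m \<ge> 0" using f by simp
      ultimately show ?thesis by (simp add: g_def distrib_right max_divide_distrib_right)
    qed
    then show "\<exists>N. \<forall>n\<ge>N. g (x + y) n \<le> max (g x n) (g y n)" by blast
  qed (use that in auto)
  \<comment> \<open>The product of \<open>x * f ^ m\<close> and \<open>y * f ^ m\<close> contains
    \<open>f ^ (m + m)\<close>, so products are compared along the even subsequence.\<close>
  have even: "(\<lambda>m. g x (m + m)) \<longlonglongrightarrow> s x" if "x \<in> K" for x
    using LIMSEQ_subseq_LIMSEQ[OF lim[OF that], of "\<lambda>m. m + m"] by (simp add: strict_mono_def o_def)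
  have mult: "s (x * y) \<le> s x * s y" if "x \<in> K" "y \<in> K" for x y
  proof (rule LIMSEQ_le[OF even])
    show "(\<lambda>m. g x m * g y m) \<longlonglongrightarrow> s x * s y" by (intro tendsto_intros lim that)
    have "g (x * y) (m + m) \<le> g x m * g y m" for m
    proof -
      have "r ((x * f ^ m) * (y * f ^ m)) \<le> r (x * f ^ m) * r (y * f ^ m)" using that f by (intro rK(3)) auto
      then show ?thesis using f by (simp add: g_def power_add field_simps)
    qed
    then show "\<exists>N. \<forall>n\<ge>N. g (x * y) (n + n) \<le> g x n * g y n" by blast
  qed (use that in auto)
  have sq: "s (x * x) = s x * s x" if "x \<in> K" for x
  proof (rule LIMSEQ_unique[OF even])
    have "g (x * x) (m + m) = g x m * g x m" for m
    proof -
      have "r ((x * f ^ m) * (x * f ^ m)) = r (x * f ^ m) * r (x * f ^ m)" using that f by (intro rK(5)) auto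
      then show ?thesis using f by (simp add: g_def power_add field_simps)
    qed
    then show "(\<lambda>m. g (x * x) (m + m)) \<longlonglongrightarrow> s x * s x" by (simp add: tendsto_mult lim that)
  qed (use that in auto)
  have pw: "r (f ^ m) = r f ^ m" for m
  proof -
    have two: "r (f ^ 2 ^ j) = r f ^ 2 ^ j" for j
    proof (induction j)
      case (Suc j)
      have "r (f ^ 2 ^ Suc j) = r (f ^ 2 ^ j * f ^ 2 ^ j)" by (simp add: power_add[symmetric] mult_2)
      also have "\<dots> = r (f ^ 2 ^ j) * r (f ^ 2 ^ j)" using f by (intro rK(5)) auto
      finally show ?case using Suc by (simp add: power_add[symmetric] mult_2)
    qed simp
    have le: "r (f ^ m) \<le> r f ^ m" for m
    proof (induction m)
      case (Suc m)
      have "r (f ^ Suc m) \<le> r f * r (f ^ m)" using f by (simp add: rK(3) power)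
      also have "\<dots> \<le> r f * r f ^ m" using Suc f by (intro mult_left_mono) auto
      finally show ?case by simp
    qed (simp add: rK)
    \<comment> \<open>Repeated squaring settles exponents that are powers of two. A general
      \<open>m\<close> is completed to \<open>2 ^ m = m + l\<close>; a strict inequality at
      \<open>m\<close> would spoil the equality there.\<close>
    have "m \<le> 2 ^ m" using less_exp[of m] by simp
    then obtain l where l: "2 ^ m = m + l" using le_Suc_ex by blast
    have "r f ^ m * r f ^ l = r (f ^ m * f ^ l)" using two[of m] by (simp add: l power_add)
    also have "\<dots> \<le> r (f ^ m) * r (f ^ l)" using f by (intro rK(3)) auto
    also have "\<dots> \<le> r (f ^ m) * r f ^ l" using le r0 by (intro mult_left_mono) auto
    finally show ?thesis using le[of m] f by (simp add: antisym)
  qed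
  have "g 1 = (\<lambda>_. 1)" using f by (auto simp: g_def pw)
  then have "s 1 = 1" using lim[of 1] by (simp add: LIMSEQ_const_iff)
  moreover have "g 0 = (\<lambda>_. 0)" by (auto simp: g_def rK)
  then have "s 0 = 0" using lim[of 0] by (simp add: LIMSEQ_const_iff)
  moreover have "s x = 0" if "x \<notin> K" for x using that by (simp add: s_def)
  ultimately have "power_seminorm K s"
    unfolding power_seminorm_def ultrametric_on_def using s0 um mult sq by blast
  with sle sf show ?thesis using that by blast
qed

text \<open>A minimal seminorm below \<open>r0\<close> exists by Zorn's lemma. Smoothing it at any
  \<open>f\<close> of positive value gives nothing smaller, so it is multiplicative.
  Multiplicativity and the value 1 at 1 leave no nonzero element of value 0 in a field.\<close>

theorem exists_absolute_value_le:
  assumes K: "cfield K" and r0: "power_seminorm K r0"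
  obtains u where "absolute_value_on K u" "ultrametric_on K u" "\<And>x. u x \<le> r0 x"
proof -
  interpret cfield K by fact
  define A where "A = {r. power_seminorm K r \<and> (\<forall>x. r x \<le> r0 x)}"
  \<comment> \<open>\<open>predicate_Zorn\<close> yields maximal elements, hence the reversed
    order.\<close>
  define P :: "(complex \<Rightarrow> real) \<Rightarrow> (complex \<Rightarrow> real) \<Rightarrow> bool" where "P = (\<lambda>r s. \<forall>x. s x \<le> r x)"
  have "\<exists>m\<in>A. \<forall>a\<in>A. P m a \<longrightarrow> a = m"
  proof (rule predicate_Zorn)
    show "partial_order_on A (relation_of P A)"
      unfolding partial_order_on_def preorder_on_def
    proof (intro conjI)
      show "refl_on A (relation_of P A)" by (auto simp: refl_on_def relation_of_def P_def)
      show "trans (relation_of P A)" unfolding trans_def relation_of_def P_def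
        by clarsimp (meson order_trans)
      show "antisym (relation_of P A)"
        unfolding antisym_def relation_of_def P_def by (simp add: antisym ext)
    qed (auto simp: relation_of_def)
  next
    fix C assume C: "C \<in> Chains (relation_of P A)"
    show "\<exists>u\<in>A. \<forall>a\<in>C. P a u"
    proof (cases "C = {}")
      case True
      then show ?thesis using r0 by (auto simp: A_def)
    next
      case False
      have CA: "C \<subseteq> A" using C by (auto simp: Chains_def relation_of_def)
      have ch: "(\<forall>x. r x \<le> s x) \<or> (\<forall>x. s x \<le> r x)" if "r \<in> C" "s \<in> C" for r s
        using C that by (auto simp: Chains_def relation_of_def P_def)
      have sn: "power_seminorm K (\<lambda>x. INF r\<in>C. r x)"
        using CA False ch by (intro power_seminorm_chain_Inf[OF K]) (auto simp: A_def)
      have nn: "r x \<ge> 0" if "r \<in> C" for r x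
        using CA that by (cases "x \<in> K") (auto simp: A_def power_seminorm_def)
      have "bdd_below ((\<lambda>r. r x) ` C)" for x using nn by (intro bdd_belowI[of _ 0]) auto
      then have le: "(INF r\<in>C. r x) \<le> r x" if "r \<in> C" for r x by (rule cINF_lower) fact
      obtain r where "r \<in> C" using False by blast
      then have "(INF r\<in>C. r x) \<le> r0 x" for x 
      proof (rule order_trans[OF le])
        show "r x \<le> r0 x" using CA \<open>r \<in> C\<close> by (auto simp: A_def)
      qed
      with sn le show ?thesis by (intro bexI[of _ "\<lambda>x. INF r\<in>C. r x"]) (auto simp: A_def P_def)
    qed
  qed
  then obtain u where u: "u \<in> A" and min: "\<And>a. a \<in> A \<Longrightarrow> (\<And>x. a x \<le> u x) \<Longrightarrow> a = u"
    by (auto simp: P_def)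
  have us: "power_seminorm K u" "\<And>x. u x \<le> r0 x" using u by (auto simp: A_def)
  have mult: "u (x * f) = u x * u f" if xf: "x \<in> K" "f \<in> K" for x f
  proof (cases "u f > 0")
    case True
    obtain s where s: "power_seminorm K s" "\<And>x. s x \<le> u x" "\<And>x. x \<in> K \<Longrightarrow> s (x * f) = s x * u f"
      using power_seminorm_smoothing[OF K us(1) xf(2) True] by blast
    have "s x \<le> r0 x" for x using s(2)[of x] us(2)[of x] by linarith
    then have "s = u" using s by (intro min) (auto simp: A_def)
    then show ?thesis using s(3) xf by blast
  next
    case False
    then have 0: "u f = 0" using us xf by (force simp: power_seminorm_def)
    have "u (x * f) \<le> u x * u f" "u (x * f) \<ge> 0" using us xf by (auto simp: power_seminorm_def)
    then show ?thesis using 0 by simp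
  qed
  have "x = 0" if "x \<in> K" "u x = 0" for x
  proof (rule ccontr)
    assume "x \<noteq> 0"
    then have "u 1 = u x * u (inverse x)" using mult[of x "inverse x"] that by auto
    then show False using that us by (simp add: power_seminorm_def)
  qed
  moreover have "u (x + y) \<le> u x + u y" if "x \<in> K" "y \<in> K" for x y
  proof -
    have "u (x + y) \<le> max (u x) (u y)" "u x \<ge> 0" "u y \<ge> 0"
      using us that by (auto simp: power_seminorm_def ultrametric_on_def)
    then show ?thesis by auto
  qed
  ultimately have "absolute_value_on K u"
    unfolding absolute_value_on_def using mult us by (auto simp: power_seminorm_def)
  moreover have "ultrametric_on K u" using us by (simp add: power_seminorm_def)
  ultimately show ?thesis using that us by blast
qed

section \<open>Algebraic numbers that are integral at p\<close>

context
  fixes p :: nat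
  assumes p: "Factorial_Ring.prime p"
begin

text \<open>The integral closure of the localization of \<open>\<int>\<close> at p in the algebraic
  numbers, written with an explicit denominator \<open>m\<close> prime to p.\<close>

definition p_integral :: "complex set" where
  "p_integral = {y. \<exists>m::nat. m > 0 \<and> \<not> p dvd m \<and> algebraic_int (of_nat m * y)}"

lemma p_integralI: "m > 0 \<Longrightarrow> \<not> p dvd m \<Longrightarrow> algebraic_int (of_nat m * y) \<Longrightarrow> y \<in> p_integral"
  unfolding p_integral_def by blast

lemma p_integral_algebraic_int: "algebraic_int y \<Longrightarrow> y \<in> p_integral"
  using prime_gt_1_nat[OF p] by (intro p_integralI[of 1]) simp_all

lemma p_integral_add:
  assumes "x \<in> p_integral" "y \<in> p_integral" shows "x + y \<in> p_integral"
proof -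
  obtain a b :: nat where ab: "a > 0" "\<not> p dvd a" "algebraic_int (of_nat a * x)" "b > 0" "\<not> p dvd b" "algebraic_int (of_nat b * y)"
    using assms by (auto simp: p_integral_def)
  have "algebraic_int (of_nat b * (of_nat a * x) + of_nat a * (of_nat b * y))"
    by (intro algebraic_int_add algebraic_int_mult[OF _ ab(3)] algebraic_int_mult[OF _ ab(6)]) auto
  then show ?thesis using ab p
    by (intro p_integralI[of "a * b"]) (auto simp: prime_dvd_mult_iff algebra_simps)
qed

lemma p_integral_mult:
  assumes "x \<in> p_integral" "y \<in> p_integral" shows "x * y \<in> p_integral"
proof -
  obtain a b :: nat where ab: "a > 0" "\<not> p dvd a" "algebraic_int (of_nat a * x)" "b > 0" "\<not> p dvd b" "algebraic_int (of_nat b * y)"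
    using assms by (auto simp: p_integral_def)
  have "algebraic_int ((of_nat a * x) * (of_nat b * y))"
    using ab by (intro algebraic_int_mult[OF ab(3,6)])
  then show ?thesis using ab p
    by (intro p_integralI[of "a * b"]) (auto simp: prime_dvd_mult_iff mult_ac)
qed

lemma p_integral_power: "x \<in> p_integral \<Longrightarrow> x ^ n \<in> p_integral"
  by (induction n) (simp_all add: p_integral_mult p_integral_algebraic_int)

lemma algebraic_int_power_root:
  fixes x :: complex
  assumes "algebraic_int (x ^ t)" "t > 0" shows "algebraic_int x"
  by (rule algebraic_int_root[OF assms(1), of "monom 1 t"]) (use assms(2) in \<open>simp_all add: poly_monom degree_monom_eq\<close>)

text \<open>Integral closedness for t-th roots. It converts divisibility statements about
  \<open>x ^ t\<close> into statements about \<open>x\<close> itself, which can be added.\<close>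

lemma p_integral_root:
  assumes "x ^ t \<in> p_integral" "t > 0" shows "x \<in> p_integral"
proof -
  obtain a :: nat where a: "a > 0" "\<not> p dvd a" "algebraic_int (of_nat a * x ^ t)"
    using assms by (auto simp: p_integral_def)
  have "(of_nat a * x) ^ t = of_nat (a ^ (t - 1)) * (of_nat a * x ^ t)"
    using assms(2) by (cases t) (auto simp: power_mult_distrib)
  also have "algebraic_int \<dots>" by (intro algebraic_int_mult[OF _ a(3)] algebraic_int_of_nat)
  finally show ?thesis using a algebraic_int_power_root[OF _ assms(2)] by (intro p_integralI[of a]) auto
qed

text \<open>A rational algebraic integer is an integer, so p does not become a unit. This is what
  prevents the seminorm built from \<open>padic_bounds\<close> from dropping below 1 at 1.\<close>

lemma inverse_p_not_p_integral: "inverse (of_nat p) \<notin> p_integral"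
proof
  assume "inverse (of_nat p) \<in> p_integral"
  then obtain a :: nat where a: "\<not> p dvd a" "algebraic_int (of_nat a * inverse (of_nat p) :: complex)"
    by (auto simp: p_integral_def)
  then have "of_nat a * inverse (of_nat p) \<in> (\<int> :: complex set)"
    by (intro rational_algebraic_int_is_int[OF a(2)] Rats_mult Rats_inverse Rats_of_nat)
  then obtain c where c: "of_nat a * inverse (of_nat p) = (of_int c :: complex)" by (rule Ints_cases)
  have "(of_nat p :: complex) \<noteq> 0" using p by (auto simp: prime_nat_iff)
  then have "(of_nat a :: complex) = of_int c * of_nat p" using c by (simp add: divide_inverse[symmetric] nonzero_divide_eq_eq)
  then have "(of_int (int a) :: complex) = of_int (c * int p)" by simp
  then have "int a = c * int p" by (simp only: of_int_eq_iff)
  then have "int p dvd int a" by simp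
  then show False using a by simp
qed

text \<open>With leading coefficient \<open>c\<close> and degree \<open>n\<close>, multiplying the
  equation of \<open>x\<close> by \<open>c ^ (n - 1)\<close> turns it into a monic equation
  \<open>q'\<close> for \<open>c * x\<close>.\<close>

lemma algebraic_multiple_algebraic_int:
  assumes "algebraic (x :: complex)"
  obtains m :: nat where "m > 0" "algebraic_int (of_nat m * x)"
proof -
  obtain q where q: "\<And>i. coeff q i \<in> \<int>" "q \<noteq> 0" "poly q x = 0"
    using assms unfolding algebraic_def by blast
  define n c where "n = degree q" and "c = lead_coeff q"
  have "c \<in> \<int>" using q(1)[of n] by (simp add: c_def n_def)
  then obtain ci where ci: "c = of_int ci" by (rule Ints_cases)
  have c0: "c \<noteq> 0" using q by (simp add: c_def)
  have n0: "n > 0"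
  proof (rule ccontr)
    assume "\<not> n > 0"
    then obtain a where "q = [:a:]" by (auto simp: n_def elim: degree_eq_zeroE)
    then show False using q by simp
  qed
  define q' where "q' = (\<Sum>i<n. monom (coeff q i * c ^ (n - 1 - i)) i) + monom 1 n"
  have co: "coeff q' i = (if i < n then coeff q i * c ^ (n - 1 - i) else if i = n then 1 else 0)" for i
    by (auto simp: q'_def coeff_sum)
  have dq: "degree q' = n"
    by (rule antisym[OF degree_le le_degree]) (auto simp: co)
  have "poly q' (c * x) = (\<Sum>i<n. coeff q i * c ^ (n - 1 - i) * (c * x) ^ i) + (c * x) ^ n"
    by (simp add: q'_def poly_sum poly_monom)
  also have "(c * x) ^ n = c ^ (n - 1) * (c * x ^ n)"
    using n0 by (cases n) (auto simp: power_mult_distrib)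
  also have "(\<Sum>i<n. coeff q i * c ^ (n - 1 - i) * (c * x) ^ i) = (\<Sum>i<n. c ^ (n - 1) * (coeff q i * x ^ i))"
  proof (intro sum.cong refl)
    fix i assume "i \<in> {..<n}"
    then have "c ^ (n - 1) = c ^ (n - 1 - i) * c ^ i" by (simp add: power_add[symmetric])
    then show "coeff q i * c ^ (n - 1 - i) * (c * x) ^ i = c ^ (n - 1) * (coeff q i * x ^ i)"
      by (simp add: power_mult_distrib mult_ac)
  qed
  also have "(\<Sum>i<n. c ^ (n - 1) * (coeff q i * x ^ i)) + c ^ (n - 1) * (c * x ^ n) = c ^ (n - 1) * poly q x"
    by (simp add: poly_altdef n_def c_def sum_distrib_left lessThan_Suc_atMost[symmetric] distrib_left)
  finally have "poly q' (c * x) = 0" using q by simp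
  moreover have "coeff q' i \<in> \<int>" for i
    unfolding co using Ints_mult[OF q(1) Ints_power[OF \<open>c \<in> \<int>\<close>]] by simp
  ultimately have "algebraic_int (c * x)"
    using dq by (intro algebraic_int.intros[of q']) (auto simp: co)
  then have "algebraic_int (of_int (abs ci) * x)"
    using algebraic_int_minus[of "c * x"] by (cases "ci \<ge> 0") (simp_all add: ci)
  moreover have "(of_nat (nat \<bar>ci\<bar>) :: complex) = of_int \<bar>ci\<bar>" by simp
  ultimately show ?thesis using c0 ci by (intro that[of "nat \<bar>ci\<bar>"]) auto
qed

lemma p_power_multiple_p_integral:
  assumes "algebraic x"
  obtains s :: nat where "of_nat p ^ s * x \<in> p_integral"
proof -
  obtain m :: nat where m: "m > 0" "algebraic_int (of_nat m * x)"
    using algebraic_multiple_algebraic_int[OF assms] by blast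
  have "m \<noteq> 0" "\<not> is_unit p" using m p by (auto simp: prime_nat_iff)
  then obtain a where a: "m = p ^ multiplicity p m * a" "\<not> p dvd a" using multiplicity_decompose' by metis
  have "of_nat m * x = of_nat a * (of_nat p ^ multiplicity p m * x)" by (subst a(1)) (simp add: mult_ac)
  with m(2) have "algebraic_int (of_nat a * (of_nat p ^ multiplicity p m * x))"
    by (simp only:)
  moreover have "a > 0" using a(2) by (cases a) auto
  ultimately show ?thesis using a(2) by (intro that[of "multiplicity p m"] p_integralI[of a]) auto
qed

end

section \<open>The seminorm given by divisibility by fractional powers of p\<close>

context
  fixes p :: nat
  assumes p: "Factorial_Ring.prime p"
begin

text \<open>An ultrametric extension of the p-adic absolute value is at most 1 on
  \<open>p_integral p\<close>, so each member of this set is an upper bound for its value at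
  \<open>x\<close>. The infimum is the best bound obtained from integrality in this way.\<close>

definition padic_bounds :: "complex \<Rightarrow> real set" where
  "padic_bounds x = {real p powr (- (of_int s / of_nat t)) | (s::int) (t::nat).
      t > 0 \<and> x ^ t * of_nat p powi (- s) \<in> p_integral p}"

definition padic_seminorm :: "complex \<Rightarrow> real" where
  "padic_seminorm x = (if x \<in> Qbar then Inf (padic_bounds x) else 0)"

lemma p_gt_1: "real p > 1"
  using p by (metis of_nat_1 of_nat_less_iff prime_gt_1_nat)

lemma p_neq_0: "(of_nat p :: complex) \<noteq> 0"
  using p by (auto simp: prime_nat_iff)

lemma padic_boundsI:
  "t > 0 \<Longrightarrow> x ^ t * of_nat p powi (- s) \<in> p_integral p \<Longrightarrow> real p powr (- (of_int s / of_nat t)) \<in> padic_bounds x"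
  unfolding padic_bounds_def by blast

lemma p_integral_powi_mono:
  assumes "x * of_nat p powi (- s) \<in> p_integral p" "s' \<le> s"
  shows "x * of_nat p powi (- s') \<in> p_integral p"
proof -
  have "x * of_nat p powi (- s') = (x * of_nat p powi (- s)) * of_nat p ^ nat (s - s')"
  proof -
    have "(of_nat p :: complex) powi (- s') = of_nat p powi (- s) * of_nat p powi (s - s')"
      using p_neq_0 by (subst power_int_add[symmetric]) auto
    also have "(of_nat p :: complex) powi (s - s') = of_nat p ^ nat (s - s')"
      using assms(2) by (simp add: power_int_def)
    finally show ?thesis by (simp add: mult_ac)
  qed
  moreover have "of_nat p ^ nat (s - s') \<in> p_integral p"
    by (intro p_integral_power[OF p] p_integral_algebraic_int[OF p]) auto
  ultimately show ?thesis using p_integral_mult[OF p assms(1)] by (simp only:)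
qed

lemma padic_bounds_common:
  assumes "a \<in> padic_bounds x" "b \<in> padic_bounds y"
  obtains t :: nat and s s' :: int where "t > 0" "a = real p powr (- (of_int s / of_nat t))" "b = real p powr (- (of_int s' / of_nat t))"
    "x ^ t * of_nat p powi (- s) \<in> p_integral p" "y ^ t * of_nat p powi (- s') \<in> p_integral p"
proof -
  obtain t1 :: nat and s1 :: int where 1: "t1 > 0" "a = real p powr (- (of_int s1 / of_nat t1))" "x ^ t1 * of_nat p powi (- s1) \<in> p_integral p"
    using assms(1) by (auto simp: padic_bounds_def)
  obtain t2 :: nat and s2 :: int where 2: "t2 > 0" "b = real p powr (- (of_int s2 / of_nat t2))" "y ^ t2 * of_nat p powi (- s2) \<in> p_integral p"
    using assms(2) by (auto simp: padic_bounds_def)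
  have "x ^ (t1 * t2) * of_nat p powi (- (s1 * int t2)) = (x ^ t1 * of_nat p powi (- s1)) ^ t2"
    by (simp add: power_mult power_mult_distrib power_int_minus power_int_mult power_inverse)
  moreover have "y ^ (t1 * t2) * of_nat p powi (- (s2 * int t1)) = (y ^ t2 * of_nat p powi (- s2)) ^ t1"
    by (simp add: mult.commute[of t1] power_mult power_mult_distrib power_int_minus power_int_mult power_inverse)
  ultimately show ?thesis
    using 1 2 p_integral_power[OF p 1(3), of t2] p_integral_power[OF p 2(3), of t1]
    by (intro that[of "t1 * t2" "s1 * int t2" "s2 * int t1"]) auto
qed

lemma p_powr_root:
  assumes "t > 0"
  obtains z :: complex where "z \<noteq> 0" "z ^ t = of_nat p powi s"
proof
  show "complex_of_real (real p powr (of_int s / real t)) \<noteq> 0" using p_gt_1 by auto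
  have "(real p powr (of_int s / real t)) ^ t = real p powr of_int s"
    using assms p_gt_1 by (simp add: powr_power)
  also have "\<dots> = real p powi s" using p_gt_1 by (simp add: powr_real_of_int')
  finally have "complex_of_real (real p powr (of_int s / real t)) ^ t = complex_of_real (real p powi s)"
    by (metis of_real_power)
  then show "complex_of_real (real p powr (of_int s / real t)) ^ t = of_nat p powi s" by simp
qed

text \<open>Both summands are divided by a common t-th root \<open>z\<close> of p to the power
  \<open>min s s'\<close>, which exists as a positive real. The quotients are p-integral because
  p-integral numbers are closed under roots, so their sum is p-integral, and taking t-th powers
  returns to the definition.\<close>

lemma padic_bounds_add:
  assumes "a \<in> padic_bounds x" "b \<in> padic_bounds y"
  shows "max a b \<in> padic_bounds (x + y)"
proof -
  obtain t s s' where *: "t > 0" "a = real p powr (- (of_int s / of_nat t))" "b = real p powr (- (of_int s' / of_nat t))"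
    "x ^ t * of_nat p powi (- s) \<in> p_integral p" "y ^ t * of_nat p powi (- s') \<in> p_integral p"
    using padic_bounds_common[OF assms] by blast
  define r where "r = min s s'"
  obtain z :: complex where z: "z \<noteq> 0" "z ^ t = of_nat p powi r" using p_powr_root[OF *(1)] by blast
  have wz: "w / z \<in> p_integral p" if "w ^ t * of_nat p powi (- l) \<in> p_integral p" "r \<le> l" for w l
  proof (rule p_integral_root[OF p])
    have "(w / z) ^ t = w ^ t * of_nat p powi (- r)"
      by (subst power_divide) (simp add: z power_int_minus divide_inverse)
    then show "(w / z) ^ t \<in> p_integral p" using p_integral_powi_mono[OF that] by (simp only:)
  qed fact
  have "x / z + y / z \<in> p_integral p"
    by (intro p_integral_add[OF p] wz[OF *(4)] wz[OF *(5)]) (auto simp: r_def)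
  then have "((x + y) / z) ^ t \<in> p_integral p"
    by (intro p_integral_power[OF p]) (simp add: add_divide_distrib)
  moreover have "((x + y) / z) ^ t = (x + y) ^ t * of_nat p powi (- r)"
    by (subst power_divide) (simp add: z power_int_minus divide_inverse)
  ultimately have "real p powr (- (of_int r / of_nat t)) \<in> padic_bounds (x + y)"
    using * by (intro padic_boundsI) (simp_all only:)
  moreover have "max a b = real p powr (- (of_int r / of_nat t))"
  proof -
    have "real p powr (- (of_int u / of_nat t)) \<le> real p powr (- (of_int v / of_nat t)) \<longleftrightarrow> v \<le> u" for u v
      using p_gt_1 *(1) by (simp add: divide_le_cancel)
    then show ?thesis unfolding r_def * by (simp add: max_def min_def)
  qed
  ultimately show ?thesis by simp
qed

lemma padic_bounds_mult:
  assumes "a \<in> padic_bounds x" "b \<in> padic_bounds y"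
  shows "a * b \<in> padic_bounds (x * y)"
proof -
  obtain t s s' where *: "t > 0" "a = real p powr (- (of_int s / of_nat t))" "b = real p powr (- (of_int s' / of_nat t))"
    "x ^ t * of_nat p powi (- s) \<in> p_integral p" "y ^ t * of_nat p powi (- s') \<in> p_integral p"
    using padic_bounds_common[OF assms] by blast
  have "(x * y) ^ t * of_nat p powi (- (s + s')) = (x ^ t * of_nat p powi (- s)) * (y ^ t * of_nat p powi (- s'))"
    using p_neq_0 by (simp add: power_mult_distrib power_int_diff power_int_minus divide_inverse)
  then have "real p powr (- (of_int (s + s') / of_nat t)) \<in> padic_bounds (x * y)"
    using * p_integral_mult[OF p *(4,5)] by (intro padic_boundsI) auto
  moreover have "a * b = real p powr (- (of_int (s + s') / of_nat t))"
    unfolding * powr_add[symmetric] by (simp add: add_divide_distrib)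
  ultimately show ?thesis by simp
qed

lemma padic_bounds_square:
  assumes "a \<in> padic_bounds (x * x)"
  shows "sqrt a \<in> padic_bounds x"
proof -
  obtain t :: nat and s :: int where 1: "t > 0" "a = real p powr (- (of_int s / of_nat t))" "(x * x) ^ t * of_nat p powi (- s) \<in> p_integral p"
    using assms(1) by (auto simp: padic_bounds_def)
  have "x ^ (2 * t) * of_nat p powi (- s) \<in> p_integral p"
    using 1(3) by (simp add: power_mult power2_eq_square)
  then have "real p powr (- (of_int s / of_nat (2 * t))) \<in> padic_bounds x" using 1 by (intro padic_boundsI) auto
  moreover have "sqrt a = real p powr (- (of_int s / of_nat (2 * t)))"
    unfolding 1 using p_gt_1 by (intro real_sqrt_unique) (auto simp: powr_power)
  ultimately show ?thesis by simp
qed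

lemma padic_bounds_pos: "a \<in> padic_bounds x \<Longrightarrow> a > 0"
  using p_gt_1 by (auto simp: padic_bounds_def)

lemma padic_bounds_nonempty:
  assumes "x \<in> Qbar" shows "padic_bounds x \<noteq> {}"
proof -
  obtain s where "of_nat p ^ s * x \<in> p_integral p" using p_power_multiple_p_integral[OF p] assms by blast
  then have "real p powr (- (of_int (- int s) / of_nat 1)) \<in> padic_bounds x"
    by (intro padic_boundsI) (auto simp: mult.commute)
  then show ?thesis by blast
qed

text \<open>A bound below 1 would have \<open>s > 0\<close> and would make the inverse of p
  p-integral.\<close>

lemma padic_bounds_1:
  assumes "a \<in> padic_bounds 1" shows "a \<ge> 1"
proof -
  obtain t :: nat and s :: int where 1: "t > 0" "a = real p powr (- (of_int s / of_nat t))" "of_nat p powi (- s) \<in> p_integral p"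
    using assms(1) by (auto simp: padic_bounds_def)
  have "s \<le> 0"
  proof (rule ccontr)
    assume "\<not> s \<le> 0"
    then have "1 * of_nat p powi (- 1) \<in> p_integral p" using 1 by (intro p_integral_powi_mono[of 1 s 1]) auto
    then show False using inverse_p_not_p_integral[OF p] by (simp add: power_int_minus)
  qed
  then have "0 \<le> - (of_int s / real t)" using 1(1) by (simp add: divide_nonpos_pos)
  then show ?thesis unfolding 1(2) using p_gt_1 by (intro ge_one_powr_ge_zero) auto
qed

lemma padic_seminorm_le: "a \<in> padic_bounds x \<Longrightarrow> x \<in> Qbar \<Longrightarrow> padic_seminorm x \<le> a"
  unfolding padic_seminorm_def
  by (auto intro!: cInf_lower bdd_belowI[of _ 0] less_imp_le[OF padic_bounds_pos])

lemma padic_seminorm_ge: "(\<And>a. a \<in> padic_bounds x \<Longrightarrow> c \<le> a) \<Longrightarrow> x \<in> Qbar \<Longrightarrow> c \<le> padic_seminorm x"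
  unfolding padic_seminorm_def using padic_bounds_nonempty by (auto intro!: cInf_greatest)

lemma padic_seminorm_nonneg: "padic_seminorm x \<ge> 0"
proof (cases "x \<in> Qbar")
  case True
  then show ?thesis by (intro padic_seminorm_ge) (auto intro: less_imp_le padic_bounds_pos)
qed (auto simp: padic_seminorm_def)

lemma padic_seminorm_eps:
  assumes "x \<in> Qbar" "\<epsilon> > 0"
  obtains a where "a \<in> padic_bounds x" "a < padic_seminorm x + \<epsilon>"
proof -
  have "Inf (padic_bounds x) < padic_seminorm x + \<epsilon>" using assms by (simp add: padic_seminorm_def)
  then show ?thesis
    using that cInf_less_iff[OF padic_bounds_nonempty[OF assms(1)]] padic_bounds_pos
    by (metis bdd_belowI less_imp_le)
qed

lemma power_seminorm_padic: "power_seminorm Qbar padic_seminorm"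
proof -
  interpret Q: cfield Qbar by (rule cfield_Qbar)
  have um: "padic_seminorm (x + y) \<le> max (padic_seminorm x) (padic_seminorm y)" if xy: "x \<in> Qbar" "y \<in> Qbar" for x y
  proof (rule field_le_epsilon)
    fix \<epsilon> :: real assume \<epsilon>: "\<epsilon> > 0"
    obtain a where a: "a \<in> padic_bounds x" "a < padic_seminorm x + \<epsilon>" using padic_seminorm_eps[OF xy(1) \<epsilon>] .
    obtain b where b: "b \<in> padic_bounds y" "b < padic_seminorm y + \<epsilon>" using padic_seminorm_eps[OF xy(2) \<epsilon>] .
    have "padic_seminorm (x + y) \<le> max a b" using padic_bounds_add[OF a(1) b(1)] xy Q.add by (intro padic_seminorm_le) auto
    then show "padic_seminorm (x + y) \<le> max (padic_seminorm x) (padic_seminorm y) + \<epsilon>" using a b by auto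
  qed
  have mult: "padic_seminorm (x * y) \<le> padic_seminorm x * padic_seminorm y" if xy: "x \<in> Qbar" "y \<in> Qbar" for x y
  proof (rule real_le_if_le_product_eps[OF padic_seminorm_nonneg padic_seminorm_nonneg])
    fix \<epsilon> :: real assume \<epsilon>: "\<epsilon> > 0"
    obtain a where a: "a \<in> padic_bounds x" "a < padic_seminorm x + \<epsilon>" using padic_seminorm_eps[OF xy(1) \<epsilon>] .
    obtain b where b: "b \<in> padic_bounds y" "b < padic_seminorm y + \<epsilon>" using padic_seminorm_eps[OF xy(2) \<epsilon>] .
    have "padic_seminorm (x * y) \<le> a * b" using padic_bounds_mult[OF a(1) b(1)] xy Q.mult by (intro padic_seminorm_le) auto
    also have "\<dots> \<le> (padic_seminorm x + \<epsilon>) * (padic_seminorm y + \<epsilon>)"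
      using a b padic_bounds_pos[OF a(1)] padic_bounds_pos[OF b(1)] by (intro mult_mono) auto
    finally show "padic_seminorm (x * y) \<le> (padic_seminorm x + \<epsilon>) * (padic_seminorm y + \<epsilon>)" .
  qed
  have sq: "padic_seminorm (x * x) = padic_seminorm x * padic_seminorm x" if x: "x \<in> Qbar" for x
  proof (rule antisym[OF mult[OF x x] padic_seminorm_ge])
    fix a assume a: "a \<in> padic_bounds (x * x)"
    have "padic_seminorm x \<le> sqrt a" using padic_bounds_square[OF a] x by (intro padic_seminorm_le) auto
    then have "padic_seminorm x * padic_seminorm x \<le> sqrt a * sqrt a"
      using padic_seminorm_nonneg[of x] padic_bounds_pos[OF a] by (intro mult_mono) auto
    then show "padic_seminorm x * padic_seminorm x \<le> a" using padic_bounds_pos[OF a] by simp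
  qed (use x Q.mult in auto)
  have one: "padic_seminorm 1 = 1"
  proof (rule antisym)
    have "real p powr (- (of_int 0 / of_nat 1)) \<in> padic_bounds 1"
      by (intro padic_boundsI) (auto intro: p_integral_algebraic_int[OF p])
    then show "padic_seminorm 1 \<le> 1" using p_gt_1 padic_seminorm_le[of _ 1] by fastforce
    show "padic_seminorm 1 \<ge> 1" using padic_bounds_1 by (intro padic_seminorm_ge) auto
  qed
  \<comment> \<open>Zero is divisible by every power of p, so its bounds tend to 0.\<close>
  have "padic_seminorm 0 \<le> 1 / real p ^ s" for s
  proof -
    have "real p powr (- (of_int (int s) / of_nat 1)) \<in> padic_bounds 0"
      by (intro padic_boundsI) (auto intro: p_integral_algebraic_int[OF p])
    then have "padic_seminorm 0 \<le> real p powr (- (of_int (int s) / of_nat 1))" by (intro padic_seminorm_le) auto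
    also have "\<dots> = 1 / real p ^ s" using p_gt_1 by (simp add: powr_minus powr_realpow divide_inverse)
    finally show ?thesis .
  qed
  moreover have "(\<lambda>s. 1 / real p ^ s) \<longlonglongrightarrow> 0"
    using LIMSEQ_inverse_realpow_zero[OF p_gt_1] by (simp add: divide_inverse)
  ultimately have "padic_seminorm 0 \<le> 0" by (intro LIMSEQ_le_const) auto
  then have zero: "padic_seminorm 0 = 0" using padic_seminorm_nonneg[of 0] by simp
  have "padic_seminorm x = 0" if "x \<notin> Qbar" for x using that by (simp add: padic_seminorm_def)
  then show ?thesis
    unfolding power_seminorm_def ultrametric_on_def
    using um mult sq one zero padic_seminorm_nonneg by blast
qed

text \<open>The minimal seminorm is only known to lie below \<open>padic_seminorm\<close>. For p,
  and for integers prime to p, upper bounds at both \<open>x\<close> and \<open>inverse x\<close>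
  are available, and multiplicativity turns the two into an equality (\<open>inv\<close>).\<close>

theorem exists_padic_absolute_value:
  obtains u where "absolute_value_on Qbar u" "ultrametric_on Qbar u" "extends_padic p u"
proof -
  interpret Q: cfield Qbar by (rule cfield_Qbar)
  obtain u where u: "absolute_value_on Qbar u" "ultrametric_on Qbar u" "\<And>x. u x \<le> padic_seminorm x"
    using exists_absolute_value_le[OF cfield_Qbar power_seminorm_padic] by blast
  have m: "u (x * y) = u x * u y" if "x \<in> Qbar" "y \<in> Qbar" for x y
    using u(1) that by (auto simp: absolute_value_on_def)
  have nn: "u x \<ge> 0" "u x = 0 \<longleftrightarrow> x = 0" if "x \<in> Qbar" for x
    using u(1) that by (auto simp: absolute_value_on_def)
  have u1: "u 1 = 1" using m[of 1 1] nn[of 1] by auto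
  have inv: "u x = 1 / c" if "x \<in> Qbar" "x \<noteq> 0" "u x \<le> 1 / c" "u (inverse x) \<le> c" "c > 0" for x c
  proof -
    have "u x * u (inverse x) = 1" using m[of x "inverse x"] that u1 by auto
    moreover have "u x * u (inverse x) \<le> u x * c" using that nn by (intro mult_left_mono) auto
    ultimately have "1 / c \<le> u x" using that by (simp add: field_simps)
    then show ?thesis using that by simp
  qed
  have le: "u x \<le> real p powr (- of_int s)" if "x \<in> Qbar" "x * of_nat p powi (- s) \<in> p_integral p" for x s
  proof -
    have "real p powr (- (of_int s / of_nat 1)) \<in> padic_bounds x" using that(2) by (intro padic_boundsI) auto
    then show ?thesis using padic_seminorm_le that(1) u(3)[of x] by force
  qed
  have up: "u (of_nat p) = 1 / real p"
  proof (rule inv)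
    show "u (of_nat p) \<le> 1 / real p"
      using le[of "of_nat p" 1] p_gt_1 p_neq_0 p_integral_algebraic_int[OF p, of 1]
      by (auto simp: power_int_minus powr_minus divide_inverse)
    show "u (inverse (of_nat p)) \<le> real p"
      using le[of "inverse (of_nat p)" "- 1"] p_gt_1 p_neq_0 p_integral_algebraic_int[OF p, of 1]
      by auto
  qed (use p_neq_0 p_gt_1 in auto)
  have uc: "u (of_nat a) = 1" if a: "\<not> p dvd a" for a
  proof -
    have a0: "a > 0" using a by (cases a) auto
    have "u (of_nat a) = 1 / 1"
    proof (rule inv)
      show "u (of_nat a) \<le> 1 / 1"
        using le[of "of_nat a" 0] p_gt_1 p_integral_algebraic_int[OF p, of "of_nat a"] by auto
      have "inverse (of_nat a) \<in> p_integral p" using a a0 by (intro p_integralI[OF p, of a]) auto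
      then show "u (inverse (of_nat a)) \<le> 1"
        using le[of "inverse (of_nat a)" 0] p_gt_1 by auto
    qed (use a0 in auto)
    then show ?thesis by simp
  qed
  have pw: "u (of_nat p ^ n) = 1 / real p ^ n" for n
  proof (induction n)
    case (Suc n)
    have "u (of_nat p * of_nat p ^ n) = u (of_nat p) * u (of_nat p ^ n)"
      by (rule m) (use Q.power[of "of_nat p"] in auto)
    then show ?case using Suc up by simp
  qed (simp add: u1)
  have "u (- 1) * u (- 1) = 1" using m[of "- 1" "- 1"] u1 by simp
  then have um1: "u (- 1) = 1" using nn(1)[of "- 1"] by (auto simp: square_eq_1_iff)
  have uci: "u (of_int i) = 1" if i: "\<not> int p dvd i" for i
  proof -
    have a: "\<not> p dvd nat \<bar>i\<bar>" using i by (simp add: dvd_nat_abs_iff)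
    show ?thesis
    proof (cases "i \<ge> 0")
      case True
      then have "(of_int i :: complex) = of_nat (nat \<bar>i\<bar>)" by simp
      then show ?thesis using uc[OF a] by simp
    next
      case False
      then have "(of_int i :: complex) = (- 1) * of_nat (nat \<bar>i\<bar>)" by simp
      then have "u (of_int i) = u (- 1) * u (of_nat (nat \<bar>i\<bar>))" using m[of "- 1" "of_nat (nat \<bar>i\<bar>)"] by simp
      then show ?thesis using uc[OF a] um1 by simp
    qed
  qed
  have "u (of_int i) = 1 / real p ^ multiplicity (int p) i" if i: "i \<noteq> 0" for i :: int
  proof -
    have "\<not> is_unit (int p)" using p by (auto simp: prime_nat_iff)
    then obtain b where b: "i = int p ^ multiplicity (int p) i * b" "\<not> int p dvd b"
      using multiplicity_decompose'[of i "int p"] i by auto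
    have "u (of_int i) = u (of_nat p ^ multiplicity (int p) i * of_int b)" by (subst b(1)) simp
    also have "\<dots> = u (of_nat p ^ multiplicity (int p) i) * u (of_int b)"
      by (rule m) (use Q.power[of "of_nat p"] in auto)
    finally show ?thesis using uci[OF b(2)] pw by simp
  qed
  then have "extends_padic p u" by (simp add: extends_padic_def)
  with u that show ?thesis by blast
qed

end

subsection \<open>Number fields and their embeddings\<close>

definition poly_over :: "complex set \<Rightarrow> complex poly \<Rightarrow> bool" where
  "poly_over F p \<longleftrightarrow> (\<forall>i. coeff p i \<in> F)"

context cfield
begin

lemma csubring: "csubring K"
  by unfold_locales auto

lemma poly_over_0: "poly_over K 0" and poly_over_1: "poly_over K 1"
  by (auto simp: poly_over_def coeff_1)

lemma poly_over_add: "poly_over K p \<Longrightarrow> poly_over K q \<Longrightarrow> poly_over K (p + q)"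
  and poly_over_diff: "poly_over K p \<Longrightarrow> poly_over K q \<Longrightarrow> poly_over K (p - q)"
  and poly_over_uminus: "poly_over K p \<Longrightarrow> poly_over K (- p)"
  by (auto simp: poly_over_def)

lemma poly_over_mult: "poly_over K p \<Longrightarrow> poly_over K q \<Longrightarrow> poly_over K (p * q)"
  by (simp add: poly_over_def csubring.coeff_mult_mem[OF csubring])

lemma poly_over_prod: "(\<And>i. i \<in> I \<Longrightarrow> poly_over K (f i)) \<Longrightarrow> poly_over K (\<Prod>i\<in>I. f i)"
  by (induction I rule: infinite_finite_induct) (auto intro: poly_over_mult poly_over_1)

lemma poly_over_monom: "c \<in> K \<Longrightarrow> poly_over K (monom c i)"
  by (auto simp: poly_over_def)

lemma poly_over_pCons: "c \<in> K \<Longrightarrow> poly_over K p \<Longrightarrow> poly_over K (pCons c p)"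
  by (auto simp: poly_over_def coeff_pCons split: nat.splits)

lemma poly_over_pcompose: "poly_over K p \<Longrightarrow> poly_over K q \<Longrightarrow> poly_over K (pcompose p q)"
  unfolding poly_over_def
  by (intro allI coeff_pcompose_semiring_closed) auto

lemma poly_over_pderiv: "poly_over K p \<Longrightarrow> poly_over K (pderiv p)"
  by (auto simp: poly_over_def coeff_pderiv simp del: of_nat_Suc)

lemma poly_over_division:
  assumes "poly_over K p" "lead_coeff p = 1" "poly_over K q"
  shows "\<exists>s r. poly_over K s \<and> poly_over K r \<and> q = p * s + r \<and> (r = 0 \<or> degree r < degree p)"
  using assms(3)
proof (induction "degree q" arbitrary: q rule: less_induct)
  case less
  show ?case
  proof (cases "degree q < degree p \<or> q = 0")
    case True
    then show ?thesis using less.prems by (intro exI[of _ 0] exI[of _ q]) (auto simp: poly_over_0)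
  next
    case False
    define m where "m = monom (lead_coeff q) (degree q - degree p)"
    have m: "poly_over K m" unfolding m_def using less.prems by (intro poly_over_monom) (auto simp: poly_over_def)
    have m0: "m \<noteq> 0" using False by (simp add: m_def)
    have pm: "degree (p * m) = degree q" "lead_coeff (p * m) = lead_coeff q"
    proof -
      have "p \<noteq> 0" using assms(2) by auto
      moreover have "lead_coeff q \<noteq> 0" using False by simp
      then have "degree m = degree q - degree p" unfolding m_def by (rule degree_monom_eq)
      ultimately show "degree (p * m) = degree q" using m0 False by (simp add: degree_mult_eq)
      show "lead_coeff (p * m) = lead_coeff q" using assms(2) unfolding lead_coeff_mult m_def lead_coeff_monom by simp
    qed
    define q' where "q' = q - p * m"
    have q': "poly_over K q'" unfolding q'_def by (intro poly_over_diff poly_over_mult less.prems assms m)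
    have "q' = 0 \<or> degree q' < degree q"
    proof -
      have "degree q' \<le> degree q" unfolding q'_def using degree_diff_le_max[of q "p * m"] pm by simp
      moreover have "coeff q' (degree q) = 0" using pm by (simp add: q'_def)
      ultimately show ?thesis by (metis leading_coeff_0_iff le_neq_implies_less)
    qed
    then have "\<exists>s r. poly_over K s \<and> poly_over K r \<and> q' = p * s + r \<and> (r = 0 \<or> degree r < degree p)"
    proof
      assume "q' = 0"
      then show ?thesis by (intro exI[of _ 0]) (simp add: poly_over_0)
    next
      assume "degree q' < degree q"
      then show ?thesis by (rule less.hyps[OF _ q'])
    qed
    then obtain s r where sr: "poly_over K s" "poly_over K r" "q' = p * s + r" "r = 0 \<or> degree r < degree p" by blast
    have "q = p * (s + m) + r" using sr(3) by (simp add: q'_def algebra_simps)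
    then show ?thesis using sr(2,4) poly_over_add[OF sr(1) m] by blast
  qed
qed

definition is_min_poly :: "complex \<Rightarrow> complex poly \<Rightarrow> bool" where
  "is_min_poly x p \<longleftrightarrow> poly_over K p \<and> lead_coeff p = 1 \<and> poly p x = 0 \<and>
     (\<forall>q. poly_over K q \<and> poly q x = 0 \<and> q \<noteq> 0 \<longrightarrow> degree p \<le> degree q)"

lemma exists_min_poly:
  assumes "poly_over K q" "q \<noteq> 0" "poly q x = 0"
  obtains p where "is_min_poly x p"
proof -
  define P where "P = (\<lambda>q. poly_over K q \<and> poly q x = 0 \<and> q \<noteq> 0)"
  define p where "p = arg_min degree P"
  have P: "P p" "\<And>q. P q \<Longrightarrow> degree p \<le> degree q"
    using arg_min_nat_lemma[of P q degree] assms unfolding p_def P_def by auto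
  define p' where "p' = Polynomial.smult (inverse (lead_coeff p)) p"
  have "p \<noteq> 0" using P by (simp add: P_def)
  then have "is_min_poly x p'" unfolding is_min_poly_def
    using P by (auto simp: p'_def P_def poly_over_def)
  then show ?thesis using that by blast
qed

lemma min_poly_dvd:
  assumes "is_min_poly x p" "poly_over K q" "poly q x = 0"
  obtains s where "poly_over K s" "q = p * s"
proof -
  obtain s r where sr: "poly_over K s" "poly_over K r" "q = p * s + r" "r = 0 \<or> degree r < degree p"
    using poly_over_division[of p q] assms by (auto simp: is_min_poly_def)
  have "poly r x = 0" using sr(3) assms by (simp add: is_min_poly_def)
  then have "r = 0" using assms(1) sr unfolding is_min_poly_def by (metis not_le)
  then show ?thesis using that sr by auto
qed

lemma min_poly_degree_pos: "is_min_poly x p \<Longrightarrow> degree p > 0"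
  unfolding is_min_poly_def using csubring.integral_degree_pos[OF csubring] by blast

text \<open>If \<open>g\<close> is minimal for another root \<open>z\<close>, then
  \<open>p = g * s\<close>, and \<open>x\<close> is a root of \<open>g\<close> or of
  \<open>s\<close>. Minimality of \<open>p\<close> excludes \<open>s\<close>, whose degree is
  smaller, and forces equal degrees. Hence all conjugates may be treated alike.\<close>

lemma min_poly_root:
  assumes "is_min_poly x p" "poly p z = 0" shows "is_min_poly z p"
proof -
  have p: "poly_over K p" "lead_coeff p = 1" "poly p x = 0" "p \<noteq> 0"
    using assms(1) unfolding is_min_poly_def by auto
  obtain g where g: "is_min_poly z g" using exists_min_poly[OF p(1,4) assms(2)] by blast
  obtain s where s: "poly_over K s" "p = g * s" using min_poly_dvd[OF g p(1) assms(2)] by blast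
  have s0: "s \<noteq> 0" "g \<noteq> 0" using s p by auto
  then have deg: "degree p = degree g + degree s" using s by (simp add: degree_mult_eq)
  have "poly g x = 0 \<or> poly s x = 0" using p(3) s by simp
  then have "poly g x = 0"
  proof
    assume "poly s x = 0"
    then have "degree p \<le> degree s" using assms(1) s s0 by (auto simp: is_min_poly_def)
    then show ?thesis using deg min_poly_degree_pos[OF g] by simp
  qed
  then have "degree p \<le> degree g" using assms(1) g s0 by (auto simp: is_min_poly_def)
  then have "degree s = 0" "degree p = degree g" using deg by auto
  then show ?thesis using g p assms(2) unfolding is_min_poly_def by simp
qed

text \<open>Separability in characteristic 0: the derivative is nonzero of smaller degree, so it
  cannot share a root with a polynomial that is minimal for that root.\<close>

lemma min_poly_pderiv_nonzero:
  assumes "is_min_poly x p" "poly p z = 0" shows "poly (pderiv p) z \<noteq> 0"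
proof
  assume "poly (pderiv p) z = 0"
  note z = min_poly_root[OF assms]
  have "pderiv p \<noteq> 0" using min_poly_degree_pos[OF z] by (auto simp: pderiv_eq_0_iff)
  then have "degree p \<le> degree (pderiv p)"
    using z \<open>poly (pderiv p) z = 0\<close> poly_over_pderiv by (auto simp: is_min_poly_def)
  then show False using min_poly_degree_pos[OF z] by (simp add: degree_pderiv)
qed

end

interpretation Rats: cfield \<rat> by (rule cfield_Rats)
interpretation Qbar: cfield Qbar by (rule cfield_Qbar)

lemma algebraic_min_poly:
  assumes "algebraic x" obtains p where "Rats.is_min_poly x p"
proof -
  obtain q where "\<forall>i. coeff q i \<in> \<rat>" "q \<noteq> 0" "poly q x = 0" using assms unfolding algebraic_altdef by blast
  then show ?thesis using Rats.exists_min_poly[of q x] that unfolding poly_over_def by blast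
qed

lemma min_poly_algebraic: "Rats.is_min_poly x p \<Longrightarrow> algebraic x"
  unfolding Rats.is_min_poly_def algebraic_altdef poly_over_def by (intro exI[of _ p]) auto

section \<open>Simple extensions of the rationals and primitive elements\<close>

definition adjoin :: "complex \<Rightarrow> complex set" where
  "adjoin c = {poly q c | q. poly_over \<rat> q}"

lemma adjoinI: "poly_over \<rat> q \<Longrightarrow> poly q c \<in> adjoin c"
  by (auto simp: adjoin_def)

lemma adjoin_self: "c \<in> adjoin c"
  using adjoinI[OF Rats.poly_over_monom[of 1 1], of c] by (simp add: poly_monom)

lemma cfield_adjoin:
  assumes c: "algebraic c" shows "cfield (adjoin c)"
proof
  fix x y assume "x \<in> adjoin c" "y \<in> adjoin c"
  then obtain q r where q: "poly_over \<rat> q" "x = poly q c" and r: "poly_over \<rat> r" "y = poly r c"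
    by (auto simp: adjoin_def)
  show "x + y \<in> adjoin c" using adjoinI[OF Rats.poly_over_add[OF q(1) r(1)], of c] q r by simp
  show "x * y \<in> adjoin c" using adjoinI[OF Rats.poly_over_mult[OF q(1) r(1)], of c] q r by simp
  show "- x \<in> adjoin c" using adjoinI[OF Rats.poly_over_uminus[OF q(1)], of c] q by simp
  show "inverse x \<in> adjoin c"
  proof (cases "x = 0")
    case True
    then show ?thesis using adjoinI[OF Rats.poly_over_0, of c] by simp
  next
    case False
    have "algebraic x" using Qbar.poly[of q c] q c unfolding poly_over_def
      by (metis Qbar.Rats_subset mem_Collect_eq subsetD)
    then obtain p where p: "Rats.is_min_poly x p" using algebraic_min_poly by blast
    \<comment> \<open>Splitting off the constant term \<open>a\<close> turns the minimal equation
      into \<open>x * poly p' x = - a\<close>. By minimality \<open>a\<close> is nonzero, which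
      exhibits the inverse as a polynomial in \<open>x\<close>.\<close>
    obtain a p' where pp: "p = pCons a p'" by (cases p)
    have over: "poly_over \<rat> p'" "a \<in> \<rat>"
    proof -
      have "\<forall>i. coeff p i \<in> \<rat>" using p unfolding Rats.is_min_poly_def poly_over_def by blast
      then show "poly_over \<rat> p'" unfolding pp poly_over_def by (metis coeff_pCons_Suc)
      show "a \<in> \<rat>" using \<open>\<forall>i. coeff p i \<in> \<rat>\<close> unfolding pp by (metis coeff_pCons_0)
    qed
    have root: "a + x * poly p' x = 0" using p unfolding Rats.is_min_poly_def pp by simp
    have "a \<noteq> 0"
    proof
      assume "a = 0"
      then have "poly p' x = 0" using root False by simp
      moreover have "p' \<noteq> 0" using p Rats.min_poly_degree_pos[OF p] unfolding pp by auto
      ultimately have "degree p \<le> degree p'" using p over unfolding Rats.is_min_poly_def by blast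
      then show False using \<open>p' \<noteq> 0\<close> unfolding pp by simp
    qed
    then have "x * (- poly p' x / a) = 1" using root by (simp add: field_simps add_eq_0_iff)
    then have "inverse x = - poly p' x / a" by (rule inverse_unique)
    also have "\<dots> = poly (Polynomial.smult (- inverse a) (pcompose p' q)) c"
      by (simp add: poly_pcompose q divide_inverse)
    also have "\<dots> \<in> adjoin c"
      using over Rats.poly_over_pcompose[OF over(1) q(1)]
      by (intro adjoinI) (auto simp: poly_over_def)
    finally show ?thesis .
  qed
next
  show "0 \<in> adjoin c" using adjoinI[OF Rats.poly_over_0, of c] by simp
  show "1 \<in> adjoin c" using adjoinI[OF Rats.poly_over_1, of c] by simp
qed

lemma adjoin_subset: "cfield K \<Longrightarrow> c \<in> K \<Longrightarrow> adjoin c \<subseteq> K"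
  unfolding adjoin_def poly_over_def using cfield.poly[of K _ c] cfield.Rats_subset[of K] by blast

text \<open>The natural number \<open>t\<close> avoids the finitely many coincidences in
  \<open>bad\<close>. Over the field generated by \<open>c\<close>, the minimal polynomial of
  \<open>b\<close> divides both \<open>g\<close> and \<open>h\<close>, which is \<open>f\<close>
  composed with a linear polynomial; their only common root is \<open>b\<close>. Since
  \<open>g\<close> has no double root there, this minimal polynomial is linear, so \<open>b\<close>
  and then \<open>a\<close> lie in the field.\<close>

lemma primitive_element_two:
  assumes a: "algebraic a" and b: "algebraic b"
  obtains t :: nat where "a \<in> adjoin (a + of_nat t * b)" "b \<in> adjoin (a + of_nat t * b)"
proof -
  obtain f where f: "Rats.is_min_poly a f" using algebraic_min_poly[OF a] by blast
  obtain g where g: "Rats.is_min_poly b g" using algebraic_min_poly[OF b] by blast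
  define A B where "A = {z. poly f z = 0}" and "B = {z. poly g z = 0} - {b}"
  have fg: "poly_over \<rat> f" "poly_over \<rat> g" "poly f a = 0" "poly g b = 0" "g \<noteq> 0" "f \<noteq> 0"
    using f g unfolding Rats.is_min_poly_def by auto
  have fin: "finite A" "finite B"
    using poly_roots_finite[OF fg(5)] poly_roots_finite[OF fg(6)] by (simp_all add: A_def B_def)
  define bad where "bad = (\<lambda>(z, w). (z - a) / (b - w)) ` (A \<times> B)"
  have "finite bad" using fin by (simp add: bad_def)
  moreover have "infinite (range (of_nat :: nat \<Rightarrow> complex))"
    by (simp add: range_inj_infinite inj_of_nat)
  ultimately obtain t :: nat where t: "of_nat t \<notin> bad"
    by (meson finite_subset image_subsetI)
  define c where "c = a + of_nat t * b"
  have alg: "algebraic c" using Qbar.add[of a "of_nat t * b"] Qbar.mult[of "of_nat t" b] a b by (auto simp: c_def)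
  interpret F: cfield "adjoin c" by (rule cfield_adjoin[OF alg])
  have over: "poly_over (adjoin c) q" if "poly_over \<rat> q" for q
    using that F.Rats_subset unfolding poly_over_def by blast
  obtain m where m: "F.is_min_poly b m" using F.exists_min_poly[OF over[OF fg(2)] fg(5,4)] by blast
  obtain s where s: "g = m * s" using F.min_poly_dvd[OF m over[OF fg(2)] fg(4)] by blast
  define h where "h = pcompose f [:c, - of_nat t:]"
  have "poly_over (adjoin c) h" unfolding h_def
    by (intro F.poly_over_pcompose over fg F.poly_over_pCons F.poly_over_0 adjoin_self F.uminus F.of_nat)
  moreover have "poly h b = 0" using fg by (simp add: h_def poly_pcompose c_def)
  ultimately obtain s' where s': "h = m * s'" using F.min_poly_dvd[OF m] by blast
  have root: "z = b" if z: "poly m z = 0" for z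
  proof (rule ccontr)
    assume "z \<noteq> b"
    have "poly h z = 0" using s' z by simp
    then have "poly f (c - of_nat t * z) = 0" by (simp add: h_def poly_pcompose mult.commute)
    moreover have "poly g z = 0" using s z by simp
    ultimately have "(c - of_nat t * z, z) \<in> A \<times> B" using \<open>z \<noteq> b\<close> by (simp add: A_def B_def)
    moreover have "of_nat t = ((c - of_nat t * z) - a) / (b - z)"
      using \<open>z \<noteq> b\<close> by (simp add: c_def field_simps)
    ultimately have "of_nat t \<in> bad" unfolding bad_def by (intro image_eqI[of _ _ "(c - of_nat t * z, z)"]) auto
    then show False using t by simp
  qed
  have "poly m b = 0" using m unfolding F.is_min_poly_def by blast
  define l where "l = [:- b, 1:]"
  have lb: "poly l b = 0" by (simp add: l_def)
  have dvd: "\<exists>q. p = l * q" if "poly p b = 0" for p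
    using that unfolding poly_eq_0_iff_dvd l_def dvd_def by simp
  obtain m1 where m1: "m = l * m1" using dvd[OF \<open>poly m b = 0\<close>] by blast
  have "degree m1 = 0"
  proof (rule ccontr)
    assume "degree m1 \<noteq> 0"
    then have "\<not> constant (poly m1)" by (simp add: constant_degree)
    then obtain z where z: "poly m1 z = 0" using fundamental_theorem_of_algebra by blast
    then have "poly m z = 0" by (simp add: m1)
    then have "poly m1 b = 0" using root z by blast
    then obtain m2 where "m1 = l * m2" using dvd by blast
    then have "g = l * (l * m2 * s)" unfolding s m1 by (simp only: mult.assoc)
    then have "pderiv g = l * pderiv (l * m2 * s) + l * m2 * s * pderiv l" by (simp only: pderiv_mult)
    then have "poly (pderiv g) b = 0" using lb by simp
    then show False using Rats.min_poly_pderiv_nonzero[OF g fg(4)] by simp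
  qed
  then obtain e where e: "m1 = [:e:]" by (rule degree_eq_zeroE)
  have me: "m = [:- b * e, e:]" by (simp add: m1 e l_def)
  have "lead_coeff m = 1" using m unfolding F.is_min_poly_def by blast
  then have "e = 1" unfolding me by (cases "e = 0") simp_all
  then have "m = [:- b, 1:]" by (simp add: me)
  moreover have "coeff m 0 \<in> adjoin c" using m unfolding F.is_min_poly_def poly_over_def by blast
  ultimately have "- b \<in> adjoin c" by simp
  then have bF: "b \<in> adjoin c" using F.uminus by fastforce
  have "a = c - of_nat t * b" by (simp add: c_def)
  then have "a \<in> adjoin c" using F.diff[OF adjoin_self F.mult[OF F.of_nat bF]] by simp
  then show ?thesis using that bF unfolding c_def by blast
qed

lemma primitive_element_finite:
  assumes "finite B" "B \<subseteq> K" "cfield K" "\<And>x. x \<in> K \<Longrightarrow> algebraic x"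
  shows "\<exists>c\<in>K. B \<subseteq> adjoin c"
  using assms(1,2)
proof (induction B rule: finite_induct)
  case empty
  then show ?case using cfield.zero[OF assms(3)] by blast
next
  case (insert b B)
  then obtain c where c: "c \<in> K" "B \<subseteq> adjoin c" by auto
  obtain t where t: "c \<in> adjoin (c + of_nat t * b)" "b \<in> adjoin (c + of_nat t * b)"
    using primitive_element_two[of c b] assms(4) c insert by auto
  interpret K: cfield K by fact
  have cK: "c + of_nat t * b \<in> K" using c insert by auto
  have "adjoin c \<subseteq> adjoin (c + of_nat t * b)"
    by (rule adjoin_subset[OF cfield_adjoin t(1)]) (rule assms(4)[OF cK])
  then show ?case using t c cK by blast
qed

section \<open>Comparison with the algebraic definition of number fields\<close>

lemma complex_ring_simps [simp]:
  "carrier complex_ring = UNIV" "x \<otimes>\<^bsub>complex_ring\<^esub> y = x * y" "x \<oplus>\<^bsub>complex_ring\<^esub> y = x + y"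
  "\<zero>\<^bsub>complex_ring\<^esub> = 0" "\<one>\<^bsub>complex_ring\<^esub> = 1"
  by (simp_all add: ring_of_type_algebra_def)

interpretation CR: cring complex_ring by (rule cring_from_type_algebra)

lemma complex_ring_minus [simp]: "\<ominus>\<^bsub>complex_ring\<^esub> x = - x"
  by (rule CR.minus_equality) simp_all

lemma complex_ring_inv: "x \<noteq> 0 \<Longrightarrow> inv\<^bsub>complex_ring\<^esub> x = inverse x"
  by (rule CR.comm_inv_char) simp_all

lemma subfield_imp_cfield:
  assumes "subfield k complex_ring" shows "cfield k"
proof -
  note sr = subringE[OF subfieldE(1)[OF assms]]
  show ?thesis
  proof
    fix x y assume xy: "x \<in> k" "y \<in> k"
    show "x + y \<in> k" using sr(7)[OF xy] by simp
    show "x * y \<in> k" using sr(6)[OF xy] by simp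
    show "- x \<in> k" using sr(5)[OF xy(1)] by simp
    show "inverse x \<in> k"
    proof (cases "x = 0")
      case False
      then show ?thesis using CR.subfield_m_inv(1)[OF assms, of x] xy by (simp add: complex_ring_inv)
    qed (use xy in simp)
  qed (use sr(2,3) in auto)
qed

lemma cfield_imp_subfield:
  assumes "cfield k" shows "subfield k complex_ring"
proof -
  interpret cfield k by fact
  show ?thesis
  proof (rule field.subfieldI'[OF field_from_type_algebra])
    show "subring k complex_ring" by (rule CR.subringI) (auto intro: uminus)
    show "\<And>x. x \<in> k - {\<zero>\<^bsub>complex_ring\<^esub>} \<Longrightarrow> inv\<^bsub>complex_ring\<^esub> x \<in> k"
      by (auto simp: complex_ring_inv)
  qed
qed

interpretation RR: csubring \<rat> by (rule csubring_Rats)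

lemma combine_rspan:
  "set Ks \<subseteq> \<rat> \<Longrightarrow> length Ks = length Us \<Longrightarrow> set Us \<subseteq> B \<Longrightarrow> finite B \<Longrightarrow> CR.combine Ks Us \<in> RR.rspan B"
proof (induction Ks Us rule: list_induct2')
  case (4 x xs y ys)
  then have "x * y \<in> RR.rspan B" "CR.combine xs ys \<in> RR.rspan B"
    by (auto intro: RR.rspan_smult[OF RR.rspan_base])
  then show ?case by (simp add: RR.rspan_add)
qed (simp_all add: RR.rspan_0)

lemma number_field_spanned:
  assumes "number_field k"
  obtains B where "finite B" "B \<subseteq> k" "1 \<in> B" "k \<subseteq> RR.rspan B"
proof -
  have sk: "subfield k complex_ring" using assms by (simp add: number_field_def)
  interpret cfield k by (rule subfield_imp_cfield[OF sk])
  have sq: "subfield \<rat> complex_ring" by (rule cfield_imp_subfield[OF cfield_Rats])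
  obtain n where "CR.dimension n \<rat> k" using assms by (auto simp: number_field_def CR.finite_dimension_def)
  then obtain Us where Us: "CR.Span \<rat> Us = k" using CR.exists_base[OF sq] by blast
  have "k \<subseteq> RR.rspan (insert 1 (set Us))"
  proof
    fix x assume "x \<in> k"
    then obtain Ks where "set Ks \<subseteq> \<rat>" "length Ks = length Us" "x = CR.combine Ks Us"
      using CR.Span_mem_iff_length_version[OF sq, of Us x] Us by auto
    then show "x \<in> RR.rspan (insert 1 (set Us))" using combine_rspan[of Ks Us "insert 1 (set Us)"] by blast
  qed
  moreover have "set Us \<subseteq> k" using CR.Span_base_incl[OF sq, of Us] Us by simp
  ultimately show ?thesis using that[of "insert 1 (set Us)"] by auto
qed

text \<open>Multiplication by any \<open>x\<close> in \<open>k\<close> preserves the finitely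
  generated rational span of \<open>B\<close>, so \<open>x\<close> is algebraic by the determinant
  trick; a primitive element for \<open>B\<close> then generates all of \<open>k\<close>.\<close>

theorem number_field_primitive:
  assumes "number_field k"
  obtains \<alpha> where "\<alpha> \<in> k" "k = adjoin \<alpha>" "algebraic \<alpha>" "cfield k"
proof -
  interpret cfield k by (rule subfield_imp_cfield) (use assms in \<open>simp add: number_field_def\<close>)
  obtain B where B: "finite B" "B \<subseteq> k" "1 \<in> B" "k \<subseteq> RR.rspan B" using number_field_spanned[OF assms] .
  have alg: "algebraic x" if x: "x \<in> k" for x
    unfolding algebraic_iff_integral
  proof (rule RR.integral_if_rspan_stable[OF B(1,3)])
    fix b assume "b \<in> B"
    then have "x * b \<in> k" using B(2) x by (intro mult) auto
    then show "x * b \<in> RR.rspan B" using B(4) by blast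
  qed
  obtain c where c: "c \<in> k" "B \<subseteq> adjoin c"
    using primitive_element_finite[OF B(1,2) cfield_axioms alg] by blast
  interpret A: cfield "adjoin c" by (rule cfield_adjoin[OF alg[OF c(1)]])
  have "RR.rspan B \<subseteq> adjoin c"
  proof
    fix x assume "x \<in> RR.rspan B"
    then obtain M where "x = (\<Sum>z\<in>B. M z * z)" "\<forall>z\<in>B. M z \<in> \<rat>" unfolding RR.rspan_def by blast
    moreover have "M z * z \<in> adjoin c" if "z \<in> B" for z
      using \<open>\<forall>z\<in>B. M z \<in> \<rat>\<close> that c(2) A.Rats_subset by (intro A.mult) auto
    ultimately show "x \<in> adjoin c" using A.sum[of B "\<lambda>z. M z * z"] by simp
  qed
  then have "k = adjoin c" using B(4) adjoin_subset[OF cfield_axioms c(1)] by blast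
  then show ?thesis using that c alg cfield_axioms by blast
qed

section \<open>Embeddings, interpolation and the norm\<close>

locale number_field_gen =
  fixes k :: "complex set" and \<alpha> :: complex and f :: "complex poly"
  assumes nf: "number_field k" and k_eq: "k = adjoin \<alpha>" and f: "Rats.is_min_poly \<alpha> f"
begin

sublocale cfield k
  unfolding k_eq by (rule cfield_adjoin[OF min_poly_algebraic[OF f]])

definition n :: nat where "n = degree f"

definition R :: "complex set" where "R = {z. poly f z = 0}"

lemma f_props: "poly_over \<rat> f" "lead_coeff f = 1" "poly f \<alpha> = 0" "f \<noteq> 0"
  using f unfolding Rats.is_min_poly_def by auto

lemma finite_R [simp]: "finite R"
  unfolding R_def by (rule poly_roots_finite[OF f_props(4)])

lemma card_R: "card R = n"
proof -
  have "rsquarefree f"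
    unfolding rsquarefree_roots using Rats.min_poly_pderiv_nonzero[OF f] by blast
  then have "f = (\<Prod>z\<in>R. [:- z, 1:])"
    using complex_poly_decompose_rsquarefree[of f] f_props(2) by (simp add: R_def)
  then have "n = degree (\<Prod>z\<in>R. [:- z, 1:])" unfolding n_def by (rule arg_cong)
  also have "\<dots> = (\<Sum>z\<in>R. degree [:- z, 1:])" by (rule degree_prod_sum_eq) simp
  finally show ?thesis by simp
qed

lemma n_pos: "n > 0"
  unfolding n_def by (rule Rats.min_poly_degree_pos[OF f])

lemma alpha_in_R: "\<alpha> \<in> R" using f_props by (simp add: R_def)

lemma R_nonempty: "R \<noteq> {}" using alpha_in_R by blast

lemma R_algebraic: "\<rho> \<in> R \<Longrightarrow> \<rho> \<in> Qbar"
  using min_poly_algebraic[OF Rats.min_poly_root[OF f]] by (simp add: R_def)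

text \<open>The embedding of \<open>k\<close> that sends \<alpha> to the root \<rho>. The
  representing polynomial is chosen by \<open>SOME\<close>; any two choices differ by a multiple of
  \<open>f\<close>, so the value does not depend on it (\<open>emb_poly\<close>).\<close>

definition emb :: "complex \<Rightarrow> complex \<Rightarrow> complex" where
  "emb \<rho> x = poly (SOME q. poly_over \<rat> q \<and> poly q \<alpha> = x) \<rho>"

lemma emb_poly:
  assumes "poly_over \<rat> q" "\<rho> \<in> R" shows "emb \<rho> (poly q \<alpha>) = poly q \<rho>"
proof -
  define r where "r = (SOME r. poly_over \<rat> r \<and> poly r \<alpha> = poly q \<alpha>)"
  have r: "poly_over \<rat> r" "poly r \<alpha> = poly q \<alpha>"
    using someI_ex[of "\<lambda>r. poly_over \<rat> r \<and> poly r \<alpha> = poly q \<alpha>"] assms unfolding r_def by blast+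
  obtain s where "q - r = f * s"
    using Rats.min_poly_dvd[OF f Rats.poly_over_diff[OF assms(1) r(1)]] r(2) by auto
  then have "poly q \<rho> - poly r \<rho> = poly f \<rho> * poly s \<rho>" by (metis poly_diff poly_mult)
  then show ?thesis using assms(2) by (simp add: emb_def R_def r_def)
qed

lemma kE:
  assumes "x \<in> k" obtains q where "poly_over \<rat> q" "x = poly q \<alpha>"
  using assms unfolding k_eq adjoin_def by blast

lemma emb_add: "x \<in> k \<Longrightarrow> y \<in> k \<Longrightarrow> \<rho> \<in> R \<Longrightarrow> emb \<rho> (x + y) = emb \<rho> x + emb \<rho> y"
  by (elim kE) (metis Rats.poly_over_add emb_poly poly_add)

lemma emb_mult: "x \<in> k \<Longrightarrow> y \<in> k \<Longrightarrow> \<rho> \<in> R \<Longrightarrow> emb \<rho> (x * y) = emb \<rho> x * emb \<rho> y"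
  by (elim kE) (metis Rats.poly_over_mult emb_poly poly_mult)

lemma emb_diff: "x \<in> k \<Longrightarrow> y \<in> k \<Longrightarrow> \<rho> \<in> R \<Longrightarrow> emb \<rho> (x - y) = emb \<rho> x - emb \<rho> y"
  by (elim kE) (metis Rats.poly_over_diff emb_poly poly_diff)

lemma emb_Rats: "c \<in> \<rat> \<Longrightarrow> \<rho> \<in> R \<Longrightarrow> emb \<rho> c = c"
  using emb_poly[of "[:c:]" \<rho>] Rats.poly_over_pCons[OF _ Rats.poly_over_0] by simp

lemma emb_0: "\<rho> \<in> R \<Longrightarrow> emb \<rho> 0 = 0" and emb_1: "\<rho> \<in> R \<Longrightarrow> emb \<rho> 1 = 1"
  by (simp_all add: emb_Rats)

lemma emb_alpha: "x \<in> k \<Longrightarrow> emb \<alpha> x = x"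
  by (elim kE) (simp add: emb_poly alpha_in_R)

lemma emb_nonzero:
  assumes "x \<in> k" "x \<noteq> 0" "\<rho> \<in> R" shows "emb \<rho> x \<noteq> 0"
proof -
  have "emb \<rho> x * emb \<rho> (inverse x) = 1"
    using emb_mult[of x "inverse x" \<rho>] assms emb_1 by (simp add: inverse)
  then show ?thesis by auto
qed

lemma emb_Qbar: "x \<in> k \<Longrightarrow> \<rho> \<in> R \<Longrightarrow> emb \<rho> x \<in> Qbar"
  using Qbar.poly[of _ \<rho>] R_algebraic Qbar.Rats_subset
  by (elim kE) (simp add: emb_poly poly_over_def subset_iff)

lemma k_algebraic: "x \<in> k \<Longrightarrow> x \<in> Qbar"
  using emb_Qbar[OF _ alpha_in_R] emb_alpha by simp

lemma emb_sum: "(\<And>i. i \<in> I \<Longrightarrow> g i \<in> k) \<Longrightarrow> \<rho> \<in> R \<Longrightarrow> emb \<rho> (\<Sum>i\<in>I. g i) = (\<Sum>i\<in>I. emb \<rho> (g i))"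
  by (induction I rule: infinite_finite_induct) (simp_all add: emb_add emb_0 sum)

lemma emb_power: "x \<in> k \<Longrightarrow> \<rho> \<in> R \<Longrightarrow> emb \<rho> (x ^ m) = emb \<rho> x ^ m"
  by (induction m) (simp_all add: emb_1 emb_mult power)

lemma alpha_in_k: "\<alpha> \<in> k" unfolding k_eq by (rule adjoin_self)

lemma emb_alpha_root: "\<rho> \<in> R \<Longrightarrow> emb \<rho> \<alpha> = \<rho>"
  using emb_poly[OF Rats.poly_over_monom[of 1 1]] by (simp add: poly_monom)

lemma coordinates:
  assumes "x \<in> k"
  obtains c where "\<And>j. c j \<in> \<rat>" "x = (\<Sum>j<n. c j * \<alpha> ^ j)"
proof -
  obtain q where q: "poly_over \<rat> q" "x = poly q \<alpha>" using kE[OF assms] .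
  obtain s r where sr: "poly_over \<rat> s" "poly_over \<rat> r" "q = f * s + r" "r = 0 \<or> degree r < degree f"
    using Rats.poly_over_division[OF f_props(1,2) q(1)] by blast
  have x: "x = poly r \<alpha>" using sr(3) q(2) f_props(3) by simp
  also have "\<dots> = (\<Sum>j<n. coeff r j * \<alpha> ^ j)"
    unfolding poly_altdef using sr(4) n_pos
    by (intro sum.mono_neutral_left) (auto simp: coeff_eq_0 n_def)
  finally show ?thesis using sr(2) that[of "coeff r"] unfolding poly_over_def by blast
qed

lemma emb_coordinates:
  assumes "\<And>j. c j \<in> \<rat>" "\<rho> \<in> R"
  shows "emb \<rho> (\<Sum>j<n. c j * \<alpha> ^ j) = (\<Sum>j<n. c j * \<rho> ^ j)" "(\<Sum>j<n. c j * \<alpha> ^ j) \<in> k"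
proof -
  have k: "c j * \<alpha> ^ j \<in> k" for j using Rats_subset assms(1) alpha_in_k by (intro mult power) auto
  then show "(\<Sum>j<n. c j * \<alpha> ^ j) \<in> k" by (rule sum)
  have "emb \<rho> (c j * \<alpha> ^ j) = c j * \<rho> ^ j" for j
    using emb_mult[of "c j" "\<alpha> ^ j" \<rho>] Rats_subset assms alpha_in_k
    by (simp add: emb_power emb_alpha_root emb_Rats power subset_iff)
  then show "emb \<rho> (\<Sum>j<n. c j * \<alpha> ^ j) = (\<Sum>j<n. c j * \<rho> ^ j)"
    using emb_sum[of "{..<n}" "\<lambda>j. c j * \<alpha> ^ j", OF k assms(2)] by simp
qed

text \<open>The Lagrange basis polynomials for the nodes \<open>R\<close>.\<close>

definition lag :: "complex \<Rightarrow> complex poly" where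
  "lag \<rho> = Polynomial.smult (inverse (\<Prod>\<tau>\<in>R - {\<rho>}. \<rho> - \<tau>)) (\<Prod>\<tau>\<in>R - {\<rho>}. [:- \<tau>, 1:])"

lemma lag_poly:
  assumes "\<rho> \<in> R" "\<tau> \<in> R" shows "poly (lag \<rho>) \<tau> = (if \<tau> = \<rho> then 1 else 0)"
proof -
  have "(\<Prod>\<tau>\<in>R - {\<rho>}. \<rho> - \<tau>) \<noteq> 0" by auto
  moreover have "\<tau> \<noteq> \<rho> \<Longrightarrow> (\<Prod>\<sigma>\<in>R - {\<rho>}. \<tau> - \<sigma>) = 0" using assms by (intro prod_zero) auto
  ultimately show ?thesis by (simp add: lag_def poly_prod)
qed

lemma lag_degree: "\<rho> \<in> R \<Longrightarrow> degree (lag \<rho>) < n"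
proof -
  assume \<rho>: "\<rho> \<in> R"
  have "degree (lag \<rho>) \<le> degree (\<Prod>\<tau>\<in>R - {\<rho>}. [:- \<tau>, 1:])" unfolding lag_def by (rule degree_smult_le)
  also have "\<dots> = (\<Sum>z\<in>R - {\<rho>}. degree [:- z, 1:])" by (rule degree_prod_sum_eq) simp
  also have "\<dots> = n - 1" using \<rho> by (simp add: card_R)
  finally show ?thesis using n_pos by simp
qed

lemma lag_Qbar: "\<rho> \<in> R \<Longrightarrow> coeff (lag \<rho>) j \<in> Qbar"
proof -
  assume \<rho>: "\<rho> \<in> R"
  have "(\<Prod>\<tau>\<in>R - {\<rho>}. \<rho> - \<tau>) \<in> Qbar" using \<rho> R_algebraic by (intro Qbar.prod Qbar.diff) auto
  moreover have "poly_over Qbar (\<Prod>\<tau>\<in>R - {\<rho>}. [:- \<tau>, 1:])"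
    using R_algebraic by (intro Qbar.poly_over_prod Qbar.poly_over_pCons Qbar.poly_over_0 Qbar.uminus Qbar.one) auto
  ultimately show ?thesis unfolding lag_def poly_over_def coeff_smult by (intro Qbar.mult Qbar.inverse) auto
qed

text \<open>Interpolation at the conjugates expresses each coefficient linearly through the values
  at the roots. Applied to the coordinates of an element of \<open>k\<close>, it bounds them by the
  sizes of its conjugates.\<close>

lemma lagrange:
  assumes "\<And>j. j \<ge> n \<Longrightarrow> c j = 0" "i < n"
  shows "c i = (\<Sum>\<rho>\<in>R. (\<Sum>j<n. c j * \<rho> ^ j) * coeff (lag \<rho>) i)"
proof -
  define p where "p = (\<Sum>j<n. monom (c j) j)"
  have cp: "coeff p i = c i" if "i < n" for i using that by (simp add: p_def coeff_sum)
  have pp: "poly p x = (\<Sum>j<n. c j * x ^ j)" for x by (simp add: p_def poly_sum poly_monom)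
  define q where "q = (\<Sum>\<rho>\<in>R. Polynomial.smult (poly p \<rho>) (lag \<rho>))"
  have dp: "degree p \<le> n - 1" unfolding p_def
    by (intro degree_sum_le) (auto intro: order_trans[OF degree_monom_le])
  have dq: "degree q \<le> n - 1" unfolding q_def
  proof (intro degree_sum_le)
    fix \<rho> assume "\<rho> \<in> R"
    then show "degree (Polynomial.smult (poly p \<rho>) (lag \<rho>)) \<le> n - 1"
      using degree_smult_le[of "poly p \<rho>" "lag \<rho>"] lag_degree[of \<rho>] by linarith
  qed simp
  have "p = q"
  proof (rule poly_eqI_degree)
    show "poly p x = poly q x" if "x \<in> R" for x
    proof -
      have "poly q x = (\<Sum>\<rho>\<in>R. if x = \<rho> then poly p \<rho> else 0)"
        unfolding q_def poly_sum poly_smult using that by (intro sum.cong refl) (simp add: lag_poly)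
      then show ?thesis using that by simp
    qed
  qed (use dp dq n_pos card_R in auto)
  then have "c i = coeff q i" using cp[OF assms(2)] by simp
  then show ?thesis by (simp add: q_def coeff_sum pp)
qed

text \<open>Linear independence of the embeddings, tested on the powers of \<alpha>. Weighting the
  vanishing sums with the coefficients of \<open>lag \<tau>\<close> isolates
  \<open>a \<tau>\<close>.\<close>

lemma dedekind:
  assumes "\<And>j. j < n \<Longrightarrow> (\<Sum>\<rho>\<in>R. a \<rho> * \<rho> ^ j) = 0" "\<tau> \<in> R"
  shows "a \<tau> = 0"
proof -
  have "0 = (\<Sum>j<n. coeff (lag \<tau>) j * (\<Sum>\<rho>\<in>R. a \<rho> * \<rho> ^ j))" using assms(1) by simp
  also have "\<dots> = (\<Sum>\<rho>\<in>R. a \<rho> * (\<Sum>j<n. coeff (lag \<tau>) j * \<rho> ^ j))"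
    by (simp add: sum_distrib_left mult_ac) (rule sum.swap)
  also have "(\<lambda>\<rho>. \<Sum>j<n. coeff (lag \<tau>) j * \<rho> ^ j) = poly (lag \<tau>)"
  proof
    fix \<rho>
    have "poly (lag \<tau>) \<rho> = (\<Sum>j\<le>degree (lag \<tau>). coeff (lag \<tau>) j * \<rho> ^ j)" by (rule poly_altdef)
    also have "\<dots> = (\<Sum>j<n. coeff (lag \<tau>) j * \<rho> ^ j)"
      using lag_degree[OF assms(2)] by (intro sum.mono_neutral_left) (auto simp: coeff_eq_0)
    finally show "(\<Sum>j<n. coeff (lag \<tau>) j * \<rho> ^ j) = poly (lag \<tau>) \<rho>" by simp
  qed
  then have "(\<Sum>\<rho>\<in>R. a \<rho> * (\<Sum>j<n. coeff (lag \<tau>) j * \<rho> ^ j)) = (\<Sum>\<rho>\<in>R. a \<rho> * poly (lag \<tau>) \<rho>)" by metis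
  also have "\<dots> = (\<Sum>\<rho>\<in>R. if \<rho> = \<tau> then a \<rho> else 0)"
    using assms(2) by (intro sum.cong refl) (simp add: lag_poly)
  also have "\<dots> = a \<tau>" using assms(2) by simp
  finally show ?thesis by simp
qed

definition nrm :: "complex \<Rightarrow> complex" where "nrm x = (\<Prod>\<rho>\<in>R. emb \<rho> x)"

lemma nrm_nonzero: "x \<in> k \<Longrightarrow> x \<noteq> 0 \<Longrightarrow> nrm x \<noteq> 0"
  unfolding nrm_def using emb_nonzero by simp

text \<open>In the power basis, multiplication by \<open>x\<close> has a rational matrix
  \<open>A\<close>. The Vandermonde matrix \<open>V\<close> of the roots diagonalizes it,
  \<open>A * V = V * W\<close>, and is invertible by \<open>dedekind\<close>; so the product of the
  conjugates is \<open>det A\<close>.\<close>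

theorem nrm_Rats:
  assumes x: "x \<in> k" shows "nrm x \<in> \<rat>"
proof -
  have "\<exists>c. (\<forall>l. c l \<in> \<rat>) \<and> x * \<alpha> ^ j = (\<Sum>l<n. c l * \<alpha> ^ l)" for j
    using coordinates[of "x * \<alpha> ^ j"] x alpha_in_k by (metis mult power)
  then obtain M where M: "\<And>j l. M j l \<in> \<rat>" "\<And>j. x * \<alpha> ^ j = (\<Sum>l<n. M j l * \<alpha> ^ l)" by metis
  obtain e where e: "bij_betw e {0..<n} R"
    using ex_bij_betw_nat_finite[OF finite_R] unfolding card_R by blast
  have eR: "e i \<in> R" if "i < n" for i using e that by (auto simp: bij_betw_def)
  define A where "A = mat n n (\<lambda>(i, j). M i j)"
  define V where "V = mat n n (\<lambda>(l, i). e i ^ l)"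
  define W where "W = mat n n (\<lambda>(i, j). if i = j then emb (e i) x else 0)"
  have carr: "A \<in> carrier_mat n n" "V \<in> carrier_mat n n" "W \<in> carrier_mat n n"
    by (simp_all add: A_def V_def W_def)
  have "A * V = V * W"
  proof (rule eq_matI)
    fix j i assume "j < dim_row (V * W)" "i < dim_col (V * W)"
    then have ji: "j < n" "i < n" using carr by auto
    have "(A * V) $$ (j, i) = (\<Sum>l = 0..<n. M j l * e i ^ l)"
      using ji by (simp add: A_def V_def scalar_prod_def)
    also have "\<dots> = emb (e i) (\<Sum>l<n. M j l * \<alpha> ^ l)"
      using emb_coordinates(1)[OF M(1) eR[OF ji(2)]] by (simp add: atLeast0LessThan)
    also have "\<dots> = emb (e i) (x * \<alpha> ^ j)" by (simp only: M(2)[symmetric])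
    also have "\<dots> = e i ^ j * emb (e i) x"
      using emb_mult[OF x power[OF alpha_in_k] eR[OF ji(2)]] eR[OF ji(2)]
      by (simp add: emb_power emb_alpha_root alpha_in_k)
    also have "\<dots> = (\<Sum>l = 0..<n. if l = i then e l ^ j * emb (e l) x else 0)" using ji by simp
    also have "\<dots> = (\<Sum>l = 0..<n. e l ^ j * (if l = i then emb (e l) x else 0))"
      by (intro sum.cong) auto
    also have "\<dots> = (V * W) $$ (j, i)"
      using ji by (simp add: V_def W_def scalar_prod_def)
    finally show "(A * V) $$ (j, i) = (V * W) $$ (j, i)" .
  qed (use carr in auto)
  then have "det A * det V = det V * det W" using det_mult carr by metis
  moreover have "det V \<noteq> 0"
  proof
    assume "det V = 0"
    then obtain w where w: "w \<in> carrier_vec n" "w \<noteq> 0\<^sub>v n" "V *\<^sub>v w = 0\<^sub>v n"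
      using det_0_iff_vec_prod_zero_field[OF carr(2)] by blast
    define a where "a = (\<lambda>\<rho>. w $ (the_inv_into {0..<n} e \<rho>))"
    have ae: "a (e i) = w $ i" if "i < n" for i
      using that e by (simp add: a_def the_inv_into_f_f bij_betw_def)
    have "(\<Sum>\<rho>\<in>R. a \<rho> * \<rho> ^ j) = 0" if j: "j < n" for j
    proof -
      have "(\<Sum>\<rho>\<in>R. a \<rho> * \<rho> ^ j) = (\<Sum>i = 0..<n. a (e i) * e i ^ j)"
        by (rule sum.reindex_bij_betw[OF e, symmetric])
      also have "\<dots> = (\<Sum>i = 0..<n. e i ^ j * w $ i)" by (intro sum.cong) (simp_all add: ae)
      also have "\<dots> = (V *\<^sub>v w) $ j" using j w(1) by (simp add: V_def scalar_prod_def)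
      also have "\<dots> = 0" using j by (simp add: w(3))
      finally show ?thesis .
    qed
    then have "w $ i = 0" if "i < n" for i using dedekind[of a "e i"] ae eR that by auto
    then have "w = 0\<^sub>v n" using w(1) by (intro eq_vecI) auto
    then show False using w(2) by simp
  qed
  ultimately have "det A = det W" by simp
  also have "det W = prod_list (diag_mat W)"
    by (rule det_upper_triangular[OF _ carr(3)]) (auto simp: W_def)
  also have "\<dots> = (\<Prod>i = 0..<n. emb (e i) x)"
  proof -
    have "diag_mat W = map (\<lambda>i. emb (e i) x) [0..<n]" by (simp add: diag_mat_def W_def)
    then show ?thesis using prod.distinct_set_conv_list[of "[0..<n]" "\<lambda>i. emb (e i) x"] by simp
  qed
  also have "\<dots> = nrm x" unfolding nrm_def by (rule prod.reindex_bij_betw[OF e])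
  finally have "nrm x = det A" by simp
  moreover have "det A \<in> \<rat>" by (rule RR.det_mem[OF carr(1)]) (simp add: A_def M)
  ultimately show ?thesis by simp
qed

end

lemma number_field_gen_exists:
  assumes "number_field k" obtains \<alpha> f where "number_field_gen k \<alpha> f"
proof -
  obtain \<alpha> where "k = adjoin \<alpha>" "algebraic \<alpha>" using number_field_primitive[OF assms] by blast
  moreover obtain f where "Rats.is_min_poly \<alpha> f" using algebraic_min_poly[OF calculation(2)] by blast
  ultimately show ?thesis using that[of \<alpha> f] assms by (simp add: number_field_gen_def)
qed

subsection \<open>Absolute values on a number field\<close>

locale abs_val = cfield +
  fixes v :: "complex \<Rightarrow> real"
  assumes absv: "absolute_value_on K v"
begin

lemma nonneg: "x \<in> K \<Longrightarrow> v x \<ge> 0" and eq_0_iff: "x \<in> K \<Longrightarrow> v x = 0 \<longleftrightarrow> x = 0"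
  and v_mult: "x \<in> K \<Longrightarrow> y \<in> K \<Longrightarrow> v (x * y) = v x * v y"
  and triangle: "x \<in> K \<Longrightarrow> y \<in> K \<Longrightarrow> v (x + y) \<le> v x + v y"
  using absv by (auto simp: absolute_value_on_def)

lemma v_0 [simp]: "v 0 = 0" using eq_0_iff[of 0] by simp

lemma v_pos: "x \<in> K \<Longrightarrow> x \<noteq> 0 \<Longrightarrow> v x > 0" using nonneg[of x] eq_0_iff[of x] by simp

lemma v_1 [simp]: "v 1 = 1" using v_mult[of 1 1] v_pos[of 1] by simp

lemma v_power: "x \<in> K \<Longrightarrow> v (x ^ m) = v x ^ m"
  by (induction m) (simp_all add: v_mult power)

lemma v_uminus: assumes "x \<in> K" shows "v (- x) = v x"
proof -
  have "v (- x) * v (- x) = v x * v x" using v_mult[of "- x" "- x"] v_mult[of x x] assms uminus by simp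
  then show ?thesis using nonneg[of x] nonneg[of "- x"] assms uminus by (metis abs_of_nonneg real_sqrt_abs2)
qed

lemma triangle_diff: "x \<in> K \<Longrightarrow> y \<in> K \<Longrightarrow> v (x - y) \<le> v x + v y"
  using triangle[of x "- y"] v_uminus[of y] uminus[of y] by simp

lemma reverse_triangle: "x \<in> K \<Longrightarrow> y \<in> K \<Longrightarrow> v x - v y \<le> v (x + y)"
  using triangle_diff[of "x + y" y] add[of x y] by simp

lemma v_inverse: assumes "x \<in> K" shows "v (inverse x) = inverse (v x)"
proof (cases "x = 0")
  case False
  then have "v x * v (inverse x) = 1" using v_mult[of x "inverse x"] assms inverse by simp
  then show ?thesis by (rule inverse_unique[symmetric])
qed simp

lemma v_divide: "x \<in> K \<Longrightarrow> y \<in> K \<Longrightarrow> v (x / y) = v x / v y"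
  by (simp add: divide_inverse v_mult v_inverse inverse)

lemma v_sum: "(\<And>i. i \<in> I \<Longrightarrow> g i \<in> K) \<Longrightarrow> v (\<Sum>i\<in>I. g i) \<le> (\<Sum>i\<in>I. v (g i))"
proof (induction I rule: infinite_finite_induct)
  case (insert x I)
  have "v (g x + (\<Sum>i\<in>I. g i)) \<le> v (g x) + v (\<Sum>i\<in>I. g i)" using insert.prems by (intro triangle sum) auto
  also have "v (\<Sum>i\<in>I. g i) \<le> (\<Sum>i\<in>I. v (g i))" using insert by simp
  finally show ?case using insert.hyps by simp
qed simp_all

lemma v_prod: "(\<And>i. i \<in> I \<Longrightarrow> g i \<in> K) \<Longrightarrow> v (\<Prod>i\<in>I. g i) = (\<Prod>i\<in>I. v (g i))"
  by (induction I rule: infinite_finite_induct) (simp_all add: v_mult prod)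

end

lemma abs_valI: "cfield K \<Longrightarrow> absolute_value_on K v \<Longrightarrow> abs_val K v"
  by (simp add: abs_val_def abs_val_axioms_def)

lemma le_if_powers_le:
  fixes a b C :: real
  assumes "b \<ge> 0" "\<And>m. a ^ m \<le> C * b ^ m" shows "a \<le> b"
proof (rule ccontr)
  assume "\<not> a \<le> b"
  then have ab: "a > b" by simp
  show False
  proof (cases "b = 0")
    case True
    then show False using assms(2)[of 1] ab by simp
  next
    case False
    then have b: "b > 0" using assms(1) by simp
    then obtain m where "C < (a / b) ^ m" using real_arch_pow[of "a / b" C] ab by auto
    then have "C * b ^ m < a ^ m" using b by (simp add: power_divide pos_less_divide_eq)
    then show False using assms(2)[of m] by simp
  qed
qed

section \<open>Absolute values of k above a fixed one on the rationals\<close>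

locale places_over = number_field_gen +
  fixes u :: "complex \<Rightarrow> real"
  assumes u: "absolute_value_on Qbar u" and nontrivial: "\<exists>q\<in>\<rat>. q \<noteq> 0 \<and> u q < 1"
begin

sublocale U: abs_val Qbar u by (rule abs_valI[OF cfield_Qbar u])

definition exts :: "(complex \<Rightarrow> real) set" where
  "exts = {v. absolute_value_on k v \<and> (\<forall>x. x \<notin> k \<longrightarrow> v x = 0) \<and> (\<forall>x\<in>\<rat>. v x = u x)}"

lemma exts_abs_val: "v \<in> exts \<Longrightarrow> abs_val k v"
  by (rule abs_valI[OF cfield_axioms]) (simp add: exts_def)

lemma exts_Rats: "v \<in> exts \<Longrightarrow> q \<in> \<rat> \<Longrightarrow> v q = u q"
  by (simp add: exts_def)

definition pull :: "complex \<Rightarrow> complex \<Rightarrow> real" where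
  "pull \<rho> x = (if x \<in> k then u (emb \<rho> x) else 0)"

lemma pull_exts: assumes "\<rho> \<in> R" shows "pull \<rho> \<in> exts"
proof -
  have e: "emb \<rho> x \<in> Qbar" if "x \<in> k" for x using that assms by (rule emb_Qbar)
  have "absolute_value_on k (pull \<rho>)"
    unfolding absolute_value_on_def pull_def
    using e assms by (auto simp: U.nonneg U.eq_0_iff emb_mult emb_add U.v_mult U.triangle emb_0 dest: emb_nonzero)
  then show ?thesis
    unfolding exts_def using assms Rats_subset by (auto simp: pull_def emb_Rats)
qed

text \<open>The constant depends only on the Lagrange polynomials, hence is uniform over all
  elements of \<open>k\<close>.\<close>

lemma coordinate_bound:
  obtains C where "C > 0" "\<And>c B j. (\<And>j. c j \<in> \<rat>) \<Longrightarrow> (\<And>\<rho>. \<rho> \<in> R \<Longrightarrow> pull \<rho> (\<Sum>j<n. c j * \<alpha> ^ j) \<le> B) \<Longrightarrow> j < n \<Longrightarrow> u (c j) \<le> C * B"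
proof -
  define C where "C = 1 + (\<Sum>j<n. \<Sum>\<rho>\<in>R. u (coeff (lag \<rho>) j))"
  have nn: "0 \<le> u (coeff (lag \<rho>) j)" if "\<rho> \<in> R" for \<rho> j using U.nonneg[OF lag_Qbar[OF that]] .
  have "C > 0" unfolding C_def using nn by (intro add_pos_nonneg sum_nonneg) auto
  moreover have "u (c j) \<le> C * B" if c: "\<And>j. c j \<in> \<rat>" "\<And>\<rho>. \<rho> \<in> R \<Longrightarrow> pull \<rho> (\<Sum>j<n. c j * \<alpha> ^ j) \<le> B" "j < n" for c B j
  proof -
    define d where "d = (\<lambda>j. if j < n then c j else 0)"
    define x where "x = (\<lambda>\<rho>. \<Sum>j<n. c j * \<rho> ^ j)"
    have xd: "(\<Sum>j<n. d j * \<rho> ^ j) = x \<rho>" for \<rho> by (simp add: x_def d_def)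
    have xb: "u (x \<rho>) \<le> B" "x \<rho> \<in> Qbar" if "\<rho> \<in> R" for \<rho>
      using c(2)[OF that] emb_coordinates[OF c(1) that] emb_Qbar[OF emb_coordinates(2)[OF c(1) that] that]
      by (simp_all add: pull_def x_def)
    obtain \<rho>0 where "\<rho>0 \<in> R" using R_nonempty by blast
    then have B0: "B \<ge> 0" using xb U.nonneg by (meson order_trans)
    have "c j = (\<Sum>\<rho>\<in>R. x \<rho> * coeff (lag \<rho>) j)"
      using lagrange[of d j] c(3) unfolding xd by (simp add: d_def)
    then have "u (c j) \<le> (\<Sum>\<rho>\<in>R. u (x \<rho> * coeff (lag \<rho>) j))"
      using U.v_sum[of R "\<lambda>\<rho>. x \<rho> * coeff (lag \<rho>) j"] xb lag_Qbar Qbar.mult by simp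
    also have "\<dots> \<le> (\<Sum>\<rho>\<in>R. B * u (coeff (lag \<rho>) j))"
    proof (intro sum_mono)
      fix \<rho> assume \<rho>: "\<rho> \<in> R"
      have "u (x \<rho> * coeff (lag \<rho>) j) = u (x \<rho>) * u (coeff (lag \<rho>) j)" by (rule U.v_mult[OF xb(2)[OF \<rho>] lag_Qbar[OF \<rho>]])
      also have "\<dots> \<le> B * u (coeff (lag \<rho>) j)" by (rule mult_right_mono[OF xb(1)[OF \<rho>] nn[OF \<rho>]])
      finally show "u (x \<rho> * coeff (lag \<rho>) j) \<le> B * u (coeff (lag \<rho>) j)" .
    qed
    also have "\<dots> = (\<Sum>\<rho>\<in>R. u (coeff (lag \<rho>) j)) * B" by (simp add: sum_distrib_left mult.commute)
    also have "\<dots> \<le> C * B"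
    proof (rule mult_right_mono[OF _ B0])
      have "(\<Sum>\<rho>\<in>R. u (coeff (lag \<rho>) j)) \<le> (\<Sum>j<n. \<Sum>\<rho>\<in>R. u (coeff (lag \<rho>) j))"
        using c(3) nn by (intro member_le_sum) (auto intro!: sum_nonneg)
      then show "(\<Sum>\<rho>\<in>R. u (coeff (lag \<rho>) j)) \<le> C" by (simp add: C_def)
    qed
    finally show ?thesis .
  qed
  ultimately show ?thesis using that by blast
qed

text \<open>Rational coordinates have the same size under \<open>v\<close> and \<open>u\<close>, so
  \<open>coordinate_bound\<close> gives the claim up to a factor \<open>D\<close>. Applying this to
  \<open>x ^ m\<close> and letting m grow removes the factor.\<close>

lemma exts_le_pull:
  assumes v: "v \<in> exts" and x: "x \<in> k" and B: "\<And>\<rho>. \<rho> \<in> R \<Longrightarrow> pull \<rho> x \<le> B"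
  shows "v x \<le> B"
proof -
  interpret V: abs_val k v by (rule exts_abs_val[OF v])
  obtain C where C: "C > 0" "\<And>c B j. (\<And>j. c j \<in> \<rat>) \<Longrightarrow> (\<And>\<rho>. \<rho> \<in> R \<Longrightarrow> pull \<rho> (\<Sum>j<n. c j * \<alpha> ^ j) \<le> B) \<Longrightarrow> j < n \<Longrightarrow> u (c j) \<le> C * B"
    using coordinate_bound by blast
  define D where "D = (\<Sum>j<n. C * v \<alpha> ^ j)"
  have bound: "v y \<le> D * B" if y: "y \<in> k" and B: "\<And>\<rho>. \<rho> \<in> R \<Longrightarrow> pull \<rho> y \<le> B" for y B
  proof -
    obtain c where c: "\<And>j. c j \<in> \<rat>" "y = (\<Sum>j<n. c j * \<alpha> ^ j)" using coordinates[OF y] by blast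
    have ck: "c j \<in> k" for j using c(1) Rats_subset by blast
    have "v y \<le> (\<Sum>j<n. v (c j * \<alpha> ^ j))" unfolding c(2) by (intro V.v_sum mult ck power alpha_in_k)
    also have "\<dots> \<le> (\<Sum>j<n. (C * B) * v \<alpha> ^ j)"
    proof (intro sum_mono)
      fix j assume j: "j \<in> {..<n}"
      have "v (c j * \<alpha> ^ j) = u (c j) * v \<alpha> ^ j"
        using V.v_mult[OF ck power[OF alpha_in_k]] V.v_power[OF alpha_in_k] exts_Rats[OF v c(1)] by simp
      also have "\<dots> \<le> (C * B) * v \<alpha> ^ j"
        using C(2)[of c B j] c B j V.nonneg[OF alpha_in_k] by (intro mult_right_mono) auto
      finally show "v (c j * \<alpha> ^ j) \<le> (C * B) * v \<alpha> ^ j" .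
    qed
    also have "\<dots> = D * B" by (simp add: D_def sum_distrib_right sum_distrib_left mult_ac)
    finally show ?thesis .
  qed
  obtain \<rho>0 where \<rho>0: "\<rho>0 \<in> R" using R_nonempty by blast
  have pn: "0 \<le> pull \<rho> x" if "\<rho> \<in> R" for \<rho> using abs_val.nonneg[OF exts_abs_val[OF pull_exts[OF that]] x] .
  have B0: "B \<ge> 0" using B[OF \<rho>0] pn[OF \<rho>0] by simp
  show ?thesis
  proof (rule le_if_powers_le[OF B0])
    fix m
    have "v (x ^ m) \<le> D * B ^ m"
    proof (rule bound)
      fix \<rho> assume \<rho>: "\<rho> \<in> R"
      have "pull \<rho> (x ^ m) = pull \<rho> x ^ m" using abs_val.v_power[OF exts_abs_val[OF pull_exts[OF \<rho>]] x] .
      also have "\<dots> \<le> B ^ m" using B[OF \<rho>] pn[OF \<rho>] by (rule power_mono)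
      finally show "pull \<rho> (x ^ m) \<le> B ^ m" .
    qed (rule power[OF x])
    then show "v x ^ m \<le> D * B ^ m" using V.v_power[OF x] by simp
  qed
qed

text \<open>On a logarithmic scale the gap between \<open>a * ln (v x)\<close> and
  \<open>a * ln (w x)\<close> exceeds \<open>L = - ln (u q)\<close> for large \<open>a\<close>, so
  some multiple \<open>b * L\<close> falls into it. As \<open>v\<close> and \<open>w\<close> agree
  at the rational \<open>q\<close>, the element \<open>x ^ a * q powi b\<close> contradicts
  \<open>le\<close>.\<close>

lemma exts_distinct_witness_aux:
  assumes v: "v \<in> exts" and w: "w \<in> exts" and le: "\<And>x. x \<in> k \<Longrightarrow> v x < 1 \<Longrightarrow> w x < 1"
    and x: "x \<in> k" "x \<noteq> 0" and less: "v x < w x"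
  shows False
proof -
  interpret V: abs_val k v by (rule exts_abs_val[OF v])
  interpret W: abs_val k w by (rule exts_abs_val[OF w])
  obtain q where q: "q \<in> \<rat>" "q \<noteq> 0" "u q < 1" using nontrivial by blast
  have qk: "q \<in> k" using q(1) Rats_subset by blast
  define L where "L = - ln (u q)"
  have vq: "v q = u q" "w q = u q" using exts_Rats[OF v q(1)] exts_Rats[OF w q(1)] .
  have uq: "u q > 0" using V.v_pos[OF qk q(2)] vq by simp
  have L: "L > 0" using q uq by (simp add: L_def)
  have pos: "v x > 0" "w x > 0" using V.v_pos[OF x] W.v_pos[OF x] .
  define e where "e = ln (w x) - ln (v x)"
  have e: "e > 0" using less pos by (simp add: e_def)
  obtain a :: nat where a: "L < of_nat a * e" using reals_Archimedean3[OF e] by blast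
  define b where "b = \<lfloor>of_nat a * ln (w x) / L\<rfloor>"
  have "of_int b \<le> of_nat a * ln (w x) / L" by (simp add: b_def)
  then have b1: "of_int b * L \<le> of_nat a * ln (w x)" using L by (simp add: pos_le_divide_eq)
  have "of_nat a * ln (w x) / L < of_int b + 1" by (simp add: b_def)
  then have "of_nat a * ln (w x) < of_int b * L + L" using L by (simp add: divide_less_eq distrib_right)
  then have b2: "of_nat a * ln (v x) < of_int b * L" using a by (simp add: e_def algebra_simps)
  define y where "y = x ^ a * q powi b"
  have qb: "q powi b \<in> k" using qk by (auto simp: power_int_def)
  have yk: "y \<in> k" using qb x by (auto simp: y_def)
  have pw: "w' (q powi b) = u q powi b" if "abs_val k w'" "w' q = u q" for w'
  proof -
    interpret W': abs_val k w' by fact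
    show ?thesis using that(2) qk by (auto simp: power_int_def W'.v_power W'.v_inverse inverse)
  qed
  have lnpow: "ln (t ^ a * u q powi b) = of_nat a * ln t - of_int b * L" if "t > 0" for t
    using that uq by (simp add: ln_mult ln_realpow L_def powr_real_of_int'[symmetric] ln_powr)
  have "v y = v x ^ a * u q powi b" unfolding y_def
    using V.v_mult[OF power[OF x(1)] qb] V.v_power[OF x(1)] pw[OF exts_abs_val[OF v] vq(1)] by simp
  then have "ln (v y) < 0" using lnpow[OF pos(1)] b2 by simp
  moreover have "w y = w x ^ a * u q powi b" unfolding y_def
    using W.v_mult[OF power[OF x(1)] qb] W.v_power[OF x(1)] pw[OF exts_abs_val[OF w] vq(2)] by simp
  then have "ln (w y) \<ge> 0" using lnpow[OF pos(2)] b1 by simp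
  moreover have "y \<noteq> 0" using x q by (simp add: y_def)
  then have "v y > 0" "w y > 0" using V.v_pos[OF yk] W.v_pos[OF yk] by auto
  ultimately have "v y < 1" "w y \<ge> 1" by auto
  then show False using le[OF yk] by simp
qed

lemma exts_eqI:
  assumes v: "v \<in> exts" and w: "w \<in> exts" and le: "\<And>x. x \<in> k \<Longrightarrow> v x < 1 \<Longrightarrow> w x < 1"
  shows "v = w"
proof
  fix x
  interpret V: abs_val k v by (rule exts_abs_val[OF v])
  interpret W: abs_val k w by (rule exts_abs_val[OF w])
  show "v x = w x"
  proof (cases "x \<in> k \<and> x \<noteq> 0")
    case True
    then have ge: "\<not> v y < w y" if "y \<in> k" "y \<noteq> 0" for y
      using exts_distinct_witness_aux[OF v w le that] by blast
    have "\<not> v (inverse x) < w (inverse x)" using True by (intro ge inverse) auto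
    moreover have "v x > 0" "w x > 0" using True V.v_pos W.v_pos by auto
    ultimately have "v x \<le> w x" using True by (simp add: V.v_inverse W.v_inverse)
    then show ?thesis using ge[of x] True by simp
  next
    case False
    then show ?thesis using v w by (auto simp: exts_def)
  qed
qed

lemma exts_separate:
  assumes "v \<in> exts" "w \<in> exts" "v \<noteq> w"
  obtains z where "z \<in> k" "v z > 1" "w z < 1"
proof -
  interpret V: abs_val k v by (rule exts_abs_val[OF assms(1)])
  interpret W: abs_val k w by (rule exts_abs_val[OF assms(2)])
  obtain x where x: "x \<in> k" "v x < 1" "\<not> w x < 1" using exts_eqI[OF assms(1,2)] assms(3) by blast
  obtain y where y: "y \<in> k" "w y < 1" "\<not> v y < 1" using exts_eqI[OF assms(2,1)] assms(3) by blast
  have x0: "x \<noteq> 0" using x(3) by auto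
  have "v (y / x) > 1" using x y V.v_pos[OF x(1) x0] by (simp add: V.v_divide less_divide_eq)
  moreover have "w (y / x) < 1" using x y by (simp add: W.v_divide divide_less_eq)
  ultimately show ?thesis using that x y divide by blast
qed

text \<open>The quotient \<open>z ^ m / (1 + z ^ m)\<close> tends to 1 where \<open>z\<close> is
  larger than 1 and to 0 where it is smaller than 1. The conclusion is stated for all large m, so
  that several applications can share one exponent.\<close>

lemma approx_idempotent:
  assumes v0: "v0 \<in> exts" and V: "finite V" "V \<subseteq> exts" and z: "z \<in> k" "v0 z > 1" "\<forall>v\<in>V. v z < 1"
    and \<delta>: "\<delta> > 0"
  obtains m0 where "\<And>m. m \<ge> m0 \<Longrightarrow> 1 + z ^ m \<noteq> 0 \<and> v0 (z ^ m / (1 + z ^ m) - 1) < \<delta> \<and> (\<forall>v\<in>V. v (z ^ m / (1 + z ^ m)) < \<delta>)"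
proof -
  interpret V0: abs_val k v0 by (rule exts_abs_val[OF v0])
  obtain l where l: "1 + 1 / \<delta> < v0 z ^ l" using real_arch_pow[OF z(2)] by blast
  have "1 + 1 / \<delta> < v0 z ^ m" if "m \<ge> l" for m
    using l power_increasing[OF that, of "v0 z"] z(2) by linarith
  then have "\<forall>\<^sub>F m in sequentially. 1 + 1 / \<delta> < v0 z ^ m" unfolding eventually_sequentially by blast
  moreover have "\<forall>\<^sub>F m in sequentially. \<forall>v\<in>V. v z ^ m < min (1/2) (\<delta> / 2)"
  proof (intro eventually_ball_finite V(1) ballI)
    fix v assume v: "v \<in> V"
    interpret Vv: abs_val k v by (rule exts_abs_val) (use v V in auto)
    have "(\<lambda>m. v z ^ m) \<longlonglongrightarrow> 0" using z(3) v Vv.nonneg[OF z(1)] by (intro LIMSEQ_power_zero) auto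
    then show "\<forall>\<^sub>F m in sequentially. v z ^ m < min (1/2) (\<delta> / 2)" by (rule order_tendstoD) (use \<delta> in auto)
  qed
  ultimately have "\<forall>\<^sub>F m in sequentially. 1 + z ^ m \<noteq> 0 \<and> v0 (z ^ m / (1 + z ^ m) - 1) < \<delta> \<and> (\<forall>v\<in>V. v (z ^ m / (1 + z ^ m)) < \<delta>)"
  proof eventually_elim
    case (elim m)
    have zk: "z ^ m \<in> k" "1 + z ^ m \<in> k" using z(1) by auto
    have "v0 (z ^ m) - v0 1 \<le> v0 (z ^ m + 1)" by (rule V0.reverse_triangle) (use zk in auto)
    then have big: "v0 z ^ m - 1 \<le> v0 (1 + z ^ m)" by (simp add: V0.v_power[OF z(1)] add.commute)
    have "1 / \<delta> < v0 (1 + z ^ m)" using elim big by linarith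
    moreover have "1 / \<delta> > 0" using \<delta> by simp
    ultimately have pos: "v0 (1 + z ^ m) > 0" by linarith
    then have ne: "1 + z ^ m \<noteq> 0" by auto
    have "z ^ m / (1 + z ^ m) - 1 = - (1 / (1 + z ^ m))" using ne by (simp add: field_simps)
    then have "v0 (z ^ m / (1 + z ^ m) - 1) = 1 / v0 (1 + z ^ m)"
      using V0.v_uminus[of "1 / (1 + z ^ m)"] V0.v_divide[OF one zk(2)] zk by (simp add: divide)
    also have "\<dots> < \<delta>" using \<open>1 / \<delta> < v0 (1 + z ^ m)\<close> \<delta> pos by (simp add: field_simps)
    finally have 1: "v0 (z ^ m / (1 + z ^ m) - 1) < \<delta>" .
    have "v (z ^ m / (1 + z ^ m)) < \<delta>" if v: "v \<in> V" for v
    proof -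
      interpret Vv: abs_val k v by (rule exts_abs_val) (use v V in auto)
      have lt: "v z ^ m < 1/2" "v z ^ m < \<delta> / 2" using elim v by auto
      have "v 1 - v (z ^ m) \<le> v (1 + z ^ m)" by (rule Vv.reverse_triangle) (use zk in auto)
      then have "1/2 < v (1 + z ^ m)" using lt by (simp add: Vv.v_power[OF z(1)])
      then have "v z ^ m / v (1 + z ^ m) \<le> v z ^ m / (1/2)" using Vv.nonneg[OF z(1)] by (intro divide_left_mono) auto
      also have "\<dots> < \<delta>" using lt by simp
      finally show ?thesis using Vv.v_divide[OF zk] Vv.v_power[OF z(1)] by simp
    qed
    then show ?case using ne 1 by blast
  qed
  then show ?thesis using that unfolding eventually_sequentially by blast
qed

text \<open>Induction on the places to be made small. An element \<open>z\<close> serves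
  \<open>V\<close>, an element \<open>y\<close> separates \<open>v0\<close> from the new place
  \<open>w\<close>. If \<open>w z \<le> 1\<close>, a power of \<open>z\<close> times
  \<open>y\<close> works; otherwise the powers of \<open>z\<close> are large at \<open>w\<close> too
  and are replaced by an approximate idempotent \<open>T\<close>.\<close>

lemma artin_whaples:
  assumes v0: "v0 \<in> exts" and "finite V" "V \<subseteq> exts" "v0 \<notin> V"
  shows "\<exists>z\<in>k. v0 z > 1 \<and> (\<forall>v\<in>V. v z < 1)"
  using assms(2-4)
proof (induction V rule: finite_induct)
  case empty
  interpret V0: abs_val k v0 by (rule exts_abs_val[OF v0])
  obtain q where q: "q \<in> \<rat>" "q \<noteq> 0" "u q < 1" using nontrivial by blast
  have qk: "q \<in> k" using q Rats_subset by blast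
  have "v0 q < 1" "v0 q > 0" using q V0.v_pos[OF qk q(2)] exts_Rats[OF v0 q(1)] by auto
  then have "v0 (inverse q) > 1" using V0.v_inverse[OF qk] by (simp add: one_less_inverse)
  then show ?case using inverse[OF qk] by blast
next
  case (insert w V)
  then obtain z where z: "z \<in> k" "v0 z > 1" "\<And>v. v \<in> V \<Longrightarrow> v z < 1" by auto
  have wo: "w \<in> exts" "V \<subseteq> exts" "v0 \<noteq> w" using insert by auto
  obtain y where y: "y \<in> k" "v0 y > 1" "w y < 1" using exts_separate[OF v0 wo(1,3)] .
  interpret V0: abs_val k v0 by (rule exts_abs_val[OF v0])
  interpret W: abs_val k w by (rule exts_abs_val[OF wo(1)])
  \<comment> \<open>Exceeds every value of \<open>y\<close> on \<open>V\<close>; the factor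
    multiplied onto \<open>y\<close> is kept at most \<open>1 / Y\<close> there.\<close>
  define Y where "Y = 1 + (\<Sum>v\<in>V. v y)"
  have nn: "v x \<ge> 0" if "v \<in> V" "x \<in> k" for v x using abs_val.nonneg[OF exts_abs_val] that wo by blast
  have Y: "Y \<ge> 1" "\<And>v. v \<in> V \<Longrightarrow> v y < Y"
  proof -
    show "Y \<ge> 1" unfolding Y_def using nn y by (simp add: sum_nonneg)
    fix v assume "v \<in> V"
    then have "v y \<le> (\<Sum>v\<in>V. v y)" using nn y insert.hyps by (intro member_le_sum) auto
    then show "v y < Y" by (simp add: Y_def)
  qed
  show ?case
  proof (cases "w z \<le> 1")
    case True
    have "\<forall>\<^sub>F m in sequentially. \<forall>v\<in>V. v z ^ m < 1 / Y"
    proof (intro eventually_ball_finite insert.hyps ballI)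
      fix v assume v: "v \<in> V"
      have "(\<lambda>m. v z ^ m) \<longlonglongrightarrow> 0" using z(3)[OF v] nn[OF v z(1)] by (intro LIMSEQ_power_zero) auto
      then show "\<forall>\<^sub>F m in sequentially. v z ^ m < 1 / Y" by (rule order_tendstoD) (use Y in auto)
    qed
    then obtain m where m: "\<And>v. v \<in> V \<Longrightarrow> v z ^ m < 1 / Y" unfolding eventually_sequentially by blast
    have zm: "z ^ m \<in> k" using z by auto
    have "v0 (z ^ m * y) > 1"
    proof -
      have "1 \<le> v0 z ^ m" using z(2) by (simp add: one_le_power)
      then have "1 * 1 < v0 z ^ m * v0 y" using y(2) by (intro mult_le_less_imp_less) auto
      then show ?thesis using V0.v_mult[OF zm y(1)] V0.v_power[OF z(1)] by simp
    qed
    moreover have "w (z ^ m * y) < 1"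
    proof -
      have "w z ^ m \<le> 1" using True W.nonneg[OF z(1)] by (intro power_le_one) auto
      then have "w z ^ m * w y \<le> 1 * w y" using W.nonneg[OF y(1)] by (intro mult_right_mono) auto
      then show ?thesis using y(3) W.v_mult[OF zm y(1)] W.v_power[OF z(1)] by simp
    qed
    moreover have "v (z ^ m * y) < 1" if v: "v \<in> V" for v
    proof -
      interpret Vv: abs_val k v by (rule exts_abs_val) (use v wo in auto)
      have "v z ^ m * v y \<le> (1 / Y) * v y" using m[OF v] nn[OF v y(1)] by (intro mult_right_mono) auto
      also have "\<dots> < (1 / Y) * Y" using Y v by (intro mult_strict_left_mono) auto
      finally show ?thesis using Y Vv.v_mult[OF zm y(1)] Vv.v_power[OF z(1)] by simp
    qed
    ultimately show ?thesis using mult[OF zm y(1)] by blast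
  next
    case False
    \<comment> \<open>The three bounds keep \<open>T * y\<close> below 1 on \<open>V\<close>, above
      1 at \<open>v0\<close> and below 1 at \<open>w\<close>, in this order.\<close>
    define \<delta> where "\<delta> = min (1 / Y) (min ((v0 y - 1) / (2 * v0 y)) ((1 - w y) / 2))"
    have \<delta>: "\<delta> > 0" using Y y by (simp add: \<delta>_def)
    obtain m0 where m0: "\<And>m. m \<ge> m0 \<Longrightarrow> 1 + z ^ m \<noteq> 0 \<and> v0 (z ^ m / (1 + z ^ m) - 1) < \<delta> \<and> (\<forall>v\<in>V. v (z ^ m / (1 + z ^ m)) < \<delta>)"
      using approx_idempotent[of v0 V z \<delta>, OF v0 insert.hyps(1) wo(2) z(1,2) _ \<delta>] z(3) by blast
    \<comment> \<open>With the empty set of small places, \<open>approx_idempotent\<close> says that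
      the same quotient is close to 1 at \<open>w\<close>.\<close>
    obtain m1 where m1: "\<And>m. m \<ge> m1 \<Longrightarrow> w (z ^ m / (1 + z ^ m) - 1) < \<delta>"
      using approx_idempotent[OF wo(1) finite.emptyI _ z(1) _ _ \<delta>] False by (metis empty_iff empty_subsetI not_le)
    define T where "T = z ^ max m0 m1 / (1 + z ^ max m0 m1)"
    have T: "v0 (T - 1) < \<delta>" "\<And>v. v \<in> V \<Longrightarrow> v T < \<delta>" "w (T - 1) < \<delta>"
      using m0[of "max m0 m1"] m1[of "max m0 m1"] by (auto simp: T_def)
    have Tk: "T \<in> k" "T - 1 \<in> k" using z by (auto simp: T_def)
    have "v0 (T * y) > 1"
    proof -
      have "v0 1 - v0 (T - 1) \<le> v0 (1 + (T - 1))" by (rule V0.reverse_triangle[OF one Tk(2)])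
      then have "1 - \<delta> < v0 T" using T(1) by simp
      moreover have "\<delta> \<le> (v0 y - 1) / (2 * v0 y)" by (simp add: \<delta>_def)
      ultimately have "1 - (v0 y - 1) / (2 * v0 y) < v0 T" by linarith
      then have "(1 - (v0 y - 1) / (2 * v0 y)) * v0 y < v0 T * v0 y" using y by (intro mult_strict_right_mono) auto
      moreover have "(1 - (v0 y - 1) / (2 * v0 y)) * v0 y = (v0 y + 1) / 2" using y by (simp add: field_simps)
      ultimately show ?thesis using y V0.v_mult[OF Tk(1) y(1)] by simp
    qed
    moreover have "w (T * y) < 1"
    proof -
      have "w (1 + (T - 1)) \<le> w 1 + w (T - 1)" by (rule W.triangle[OF one Tk(2)])
      then have "w T \<le> 1 + \<delta>" using T(3) by simp
      then have "w T * w y \<le> (1 + \<delta>) * w y" using W.nonneg[OF y(1)] by (rule mult_right_mono)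
      also have "\<dots> = w y + \<delta> * w y" by (simp add: algebra_simps)
      also have "\<delta> * w y \<le> \<delta> * 1" using \<delta> y by (intro mult_left_mono) auto
      also have "\<delta> * 1 \<le> (1 - w y) / 2" unfolding \<delta>_def by linarith
      also have "w y + (1 - w y) / 2 < 1" using y(3) by (simp add: field_simps)
      finally show ?thesis using W.v_mult[OF Tk(1) y(1)] by simp
    qed
    moreover have "v (T * y) < 1" if v: "v \<in> V" for v
    proof -
      interpret Vv: abs_val k v by (rule exts_abs_val) (use v wo in auto)
      have "\<delta> \<le> 1 / Y" by (simp add: \<delta>_def)
      then have "v T \<le> 1 / Y" using T(2)[OF v] by linarith
      then have "v T * v y \<le> (1 / Y) * v y" using nn[OF v y(1)] by (intro mult_right_mono) auto
      also have "\<dots> < (1 / Y) * Y" using Y v by (intro mult_strict_left_mono) auto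
      finally show ?thesis using Y Vv.v_mult[OF Tk(1) y(1)] by simp
    qed
    ultimately show ?thesis using mult[OF Tk(1) y(1)] by blast
  qed
qed

text \<open>A place outside the finite set of pulled back ones could be made large by an element
  that is small at all of these, against \<open>exts_le_pull\<close>. So every extension comes from
  an embedding into \<open>Qbar\<close>.\<close>

theorem exts_eq: "exts = pull ` R"
proof
  show "pull ` R \<subseteq> exts" using pull_exts by blast
  show "exts \<subseteq> pull ` R"
  proof
    fix v assume v: "v \<in> exts"
    show "v \<in> pull ` R"
    proof (rule ccontr)
      assume "v \<notin> pull ` R"
      then have "\<exists>z\<in>k. v z > 1 \<and> (\<forall>w\<in>pull ` R. w z < 1)"
        using pull_exts by (intro artin_whaples[OF v]) auto
      then obtain z where z: "z \<in> k" "v z > 1" "\<And>w. w \<in> pull ` R \<Longrightarrow> w z < 1" by blast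
      have "v z \<le> 1" by (rule exts_le_pull[OF v z(1)]) (use z(3) in \<open>auto intro: less_imp_le\<close>)
      then show False using z(2) by simp
    qed
  qed
qed

lemma finite_exts: "finite exts" by (simp add: exts_eq)

lemma weak_idempotent:
  assumes v0: "v0 \<in> exts" and \<delta>: "\<delta> > 0"
  obtains T where "T \<in> k" "v0 (T - 1) < \<delta>" "\<And>v. v \<in> exts - {v0} \<Longrightarrow> v T < \<delta>"
proof -
  obtain z where z: "z \<in> k" "v0 z > 1" "\<And>v. v \<in> exts - {v0} \<Longrightarrow> v z < 1"
    using artin_whaples[OF v0, of "exts - {v0}"] finite_exts by auto
  obtain m0 where "\<And>m. m \<ge> m0 \<Longrightarrow> 1 + z ^ m \<noteq> 0 \<and> v0 (z ^ m / (1 + z ^ m) - 1) < \<delta> \<and> (\<forall>v\<in>exts - {v0}. v (z ^ m / (1 + z ^ m)) < \<delta>)"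
    using approx_idempotent[of v0 "exts - {v0}" z \<delta>, OF v0 _ _ z(1,2) _ \<delta>] finite_exts z(3) by blast
  then show ?thesis using z(1) by (intro that[of "z ^ m0 / (1 + z ^ m0)"]) auto
qed

end

subsection \<open>The dimension of a completion\<close>

context abs_val
begin

definition cauchy :: "(nat \<Rightarrow> complex) \<Rightarrow> bool" where
  "cauchy s \<longleftrightarrow> (\<forall>n. s n \<in> K) \<and> (\<forall>\<delta>>0. \<exists>M. \<forall>m\<ge>M. \<forall>n\<ge>M. v (s m - s n) < \<delta>)"

lemma cauchy_mem: "cauchy s \<Longrightarrow> s n \<in> K" by (simp add: cauchy_def)

lemma cauchyD: "cauchy s \<Longrightarrow> \<delta> > 0 \<Longrightarrow> \<exists>M. \<forall>m\<ge>M. \<forall>n\<ge>M. v (s m - s n) < \<delta>" by (simp add: cauchy_def)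

lemma cauchy_const: "x \<in> K \<Longrightarrow> cauchy (\<lambda>_. x)" by (simp add: cauchy_def)

lemma cauchy_bounded:
  assumes "cauchy s" obtains B where "B > 0" "\<And>n. v (s n) \<le> B"
proof -
  obtain M where M: "\<And>m n. m \<ge> M \<Longrightarrow> n \<ge> M \<Longrightarrow> v (s m - s n) < 1" using cauchyD[OF assms, of 1] by auto
  define B where "B = 1 + v (s M) + (\<Sum>i<M. v (s i))"
  have nn: "v (s i) \<ge> 0" for i using nonneg[OF cauchy_mem[OF assms]] .
  have "v (s n) \<le> B" for n
  proof (cases "n < M")
    case True
    then have "v (s n) \<le> (\<Sum>i<M. v (s i))" using nn by (intro member_le_sum) auto
    then show ?thesis using nn[of M] by (simp add: B_def)
  next
    case False
    have "v ((s n - s M) + s M) \<le> v (s n - s M) + v (s M)"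
      using cauchy_mem[OF assms] by (intro triangle diff) auto
    moreover have "v (s n - s M) < 1" using False M by simp
    moreover have "(\<Sum>i<M. v (s i)) \<ge> 0" using nn by (simp add: sum_nonneg)
    ultimately show ?thesis by (simp add: B_def)
  qed
  moreover have "B > 0" using nn by (simp add: B_def add_pos_nonneg sum_nonneg)
  ultimately show ?thesis using that by blast
qed

lemma cauchy_add:
  assumes "cauchy s" "cauchy t" shows "cauchy (\<lambda>n. s n + t n)"
  unfolding cauchy_def
proof (intro conjI allI impI)
  note mem = cauchy_mem[OF assms(1)] cauchy_mem[OF assms(2)]
  show "s n + t n \<in> K" for n using mem by auto
  fix \<delta> :: real assume "\<delta> > 0"
  then have d: "\<delta> / 2 > 0" by simp
  obtain M where M: "\<And>m n. m \<ge> M \<Longrightarrow> n \<ge> M \<Longrightarrow> v (s m - s n) < \<delta> / 2" using cauchyD[OF assms(1) d] by blast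
  obtain M' where M': "\<And>m n. m \<ge> M' \<Longrightarrow> n \<ge> M' \<Longrightarrow> v (t m - t n) < \<delta> / 2" using cauchyD[OF assms(2) d] by blast
  have "v (s m + t m - (s n + t n)) < \<delta>" if "m \<ge> max M M'" "n \<ge> max M M'" for m n
  proof -
    have "v ((s m - s n) + (t m - t n)) \<le> v (s m - s n) + v (t m - t n)" using mem by (intro triangle diff) auto
    moreover have eq: "s m + t m - (s n + t n) = (s m - s n) + (t m - t n)" by simp
    moreover have "v (s m - s n) < \<delta> / 2" "v (t m - t n) < \<delta> / 2" using M M' that by auto
    ultimately show ?thesis unfolding eq by linarith
  qed
  then show "\<exists>M. \<forall>m\<ge>M. \<forall>n\<ge>M. v (s m + t m - (s n + t n)) < \<delta>" by blast
qed

lemma cauchy_mult: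
  assumes "cauchy s" "cauchy t" shows "cauchy (\<lambda>n. s n * t n)"
  unfolding cauchy_def
proof (intro conjI allI impI)
  note mem = cauchy_mem[OF assms(1)] cauchy_mem[OF assms(2)]
  show "s n * t n \<in> K" for n using mem by auto
  obtain A where A: "A > 0" "\<And>n. v (s n) \<le> A" using cauchy_bounded[OF assms(1)] by blast
  obtain B where B: "B > 0" "\<And>n. v (t n) \<le> B" using cauchy_bounded[OF assms(2)] by blast
  fix \<delta> :: real assume \<delta>: "\<delta> > 0"
  obtain M where M: "\<And>m n. m \<ge> M \<Longrightarrow> n \<ge> M \<Longrightarrow> v (s m - s n) < \<delta> / (2 * B)"
    using cauchyD[OF assms(1), of "\<delta> / (2 * B)"] \<delta> B(1) by auto
  obtain M' where M': "\<And>m n. m \<ge> M' \<Longrightarrow> n \<ge> M' \<Longrightarrow> v (t m - t n) < \<delta> / (2 * A)"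
    using cauchyD[OF assms(2), of "\<delta> / (2 * A)"] \<delta> A(1) by auto
  have "v (s m * t m - s n * t n) < \<delta>" if "m \<ge> max M M'" "n \<ge> max M M'" for m n
  proof -
    have "s m * t m - s n * t n = (s m - s n) * t m + s n * (t m - t n)" by (simp add: algebra_simps)
    then have "v (s m * t m - s n * t n) \<le> v ((s m - s n) * t m) + v (s n * (t m - t n))"
      using triangle[of "(s m - s n) * t m" "s n * (t m - t n)"] mem by (metis diff mult)
    also have "v ((s m - s n) * t m) = v (s m - s n) * v (t m)" using mem by (intro v_mult diff)
    also have "v (s n * (t m - t n)) = v (s n) * v (t m - t n)" using mem by (intro v_mult diff)
    also have "v (s m - s n) * v (t m) \<le> v (s m - s n) * B"
      using B(2) mem by (intro mult_left_mono nonneg diff)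
    also have "v (s n) * v (t m - t n) \<le> A * v (t m - t n)"
      using A(2) mem by (intro mult_right_mono nonneg diff)
    also have "v (s m - s n) * B < \<delta> / (2 * B) * B" using M that B(1) by (intro mult_strict_right_mono) auto
    also have "A * v (t m - t n) < A * (\<delta> / (2 * A))" using M' that A(1) by (intro mult_strict_left_mono) auto
    also have "\<delta> / (2 * B) * B + A * (\<delta> / (2 * A)) = \<delta>" using A(1) B(1) by simp
    finally show ?thesis by simp
  qed
  then show "\<exists>M. \<forall>m\<ge>M. \<forall>n\<ge>M. v (s m * t m - s n * t n) < \<delta>" by blast
qed

lemma cauchy_uminus: "cauchy s \<Longrightarrow> cauchy (\<lambda>n. - s n)"
  using cauchy_mult[OF cauchy_const[of "- 1"], of s] uminus[OF one] by simp

abbreviation "CS \<equiv> cauchy_ring K v"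

lemma CS_simps [simp]:
  "s \<in> carrier CS \<longleftrightarrow> cauchy s" "s \<otimes>\<^bsub>CS\<^esub> t = (\<lambda>n. s n * t n)" "s \<oplus>\<^bsub>CS\<^esub> t = (\<lambda>n. s n + t n)"
  "\<one>\<^bsub>CS\<^esub> = (\<lambda>_. 1)" "\<zero>\<^bsub>CS\<^esub> = (\<lambda>_. 0)"
  by (auto simp: cauchy_ring_def cauchy_def)

lemma cring_CS: "cring CS"
proof (intro cringI abelian_groupI comm_monoidI)
  fix s assume "s \<in> carrier CS"
  then show "\<exists>y\<in>carrier CS. y \<oplus>\<^bsub>CS\<^esub> s = \<zero>\<^bsub>CS\<^esub>"
    by (intro bexI[of _ "\<lambda>n. - s n"]) (auto simp: cauchy_uminus)
qed (auto simp: cauchy_add cauchy_mult cauchy_const algebra_simps)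

interpretation CSr: cring CS by (rule cring_CS)

lemma CS_uminus: "cauchy s \<Longrightarrow> \<ominus>\<^bsub>CS\<^esub> s = (\<lambda>n. - s n)"
  by (rule CSr.minus_equality) (auto simp: cauchy_uminus)

lemma CS_minus: "cauchy s \<Longrightarrow> cauchy t \<Longrightarrow> s \<ominus>\<^bsub>CS\<^esub> t = (\<lambda>n. s n - t n)"
  by (simp add: a_minus_def CS_uminus)

abbreviation "NI \<equiv> null_ideal K v"

lemma NI_iff: "s \<in> NI \<longleftrightarrow> cauchy s \<and> (\<lambda>n. v (s n)) \<longlonglongrightarrow> 0"
  by (simp add: null_ideal_def)

lemma ideal_NI: "ideal NI CS"
proof (rule idealI)
  show "ring CS" by (rule CSr.ring_axioms)
  have prod: "(\<lambda>n. x n * a n) \<in> NI" if aN: "a \<in> NI" and x: "cauchy x" for a x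
  proof -
    have a: "cauchy a" "(\<lambda>n. v (a n)) \<longlonglongrightarrow> 0" using aN by (auto simp: NI_iff)
    obtain B where B: "B > 0" "\<And>n. v (x n) \<le> B" using cauchy_bounded[OF x] by blast
    have "(\<lambda>n. v (x n * a n)) \<longlonglongrightarrow> 0"
    proof (rule tendsto_sandwich[OF _ _ tendsto_const])
      show "(\<lambda>n. B * v (a n)) \<longlonglongrightarrow> 0" using tendsto_mult_right_zero[OF a(2)] .
      show "\<forall>\<^sub>F n in sequentially. 0 \<le> v (x n * a n)"
        using cauchy_mem[OF x] cauchy_mem[OF a(1)] by (intro always_eventually allI nonneg mult)
      show "\<forall>\<^sub>F n in sequentially. v (x n * a n) \<le> B * v (a n)"
        using v_mult nonneg cauchy_mem[OF x] cauchy_mem[OF a(1)] B(2)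
        by (intro always_eventually allI) (simp add: mult_right_mono)
    qed
    then show ?thesis using cauchy_mult[OF x a(1)] by (simp add: NI_iff)
  qed
  show "x \<otimes>\<^bsub>CS\<^esub> a \<in> NI" if "a \<in> NI" "x \<in> carrier CS" for a x using prod that by simp
  then show "a \<otimes>\<^bsub>CS\<^esub> x \<in> NI" if "a \<in> NI" "x \<in> carrier CS" for a x using prod[of a x] that by (simp add: mult.commute)
  show "subgroup NI (add_monoid CS)"
  proof (rule CSr.add.subgroupI)
    show "NI \<subseteq> carrier CS" by (auto simp: NI_iff)
    have "(\<lambda>_. 0) \<in> NI" using cauchy_const[of 0] by (simp add: NI_iff)
    then show "NI \<noteq> {}" by blast
    show "\<ominus>\<^bsub>CS\<^esub> a \<in> NI" if "a \<in> NI" for a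
      using that prod[OF that cauchy_const[of "- 1"]] by (auto simp: NI_iff CS_uminus)
    fix a b assume ab: "a \<in> NI" "b \<in> NI"
    have c: "cauchy a" "cauchy b" and l: "(\<lambda>n. v (a n)) \<longlonglongrightarrow> 0" "(\<lambda>n. v (b n)) \<longlonglongrightarrow> 0" using ab by (auto simp: NI_iff)
    have "(\<lambda>n. v (a n + b n)) \<longlonglongrightarrow> 0"
    proof (rule tendsto_sandwich[OF _ _ tendsto_const])
      show "(\<lambda>n. v (a n) + v (b n)) \<longlonglongrightarrow> 0" using tendsto_add[OF l] by simp
    qed (use cauchy_mem[OF c(1)] cauchy_mem[OF c(2)] in \<open>auto intro!: always_eventually nonneg triangle add\<close>)
    then show "a \<oplus>\<^bsub>CS\<^esub> b \<in> NI" using cauchy_add[OF c] by (simp add: NI_iff)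
  qed
qed

interpretation NIi: ideal NI CS by (rule ideal_NI)

abbreviation "CO \<equiv> completion K v"

definition cls :: "(nat \<Rightarrow> complex) \<Rightarrow> (nat \<Rightarrow> complex) set" where "cls s = NI +>\<^bsub>CS\<^esub> s"

lemma cring_CO: "cring CO"
  unfolding completion_def by (rule NIi.quotient_is_cring[OF cring_CS])

interpretation COr: cring CO by (rule cring_CO)

lemma carrier_CO: "carrier CO = {cls s | s. cauchy s}"
  unfolding completion_def FactRing_def A_RCOSETS_def' cls_def by auto

lemma cls_hom: "cls \<in> Ring.ring_hom CS CO"
  using NIi.rcos_ring_hom by (simp add: cls_def[abs_def] completion_def)

lemma cls_mult: "cauchy s \<Longrightarrow> cauchy t \<Longrightarrow> cls s \<otimes>\<^bsub>CO\<^esub> cls t = cls (\<lambda>n. s n * t n)"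
  using Ring.ring_hom_mult[OF cls_hom, of s t] by simp

lemma cls_add: "cauchy s \<Longrightarrow> cauchy t \<Longrightarrow> cls s \<oplus>\<^bsub>CO\<^esub> cls t = cls (\<lambda>n. s n + t n)"
  using Ring.ring_hom_add[OF cls_hom, of s t] by simp

lemma cls_one: "\<one>\<^bsub>CO\<^esub> = cls (\<lambda>_. 1)"
  using Ring.ring_hom_one[OF cls_hom] by simp

lemma cls_zero: "\<zero>\<^bsub>CO\<^esub> = cls (\<lambda>_. 0)"
  using Ring.ring_hom_zero[OF cls_hom CSr.ring_axioms COr.ring_axioms] by simp

lemma cls_eq_iff: "cauchy s \<Longrightarrow> cauchy t \<Longrightarrow> cls s = cls t \<longleftrightarrow> (\<lambda>n. v (s n - t n)) \<longlonglongrightarrow> 0"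
  unfolding cls_def using CSr.quotient_eq_iff_same_a_r_cos[OF ideal_NI, of s t] cauchy_add[of s "\<lambda>n. - t n"]
  by (simp add: CS_minus NI_iff cauchy_uminus)

definition rcauchy :: "(nat \<Rightarrow> complex) \<Rightarrow> bool" where
  "rcauchy s \<longleftrightarrow> cauchy s \<and> (\<forall>n. s n \<in> \<rat>)"

lemma CR_eq: "completion_Rats K v = {cls s | s. rcauchy s}"
  unfolding completion_Rats_def cls_def rcauchy_def by auto

text \<open>A Cauchy sequence that is not null stays away from 0 from some index \<open>M\<close>
  on, so the termwise inverse is Cauchy.\<close>

lemma rcauchy_inverse:
  assumes s: "rcauchy s" and ne: "\<not> (\<lambda>n. v (s n)) \<longlonglongrightarrow> 0"
  obtains t where "rcauchy t" "cls s \<otimes>\<^bsub>CO\<^esub> cls t = \<one>\<^bsub>CO\<^esub>"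
proof -
  have c: "cauchy s" and q: "\<And>n. s n \<in> \<rat>" using s by (auto simp: rcauchy_def)
  note mem = cauchy_mem[OF c]
  obtain \<delta> where \<delta>: "\<delta> > 0" "\<And>M. \<exists>n\<ge>M. v (s n) \<ge> \<delta>"
    using ne nonneg[OF mem] unfolding LIMSEQ_iff by (auto simp: not_less)
  obtain M where M: "\<And>m n. m \<ge> M \<Longrightarrow> n \<ge> M \<Longrightarrow> v (s m - s n) < \<delta> / 2"
    using cauchyD[OF c, of "\<delta> / 2"] \<delta>(1) by auto
  obtain n0 where n0: "n0 \<ge> M" "v (s n0) \<ge> \<delta>" using \<delta>(2) by blast
  have low: "v (s n) \<ge> \<delta> / 2" if "n \<ge> M" for n
  proof -
    have "v (s n0) - v (s n0 - s n) \<le> v (s n0 + (s n - s n0))"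
      using reverse_triangle[of "s n0" "s n - s n0"] v_uminus[of "s n0 - s n"] mem diff by simp
    then show ?thesis using M[of n0 n] n0 that by simp
  qed
  have ne0: "s n \<noteq> 0" if "n \<ge> M" for n using low[OF that] \<delta>(1) by auto
  \<comment> \<open>Earlier terms may be 0; there \<open>inverse 0 = 0\<close> is harmless, since
    only the tail matters.\<close>
  define t where "t = (\<lambda>n. inverse (s n))"
  have tmem: "t n \<in> K" "t n \<in> \<rat>" for n using mem q by (auto simp: t_def)
  have ct: "cauchy t" unfolding cauchy_def
  proof (intro conjI allI impI tmem)
    fix \<epsilon> :: real assume "\<epsilon> > 0"
    then have "\<epsilon> * (\<delta> / 2 * (\<delta> / 2)) > 0" using \<delta> by simp
    then obtain M' where M': "\<And>m n. m \<ge> M' \<Longrightarrow> n \<ge> M' \<Longrightarrow> v (s m - s n) < \<epsilon> * (\<delta> / 2 * (\<delta> / 2))" using cauchyD[OF c] by blast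
    have "v (t m - t n) < \<epsilon>" if "m \<ge> max M M'" "n \<ge> max M M'" for m n
    proof -
      have nz: "s m \<noteq> 0" "s n \<noteq> 0" using ne0 that by auto
      have lo: "\<delta> / 2 * (\<delta> / 2) \<le> v (s m) * v (s n)"
        using low that \<delta> nonneg[OF mem] by (intro mult_mono) auto
      have "t m - t n = (s n - s m) / (s m * s n)" using nz by (simp add: t_def field_simps)
      then have "v (t m - t n) = v (s n - s m) / (v (s m) * v (s n))"
        using mem by (simp add: v_divide v_mult diff mult)
      also have "\<dots> < \<epsilon>"
      proof -
        have "v (s n - s m) < \<epsilon> * (\<delta> / 2 * (\<delta> / 2))" using M' that by simp
        also have "\<dots> \<le> \<epsilon> * (v (s m) * v (s n))" using lo \<open>\<epsilon> > 0\<close> by (intro mult_left_mono) auto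
        finally show ?thesis using v_pos[OF mem nz(1)] v_pos[OF mem nz(2)] by (simp add: pos_divide_less_eq)
      qed
      finally show ?thesis .
    qed
    then show "\<exists>M. \<forall>m\<ge>M. \<forall>n\<ge>M. v (t m - t n) < \<epsilon>" by blast
  qed
  have "\<forall>\<^sub>F n in sequentially. v (s n * t n - 1) = 0"
    unfolding eventually_sequentially using ne0 by (intro exI[of _ M]) (simp add: t_def)
  then have "(\<lambda>n. v (s n * t n - 1)) \<longlonglongrightarrow> 0" by (rule tendsto_eventually)
  then have "cls (\<lambda>n. s n * t n) = cls (\<lambda>_. 1)"
    by (subst cls_eq_iff) (auto simp: cauchy_mult c ct cauchy_const)
  then show ?thesis using that[of t] ct c tmem by (simp add: rcauchy_def cls_mult cls_one)
qed

text \<open>The dimension theory works for a ring over a subfield, so the completed rationals have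
  to be shown to be a field, while the completion enters as a commutative ring.\<close>

lemma subfield_CR: "subfield (completion_Rats K v) CO"
proof -
  have sub: "subring (completion_Rats K v) CO"
  proof (rule COr.subringI)
    show "completion_Rats K v \<subseteq> carrier CO" unfolding CR_eq carrier_CO rcauchy_def by auto
    show "\<one>\<^bsub>CO\<^esub> \<in> completion_Rats K v" unfolding CR_eq cls_one rcauchy_def using cauchy_const[OF one] by auto
    fix h assume "h \<in> completion_Rats K v"
    then obtain s where s: "h = cls s" "rcauchy s" unfolding CR_eq by auto
    have c: "cauchy s" using s by (simp add: rcauchy_def)
    have "cls (\<lambda>n. - s n) \<oplus>\<^bsub>CO\<^esub> cls s = \<zero>\<^bsub>CO\<^esub>"
      using c by (simp add: cls_add cauchy_uminus cls_zero)
    then have "\<ominus>\<^bsub>CO\<^esub> cls s = cls (\<lambda>n. - s n)"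
      by (rule COr.minus_equality) (auto simp: carrier_CO c cauchy_uminus)
    then show "\<ominus>\<^bsub>CO\<^esub> h \<in> completion_Rats K v"
      unfolding CR_eq using s cauchy_uminus[OF c] by (auto simp: rcauchy_def)
    fix h' assume "h' \<in> completion_Rats K v"
    then obtain t where t: "h' = cls t" "rcauchy t" unfolding CR_eq by auto
    show "h \<otimes>\<^bsub>CO\<^esub> h' \<in> completion_Rats K v"
      unfolding CR_eq using s t cauchy_mult[of s t] cls_mult[of s t] by (auto simp: rcauchy_def intro!: exI[of _ "\<lambda>n. s n * t n"])
    show "h \<oplus>\<^bsub>CO\<^esub> h' \<in> completion_Rats K v"
      unfolding CR_eq using s t cauchy_add[of s t] cls_add[of s t] by (auto simp: rcauchy_def intro!: exI[of _ "\<lambda>n. s n + t n"])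
  qed
  have one_ne: "\<one>\<^bsub>CO\<^esub> \<noteq> \<zero>\<^bsub>CO\<^esub>"
    unfolding cls_one cls_zero by (subst cls_eq_iff) (auto simp: cauchy_const LIMSEQ_const_iff)
  show ?thesis
  proof (rule COr.subfieldI[OF COr.subcringI'[OF sub]])
    let ?F = "CO \<lparr> carrier := completion_Rats K v \<rparr>"
    have "x \<in> Units ?F" if x: "x \<in> completion_Rats K v" "x \<noteq> \<zero>\<^bsub>CO\<^esub>" for x
    proof -
      obtain s where s: "x = cls s" "rcauchy s" using x unfolding CR_eq by auto
      have "\<not> (\<lambda>n. v (s n)) \<longlonglongrightarrow> 0"
        using x(2) s cls_eq_iff[of s "\<lambda>_. 0"] unfolding cls_zero by (auto simp: rcauchy_def cauchy_const)
      then obtain t where t: "rcauchy t" "cls s \<otimes>\<^bsub>CO\<^esub> cls t = \<one>\<^bsub>CO\<^esub>" using rcauchy_inverse[OF s(2)] by blast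
      have "cls t \<otimes>\<^bsub>CO\<^esub> cls s = \<one>\<^bsub>CO\<^esub>" using t s COr.m_comm[of "cls s" "cls t"] by (auto simp: carrier_CO rcauchy_def)
      then show ?thesis using t s x unfolding Units_def CR_eq by auto
    qed
    moreover have "\<zero>\<^bsub>CO\<^esub> \<notin> Units ?F"
    proof
      assume "\<zero>\<^bsub>CO\<^esub> \<in> Units ?F"
      then obtain y where y: "y \<in> completion_Rats K v" "\<zero>\<^bsub>CO\<^esub> \<otimes>\<^bsub>CO\<^esub> y = \<one>\<^bsub>CO\<^esub>" unfolding Units_def by auto
      then have "y \<in> carrier CO" using subringE(1)[OF sub] by blast
      then show False using y one_ne by simp
    qed
    ultimately show "Units ?F = completion_Rats K v - {\<zero>\<^bsub>CO\<^esub>}" unfolding Units_def by auto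
  qed
qed

text \<open>Linear independence over the rationals with a uniform constant. Unlike plain
  independence it survives in the completion, where coefficients are limits of rationals.\<close>

definition strongly_independent :: "(nat \<Rightarrow> complex) \<Rightarrow> nat \<Rightarrow> bool" where
  "strongly_independent b m \<longleftrightarrow> (\<exists>C>0. \<forall>q. (\<forall>i. q i \<in> \<rat>) \<longrightarrow> (\<forall>i<m. v (q i) \<le> C * v (\<Sum>j<m. q j * b j)))"

definition dense_span :: "(nat \<Rightarrow> complex) \<Rightarrow> nat \<Rightarrow> bool" where
  "dense_span b m \<longleftrightarrow> (\<forall>y\<in>K. \<forall>\<epsilon>>0. \<exists>q. (\<forall>i. q i \<in> \<rat>) \<and> v (y - (\<Sum>j<m. q j * b j)) < \<epsilon>)"

text \<open>Adjoining the classes of the \<open>b l\<close> one by one raises the dimension each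
  time, by strong independence. The last span is everything: a Cauchy sequence is approximated by
  rational combinations, and strong independence makes their coefficient sequences Cauchy as
  well.\<close>

theorem local_degree_eq:
  assumes bK: "\<And>i. b i \<in> K" and ind: "strongly_independent b m" and dense: "dense_span b m"
  shows "local_degree K v = m"
proof -
  obtain C where C: "C > 0" "\<And>q i. (\<And>i. q i \<in> \<rat>) \<Longrightarrow> i < m \<Longrightarrow> v (q i) \<le> C * v (\<Sum>j<m. q j * b j)"
    using ind unfolding strongly_independent_def by blast
  define comb :: "(nat \<Rightarrow> nat \<Rightarrow> complex) \<Rightarrow> nat \<Rightarrow> nat \<Rightarrow> complex" where "comb = (\<lambda>s l n. \<Sum>j<l. s j n * b j)"
  have ccomb: "cauchy (comb s l)" if "\<And>j. rcauchy (s j)" for s :: "nat \<Rightarrow> nat \<Rightarrow> complex" and l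
  proof (induction l)
    case 0
    then show ?case using cauchy_const[OF zero] by (simp add: comb_def)
  next
    case (Suc l)
    have "cauchy (\<lambda>n. comb s l n + s l n * b l)"
      using that[of l] by (intro cauchy_add Suc cauchy_mult cauchy_const bK) (simp add: rcauchy_def)
    then show ?case by (simp add: comb_def)
  qed
  \<comment> \<open>The span of the first \<open>l\<close> classes over the completed
    rationals.\<close>
  define E where "E = (\<lambda>l. {cls (comb s l) | s. \<forall>j. rcauchy (s j)})"
  have rc0: "rcauchy (\<lambda>_. 0)" using cauchy_const by (auto simp: rcauchy_def)
  have ext: "COr.line_extension (completion_Rats K v) (cls (\<lambda>_. b l)) (E l) = E (Suc l)" for l
  proof -
    have step: "cls (s l) \<otimes>\<^bsub>CO\<^esub> cls (\<lambda>_. b l) \<oplus>\<^bsub>CO\<^esub> cls (comb s l) = cls (comb s (Suc l))" if "\<And>j. rcauchy (s j)" for s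
    proof -
      have sl: "cauchy (s l)" using that by (simp add: rcauchy_def)
      show ?thesis using sl cauchy_const[OF bK] ccomb[OF that] cauchy_mult[OF sl cauchy_const[OF bK]]
        by (simp add: cls_mult cls_add comb_def add.commute)
    qed
    show ?thesis
    proof (intro equalityI subsetI)
      fix x assume "x \<in> COr.line_extension (completion_Rats K v) (cls (\<lambda>_. b l)) (E l)"
      then obtain r s where rs: "rcauchy r" "\<And>j. rcauchy (s j)" "x = cls r \<otimes>\<^bsub>CO\<^esub> cls (\<lambda>_. b l) \<oplus>\<^bsub>CO\<^esub> cls (comb s l)"
        unfolding COr.line_extension_mem_iff E_def CR_eq by blast
      define s' where "s' = s(l := r)"
      have "comb s' l = comb s l" unfolding comb_def s'_def by (intro ext sum.cong) auto
      moreover have s': "rcauchy (s' j)" for j using rs by (simp add: s'_def)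
      ultimately have "x = cls (comb s' (Suc l))" using step[of s', OF s'] rs(3) by (simp add: s'_def)
      then show "x \<in> E (Suc l)" unfolding E_def using s' by blast
    next
      fix x assume "x \<in> E (Suc l)"
      then obtain s where s: "\<And>j. rcauchy (s j)" "x = cls (comb s (Suc l))" unfolding E_def by blast
      then show "x \<in> COr.line_extension (completion_Rats K v) (cls (\<lambda>_. b l)) (E l)"
        unfolding COr.line_extension_mem_iff E_def CR_eq using step[of s, OF s(1)] by blast
    qed
  qed
  have notin: "cls (\<lambda>_. b l) \<notin> E l" if l: "l < m" for l
  proof
    assume "cls (\<lambda>_. b l) \<in> E l"
    then obtain s where s: "\<And>j. rcauchy (s j)" "cls (\<lambda>_. b l) = cls (comb s l)" unfolding E_def by blast
    then have "(\<lambda>n. v (b l - comb s l n)) \<longlonglongrightarrow> 0" using cls_eq_iff[OF cauchy_const[OF bK[of l]] ccomb[of s l]] by simp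
    then have "(\<lambda>n. C * v (b l - comb s l n)) \<longlonglongrightarrow> 0" by (rule tendsto_mult_right_zero)
    moreover have "1 \<le> C * v (b l - comb s l n)" for n
    proof -
      \<comment> \<open>The relation is moved to one side with coefficient 1 at \<open>l\<close>;
        strong independence keeps its value away from 0 although it tends to 0.\<close>
      define q where "q = (\<lambda>j. if j < l then - s j n else if j = l then 1 else 0)"
      have "(\<Sum>j<m. q j * b j) = (\<Sum>j\<in>insert l {..<l}. q j * b j)"
        using l by (intro sum.mono_neutral_right) (auto simp: q_def)
      also have "\<dots> = b l + (\<Sum>j<l. - s j n * b j)" by (simp add: q_def)
      also have "\<dots> = b l - comb s l n" by (simp add: comb_def sum_negf)
      finally have "v (q l) \<le> C * v (b l - comb s l n)"
        using C(2)[of q l] l s(1) by (auto simp: q_def rcauchy_def)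
      then show ?thesis by (simp add: q_def)
    qed
    ultimately have "(1::real) \<le> 0" by (intro LIMSEQ_le_const) auto
    then show False by simp
  qed
  have dim: "COr.dimension l (completion_Rats K v) (E l)" if "l \<le> m" for l
    using that
  proof (induction l)
    case 0
    have "E 0 = {\<zero>\<^bsub>CO\<^esub>}" unfolding E_def cls_zero comb_def using rc0 by auto
    then show ?case using COr.zero_dim by simp
  next
    case (Suc l)
    have "COr.dimension (Suc l) (completion_Rats K v) (COr.line_extension (completion_Rats K v) (cls (\<lambda>_. b l)) (E l))"
      using Suc notin[of l] cauchy_const[OF bK] by (intro COr.Suc_dim) (auto simp: carrier_CO)
    then show ?case by (simp add: ext)
  qed
  have "carrier CO \<subseteq> E m"
  proof
    fix x assume "x \<in> carrier CO"
    then obtain s where s: "cauchy s" "x = cls s" unfolding carrier_CO by blast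
    have "\<exists>q. (\<forall>i. q i \<in> \<rat>) \<and> v (s n - (\<Sum>j<m. q j * b j)) < 1 / real (Suc n)" for n
      using dense cauchy_mem[OF s(1)] unfolding dense_span_def by (metis zero_less_divide_1_iff of_nat_0_less_iff zero_less_Suc)
    then obtain Q where Q: "\<And>n i. Q n i \<in> \<rat>" "\<And>n. v (s n - (\<Sum>j<m. Q n j * b j)) < 1 / real (Suc n)" by metis
    have QK: "Q n j \<in> K" for n j using Q(1) Rats_subset by blast
    have sK: "(\<Sum>j<m. Q n j * b j) \<in> K" for n using QK bK by (intro sum mult)
    have lim: "(\<lambda>n. v (s n - (\<Sum>j<m. Q n j * b j))) \<longlonglongrightarrow> 0"
    proof (rule tendsto_sandwich[OF _ _ tendsto_const LIMSEQ_inverse_real_of_nat])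
      show "\<forall>\<^sub>F n in sequentially. 0 \<le> v (s n - (\<Sum>j<m. Q n j * b j))"
        by (intro always_eventually allI nonneg diff cauchy_mem[OF s(1)] sK)
      show "\<forall>\<^sub>F n in sequentially. v (s n - (\<Sum>j<m. Q n j * b j)) \<le> inverse (real (Suc n))"
        using less_imp_le[OF Q(2)] by (intro always_eventually allI) (simp only: inverse_eq_divide)
    qed
    have rc: "rcauchy (\<lambda>n. if j < m then Q n j else 0)" for j
    proof (cases "j < m")
      case True
      have "cauchy (\<lambda>n. Q n j)" unfolding cauchy_def
      proof (intro conjI allI impI QK)
        fix \<delta> :: real assume "\<delta> > 0"
        \<comment> \<open>One third of the tolerance for each of the three differences into which
          the combination is split below.\<close>
        then have d: "\<delta> / (3 * C) > 0" using C by simp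
        obtain M where M: "\<And>m n. m \<ge> M \<Longrightarrow> n \<ge> M \<Longrightarrow> v (s m - s n) < \<delta> / (3 * C)" using cauchyD[OF s(1) d] by blast
        obtain M' where M': "\<And>n. n \<ge> M' \<Longrightarrow> v (s n - (\<Sum>j<m. Q n j * b j)) < \<delta> / (3 * C)"
          using order_tendstoD(2)[OF lim d] unfolding eventually_sequentially by blast
        have "v (Q n j - Q n' j) < \<delta>" if "n \<ge> max M M'" "n' \<ge> max M M'" for n n'
        proof -
          have "v (Q n j - Q n' j) \<le> C * v (\<Sum>j<m. (Q n j - Q n' j) * b j)"
            using C(2)[of "\<lambda>j. Q n j - Q n' j" j] Q(1) True by simp
          also have "(\<Sum>j<m. (Q n j - Q n' j) * b j) = (s n - s n') - (s n - (\<Sum>j<m. Q n j * b j)) + (s n' - (\<Sum>j<m. Q n' j * b j))"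
            by (simp add: left_diff_distrib sum_subtractf)
          also have "v \<dots> \<le> v ((s n - s n') - (s n - (\<Sum>j<m. Q n j * b j))) + v (s n' - (\<Sum>j<m. Q n' j * b j))"
            using cauchy_mem[OF s(1)] sK by (intro triangle diff) auto
          also have "v ((s n - s n') - (s n - (\<Sum>j<m. Q n j * b j))) \<le> v (s n - s n') + v (s n - (\<Sum>j<m. Q n j * b j))"
            using cauchy_mem[OF s(1)] sK by (intro triangle_diff diff) auto
          also have "v (s n - s n') + v (s n - (\<Sum>j<m. Q n j * b j)) + v (s n' - (\<Sum>j<m. Q n' j * b j)) < \<delta> / (3 * C) + \<delta> / (3 * C) + \<delta> / (3 * C)"
            using M M' that by (intro add_strict_mono) auto
          finally show ?thesis using C(1) by (simp add: field_simps)
        qed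
        then show "\<exists>M. \<forall>n\<ge>M. \<forall>n'\<ge>M. v (Q n j - Q n' j) < \<delta>" by blast
      qed
      then show ?thesis using True Q(1) by (simp add: rcauchy_def)
    qed (use rc0 in simp)
    define S where "S = (\<lambda>j n. if j < m then Q n j else 0)"
    have combS: "comb S m n = (\<Sum>j<m. Q n j * b j)" for n unfolding comb_def S_def by (intro sum.cong) auto
    have cS: "cauchy (comb S m)" by (rule ccomb) (use rc in \<open>simp add: S_def\<close>)
    have "cls s = cls (comb S m)"
      using lim by (subst cls_eq_iff[OF s(1) cS]) (simp only: combS)
    then show "x \<in> E m" unfolding E_def s(2) using rc by (auto simp: S_def intro!: exI[of _ S])
  qed
  moreover have "E m \<subseteq> carrier CO" unfolding E_def carrier_CO using ccomb by blast
  ultimately have "E m = carrier CO" by blast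
  then have "COr.dimension m (completion_Rats K v) (carrier CO)" using dim[of m] by simp
  then have "COr.dim (completion_Rats K v) (carrier CO) = m"
    using COr.dimI[OF subfield_CR] by (simp only: over_def)
  then show ?thesis by (simp only: local_degree_def)
qed

end

subsection \<open>Local degrees\<close>

context places_over
begin

text \<open>The powers of \<alpha> below \<open>n\<close> span \<open>k\<close> over the rationals,
  so more than \<open>n\<close> elements satisfy a nontrivial rational relation; strong independence
  would force its coefficients to vanish.\<close>

lemma strongly_independent_le:
  assumes v: "v \<in> exts" and b: "\<And>i. b i \<in> k" and ind: "abs_val.strongly_independent v b m"
  shows "m \<le> n"
proof (rule ccontr)
  interpret V: abs_val k v by (rule exts_abs_val[OF v])
  assume "\<not> m \<le> n"
  then have mn: "card {..<n} < card {..<m}" by simp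
  have "\<exists>c. (\<forall>l. c l \<in> \<rat>) \<and> b i = (\<Sum>l<n. c l * \<alpha> ^ l)" for i using coordinates[OF b[of i]] by metis
  then obtain c where c: "\<And>i l. c i l \<in> \<rat>" "\<And>i. b i = (\<Sum>l<n. c i l * \<alpha> ^ l)" by metis
  obtain y where y: "\<forall>i\<in>{..<m}. y i \<in> \<rat>" "\<exists>i\<in>{..<m}. y i \<noteq> 0" "\<forall>l\<in>{..<n}. (\<Sum>i<m. c i l * y i) = 0"
    using Rats.homogeneous_solution[OF _ _ mn, of "\<lambda>l i. c i l"] c(1) by auto
  define q where "q = (\<lambda>i. if i < m then y i else 0)"
  have q: "q i \<in> \<rat>" for i using y by (auto simp: q_def)
  have "(\<Sum>j<m. q j * b j) = (\<Sum>j<m. y j * b j)" by (intro sum.cong) (auto simp: q_def)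
  also have "\<dots> = (\<Sum>j<m. \<Sum>l<n. (c j l * y j) * \<alpha> ^ l)" by (simp add: c(2) sum_distrib_left mult_ac)
  also have "\<dots> = (\<Sum>l<n. \<Sum>j<m. (c j l * y j) * \<alpha> ^ l)" by (rule sum.swap)
  also have "\<dots> = (\<Sum>l<n. (\<Sum>j<m. c j l * y j) * \<alpha> ^ l)" by (simp add: sum_distrib_right)
  also have "\<dots> = 0" using y(3) by simp
  finally have 0: "(\<Sum>j<m. q j * b j) = 0" .
  obtain i where i: "i < m" "q i \<noteq> 0" using y(2) by (auto simp: q_def)
  obtain C where "v (q i) \<le> C * v (\<Sum>j<m. q j * b j)"
    using ind q i(1) unfolding V.strongly_independent_def by blast
  then have "v (q i) \<le> 0" by (simp add: 0)
  moreover have "v (q i) > 0" using V.v_pos[of "q i"] q[of i] i Rats_subset by blast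
  ultimately show False by simp
qed

text \<open>Strongly independent families have at most \<open>n\<close> members, so one of maximal
  length exists. If its span were not dense, an element \<open>y\<close> at distance at least
  \<epsilon> from the span could be appended.\<close>

lemma exists_maximal_basis:
  assumes v: "v \<in> exts"
  obtains b m where "\<And>i. b i \<in> k" "abs_val.strongly_independent v b m" "abs_val.dense_span k v b m"
proof -
  interpret V: abs_val k v by (rule exts_abs_val[OF v])
  define P where "P = (\<lambda>m. \<exists>b. (\<forall>i. b i \<in> k) \<and> V.strongly_independent b m)"
  have "V.strongly_independent (\<lambda>_. 0) 0" unfolding V.strongly_independent_def by (intro exI[of _ 1]) simp
  then have P0: "P 0" unfolding P_def by (intro exI[of _ "\<lambda>_. 0"]) simp
  have Pn: "m \<le> n" if "P m" for m
    using that strongly_independent_le[OF v] unfolding P_def by blast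
  define m where "m = (GREATEST m. P m)"
  have Pm: "P m" unfolding m_def by (rule GreatestI_nat[of P 0 n]) (use P0 Pn in auto)
  have max: "m' \<le> m" if "P m'" for m' unfolding m_def by (rule Greatest_le_nat[of P m' n]) (use that Pn in auto)
  obtain b where b: "\<And>i. b i \<in> k" "V.strongly_independent b m" using Pm unfolding P_def by blast
  obtain C where C: "C > 0" "\<And>q i. (\<And>i. q i \<in> \<rat>) \<Longrightarrow> i < m \<Longrightarrow> v (q i) \<le> C * v (\<Sum>j<m. q j * b j)"
    using b(2) unfolding V.strongly_independent_def by blast
  have "V.dense_span b m"
  proof (rule ccontr)
    assume "\<not> V.dense_span b m"
    then obtain y \<epsilon> where y: "y \<in> k" "\<epsilon> > 0" "\<And>q. (\<And>i. q i \<in> \<rat>) \<Longrightarrow> \<epsilon> \<le> v (y - (\<Sum>j<m. q j * b j))"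
      unfolding V.dense_span_def by (meson not_le)
    define b' where "b' = b(m := y)"
    \<comment> \<open>The first bound controls the coefficient of \<open>y\<close>, through its
      distance from the span; the second controls the others after the term with \<open>y\<close>
      has been subtracted.\<close>
    define C' where "C' = max (1 / \<epsilon>) (C * (1 + v y / \<epsilon>))"
    have "V.strongly_independent b' (Suc m)"
      unfolding V.strongly_independent_def
    proof (intro exI[of _ C'] conjI allI impI)
      show "C' > 0" using y(2) by (simp add: C'_def less_max_iff_disj)
      fix q :: "nat \<Rightarrow> complex" and i assume q: "\<forall>i. q i \<in> \<rat>" and i: "i < Suc m"
      have qk: "q j \<in> k" for j using q Rats_subset by blast
      define X0 where "X0 = (\<Sum>j<Suc m. q j * b' j)"
      define Z where "Z = (\<Sum>j<m. q j * b j)"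
      have XZ: "X0 = q m * y + Z" unfolding X0_def Z_def by (simp add: b'_def)
      have Zk: "Z \<in> k" unfolding Z_def using qk b by (intro sum mult)
      have Xk: "X0 \<in> k" unfolding XZ using Zk qk y by auto
      have qm: "v (q m) * \<epsilon> \<le> v X0"
      proof (cases "q m = 0")
        case True
        then show ?thesis using V.nonneg[OF Xk] by simp
      next
        case False
        have "(\<Sum>j<m. - (q j / q m) * b j) = - (Z / q m)"
          by (simp add: Z_def sum_negf sum_divide_distrib)
        then have "\<epsilon> \<le> v (y + Z / q m)" using y(3)[of "\<lambda>j. - (q j / q m)"] q by simp
        also have "y + Z / q m = X0 / q m" using False by (simp add: XZ add_divide_distrib)
        also have "v (X0 / q m) = v X0 / v (q m)" by (rule V.v_divide[OF Xk qk])
        finally show ?thesis using V.v_pos[OF qk False] by (simp add: pos_le_divide_eq mult.commute)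
      qed
      show "v (q i) \<le> C' * v (\<Sum>j<Suc m. q j * b' j)" unfolding X0_def[symmetric]
      proof (cases "i = m")
        case True
        have "v (q i) \<le> (1 / \<epsilon>) * v X0" using qm True y(2) by (simp add: field_simps)
        also have "\<dots> \<le> C' * v X0" using V.nonneg[OF Xk] by (intro mult_right_mono) (simp_all add: C'_def)
        finally show "v (q i) \<le> C' * v X0" .
      next
        case False
        have "v (q i) \<le> C * v Z" unfolding Z_def using C(2)[of q i] q i False by simp
        also have "Z = X0 - q m * y" by (simp add: XZ)
        also have "v (X0 - q m * y) \<le> v X0 + v (q m) * v y"
          using V.triangle_diff[OF Xk mult[OF qk y(1)]] V.v_mult[OF qk y(1)] by simp
        also have "v (q m) * v y \<le> (v X0 / \<epsilon>) * v y"
          using qm y(2) V.nonneg[OF y(1)] by (intro mult_right_mono) (simp_all add: pos_le_divide_eq)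
        also have "C * (v X0 + v X0 / \<epsilon> * v y) = C * (1 + v y / \<epsilon>) * v X0" by (simp add: algebra_simps)
        also have "\<dots> \<le> C' * v X0" using V.nonneg[OF Xk] by (intro mult_right_mono) (simp_all add: C'_def)
        finally show "v (q i) \<le> C' * v X0" using C(1) by simp
      qed
    qed
    moreover have "b' i \<in> k" for i using b(1) y(1) by (simp add: b'_def)
    ultimately have "P (Suc m)" unfolding P_def by blast
    then show False using max by fastforce
  qed
  then show ?thesis using that b by blast
qed

definition fibre :: "(complex \<Rightarrow> real) \<Rightarrow> complex set" where
  "fibre v = {\<rho> \<in> R. pull \<rho> = v}"

text \<open>With more embeddings in the fibre than members of the family, some nontrivial
  combination \<open>S\<close> of these embeddings kills every \<open>b i\<close> with
  \<open>i < m\<close>. Each embedding has size \<open>v\<close>, so \<open>S\<close> is continuous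
  for \<open>v\<close> and vanishes on all of \<open>k\<close> by density, against
  \<open>dedekind\<close>.\<close>

lemma fibre_le:
  assumes v: "v \<in> exts" and b: "\<And>i. b i \<in> k" and dense: "abs_val.dense_span k v b m"
  shows "card (fibre v) \<le> m"
proof (rule ccontr)
  interpret V: abs_val k v by (rule exts_abs_val[OF v])
  assume "\<not> card (fibre v) \<le> m"
  then have c: "card {..<m} < card (fibre v)" by simp
  have fin: "finite (fibre v)" by (simp add: fibre_def)
  have FR: "\<rho> \<in> R" "pull \<rho> = v" if "\<rho> \<in> fibre v" for \<rho> using that by (auto simp: fibre_def)
  obtain a where a: "\<forall>\<rho>\<in>fibre v. a \<rho> \<in> Qbar" "\<exists>\<rho>\<in>fibre v. a \<rho> \<noteq> 0"
    "\<forall>i\<in>{..<m}. (\<Sum>\<rho>\<in>fibre v. emb \<rho> (b i) * a \<rho>) = 0"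
    using Qbar.homogeneous_solution[OF finite_lessThan fin c, of "\<lambda>i \<rho>. emb \<rho> (b i)"] emb_Qbar[OF b FR(1)] by blast
  define S where "S = (\<lambda>x. \<Sum>\<rho>\<in>fibre v. emb \<rho> x * a \<rho>)"
  have Sk: "S x \<in> Qbar" if "x \<in> k" for x
    unfolding S_def using emb_Qbar[OF that FR(1)] a(1) by (intro Qbar.sum Qbar.mult) auto
  have Sadd: "S (x - y) = S x - S y" if "x \<in> k" "y \<in> k" for x y
    unfolding S_def sum_subtractf[symmetric] using that FR(1)
    by (intro sum.cong) (auto simp: emb_diff left_diff_distrib)
  have S0: "S (\<Sum>i<m. q i * b i) = 0" if q: "\<And>i. q i \<in> \<rat>" for q
  proof -
    have qk: "q i \<in> k" for i using q Rats_subset by blast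
    have "emb \<rho> (\<Sum>i<m. q i * b i) = (\<Sum>i<m. q i * emb \<rho> (b i))" if "\<rho> \<in> fibre v" for \<rho>
      using emb_sum[of "{..<m}" "\<lambda>i. q i * b i", OF mult[OF qk b] FR(1)[OF that]] emb_mult[OF qk b FR(1)[OF that]] emb_Rats[OF q FR(1)[OF that]] by simp
    then have "S (\<Sum>i<m. q i * b i) = (\<Sum>\<rho>\<in>fibre v. \<Sum>i<m. q i * (emb \<rho> (b i) * a \<rho>))"
      unfolding S_def by (intro sum.cong refl) (simp add: sum_distrib_right sum_distrib_left mult_ac)
    also have "\<dots> = (\<Sum>i<m. \<Sum>\<rho>\<in>fibre v. q i * (emb \<rho> (b i) * a \<rho>))" by (rule sum.swap)
    also have "\<dots> = (\<Sum>i<m. q i * (\<Sum>\<rho>\<in>fibre v. emb \<rho> (b i) * a \<rho>))" by (simp add: sum_distrib_left)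
    also have "\<dots> = 0" using a(3) by simp
    finally show ?thesis .
  qed
  define A where "A = (\<Sum>\<rho>\<in>fibre v. u (a \<rho>))"
  have un: "u (a \<rho>) \<ge> 0" if "\<rho> \<in> fibre v" for \<rho> using a(1) that U.nonneg by blast
  have A0: "A \<ge> 0" unfolding A_def by (rule sum_nonneg) (rule un)
  have Sb: "u (S x) \<le> v x * A" if x: "x \<in> k" for x
  proof -
    have "u (S x) \<le> (\<Sum>\<rho>\<in>fibre v. u (emb \<rho> x * a \<rho>))"
      unfolding S_def using emb_Qbar[OF x FR(1)] a(1) by (intro U.v_sum Qbar.mult) auto
    also have "\<dots> = (\<Sum>\<rho>\<in>fibre v. v x * u (a \<rho>))"
    proof (intro sum.cong refl)
      fix \<rho> assume \<rho>: "\<rho> \<in> fibre v"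
      have "u (emb \<rho> x) = v x" using fun_cong[OF FR(2)[OF \<rho>], of x] x by (simp add: pull_def)
      then show "u (emb \<rho> x * a \<rho>) = v x * u (a \<rho>)"
        using U.v_mult[OF emb_Qbar[OF x FR(1)[OF \<rho>]], of "a \<rho>"] a(1) \<rho> by simp
    qed
    finally show ?thesis by (simp add: A_def sum_distrib_left)
  qed
  have Sz: "S x = 0" if x: "x \<in> k" for x
  proof -
    have "u (S x) \<le> 0 + \<epsilon>" if \<epsilon>: "\<epsilon> > 0" for \<epsilon>
    proof -
      have "\<epsilon> / (1 + A) > 0" using \<epsilon> A0 by simp
      then obtain q where q: "\<And>i. q i \<in> \<rat>" "v (x - (\<Sum>j<m. q j * b j)) < \<epsilon> / (1 + A)"
        using dense x unfolding V.dense_span_def by blast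
      have sk: "(\<Sum>j<m. q j * b j) \<in> k" using q(1) b Rats_subset by (intro sum mult) auto
      have "S x = S (x - (\<Sum>j<m. q j * b j))" using Sadd[OF x sk] S0[OF q(1)] by simp
      then have "u (S x) \<le> v (x - (\<Sum>j<m. q j * b j)) * A" using Sb[OF diff[OF x sk]] by simp
      also have "\<dots> \<le> \<epsilon> / (1 + A) * A" using q(2) A0 by (intro mult_right_mono) auto
      also have "\<dots> \<le> \<epsilon>" using A0 \<epsilon> by (simp add: field_simps)
      finally show ?thesis by simp
    qed
    then have "u (S x) \<le> 0" by (rule field_le_epsilon)
    then show ?thesis using U.nonneg[OF Sk[OF x]] U.eq_0_iff[OF Sk[OF x]] by simp
  qed
  obtain \<tau> where \<tau>: "\<tau> \<in> fibre v" "a \<tau> \<noteq> 0" using a(2) by blast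
  define a' where "a' = (\<lambda>\<rho>. if \<rho> \<in> fibre v then a \<rho> else 0)"
  have "a' \<tau> = 0"
  proof (rule dedekind[of a' \<tau>])
    show "\<tau> \<in> R" using FR \<tau> by blast
    fix j assume "j < n"
    have "(\<Sum>\<rho>\<in>R. a' \<rho> * \<rho> ^ j) = (\<Sum>\<rho>\<in>fibre v. a' \<rho> * \<rho> ^ j)"
      by (intro sum.mono_neutral_right) (auto simp: a'_def fibre_def)
    also have "\<dots> = S (\<alpha> ^ j)"
      unfolding S_def using FR(1) by (intro sum.cong refl) (simp add: a'_def emb_power[OF alpha_in_k] emb_alpha_root)
    also have "\<dots> = 0" by (intro Sz power alpha_in_k)
    finally show "(\<Sum>\<rho>\<in>R. a' \<rho> * \<rho> ^ j) = 0" .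
  qed
  then show False using \<tau> by (simp add: a'_def)
qed

text \<open>The families at different places are multiplied by approximate idempotents
  \<open>T v\<close>. A total length above \<open>n\<close> gives a rational relation; at the place
  carrying its largest coefficient \<open>M\<close>, the terms of the other places are small, so the
  combination \<open>X0\<close> there is too small for strong independence.\<close>

lemma sum_degrees_le:
  assumes b: "\<And>v i. v \<in> exts \<Longrightarrow> b v i \<in> k"
    and ind: "\<And>v. v \<in> exts \<Longrightarrow> abs_val.strongly_independent v (b v) (m v)"
  shows "(\<Sum>v\<in>exts. m v) \<le> n"
proof (rule ccontr)
  assume "\<not> (\<Sum>v\<in>exts. m v) \<le> n"
  define J where "J = Sigma exts (\<lambda>v. {..<m v})"
  have finJ: "finite J" unfolding J_def using finite_exts by auto
  have "card J = (\<Sum>v\<in>exts. m v)" unfolding J_def using finite_exts by (simp add: card_SigmaI)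
  then have card: "card {..<n} < card J" using \<open>\<not> (\<Sum>v\<in>exts. m v) \<le> n\<close> by simp
  have V: "abs_val k v" if "v \<in> exts" for v using exts_abs_val[OF that] .
  have "\<exists>C>0. \<forall>q. (\<forall>i. q i \<in> \<rat>) \<longrightarrow> (\<forall>i<m v. v (q i) \<le> C * v (\<Sum>j<m v. q j * b v j))" if "v \<in> exts" for v
    using ind[OF that] unfolding abs_val.strongly_independent_def[OF V[OF that]] .
  then obtain C where C: "\<And>v. v \<in> exts \<Longrightarrow> C v > 0"
    "\<And>v q i. v \<in> exts \<Longrightarrow> (\<And>i. q i \<in> \<rat>) \<Longrightarrow> i < m v \<Longrightarrow> v (q i) \<le> C v * v (\<Sum>j<m v. q j * b v j)" by metis
  define W :: "(complex \<Rightarrow> real) \<Rightarrow> real" where "W = (\<lambda>v. \<Sum>(w, i)\<in>J. v (b w i))"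
  have nn: "v (b w i) \<ge> 0" if "v \<in> exts" "w \<in> exts" for v w i using abs_val.nonneg[OF V] that b by blast
  have W0: "W v \<ge> 0" if "v \<in> exts" for v unfolding W_def using nn that by (intro sum_nonneg) (auto simp: J_def)
  \<comment> \<open>Larger than every \<open>C v * W v\<close>, so that with
    \<open>\<delta> = 1 / Cs\<close> the final chain reads \<open>M < M\<close>.\<close>
  define Cs where "Cs = 1 + (\<Sum>v\<in>exts. C v * W v)"
  have CW: "C v * W v < Cs" if "v \<in> exts" for v
  proof -
    have "C v * W v \<le> (\<Sum>v\<in>exts. C v * W v)"
      using that C(1) W0 finite_exts by (intro member_le_sum) (auto intro!: mult_nonneg_nonneg less_imp_le[OF C(1)])
    then show ?thesis by (simp add: Cs_def)
  qed
  have "(\<Sum>v\<in>exts. C v * W v) \<ge> 0" using C(1) W0 by (intro sum_nonneg mult_nonneg_nonneg less_imp_le[OF C(1)]) auto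
  then have Cs: "Cs > 0" by (simp add: Cs_def)
  define \<delta> where "\<delta> = 1 / Cs"
  have \<delta>: "\<delta> > 0" using Cs by (simp add: \<delta>_def)
  have "\<exists>T\<in>k. v (T - 1) < \<delta> \<and> (\<forall>w\<in>exts - {v}. w T < \<delta>)" if "v \<in> exts" for v
    using weak_idempotent[OF that \<delta>] by metis
  then obtain T where T: "\<And>v. v \<in> exts \<Longrightarrow> T v \<in> k" "\<And>v. v \<in> exts \<Longrightarrow> v (T v - 1) < \<delta>"
    "\<And>v w. v \<in> exts \<Longrightarrow> w \<in> exts \<Longrightarrow> w \<noteq> v \<Longrightarrow> w (T v) < \<delta>" by (metis DiffI singletonD)
  have "\<exists>c. (\<forall>l. c l \<in> \<rat>) \<and> T v * b v i = (\<Sum>l<n. c l * \<alpha> ^ l)" if "v \<in> exts" for v i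
    using coordinates[of "T v * b v i"] T(1)[OF that] b[OF that] by (metis mult)
  then have "\<forall>z\<in>J. \<exists>c. (\<forall>l. c l \<in> \<rat>) \<and> T (fst z) * b (fst z) (snd z) = (\<Sum>l<n. c l * \<alpha> ^ l)" unfolding J_def by auto
  then obtain c where c: "\<And>z l. z \<in> J \<Longrightarrow> c z l \<in> \<rat>" "\<And>z. z \<in> J \<Longrightarrow> T (fst z) * b (fst z) (snd z) = (\<Sum>l<n. c z l * \<alpha> ^ l)" by metis
  obtain y where y: "\<forall>z\<in>J. y z \<in> \<rat>" "\<exists>z\<in>J. y z \<noteq> 0" "\<forall>l\<in>{..<n}. (\<Sum>z\<in>J. c z l * y z) = 0"
    using Rats.homogeneous_solution[OF finite_lessThan finJ card, of "\<lambda>l z. c z l"] c(1) by blast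
  have yk: "y z \<in> k" if "z \<in> J" for z using y(1) that Rats_subset by blast
  have zero: "(\<Sum>z\<in>J. y z * (T (fst z) * b (fst z) (snd z))) = 0"
  proof -
    have "(\<Sum>z\<in>J. y z * (T (fst z) * b (fst z) (snd z))) = (\<Sum>z\<in>J. \<Sum>l<n. (c z l * y z) * \<alpha> ^ l)"
      by (intro sum.cong refl) (simp add: c(2) sum_distrib_left mult_ac)
    also have "\<dots> = (\<Sum>l<n. \<Sum>z\<in>J. (c z l * y z) * \<alpha> ^ l)" by (rule sum.swap)
    also have "\<dots> = (\<Sum>l<n. (\<Sum>z\<in>J. c z l * y z) * \<alpha> ^ l)" by (simp add: sum_distrib_right)
    also have "\<dots> = 0" using y(3) by simp
    finally show ?thesis .
  qed
  have uJ: "u (y z) \<ge> 0" "u (y z) = 0 \<longleftrightarrow> y z = 0" if "z \<in> J" for z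
  proof -
    have "y z \<in> Qbar" using y(1) that Qbar.Rats_subset by blast
    then show "u (y z) \<ge> 0" "u (y z) = 0 \<longleftrightarrow> y z = 0" by (rule U.nonneg, rule U.eq_0_iff)
  qed
  obtain z0 where z0: "z0 \<in> J" "\<And>z. z \<in> J \<Longrightarrow> u (y z) \<le> u (y z0)"
  proof -
    have "Max ((\<lambda>z. u (y z)) ` J) \<in> (\<lambda>z. u (y z)) ` J" using finJ y(2) by (intro Max_in) auto
    then obtain z0 where "z0 \<in> J" "u (y z0) = Max ((\<lambda>z. u (y z)) ` J)" by auto
    then show ?thesis using that[of z0] finJ by simp
  qed
  define M where "M = u (y z0)"
  have M: "M > 0"
  proof -
    obtain z where "z \<in> J" "y z \<noteq> 0" using y(2) by blast
    then have "u (y z) > 0" using uJ[of z] by simp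
    then show ?thesis using z0(2)[OF \<open>z \<in> J\<close>] by (simp add: M_def)
  qed
  obtain v i where vi: "z0 = (v, i)" by (cases z0)
  have v: "v \<in> exts" "i < m v" using z0(1) by (auto simp: J_def vi)
  interpret Vv: abs_val k v by (rule V[OF v(1)])
  define q where "q = (\<lambda>j. if j < m v then y (v, j) else 0)"
  have q: "q j \<in> \<rat>" for j using y(1) v by (auto simp: q_def J_def)
  define X0 where "X0 = (\<Sum>j<m v. q j * b v j)"
  have "M = v (q i)" using v exts_Rats[OF v(1) q[of i]] by (simp add: M_def q_def vi)
  then have 1: "M \<le> C v * v X0" using C(2)[of v q i] v q by (simp add: X0_def)
  \<comment> \<open>The value that the idempotent \<open>T (fst z)\<close> approximates at
    \<open>v\<close>.\<close>
  define ind' where "ind' = (\<lambda>z::(complex \<Rightarrow> real) \<times> nat. if fst z = v then 1 else 0 :: complex)"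
  have Xe: "X0 = (\<Sum>z\<in>J. y z * ind' z * b (fst z) (snd z))"
  proof -
    have "(\<Sum>z\<in>J. y z * ind' z * b (fst z) (snd z)) = (\<Sum>z\<in>{v} \<times> {..<m v}. y z * ind' z * b (fst z) (snd z))"
      using v by (intro sum.mono_neutral_right finJ) (auto simp: J_def ind'_def)
    also have "\<dots> = (\<Sum>j<m v. y (v, j) * ind' (v, j) * b v j)"
    proof -
      have "{v} \<times> {..<m v} = Pair v ` {..<m v}" by auto
      then show ?thesis by (simp add: sum.reindex inj_on_def)
    qed
    also have "\<dots> = X0" unfolding X0_def by (intro sum.cong) (auto simp: q_def ind'_def)
    finally show ?thesis by simp
  qed
  have Jk: "T (fst z) \<in> k" "b (fst z) (snd z) \<in> k" "ind' z \<in> k" if "z \<in> J" for z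
    using that T(1) b by (auto simp: J_def ind'_def)
  have "X0 = X0 - (\<Sum>z\<in>J. y z * (T (fst z) * b (fst z) (snd z)))" by (simp add: zero)
  also have "\<dots> = (\<Sum>z\<in>J. y z * ((ind' z - T (fst z)) * b (fst z) (snd z)))"
    unfolding Xe sum_subtractf[symmetric] by (intro sum.cong refl) (simp add: algebra_simps)
  finally have "v X0 \<le> (\<Sum>z\<in>J. v (y z * ((ind' z - T (fst z)) * b (fst z) (snd z))))"
    using Vv.v_sum[of J "\<lambda>z. y z * ((ind' z - T (fst z)) * b (fst z) (snd z))"] yk Jk by (simp add: mult diff)
  also have "\<dots> \<le> (\<Sum>z\<in>J. M * \<delta> * v (b (fst z) (snd z)))"
  proof (intro sum_mono)
    fix z assume z: "z \<in> J"
    have e: "fst z \<in> exts" using z by (auto simp: J_def)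
    have "v (y z) = u (y z)" using exts_Rats[OF v(1)] y(1) z by blast
    then have yM: "v (y z) \<le> M" using z0(2)[OF z] by (simp add: M_def)
    have "v (ind' z - T (fst z)) < \<delta>"
    proof (cases "fst z = v")
      case True
      have "v (- (T v - 1)) = v (T v - 1)" by (intro Vv.v_uminus diff T(1) v one)
      then show ?thesis using T(2)[OF v(1)] True by (simp add: ind'_def)
    next
      case False
      have "v (- T (fst z)) = v (T (fst z))" by (intro Vv.v_uminus T(1) e)
      then show ?thesis using T(3)[OF e v(1)] False by (simp add: ind'_def)
    qed
    then have dz: "v (ind' z - T (fst z)) \<le> \<delta>" by simp
    have "v (y z * ((ind' z - T (fst z)) * b (fst z) (snd z))) = v (y z) * v (ind' z - T (fst z)) * v (b (fst z) (snd z))"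
      using Vv.v_mult[OF yk[OF z] mult[OF diff[OF Jk(3)[OF z] Jk(1)[OF z]] Jk(2)[OF z]]] Vv.v_mult[OF diff[OF Jk(3)[OF z] Jk(1)[OF z]] Jk(2)[OF z]] by simp
    also have "\<dots> \<le> M * \<delta> * v (b (fst z) (snd z))"
      using yM dz M Vv.nonneg[OF diff[OF Jk(3)[OF z] Jk(1)[OF z]]] Vv.nonneg[OF Jk(2)[OF z]]
      by (intro mult_right_mono mult_mono) auto
    finally show "v (y z * ((ind' z - T (fst z)) * b (fst z) (snd z))) \<le> M * \<delta> * v (b (fst z) (snd z))" .
  qed
  also have "\<dots> = M * \<delta> * W v" by (simp add: W_def sum_distrib_left split_def)
  finally have 2: "v X0 \<le> M * \<delta> * W v" .
  have "M \<le> C v * (M * \<delta> * W v)" using 1 2 C(1)[OF v(1)] by (meson less_imp_le mult_left_mono order_trans)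
  also have "\<dots> = M * ((C v * W v) / Cs)" by (simp add: \<delta>_def)
  also have "\<dots> < M * 1" using M CW[OF v(1)] Cs by (intro mult_strict_left_mono) auto
  finally show False by simp
qed

text \<open>Each fibre is at most as large as the corresponding length \<open>m v\<close>, while the
  lengths sum to at most \<open>n\<close>, the total number of embeddings. Hence equality holds at
  every place.\<close>

theorem local_degree_fibre:
  assumes v: "v \<in> exts" shows "local_degree k v = card (fibre v)"
proof -
  have "\<exists>b m. (\<forall>i. b i \<in> k) \<and> abs_val.strongly_independent v b m \<and> abs_val.dense_span k v b m" if "v \<in> exts" for v
    using exists_maximal_basis[OF that] by metis
  then obtain b m where bm: "\<And>v i. v \<in> exts \<Longrightarrow> b v i \<in> k" "\<And>v. v \<in> exts \<Longrightarrow> abs_val.strongly_independent v (b v) (m v)"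
    "\<And>v. v \<in> exts \<Longrightarrow> abs_val.dense_span k v (b v) (m v)" by metis
  have le: "card (fibre w) \<le> m w" if "w \<in> exts" for w using fibre_le[OF that bm(1)[OF that] bm(3)[OF that]] .
  have "R = (\<Union>w\<in>exts. fibre w)" using pull_exts by (auto simp: fibre_def)
  then have "n = (\<Sum>w\<in>exts. card (fibre w))"
    unfolding card_R[symmetric] by (simp only:) (intro card_UN_disjoint finite_exts, auto simp: fibre_def)
  then have sum_le: "(\<Sum>w\<in>exts. m w) \<le> (\<Sum>w\<in>exts. card (fibre w))" using sum_degrees_le[of b m] bm by simp
  have "m v = card (fibre v)"
  proof (rule ccontr)
    assume "m v \<noteq> card (fibre v)"
    then have "card (fibre v) < m v" using le[OF v] by simp
    then have "(\<Sum>w\<in>exts. card (fibre w)) < (\<Sum>w\<in>exts. m w)"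
      using le v finite_exts by (intro sum_strict_mono_ex1) auto
    then show False using sum_le by simp
  qed
  then show ?thesis
    using abs_val.local_degree_eq[OF exts_abs_val[OF v] bm(1)[OF v] bm(2)[OF v] bm(3)[OF v]] by simp
qed

text \<open>Weighted sums over places become sums over embeddings; this is the form in which local
  degrees enter the product formula and Northcott's theorem.\<close>

theorem sum_over_exts:
  fixes g :: "(complex \<Rightarrow> real) \<Rightarrow> real"
  shows "(\<Sum>v\<in>exts. real (local_degree k v) * g v) = (\<Sum>\<rho>\<in>R. g (pull \<rho>))"
proof -
  have "(\<Sum>\<rho>\<in>R. g (pull \<rho>)) = (\<Sum>v\<in>pull ` R. \<Sum>\<rho>\<in>{\<rho> \<in> R. pull \<rho> = v}. g (pull \<rho>))"
    by (rule sum.image_gen) simp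
  also have "\<dots> = (\<Sum>v\<in>exts. \<Sum>\<rho>\<in>fibre v. g v)"
    unfolding exts_eq fibre_def by (intro sum.cong refl) auto
  also have "\<dots> = (\<Sum>v\<in>exts. real (local_degree k v) * g v)"
    by (intro sum.cong refl) (simp add: local_degree_fibre)
  finally show ?thesis by simp
qed

theorem sum_ln_exts:
  assumes x: "x \<in> k" "x \<noteq> 0"
  shows "(\<Sum>v\<in>exts. real (local_degree k v) * ln (v x)) = ln (u (nrm x))"
proof -
  have e: "emb \<rho> x \<in> Qbar" "emb \<rho> x \<noteq> 0" if "\<rho> \<in> R" for \<rho>
    using emb_Qbar[OF x(1) that] emb_nonzero[OF x that] by auto
  have "u (nrm x) = (\<Prod>\<rho>\<in>R. u (emb \<rho> x))" unfolding nrm_def using e by (intro U.v_prod)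
  then have "ln (u (nrm x)) = (\<Sum>\<rho>\<in>R. ln (u (emb \<rho> x)))"
  proof -
    have "u (emb \<rho> x) \<noteq> 0" if "\<rho> \<in> R" for \<rho> using U.v_pos[OF e[OF that]] by simp
    then show ?thesis using ln_prod[of R "\<lambda>\<rho>. u (emb \<rho> x)"] \<open>u (nrm x) = _\<close> by simp
  qed
  also have "\<dots> = (\<Sum>\<rho>\<in>R. ln (pull \<rho> x))" using x by (simp add: pull_def)
  finally show ?thesis using sum_over_exts[of "\<lambda>v. ln (v x)"] by simp
qed

end

subsection \<open>Places, the product formula and Northcott's theorem\<close>

text \<open>One extension is fixed for each p. All places of a number field above p arise from it
  through the different embeddings, so any choice serves.\<close>

definition padic_abs :: "nat \<Rightarrow> complex \<Rightarrow> real" where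
  "padic_abs p = (SOME u. absolute_value_on Qbar u \<and> ultrametric_on Qbar u \<and> extends_padic p u)"

lemma padic_abs:
  assumes "Factorial_Ring.prime p"
  shows "absolute_value_on Qbar (padic_abs p)" "ultrametric_on Qbar (padic_abs p)" "extends_padic p (padic_abs p)"
proof -
  have "\<exists>u. absolute_value_on Qbar u \<and> ultrametric_on Qbar u \<and> extends_padic p u"
    using exists_padic_absolute_value[OF assms] by metis
  from someI_ex[OF this] show "absolute_value_on Qbar (padic_abs p)" "ultrametric_on Qbar (padic_abs p)" "extends_padic p (padic_abs p)"
    unfolding padic_abs_def by auto
qed

lemma abs_val_cmod: "abs_val Qbar cmod"
  by (rule abs_valI[OF cfield_Qbar]) (auto simp: absolute_value_on_def norm_mult norm_triangle_ineq)

lemma abs_val_padic: "Factorial_Ring.prime p \<Longrightarrow> abs_val Qbar (padic_abs p)"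
  by (rule abs_valI[OF cfield_Qbar padic_abs(1)])

lemma padic_abs_int:
  "Factorial_Ring.prime p \<Longrightarrow> m \<noteq> 0 \<Longrightarrow> padic_abs p (of_int m) = 1 / real p ^ multiplicity (int p) m"
  using padic_abs(3) by (simp add: extends_padic_def)

lemma ln_padic_abs_int:
  assumes "Factorial_Ring.prime p" "m \<noteq> 0"
  shows "ln (padic_abs p (of_int m)) = - real (multiplicity (int p) m) * ln (real p)"
proof -
  have "real p > 0" using assms(1) prime_gt_0_nat by simp
  then show ?thesis by (simp add: padic_abs_int[OF assms] ln_div ln_realpow)
qed

text \<open>\<open>U\<close> may contain further primes, which contribute 0. Thus one set serves for
  numerator and denominator and for the places at the same time.\<close>

lemma ln_eq_sum_multiplicity:
  assumes m: "m \<noteq> (0::int)" and U: "finite U" "\<And>p. p \<in> U \<Longrightarrow> Factorial_Ring.prime p" "\<And>p. Factorial_Ring.prime p \<Longrightarrow> int p dvd m \<Longrightarrow> p \<in> U"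
  shows "ln \<bar>real_of_int m\<bar> = (\<Sum>p\<in>U. real (multiplicity (int p) m) * ln (real p))"
proof -
  have "\<bar>m\<bar> = (\<Prod>p\<in>prime_factors m. p ^ multiplicity p m)"
    using prod_prime_factors[OF m] by simp
  also have "\<dots> = (\<Prod>p\<in>int ` U. p ^ multiplicity p m)"
  proof (rule prod.mono_neutral_left)
    show "prime_factors m \<subseteq> int ` U"
    proof
      fix q assume q: "q \<in> prime_factors m"
      then have qp: "Factorial_Ring.prime q" "q dvd m" by auto
      have qn: "q = int (nat q)" using prime_gt_0_int[OF qp(1)] by simp
      have "Factorial_Ring.prime (nat q)" using qp(1) prime_int_nat_transfer by blast
      then have "nat q \<in> U" using U(3)[of "nat q"] qp(2) qn by simp
      then show "q \<in> int ` U" using qn by (rule rev_image_eqI)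
    qed
    show "\<forall>i\<in>int ` U - prime_factors m. i ^ multiplicity i m = 1"
    proof
      fix i assume i: "i \<in> int ` U - prime_factors m"
      then have "Factorial_Ring.prime i" using U(2) by auto
      then have "\<not> i dvd m" using i m by (auto simp: prime_factors_dvd)
      then show "i ^ multiplicity i m = 1" by (simp add: not_dvd_imp_multiplicity_0)
    qed
  qed (use U in auto)
  also have "\<dots> = (\<Prod>p\<in>U. int p ^ multiplicity (int p) m)" by (simp add: prod.reindex)
  finally have "real_of_int \<bar>m\<bar> = (\<Prod>p\<in>U. real p ^ multiplicity (int p) m)"
    by (simp only: of_int_prod of_int_power of_int_of_nat_eq)
  then have "\<bar>real_of_int m\<bar> = (\<Prod>p\<in>U. real p ^ multiplicity (int p) m)" by simp
  then have "ln \<bar>real_of_int m\<bar> = ln (\<Prod>p\<in>U. real p ^ multiplicity (int p) m)" by (rule arg_cong)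
  also have "\<dots> = (\<Sum>p\<in>U. ln (real p ^ multiplicity (int p) m))"
    using U(1,2) prime_gt_0_nat by (intro ln_prod) auto
  also have "\<dots> = (\<Sum>p\<in>U. real (multiplicity (int p) m) * ln (real p))"
    using U(2) prime_gt_0_nat by (intro sum.cong refl) (simp add: ln_realpow)
  finally show ?thesis .
qed

lemma ultrametric_sum_le:
  assumes "abs_val K v" "ultrametric_on K v" "\<And>i. i \<in> I \<Longrightarrow> g i \<in> K" "\<And>i. i \<in> I \<Longrightarrow> v (g i) \<le> B" "B \<ge> 0"
  shows "v (\<Sum>i\<in>I. g i) \<le> B"
  using assms(3,4)
proof (induction I rule: infinite_finite_induct)
  case (insert x I)
  interpret abs_val K v by fact
  have "v (g x + (\<Sum>i\<in>I. g i)) \<le> max (v (g x)) (v (\<Sum>i\<in>I. g i))"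
    using assms(2) insert.prems(1) sum[of I g] unfolding ultrametric_on_def by simp
  moreover have "v (g x) \<le> B" "v (\<Sum>i\<in>I. g i) \<le> B" using insert by auto
  ultimately show ?case using insert.hyps by simp
qed (use assms(5) abs_val.v_0[OF assms(1)] in simp_all)

text \<open>If \<open>v y > 1\<close>, the leading term of a monic integral equation would strictly
  dominate all the others.\<close>

lemma ultrametric_algebraic_int_le_1:
  assumes "abs_val K v" "ultrametric_on K v" and int: "\<And>i::int. v (of_int i) \<le> 1"
    and y: "y \<in> K" "algebraic_int y"
  shows "v y \<le> 1"
proof (rule ccontr)
  interpret abs_val K v by fact
  assume "\<not> v y \<le> 1"
  then have y1: "v y > 1" by simp
  obtain q where q: "lead_coeff q = 1" "\<And>i. coeff q i \<in> \<int>" "poly q y = 0" using y(2) by (auto simp: algebraic_int.simps)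
  define d where "d = degree q"
  have d: "d > 0" unfolding d_def by (rule csubring.integral_degree_pos[OF csubring_Ints q(1,3)])
  have cK: "coeff q i \<in> K" "v (coeff q i) \<le> 1" for i
    using q(2)[of i] int of_int by (auto elim!: Ints_cases)
  have "poly q y = y ^ d + (\<Sum>i<d. coeff q i * y ^ i)"
    unfolding poly_altdef d_def using q(1) by (simp add: lessThan_Suc_atMost[symmetric])
  then have yd: "y ^ d = - (\<Sum>i<d. coeff q i * y ^ i)" using q(3) by (simp add: eq_neg_iff_add_eq_0)
  have "v (\<Sum>i<d. coeff q i * y ^ i) \<le> v y ^ (d - 1)"
  proof (rule ultrametric_sum_le[OF assms(1,2)])
    fix i assume i: "i \<in> {..<d}"
    show "coeff q i * y ^ i \<in> K" using cK y by auto
    have "v (coeff q i * y ^ i) = v (coeff q i) * v y ^ i" using cK y by (simp add: v_mult v_power power)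
    also have "\<dots> \<le> 1 * v y ^ i" using cK y1 by (intro mult_right_mono) auto
    also have "v y ^ i \<le> v y ^ (d - 1)" using i y1 by (intro power_increasing) auto
    finally show "v (coeff q i * y ^ i) \<le> v y ^ (d - 1)" by simp
  qed (use y1 in simp)
  moreover have "(\<Sum>i<d. coeff q i * y ^ i) \<in> K" using cK y by auto
  ultimately have "v (y ^ d) \<le> v y ^ (d - 1)" unfolding yd by (subst v_uminus)
  then have "v y ^ d \<le> v y ^ (d - 1)" using v_power[OF y(1)] by simp
  moreover have "v y ^ (d - 1) < v y ^ d" using d y1 by (intro power_strict_increasing) auto
  ultimately show False by simp
qed

section \<open>Classification of the places of k\<close>

context number_field_gen
begin

definition archp :: "(complex \<Rightarrow> real) set" where "archp = places_over.exts k cmod"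
definition finp :: "nat \<Rightarrow> (complex \<Rightarrow> real) set" where "finp p = places_over.exts k (padic_abs p)"

lemma places_over_cmod: "places_over k \<alpha> f cmod"
proof (intro places_over.intro places_over_axioms.intro)
  show "absolute_value_on Qbar cmod" by (rule abs_val.absv[OF abs_val_cmod])
  show "\<exists>q\<in>\<rat>. q \<noteq> 0 \<and> cmod q < 1" by (intro bexI[of _ "1/2"]) auto
qed (rule number_field_gen_axioms)

lemma places_over_padic: assumes "Factorial_Ring.prime p" shows "places_over k \<alpha> f (padic_abs p)"
proof (intro places_over.intro places_over_axioms.intro)
  show "absolute_value_on Qbar (padic_abs p)" by (rule padic_abs[OF assms])
  have p1: "p > 1" using assms by (rule prime_gt_1_nat)
  have "\<not> is_unit (int p)" using p1 by simp
  then have "multiplicity (int p) (int p) = 1" using p1 by (intro multiplicity_self) auto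
  then have "padic_abs p (of_nat p) = 1 / real p" using padic_abs_int[OF assms, of "int p"] p1 by simp
  then show "\<exists>q\<in>\<rat>. q \<noteq> 0 \<and> padic_abs p q < 1" using p1 by (intro bexI[of _ "of_nat p"]) auto
qed (rule number_field_gen_axioms)

lemma exts_iff: "places_over.exts k u = {v. absolute_value_on k v \<and> (\<forall>x. x \<notin> k \<longrightarrow> v x = 0) \<and> (\<forall>x\<in>\<rat>. v x = u x)}"
  if "places_over k \<alpha> f u" for u
  by (rule places_over.exts_def[OF that])

lemma finite_archp: "finite archp" unfolding archp_def by (rule places_over.finite_exts[OF places_over_cmod])

lemma finite_finp: "Factorial_Ring.prime p \<Longrightarrow> finite (finp p)"
  unfolding finp_def by (rule places_over.finite_exts[OF places_over_padic])

text \<open>A place is defined by the triangle inequality alone. The strong form is inherited from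
  \<open>padic_abs p\<close>, because \<open>v\<close> is a pullback along an embedding.\<close>

lemma finp_ultrametric:
  assumes p: "Factorial_Ring.prime p" and v: "v \<in> finp p" shows "ultrametric_on k v"
proof -
  interpret P: places_over k \<alpha> f "padic_abs p" by (rule places_over_padic[OF p])
  obtain \<rho> where \<rho>: "\<rho> \<in> R" "v = P.pull \<rho>" using v unfolding finp_def P.exts_eq by blast
  show ?thesis unfolding ultrametric_on_def
  proof (intro ballI)
    fix x y assume xy: "x \<in> k" "y \<in> k"
    have "padic_abs p (emb \<rho> x + emb \<rho> y) \<le> max (padic_abs p (emb \<rho> x)) (padic_abs p (emb \<rho> y))"
      using padic_abs(2)[OF p] emb_Qbar[OF xy(1) \<rho>(1)] emb_Qbar[OF xy(2) \<rho>(1)] unfolding ultrametric_on_def by blast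
    then show "v (x + y) \<le> max (v x) (v y)" using xy \<rho> add[OF xy] by (simp add: P.pull_def emb_add)
  qed
qed

lemma finp_int:
  assumes p: "Factorial_Ring.prime p" and v: "v \<in> finp p"
  shows "v (of_int i) \<le> 1" "\<not> int p dvd i \<Longrightarrow> v (of_int i) = 1"
proof -
  have eq: "v (of_int i) = padic_abs p (of_int i)"
    using v unfolding finp_def exts_iff[OF places_over_padic[OF p]] by auto
  have p1: "real p \<ge> 1" using prime_gt_0_nat[OF p] by simp
  show "v (of_int i) \<le> 1"
  proof (cases "i = 0")
    case True
    then show ?thesis unfolding eq using abs_val.v_0[OF abs_val_padic[OF p]] by simp
  next
    case False
    then show ?thesis using p1 by (simp add: eq padic_abs_int[OF p] one_le_power)
  qed
  assume "\<not> int p dvd i"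
  moreover from this have "i \<noteq> 0" by auto
  ultimately show "v (of_int i) = 1" by (simp add: eq padic_abs_int[OF p] not_dvd_imp_multiplicity_0)
qed

lemma archp_eq: "archp = archimedean_places k"
  unfolding archp_def exts_iff[OF places_over_cmod] archimedean_places_def places_def extends_usual_def by auto

lemma extends_padic_Rats:
  assumes p: "Factorial_Ring.prime p" and v: "absolute_value_on k v" "extends_padic p v" and x: "x \<in> \<rat>"
  shows "v x = padic_abs p x"
proof -
  interpret V: abs_val k v by (rule abs_valI[OF cfield_axioms v(1)])
  interpret P: abs_val Qbar "padic_abs p" by (rule abs_val_padic[OF p])
  have i: "v (of_int m) = padic_abs p (of_int m)" for m
    using v(2) padic_abs(3)[OF p] by (cases "m = 0") (simp_all add: extends_padic_def)
  obtain a b where "x = of_int a / of_int b" using x by (rule Rats_cases')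
  then show ?thesis using i V.v_divide[of "of_int a" "of_int b"] P.v_divide[of "of_int a" "of_int b"] by simp
qed

lemma finp_eq:
  assumes p: "Factorial_Ring.prime p"
  shows "finp p = {v. absolute_value_on k v \<and> (\<forall>x. x \<notin> k \<longrightarrow> v x = 0) \<and> extends_padic p v}"
proof -
  have "extends_padic p v" if "\<forall>x\<in>\<rat>. v x = padic_abs p x" for v
    using padic_abs(3)[OF p] that by (simp add: extends_padic_def)
  then show ?thesis unfolding finp_def exts_iff[OF places_over_padic[OF p]]
    using extends_padic_Rats[OF p] by blast
qed

lemma places_eq: "places k = archp \<union> (\<Union>p\<in>{p. Factorial_Ring.prime p}. finp p)"
  unfolding archp_eq using finp_eq by (auto simp: archimedean_places_def places_def)

lemma archp_finp_disjoint: assumes p: "Factorial_Ring.prime p" shows "archp \<inter> finp p = {}"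
proof -
  have False if "v \<in> archp" "v \<in> finp p" for v
  proof -
    have "v (of_int (int p)) = cmod (of_int (int p))"
      using that(1) unfolding archp_def exts_iff[OF places_over_cmod] by auto
    then show False using finp_int(1)[OF p that(2), of "int p"] prime_gt_1_nat[OF p] by simp
  qed
  then show ?thesis by blast
qed

lemma finp_disjoint:
  assumes p: "Factorial_Ring.prime p" "Factorial_Ring.prime q" "p \<noteq> q" shows "finp p \<inter> finp q = {}"
proof -
  have False if v: "v \<in> finp p" "v \<in> finp q" for v
  proof -
    have "\<not> int q dvd int p" using p by (metis int_dvd_int_iff primes_dvd_imp_eq)
    then have "v (of_int (int p)) = 1" using finp_int(2)[OF p(2) v(2)] by blast
    moreover have "v (of_int (int p)) = padic_abs p (of_int (int p))"
      using v(1) unfolding finp_def exts_iff[OF places_over_padic[OF p(1)]] by auto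
    moreover have "padic_abs p (of_int (int p)) = 1 / real p"
      using padic_abs_int[OF p(1), of "int p"] multiplicity_self[of "int p"] prime_gt_1_nat[OF p(1)] by simp
    ultimately show False using prime_gt_1_nat[OF p(1)] by simp
  qed
  then show ?thesis by blast
qed

lemma places_abs_val: "v \<in> places k \<Longrightarrow> abs_val k v"
  by (rule abs_valI[OF cfield_axioms]) (simp add: places_def)

lemma nonarch_places:
  assumes "v \<in> places k - archp" obtains p where "Factorial_Ring.prime p" "v \<in> finp p"
  using assms unfolding places_eq by blast

lemma nonarch_algebraic_int_le_1:
  assumes "v \<in> places k - archp" "y \<in> k" "algebraic_int y" shows "v y \<le> 1"
proof -
  obtain p where p: "Factorial_Ring.prime p" "v \<in> finp p" using nonarch_places[OF assms(1)] .
  show ?thesis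
    using assms by (intro ultrametric_algebraic_int_le_1[OF places_abs_val finp_ultrametric[OF p] finp_int(1)[OF p]]) auto
qed

lemma nonarch_ultrametric: "v \<in> places k - archp \<Longrightarrow> ultrametric_on k v"
  by (erule nonarch_places) (rule finp_ultrametric)

text \<open>Away from the primes dividing the denominators of \<open>x\<close> and of
  \<open>inverse x\<close>, both are bounded by 1.\<close>

lemma finite_places_neq_1:
  assumes x: "x \<in> k" "x \<noteq> 0"
  obtains U where "finite U" "\<And>p. p \<in> U \<Longrightarrow> Factorial_Ring.prime p"
    "\<And>p v. Factorial_Ring.prime p \<Longrightarrow> p \<notin> U \<Longrightarrow> v \<in> finp p \<Longrightarrow> v x = 1"
proof -
  obtain a :: nat where a: "a > 0" "algebraic_int (of_nat a * x)"
    using algebraic_multiple_algebraic_int[OF two_is_prime_nat, of x] k_algebraic[OF x(1)] by auto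
  obtain b :: nat where b: "b > 0" "algebraic_int (of_nat b * inverse x)"
    using algebraic_multiple_algebraic_int[OF two_is_prime_nat, of "inverse x"] k_algebraic[OF inverse[OF x(1)]] by auto
  define U where "U = prime_factors (a * b)"
  have "v x = 1" if p: "Factorial_Ring.prime p" "p \<notin> U" "v \<in> finp p" for p v
  proof -
    have vp: "v \<in> places k - archp" using p archp_finp_disjoint[OF p(1)] by (auto simp: places_eq)
    interpret V: abs_val k v by (rule places_abs_val) (use vp in blast)
    have "\<not> p dvd a * b" using p a b by (auto simp: U_def prime_factors_dvd)
    then have nd: "\<not> p dvd a" "\<not> p dvd b" by auto
    have va: "v (of_nat a) = 1" "v (of_nat b) = 1"
      using finp_int(2)[OF p(1,3), of "int a"] finp_int(2)[OF p(1,3), of "int b"] nd by simp_all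
    have "v (of_nat a * x) \<le> 1" by (rule nonarch_algebraic_int_le_1[OF vp _ a(2)]) (use x in auto)
    then have 1: "v x \<le> 1" using V.v_mult[of "of_nat a" x] x va by simp
    have "v (of_nat b * inverse x) \<le> 1" by (rule nonarch_algebraic_int_le_1[OF vp _ b(2)]) (use x in auto)
    then have "inverse (v x) \<le> 1" using V.v_mult[of "of_nat b" "inverse x"] V.v_inverse[OF x(1)] inverse[OF x(1)] va by simp
    then have "1 \<le> v x" using V.v_pos[OF x] by (simp add: inverse_le_1_iff)
    then show ?thesis using 1 by simp
  qed
  then show ?thesis using that[of U] by (auto simp: U_def)
qed

lemma sum_places_finite:
  assumes U: "finite U" "\<And>p. p \<in> U \<Longrightarrow> Factorial_Ring.prime p"
  shows "finite (archp \<union> (\<Union>p\<in>U. finp p))"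
    "(\<Sum>v\<in>archp \<union> (\<Union>p\<in>U. finp p). g v) = (\<Sum>v\<in>archp. g v) + (\<Sum>p\<in>U. \<Sum>v\<in>finp p. (g v :: real))"
proof -
  have fin: "finite (\<Union>p\<in>U. finp p)" using U finite_finp by auto
  then show "finite (archp \<union> (\<Union>p\<in>U. finp p))" using finite_archp by simp
  have "(\<Sum>v\<in>archp \<union> (\<Union>p\<in>U. finp p). g v) = (\<Sum>v\<in>archp. g v) + (\<Sum>v\<in>(\<Union>p\<in>U. finp p). g v)"
  proof (rule sum.union_disjoint[OF finite_archp fin])
    show "archp \<inter> (\<Union>p\<in>U. finp p) = {}" using archp_finp_disjoint[OF U(2)] by blast
  qed
  also have "(\<Sum>v\<in>(\<Union>p\<in>U. finp p). g v) = (\<Sum>p\<in>U. \<Sum>v\<in>finp p. g v)"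
    using U finite_finp finp_disjoint by (intro sum.UNION_disjoint) auto
  finally show "(\<Sum>v\<in>archp \<union> (\<Union>p\<in>U. finp p). g v) = (\<Sum>v\<in>archp. g v) + (\<Sum>p\<in>U. \<Sum>v\<in>finp p. g v)" .
qed

lemma nrm_quotient:
  assumes "x \<in> k" "x \<noteq> 0"
  obtains a b :: int where "nrm x = of_int a / of_int b" "a \<noteq> 0" "b > 0" "coprime a b"
proof -
  obtain a b where ab: "b > 0" "coprime a b" "nrm x = of_int a / of_int b"
    using nrm_Rats[OF assms(1)] by (rule Rats_cases')
  moreover have "a \<noteq> 0" using ab nrm_nonzero[OF assms] by auto
  ultimately show ?thesis using that by blast
qed

text \<open>Over each place of the rationals the weighted sum is the logarithm of the size of the
  norm (\<open>sum_ln_exts\<close>). The norm is rational, so the claim reduces to the prime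
  factorization of its numerator and denominator.\<close>

theorem product_formula:
  assumes x: "x \<in> k" "x \<noteq> 0"
  shows "(\<Sum>\<^sub>\<infinity>v\<in>places k. real (local_degree k v) * ln (v x)) = 0"
proof -
  obtain U0 where U0: "finite U0" "\<And>p. p \<in> U0 \<Longrightarrow> Factorial_Ring.prime p"
    "\<And>p v. Factorial_Ring.prime p \<Longrightarrow> p \<notin> U0 \<Longrightarrow> v \<in> finp p \<Longrightarrow> v x = 1"
    using finite_places_neq_1[OF x] by blast
  obtain a b :: int where ab: "nrm x = of_int a / of_int b" "a \<noteq> 0" "b > 0" using nrm_quotient[OF x] by metis
  \<comment> \<open>Outside these primes \<open>x\<close> has absolute value 1 at every place, and
    neither numerator nor denominator of the norm contributes.\<close>
  define U where "U = U0 \<union> nat ` prime_factors (a * b)"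
  have U: "finite U" "\<And>p. p \<in> U \<Longrightarrow> Factorial_Ring.prime p"
  proof -
    show "finite U" using U0(1) by (simp add: U_def)
    fix p assume "p \<in> U"
    then consider "p \<in> U0" | q where "p = nat q" "q \<in> prime_factors (a * b)" unfolding U_def by blast
    then show "Factorial_Ring.prime p"
    proof cases
      case 2
      have "Factorial_Ring.prime q" using 2(2) by (rule in_prime_factors_imp_prime)
      then show ?thesis using 2 prime_int_nat_transfer by blast
    qed (rule U0(2))
  qed
  have Ud: "p \<in> U" if "Factorial_Ring.prime p" "int p dvd a * b" for p
  proof -
    have "int p \<in> prime_factors (a * b)" using that ab by (simp add: prime_factors_dvd)
    then have "nat (int p) \<in> nat ` prime_factors (a * b)" by (rule imageI)
    then show ?thesis by (simp add: U_def)
  qed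
  let ?F = "archp \<union> (\<Union>p\<in>U. finp p)"
  have FP: "?F \<subseteq> places k" using U unfolding places_eq by auto
  have "(\<Sum>\<^sub>\<infinity>v\<in>places k. real (local_degree k v) * ln (v x)) = (\<Sum>\<^sub>\<infinity>v\<in>?F. real (local_degree k v) * ln (v x))"
  proof (rule infsum_cong_neutral)
    fix v assume v: "v \<in> places k - ?F"
    then obtain p where p: "Factorial_Ring.prime p" "v \<in> finp p" using nonarch_places[of v] by blast
    then have "p \<notin> U0" using v unfolding U_def by blast
    then have "v x = 1" using U0(3)[OF p(1) _ p(2)] by simp
    then show "real (local_degree k v) * ln (v x) = 0" by simp
  qed (use FP in auto)
  also have "\<dots> = (\<Sum>v\<in>?F. real (local_degree k v) * ln (v x))"
    by (rule infsum_finite[OF sum_places_finite(1)[OF U]])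
  also have "\<dots> = (\<Sum>v\<in>archp. real (local_degree k v) * ln (v x)) + (\<Sum>p\<in>U. \<Sum>v\<in>finp p. real (local_degree k v) * ln (v x))"
    by (rule sum_places_finite(2)[OF U])
  also have "(\<Sum>v\<in>archp. real (local_degree k v) * ln (v x)) = ln (cmod (nrm x))"
    unfolding archp_def by (rule places_over.sum_ln_exts[OF places_over_cmod x])
  also have "(\<Sum>p\<in>U. \<Sum>v\<in>finp p. real (local_degree k v) * ln (v x)) = (\<Sum>p\<in>U. ln (padic_abs p (nrm x)))"
    unfolding finp_def using U(2) by (intro sum.cong refl places_over.sum_ln_exts[OF places_over_padic x])
  also have "\<dots> = (\<Sum>p\<in>U. real (multiplicity (int p) b) * ln (real p) - real (multiplicity (int p) a) * ln (real p))"
  proof (intro sum.cong refl)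
    fix p assume "p \<in> U"
    then have p: "Factorial_Ring.prime p" by (rule U(2))
    interpret P: abs_val Qbar "padic_abs p" by (rule abs_val_padic[OF p])
    have "padic_abs p (nrm x) = padic_abs p (of_int a) / padic_abs p (of_int b)"
      unfolding ab(1) by (rule P.v_divide) auto
    moreover have "padic_abs p (of_int a) > 0" "padic_abs p (of_int b) > 0"
      using ab by (auto intro!: P.v_pos)
    ultimately show "ln (padic_abs p (nrm x)) = real (multiplicity (int p) b) * ln (real p) - real (multiplicity (int p) a) * ln (real p)"
      using ab by (simp add: ln_div ln_padic_abs_int[OF p])
  qed
  also have "\<dots> = ln \<bar>real_of_int b\<bar> - ln \<bar>real_of_int a\<bar>"
  proof -
    have "ln \<bar>real_of_int a\<bar> = (\<Sum>p\<in>U. real (multiplicity (int p) a) * ln (real p))"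
      using ab U Ud by (intro ln_eq_sum_multiplicity) auto
    moreover have "ln \<bar>real_of_int b\<bar> = (\<Sum>p\<in>U. real (multiplicity (int p) b) * ln (real p))"
      using ab U Ud by (intro ln_eq_sum_multiplicity) auto
    ultimately show ?thesis by (simp add: sum_subtractf)
  qed
  also have "ln (cmod (nrm x)) = ln \<bar>real_of_int a\<bar> - ln \<bar>real_of_int b\<bar>"
    unfolding ab(1) norm_divide using ab by (simp add: ln_div)
  finally show ?thesis by simp
qed

section \<open>Finiteness of elements of bounded height\<close>

lemma ln_max_prod_le:
  fixes h :: "complex \<Rightarrow> real"
  assumes "finite I" "\<And>i. i \<in> I \<Longrightarrow> h i \<ge> 0"
  shows "ln (max 1 (\<Prod>i\<in>I. h i)) \<le> (\<Sum>i\<in>I. ln (max 1 (h i)))"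
proof -
  have "(\<Prod>i\<in>I. h i) \<le> (\<Prod>i\<in>I. max 1 (h i))" using assms by (intro prod_mono) auto
  moreover have "1 \<le> (\<Prod>i\<in>I. max 1 (h i))" by (intro prod_ge_1) auto
  ultimately have "ln (max 1 (\<Prod>i\<in>I. h i)) \<le> ln (\<Prod>i\<in>I. max 1 (h i))" by simp
  also have "\<dots> = (\<Sum>i\<in>I. ln (max 1 (h i)))" using assms by (intro ln_prod) auto
  finally show ?thesis .
qed

text \<open>Subtracting \<open>y\<close> from \<open>t\<close> costs at most a factor
  \<open>t + 1\<close> at each archimedean embedding and nothing at the p-adic ones. As
  \<open>a\<close> and \<open>b\<close> are coprime, the denominator \<open>b\<close> is the product
  of those p-adic sizes of the norm that exceed 1, so both the norm and its denominator are
  bounded.\<close>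

lemma nrm_height_bound:
  fixes t :: nat
  assumes y: "y \<in> k" and B: "(\<Sum>\<^sub>\<infinity>v\<in>places k. real (local_degree k v) * ln (max 1 (v y))) \<le> B"
    and ty: "of_nat t - y \<noteq> 0"
    and ab: "nrm (of_nat t - y) = of_int a / of_int b" "a \<noteq> 0" "b > 0" "coprime a b"
  shows "ln (real_of_int b) \<le> B + real n * ln (real t + 1)" "ln (cmod (nrm (of_nat t - y))) \<le> B + real n * ln (real t + 1)"
proof -
  define x where "x = of_nat t - y"
  have x: "x \<in> k" "x \<noteq> 0" using y ty by (auto simp: x_def)
  obtain U0 where U0: "finite U0" "\<And>p. p \<in> U0 \<Longrightarrow> Factorial_Ring.prime p"
    "\<And>p v. Factorial_Ring.prime p \<Longrightarrow> p \<notin> U0 \<Longrightarrow> v \<in> finp p \<Longrightarrow> y \<noteq> 0 \<Longrightarrow> v y = 1"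
  proof (cases "y = 0")
    case True
    then show ?thesis using that[of "{}"] by simp
  next
    case False
    then show ?thesis using finite_places_neq_1[OF y False] that by metis
  qed
  define U where "U = U0 \<union> nat ` prime_factors b"
  have U: "finite U" "\<And>p. p \<in> U \<Longrightarrow> Factorial_Ring.prime p"
  proof -
    show "finite U" using U0(1) by (simp add: U_def)
    fix p assume "p \<in> U"
    then consider "p \<in> U0" | q where "p = nat q" "q \<in> prime_factors b" unfolding U_def by blast
    then show "Factorial_Ring.prime p"
    proof cases
      case 2
      have "Factorial_Ring.prime q" using 2(2) by (rule in_prime_factors_imp_prime)
      then show ?thesis using 2 prime_int_nat_transfer by blast
    qed (rule U0(2))
  qed
  have Ud: "p \<in> U" if "Factorial_Ring.prime p" "int p dvd b" for p
  proof -
    have "int p \<in> prime_factors b" using that ab by (simp add: prime_factors_dvd)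
    then have "nat (int p) \<in> nat ` prime_factors b" by (rule imageI)
    then show ?thesis by (simp add: U_def)
  qed
  let ?F = "archp \<union> (\<Union>p\<in>U. finp p)"
  let ?g = "\<lambda>v. real (local_degree k v) * ln (max 1 (v y))"
  have FP: "?F \<subseteq> places k" using U unfolding places_eq by auto
  have "(\<Sum>\<^sub>\<infinity>v\<in>places k. ?g v) = (\<Sum>\<^sub>\<infinity>v\<in>?F. ?g v)"
  proof (rule infsum_cong_neutral)
    fix v assume v: "v \<in> places k - ?F"
    then obtain p where p: "Factorial_Ring.prime p" "v \<in> finp p" using nonarch_places[of v] by blast
    then have "p \<notin> U0" using v unfolding U_def by blast
    have "v y = 1 \<or> v y = 0"
    proof (cases "y = 0")
      case True
      then show ?thesis using v abs_val.v_0[OF places_abs_val] by auto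
    next
      case False
      then show ?thesis using U0(3)[OF p(1) \<open>p \<notin> U0\<close> p(2)] by simp
    qed
    then show "?g v = 0" by auto
  qed (use FP in auto)
  also have "\<dots> = (\<Sum>v\<in>?F. ?g v)"
    by (rule infsum_finite[OF sum_places_finite(1)[OF U]])
  also have "\<dots> = (\<Sum>v\<in>archp. ?g v) + (\<Sum>p\<in>U. \<Sum>v\<in>finp p. ?g v)"
    by (rule sum_places_finite(2)[OF U])
  finally have total: "(\<Sum>v\<in>archp. ?g v) + (\<Sum>p\<in>U. \<Sum>v\<in>finp p. ?g v) \<le> B" using B by simp
  have gn: "?g v \<ge> 0" for v by simp
  have ex: "emb \<rho> x = of_nat t - emb \<rho> y" if "\<rho> \<in> R" for \<rho>
    using emb_diff[of "of_nat t" y \<rho>] y that by (simp add: x_def emb_Rats)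
  have arch: "ln (max 1 (cmod (nrm x))) \<le> (\<Sum>v\<in>archp. ?g v) + real n * ln (real t + 1)"
  proof -
    interpret P: places_over k \<alpha> f cmod by (rule places_over_cmod)
    have "ln (max 1 (cmod (nrm x))) \<le> (\<Sum>\<rho>\<in>R. ln (max 1 (cmod (emb \<rho> x))))"
      unfolding nrm_def prod_norm[symmetric] by (rule ln_max_prod_le) auto
    also have "\<dots> \<le> (\<Sum>\<rho>\<in>R. ln (real t + 1) + ln (max 1 (P.pull \<rho> y)))"
    proof (rule sum_mono)
      fix \<rho> assume \<rho>: "\<rho> \<in> R"
      have pm: "P.pull \<rho> y = cmod (emb \<rho> y)" using y by (simp add: P.pull_def)
      have "cmod (emb \<rho> x) \<le> cmod (of_nat t) + cmod (emb \<rho> y)" unfolding ex[OF \<rho>] by (rule norm_triangle_ineq4)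
      also have "\<dots> = real t * 1 + cmod (emb \<rho> y)" by simp
      also have "\<dots> \<le> real t * max 1 (cmod (emb \<rho> y)) + max 1 (cmod (emb \<rho> y))"
        by (intro add_mono mult_left_mono) auto
      also have "\<dots> = (real t + 1) * max 1 (cmod (emb \<rho> y))" by (simp add: algebra_simps)
      finally have le: "cmod (emb \<rho> x) \<le> (real t + 1) * max 1 (cmod (emb \<rho> y))" .
      have "1 * 1 \<le> (real t + 1) * max 1 (cmod (emb \<rho> y))" by (intro mult_mono) auto
      then have "ln (max 1 (cmod (emb \<rho> x))) \<le> ln ((real t + 1) * max 1 (cmod (emb \<rho> y)))" using le by simp
      also have "\<dots> = ln (real t + 1) + ln (max 1 (cmod (emb \<rho> y)))" by (intro ln_mult_pos) auto
      finally show "ln (max 1 (cmod (emb \<rho> x))) \<le> ln (real t + 1) + ln (max 1 (P.pull \<rho> y))" by (simp add: pm)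
    qed
    also have "\<dots> = real n * ln (real t + 1) + (\<Sum>\<rho>\<in>R. ln (max 1 (P.pull \<rho> y)))" by (simp add: sum.distrib card_R)
    also have "(\<Sum>\<rho>\<in>R. ln (max 1 (P.pull \<rho> y))) = (\<Sum>v\<in>archp. ?g v)"
      unfolding archp_def by (rule P.sum_over_exts[symmetric])
    finally show ?thesis by simp
  qed
  have fin: "ln (max 1 (padic_abs p (nrm x))) \<le> (\<Sum>v\<in>finp p. ?g v)" if p: "Factorial_Ring.prime p" for p
  proof -
    interpret P: places_over k \<alpha> f "padic_abs p" by (rule places_over_padic[OF p])
    have eQ: "emb \<rho> x \<in> Qbar" if "\<rho> \<in> R" for \<rho> using emb_Qbar[OF x(1) that] .
    have "padic_abs p (nrm x) = (\<Prod>\<rho>\<in>R. padic_abs p (emb \<rho> x))" unfolding nrm_def using eQ by (rule P.U.v_prod)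
    then have "ln (max 1 (padic_abs p (nrm x))) = ln (max 1 (\<Prod>\<rho>\<in>R. padic_abs p (emb \<rho> x)))" by simp
    also have "\<dots> \<le> (\<Sum>\<rho>\<in>R. ln (max 1 (padic_abs p (emb \<rho> x))))"
      using eQ P.U.nonneg by (intro ln_max_prod_le) auto
    also have "\<dots> \<le> (\<Sum>\<rho>\<in>R. ln (max 1 (P.pull \<rho> y)))"
    proof (rule sum_mono)
      fix \<rho> assume \<rho>: "\<rho> \<in> R"
      have pm: "P.pull \<rho> y = padic_abs p (emb \<rho> y)" using y by (simp add: P.pull_def)
      have v: "P.pull \<rho> \<in> finp p" unfolding finp_def by (rule P.pull_exts[OF \<rho>])
      interpret V: abs_val k "P.pull \<rho>" by (rule P.exts_abs_val[OF P.pull_exts[OF \<rho>]])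
      have "P.pull \<rho> (of_nat t + - y) \<le> max (P.pull \<rho> (of_nat t)) (P.pull \<rho> (- y))"
        using finp_ultrametric[OF p v, unfolded ultrametric_on_def, rule_format, of "of_nat t" "- y"] y uminus by blast
      also have "\<dots> \<le> max 1 (P.pull \<rho> y)"
        unfolding V.v_uminus[OF y] using finp_int(1)[OF p v, of "int t"] by (intro max.mono) simp_all
      finally have "padic_abs p (emb \<rho> x) \<le> max 1 (P.pull \<rho> y)" using x by (simp add: P.pull_def x_def)
      then show "ln (max 1 (padic_abs p (emb \<rho> x))) \<le> ln (max 1 (P.pull \<rho> y))" by simp
    qed
    also have "\<dots> = (\<Sum>v\<in>finp p. ?g v)" unfolding finp_def by (rule P.sum_over_exts[symmetric])
    finally show ?thesis .
  qed
  have An: "(\<Sum>v\<in>archp. ?g v) \<ge> 0" by (rule sum_nonneg) simp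
  have Fn: "(\<Sum>p\<in>U. \<Sum>v\<in>finp p. ?g v) \<ge> 0" by (intro sum_nonneg) simp
  have nx: "nrm x \<noteq> 0" by (rule nrm_nonzero[OF x])
  have "ln (cmod (nrm x)) \<le> ln (max 1 (cmod (nrm x)))" using nx by simp
  then show "ln (cmod (nrm (of_nat t - y))) \<le> B + real n * ln (real t + 1)"
    using arch total Fn unfolding x_def by linarith
  have "ln (real_of_int b) = (\<Sum>p\<in>U. real (multiplicity (int p) b) * ln (real p))"
    using ln_eq_sum_multiplicity[of b U] ab(3) U Ud by simp
  also have "\<dots> \<le> (\<Sum>p\<in>U. \<Sum>v\<in>finp p. ?g v)"
  proof (rule sum_mono)
    fix p assume "p \<in> U"
    then have p: "Factorial_Ring.prime p" by (rule U(2))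
    interpret P: abs_val Qbar "padic_abs p" by (rule abs_val_padic[OF p])
    show "real (multiplicity (int p) b) * ln (real p) \<le> (\<Sum>v\<in>finp p. ?g v)"
    proof (cases "int p dvd b")
      case False
      then show ?thesis using sum_nonneg[of "finp p" ?g] by (simp add: not_dvd_imp_multiplicity_0)
    next
      case True
      have "\<not> int p dvd a"
      proof
        assume "int p dvd a"
        then have "is_unit (int p)" using True ab(4) by (meson coprime_common_divisor)
        then show False using prime_gt_1_nat[OF p] by simp
      qed
      then have a1: "padic_abs p (of_int a) = 1" using ab(2) by (simp add: padic_abs_int[OF p] not_dvd_imp_multiplicity_0)
      have "padic_abs p (nrm x) = padic_abs p (of_int a) / padic_abs p (of_int b)"
        unfolding x_def ab(1) by (rule P.v_divide) auto
      then have pn: "padic_abs p (nrm x) = 1 / padic_abs p (of_int b)" by (simp add: a1)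
      have pb: "padic_abs p (of_int b) > 0" using ab(3) by (intro P.v_pos) auto
      have "real (multiplicity (int p) b) * ln (real p) = ln (padic_abs p (nrm x))"
        using ab(3) pb unfolding pn by (simp add: ln_div ln_padic_abs_int[OF p])
      also have "\<dots> \<le> ln (max 1 (padic_abs p (nrm x)))" using pb unfolding pn by simp
      finally show ?thesis using fin[OF p] by simp
    qed
  qed
  also have "\<dots> \<le> B + real n * ln (real t + 1)"
  proof -
    have "real n * ln (real t + 1) \<ge> 0" by simp
    then show ?thesis using total An by linarith
  qed
  finally show "ln (real_of_int b) \<le> B + real n * ln (real t + 1)" .
qed

text \<open>The characteristic polynomial of \<open>y\<close> has degree \<open>n\<close>, so it is
  determined by its values at 0, ..., n. These are norms of \<open>of_nat t - y\<close>, rationals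
  with bounded numerator and denominator, so finitely many polynomials occur, and \<open>y\<close>
  is a root of its own.\<close>

theorem northcott:
  "finite {y \<in> k. (\<Sum>\<^sub>\<infinity>v\<in>places k. real (local_degree k v) * ln (max 1 (v y))) \<le> B}" (is "finite ?Y")
proof -
  define M where "M = (\<lambda>t::nat. exp (B + real n * ln (real t + 1)))"
  \<comment> \<open>The numerator is at most the size of the norm times the denominator, hence the
    bound \<open>M t * M t\<close>; 0 covers the case that \<open>y\<close> equals
    \<open>t\<close>.\<close>
  define Q where "Q = (\<lambda>t. insert 0 ((\<lambda>(a, b). of_int a / of_int b :: complex) `
    ({- \<lceil>M t * M t\<rceil>..\<lceil>M t * M t\<rceil>} \<times> {1..\<lceil>M t\<rceil>})))"
  have Qfin: "finite (Q t)" for t by (simp add: Q_def)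
  have val: "nrm (of_nat t - y) \<in> Q t" if y: "y \<in> ?Y" for t y
  proof (cases "of_nat t - y = 0")
    case True
    have "emb \<rho> 0 = 0" if "\<rho> \<in> R" for \<rho> by (rule emb_0[OF that])
    then have "nrm 0 = 0" using alpha_in_R unfolding nrm_def by (intro prod_zero) auto
    then show ?thesis using True by (simp add: Q_def)
  next
    case False
    have yk: "y \<in> k" "of_nat t - y \<in> k" using y by auto
    obtain a b :: int where ab: "nrm (of_nat t - y) = of_int a / of_int b" "a \<noteq> 0" "b > 0" "coprime a b"
      using nrm_quotient[OF yk(2) False] by metis
    note bnd = nrm_height_bound[OF yk(1) _ False ab, of B]
    have 1: "ln (real_of_int b) \<le> B + real n * ln (real t + 1)" and 2: "ln (cmod (nrm (of_nat t - y))) \<le> B + real n * ln (real t + 1)"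
      using bnd y by auto
    have "exp (ln (real_of_int b)) \<le> M t" unfolding M_def using 1 by (simp only: exp_le_cancel_iff)
    then have bM: "real_of_int b \<le> M t" using ab(3) by simp
    have "cmod (nrm (of_nat t - y)) > 0" using nrm_nonzero[OF yk(2) False] by simp
    moreover have "exp (ln (cmod (nrm (of_nat t - y)))) \<le> M t" unfolding M_def using 2 by (simp only: exp_le_cancel_iff)
    ultimately have nM: "cmod (nrm (of_nat t - y)) \<le> M t" by simp
    have "cmod (nrm (of_nat t - y)) = \<bar>real_of_int a\<bar> / real_of_int b" unfolding ab(1) norm_divide using ab(3) by simp
    then have "\<bar>real_of_int a\<bar> \<le> M t * real_of_int b" using nM ab(3) by (simp add: divide_le_eq)
    also have "\<dots> \<le> M t * M t" using bM by (intro mult_left_mono) (auto simp: M_def)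
    finally have aM: "\<bar>real_of_int a\<bar> \<le> M t * M t" .
    have "real_of_int \<bar>a\<bar> \<le> of_int \<lceil>M t * M t\<rceil>" using order_trans[OF aM le_of_int_ceiling] by simp
    then have "\<bar>a\<bar> \<le> \<lceil>M t * M t\<rceil>" by (simp only: of_int_le_iff)
    then have "a \<le> \<lceil>M t * M t\<rceil> \<and> - a \<le> \<lceil>M t * M t\<rceil>" by (simp only: abs_le_iff)
    then have "a \<in> {- \<lceil>M t * M t\<rceil>..\<lceil>M t * M t\<rceil>}" by auto
    moreover have "real_of_int b \<le> of_int \<lceil>M t\<rceil>" by (rule order_trans[OF bM le_of_int_ceiling])
    then have "b \<le> \<lceil>M t\<rceil>" by (simp only: of_int_le_iff)
    then have "b \<in> {1..\<lceil>M t\<rceil>}" using ab(3) by simp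
    ultimately show ?thesis unfolding Q_def ab(1) by (intro insertI2 image_eqI[of _ _ "(a, b)"]) auto
  qed
  define r where "r = (\<lambda>y. restrict (\<lambda>t. nrm (of_nat t - y)) {..n})"
  have "finite (r ` ?Y)"
  proof (rule finite_subset)
    show "r ` ?Y \<subseteq> PiE {..n} Q"
    proof (rule image_subsetI)
      fix y assume "y \<in> ?Y"
      then show "r y \<in> PiE {..n} Q" unfolding r_def using val[of y] by (intro PiE_I) simp_all
    qed
    show "finite (PiE {..n} Q)" using Qfin by (intro finite_PiE) auto
  qed
  moreover have "finite {y \<in> ?Y. r y = r z}" if z: "z \<in> ?Y" for z
  proof -
    define \<chi> where "\<chi> = (\<lambda>y. \<Prod>\<rho>\<in>R. [:- emb \<rho> y, 1:])"
    have deg: "degree (\<chi> y) = n" for y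
    proof -
      have "degree (\<chi> y) = (\<Sum>\<rho>\<in>R. degree [:- emb \<rho> y, 1:])" unfolding \<chi>_def by (rule degree_prod_sum_eq) simp
      then show ?thesis by (simp add: card_R)
    qed
    have ev: "poly (\<chi> y) (of_nat t) = nrm (of_nat t - y)" if "y \<in> k" for y t
      unfolding \<chi>_def nrm_def poly_prod using emb_diff[of "of_nat t" y] that by (intro prod.cong refl) (simp add: emb_Rats)
    have "poly (\<chi> z) y = 0" if y: "y \<in> ?Y" "r y = r z" for y
    proof -
      have "\<chi> y = \<chi> z"
      proof (rule poly_eqI_degree[of "of_nat ` {..n}"])
        fix c :: complex assume "c \<in> of_nat ` {..n}"
        then obtain t where t: "c = of_nat t" "t \<le> n" by auto
        have "nrm (of_nat t - y) = nrm (of_nat t - z)" using fun_cong[OF y(2), of t] t by (simp add: r_def)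
        then show "poly (\<chi> y) c = poly (\<chi> z) c" using ev y z t by simp
      qed (simp_all add: deg card_image inj_of_nat)
      moreover have "poly (\<chi> y) y = 0"
        unfolding \<chi>_def poly_prod using emb_alpha[of y] y(1) alpha_in_R
        by (intro prod_zero bexI[of _ \<alpha>]) auto
      ultimately show ?thesis by simp
    qed
    then have sub: "{y \<in> ?Y. r y = r z} \<subseteq> {y. poly (\<chi> z) y = 0}" by blast
    have nz: "\<chi> z \<noteq> 0" using deg[of z] n_pos by auto
    show ?thesis by (rule finite_subset[OF sub poly_roots_finite[OF nz]])
  qed
  ultimately show ?thesis
  proof -
    assume 1: "finite (r ` ?Y)" and 2: "\<And>z. z \<in> ?Y \<Longrightarrow> finite {y \<in> ?Y. r y = r z}"
    have sub: "?Y \<subseteq> (\<Union>w\<in>r ` ?Y. {y \<in> ?Y. r y = w})" by blast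
    show ?thesis
    proof (rule finite_subset[OF sub finite_UN_I[OF 1]])
      fix w assume "w \<in> r ` ?Y"
      then obtain z where z: "z \<in> ?Y" "w = r z" by blast
      show "finite {y \<in> ?Y. r y = w}" unfolding z(2) by (rule 2[OF z(1)])
    qed
  qed
qed

end

subsection \<open>Forms\<close>

type_synonym exponents = "nat \<Rightarrow>\<^sub>0 nat"

abbreviation lk :: "('a \<Rightarrow>\<^sub>0 'b::zero) \<Rightarrow> 'a \<Rightarrow> 'b" where "lk \<equiv> Poly_Mapping.lookup"
abbreviation ks :: "('a \<Rightarrow>\<^sub>0 'b::zero) \<Rightarrow> 'a set" where "ks \<equiv> Poly_Mapping.keys"
abbreviation monom_of :: "exponents \<Rightarrow> complex \<Rightarrow> mpoly" where "monom_of \<equiv> Poly_Mapping.single"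

text \<open>Defined over any commutative semiring, so that the same monomial can be evaluated at
  numbers and at the polynomials of a substitution.\<close>

definition mev :: "exponents \<Rightarrow> (nat \<Rightarrow> 'a::comm_semiring_1) \<Rightarrow> 'a" where
  "mev m x = (\<Prod>i\<in>ks m. x i ^ lk m i)"

definition mdeg :: "exponents \<Rightarrow> nat" where "mdeg m = (\<Sum>i\<in>ks m. lk m i)"

lemma mev_superset: "finite I \<Longrightarrow> ks m \<subseteq> I \<Longrightarrow> mev m x = (\<Prod>i\<in>I. x i ^ lk m i)"
  unfolding mev_def by (rule prod.mono_neutral_left) (auto simp: in_keys_iff)

lemma mdeg_superset: "finite I \<Longrightarrow> ks m \<subseteq> I \<Longrightarrow> mdeg m = (\<Sum>i\<in>I. lk m i)"
  unfolding mdeg_def by (rule sum.mono_neutral_left) (auto simp: in_keys_iff)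

lemma mev_add: "mev (a + b) x = mev a x * mev b x"
proof -
  have "ks (a + b) \<subseteq> ks a \<union> ks b" by (rule Poly_Mapping.keys_add)
  then show ?thesis
    by (simp add: mev_superset[of "ks a \<union> ks b"] lookup_add power_add prod.distrib)
qed

lemma mdeg_add: "mdeg (a + b) = mdeg a + mdeg b"
proof -
  have "ks (a + b) \<subseteq> ks a \<union> ks b" by (rule Poly_Mapping.keys_add)
  then show ?thesis
    by (simp add: mdeg_superset[of "ks a \<union> ks b"] lookup_add sum.distrib)
qed

lemma mev_0 [simp]: "mev 0 x = 1" and mdeg_0 [simp]: "mdeg 0 = 0"
  by (simp_all add: mev_def mdeg_def)

lemma mev_single [simp]: "mev (Poly_Mapping.single i c) x = x i ^ c"
  using mev_superset[of "{i}" "Poly_Mapping.single i c" x] by (simp add: Poly_Mapping.keys_single)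

lemma mdeg_single [simp]: "mdeg (Poly_Mapping.single i c) = c"
  using mdeg_superset[of "{i}" "Poly_Mapping.single i c"] by (simp add: Poly_Mapping.keys_single)

lemma mpoly_eq_sum_mono:
  assumes "finite I" "ks F \<subseteq> I"
  shows "F = (\<Sum>m\<in>I. monom_of m (lk F m))"
proof (rule poly_mapping_eqI)
  fix a
  have "lk (\<Sum>m\<in>I. monom_of m (lk F m)) a = (\<Sum>m\<in>I. if m = a then lk F m else 0)"
    by (simp add: lookup_sum lookup_single when_def)
  also have "\<dots> = lk F a" using assms by (auto simp: in_keys_iff)
  finally show "lk F a = lk (\<Sum>m\<in>I. monom_of m (lk F m)) a" by simp
qed

lemma poly_eval_superset:
  "finite I \<Longrightarrow> ks F \<subseteq> I \<Longrightarrow> poly_eval F x = (\<Sum>m\<in>I. lk F m * mev m x)"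
  unfolding poly_eval_def mev_def by (rule sum.mono_neutral_left) (auto simp: in_keys_iff)

lemma poly_eval_0 [simp]: "poly_eval 0 x = 0"
  by (simp add: poly_eval_def)

lemma poly_eval_mono [simp]: "poly_eval (monom_of m c) x = c * mev m x"
  using poly_eval_superset[of "{m}" "monom_of m c" x] by (simp add: Poly_Mapping.keys_single)

lemma poly_eval_add: "poly_eval (F + G) x = poly_eval F x + poly_eval G x"
proof -
  have "ks (F + G) \<subseteq> ks F \<union> ks G" by (rule Poly_Mapping.keys_add)
  then show ?thesis
    by (simp add: poly_eval_superset[of "ks F \<union> ks G"] lookup_add distrib_right sum.distrib)
qed

lemma poly_eval_sum: "poly_eval (\<Sum>i\<in>I. g i) x = (\<Sum>i\<in>I. poly_eval (g i) x)"
  by (induction I rule: infinite_finite_induct) (simp_all add: poly_eval_add)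

lemma mpoly_mult_eq: "F * G = (\<Sum>a\<in>ks F. \<Sum>b\<in>ks G. monom_of (a + b) (lk F a * lk G b))"
proof -
  have "F * G = (\<Sum>a\<in>ks F. monom_of a (lk F a)) * (\<Sum>b\<in>ks G. monom_of b (lk G b))"
    using mpoly_eq_sum_mono[of "ks F" F] mpoly_eq_sum_mono[of "ks G" G] by simp
  then show ?thesis by (simp add: sum_product mult_single)
qed

lemma poly_eval_mult: "poly_eval (F * G) x = poly_eval F x * poly_eval G x"
proof -
  have "poly_eval (F * G) x = (\<Sum>a\<in>ks F. \<Sum>b\<in>ks G. (lk F a * mev a x) * (lk G b * mev b x))"
    unfolding mpoly_mult_eq by (simp add: poly_eval_sum mev_add mult_ac)
  also have "\<dots> = poly_eval F x * poly_eval G x"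
    by (simp add: poly_eval_superset[of "ks F" F] poly_eval_superset[of "ks G" G] sum_product)
  finally show ?thesis .
qed

lemma poly_eval_const [simp]: "poly_eval (poly_const c) x = c"
  by (simp add: poly_const_def)

lemma poly_const_1 [simp]: "poly_const 1 = 1"
  by (simp add: poly_const_def)

lemma poly_const_mult: "poly_const a * poly_const b = poly_const (a * b)"
  by (simp add: poly_const_def mult_single)

lemma poly_const_mult_mono: "poly_const c * monom_of m d = monom_of m (c * d)"
  by (simp add: poly_const_def mult_single)

lemma poly_eval_1 [simp]: "poly_eval 1 x = 1"
  using poly_eval_const[of 1 x] by simp

lemma poly_eval_power: "poly_eval (F ^ e) x = poly_eval F x ^ e"
  by (induction e) (simp_all add: poly_eval_mult)

lemma poly_eval_prod: "poly_eval (\<Prod>i\<in>I. g i) x = (\<Prod>i\<in>I. poly_eval (g i) x)"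
  by (induction I rule: infinite_finite_induct) (simp_all add: poly_eval_mult)

lemma poly_eval_var [simp]: "poly_eval (poly_var i) x = x i"
  by (simp add: poly_var_def)

lemma poly_eval_minus: "poly_eval (F - G) x = poly_eval F x - poly_eval G x"
  using poly_eval_add[of "F - G" G x] by simp

lemma poly_subst_eq: "poly_subst F f = (\<Sum>m\<in>ks F. poly_const (lk F m) * mev m f)"
  by (simp add: poly_subst_def mev_def)

lemma poly_eval_mev: "poly_eval (mev m f) x = mev m (\<lambda>i. poly_eval (f i) x)"
  by (simp add: mev_def poly_eval_prod poly_eval_power)

lemma poly_eval_subst: "poly_eval (poly_subst F f) x = poly_eval F (\<lambda>i. poly_eval (f i) x)"
  by (simp add: poly_subst_eq poly_eval_sum poly_eval_mult poly_eval_mev poly_eval_superset[of "ks F" F])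

definition mons :: "nat \<Rightarrow> nat \<Rightarrow> exponents set" where
  "mons N e = {m. ks m \<subseteq> {..N} \<and> mdeg m = e}"

lemma forms_iff: "F \<in> forms N K e \<longleftrightarrow> (\<forall>m\<in>ks F. lk F m \<in> K \<and> m \<in> mons N e)"
  by (auto simp: forms_def mons_def mdeg_def)

lemma forms_lookup: "0 \<in> K \<Longrightarrow> F \<in> forms N K e \<Longrightarrow> lk F m \<in> K"
  by (cases "m \<in> ks F") (auto simp: forms_iff in_keys_iff)

lemma forms_keys: "F \<in> forms N K e \<Longrightarrow> ks F \<subseteq> mons N e"
  by (auto simp: forms_iff)

lemma forms_mono_field: "K \<subseteq> L \<Longrightarrow> F \<in> forms N K e \<Longrightarrow> F \<in> forms N L e"
  by (auto simp: forms_iff)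

lemma finite_mons [simp]: "finite (mons N e)"
proof -
  define B where "B = {g :: nat \<Rightarrow> nat. \<forall>i. (i \<in> {..N} \<longrightarrow> g i \<in> {..e}) \<and> (i \<notin> {..N} \<longrightarrow> g i = 0)}"
  have fin: "finite (Poly_Mapping.Abs_poly_mapping ` B)"
    unfolding B_def by (rule finite_imageI, rule finite_set_of_finite_funs) simp_all
  have "mons N e \<subseteq> Poly_Mapping.Abs_poly_mapping ` B"
  proof
    fix m :: exponents assume m: "m \<in> mons N e"
    have "lk m i \<le> e" if "i \<le> N" for i
    proof -
      have "lk m i \<le> (\<Sum>i\<in>{..N}. lk m i)" using that by (intro member_le_sum) auto
      then show ?thesis using m mdeg_superset[of "{..N}" m] by (simp add: mons_def)
    qed
    moreover have "lk m i = 0" if "i \<notin> {..N}" for i using m that by (auto simp: mons_def in_keys_iff)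
    moreover have "m = Poly_Mapping.Abs_poly_mapping (lk m)" by (simp add: Poly_Mapping.lookup_inverse)
    ultimately show "m \<in> Poly_Mapping.Abs_poly_mapping ` B"
      by (intro image_eqI[of _ _ "lk m"]) (simp_all add: B_def)
  qed
  then show ?thesis using fin by (rule finite_subset)
qed

lemma mons_add: "a \<in> mons N d \<Longrightarrow> b \<in> mons N e \<Longrightarrow> a + b \<in> mons N (d + e)"
  using Poly_Mapping.keys_add[of a b] by (auto simp: mons_def mdeg_add)

lemma forms_expand: "F \<in> forms N K e \<Longrightarrow> F = (\<Sum>m\<in>mons N e. monom_of m (lk F m))"
  by (rule mpoly_eq_sum_mono[OF finite_mons forms_keys])

lemma forms_0 [simp, intro]: "0 \<in> forms N K e"
  by (simp add: forms_iff)

lemma mono_forms: "m \<in> mons N e \<Longrightarrow> c \<in> K \<Longrightarrow> monom_of m c \<in> forms N K e"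
  by (auto simp: forms_iff Poly_Mapping.keys_single)

context cfield
begin

lemma forms_add: "F \<in> forms N K e \<Longrightarrow> G \<in> forms N K e \<Longrightarrow> F + G \<in> forms N K e"
  using Poly_Mapping.keys_add[of F G] forms_lookup[OF zero, of F N e] forms_lookup[OF zero, of G N e]
  by (auto simp: forms_iff lookup_add)

lemma forms_sum: "(\<And>i. i \<in> I \<Longrightarrow> g i \<in> forms N K e) \<Longrightarrow> (\<Sum>i\<in>I. g i) \<in> forms N K e"
  by (induction I rule: infinite_finite_induct) (simp_all add: forms_add)

lemma forms_mult: "F \<in> forms N K d \<Longrightarrow> G \<in> forms N K e \<Longrightarrow> F * G \<in> forms N K (d + e)"
  unfolding mpoly_mult_eq by (intro forms_sum mono_forms mons_add mult) (auto simp: forms_iff)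

lemma forms_const: "c \<in> K \<Longrightarrow> poly_const c \<in> forms N K 0"
  unfolding poly_const_def by (rule mono_forms) (simp_all add: mons_def)

lemma forms_1: "1 \<in> forms N K 0"
  using forms_const[OF one] by simp

lemma forms_var: "i \<le> N \<Longrightarrow> poly_var i \<in> forms N K 1"
  unfolding poly_var_def by (rule mono_forms) (auto simp: mons_def Poly_Mapping.keys_single)

lemma forms_smult: "c \<in> K \<Longrightarrow> F \<in> forms N K e \<Longrightarrow> poly_const c * F \<in> forms N K e"
  using forms_mult[OF forms_const, of c F N e] by simp

lemma forms_uminus: "F \<in> forms N K e \<Longrightarrow> - F \<in> forms N K e"
  by (simp add: forms_iff uminus)

lemma forms_diff: "F \<in> forms N K e \<Longrightarrow> G \<in> forms N K e \<Longrightarrow> F - G \<in> forms N K e"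
  using forms_add[OF _ forms_uminus, of F N e G] by simp

lemma forms_power: "F \<in> forms N K d \<Longrightarrow> F ^ j \<in> forms N K (j * d)"
  by (induction j) (simp_all add: forms_1 forms_mult)

lemma forms_prod: "finite I \<Longrightarrow> (\<And>i. i \<in> I \<Longrightarrow> g i \<in> forms N K (d i)) \<Longrightarrow> (\<Prod>i\<in>I. g i) \<in> forms N K (\<Sum>i\<in>I. d i)"
  by (induction I rule: finite_induct) (simp_all add: forms_1 forms_mult)

lemma mev_forms:
  assumes "m \<in> mons N e" "\<And>i. i \<le> N \<Longrightarrow> f i \<in> forms N K d"
  shows "mev m f \<in> forms N K (e * d)"
proof -
  have "mev m f \<in> forms N K (\<Sum>i\<in>ks m. lk m i * d)"
    unfolding mev_def using assms by (intro forms_prod forms_power) (auto simp: mons_def)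
  also have "(\<Sum>i\<in>ks m. lk m i * d) = e * d" using assms(1) by (simp add: mons_def mdeg_def sum_distrib_right[symmetric])
  finally show ?thesis .
qed

lemma forms_subst:
  assumes "F \<in> forms N K e" "\<And>i. i \<le> N \<Longrightarrow> f i \<in> forms N K d"
  shows "poly_subst F f \<in> forms N K (e * d)"
  unfolding poly_subst_eq using assms(1) by (intro forms_sum forms_smult mev_forms assms(2)) (auto simp: forms_iff)

lemma sum_mono_forms: "(\<And>m. m \<in> mons N e \<Longrightarrow> y m \<in> K) \<Longrightarrow> (\<Sum>m\<in>mons N e. monom_of m (y m)) \<in> forms N K e"
  by (intro forms_sum mono_forms)

end

lemma lookup_sum_mono: "finite I \<Longrightarrow> lk (\<Sum>m\<in>I. monom_of m (y m)) a = (if a \<in> I then y a else 0)"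
  by (simp add: lookup_sum lookup_single when_def)

lemma sum_mono_times: "finite I \<Longrightarrow> (\<Sum>m\<in>I. monom_of m (y m)) * F = (\<Sum>m\<in>I. poly_const (y m) * (monom_of m 1 * F))"
  by (simp add: sum_distrib_right mult.assoc[symmetric] poly_const_mult_mono)

lemma lookup_const_mult: "lk (poly_const c * F) a = c * lk F a"
proof -
  have "poly_const c * F = poly_const c * (\<Sum>m\<in>ks F. monom_of m (lk F m))"
    by (rule arg_cong[OF mpoly_eq_sum_mono]) simp_all
  also have "\<dots> = (\<Sum>m\<in>ks F. monom_of m (c * lk F m))"
    by (simp only: sum_distrib_left poly_const_mult_mono)
  finally show ?thesis by (simp add: lookup_sum_mono in_keys_iff)
qed

lemma mev_scale: "mev m (\<lambda>i. c * x i) = c ^ mdeg m * mev m (x :: nat \<Rightarrow> complex)"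
  by (simp add: mev_def mdeg_def power_mult_distrib prod.distrib power_sum)

lemma poly_eval_scale:
  assumes "F \<in> forms N K e" shows "poly_eval F (\<lambda>i. c * x i) = c ^ e * poly_eval F x"
proof -
  have "poly_eval F (\<lambda>i. c * x i) = (\<Sum>m\<in>ks F. lk F m * (c ^ e * mev m x))"
    unfolding poly_eval_superset[OF Poly_Mapping.finite_keys subset_refl]
    using forms_keys[OF assms] by (intro sum.cong refl) (auto simp: mev_scale mons_def)
  then show ?thesis by (simp add: poly_eval_superset[of "ks F" F] sum_distrib_left mult_ac)
qed

lemma poly_eval_cong:
  assumes "F \<in> forms N K e" "\<And>i. i \<le> N \<Longrightarrow> x i = y i" shows "poly_eval F x = poly_eval F y"
proof -
  have "mev m x = mev m y" if "m \<in> ks F" for m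
  proof -
    have "ks m \<subseteq> {..N}" using that forms_keys[OF assms(1)] by (auto simp: mons_def)
    then show ?thesis unfolding mev_def using assms(2) by (intro prod.cong refl) (metis atMost_iff subsetD)
  qed
  then show ?thesis by (simp add: poly_eval_superset[of "ks F" F])
qed

text \<open>The coefficients of the cofactor solve a linear system over \<open>K\<close>, with one
  equation for each exponent vector. The complex cofactor \<open>G\<close> shows solvability and
  fixes the finite set of unknowns.\<close>

lemma division_descent:
  fixes E A G :: mpoly
  assumes K: "cfield K" and eq: "E = A * G" and E: "\<And>m. lk E m \<in> K" and A: "\<And>m. lk A m \<in> K"
  obtains G' where "E = A * G'" "\<And>m. lk G' m \<in> K"
proof -
  interpret cfield K by fact
  have AK: "lk (monom_of \<mu> 1 * A) m \<in> K" for \<mu> m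
  proof -
    have "monom_of \<mu> 1 * A = (\<Sum>b\<in>ks A. monom_of (\<mu> + b) (lk A b))"
      by (subst mpoly_mult_eq) (simp add: Poly_Mapping.keys_single)
    then have "lk (monom_of \<mu> 1 * A) m = (\<Sum>b\<in>ks A. if \<mu> + b = m then lk A b else 0)"
      by (simp add: lookup_sum lookup_single when_def)
    then show ?thesis using A by (simp add: sum)
  qed
  have lin: "lk ((\<Sum>\<mu>\<in>ks G. monom_of \<mu> (y \<mu>)) * A) m = (\<Sum>\<mu>\<in>ks G. lk (monom_of \<mu> 1 * A) m * y \<mu>)" for y m
    unfolding sum_mono_times[OF Poly_Mapping.finite_keys] lookup_sum lookup_const_mult
    by (rule sum.cong) (simp_all add: mult.commute)
  have "(\<Sum>\<mu>\<in>ks G. lk (monom_of \<mu> 1 * A) m * lk G \<mu>) = lk E m" for m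
    unfolding lin[symmetric] mpoly_eq_sum_mono[OF Poly_Mapping.finite_keys subset_refl, symmetric] eq by (simp add: mult.commute)
  then obtain y where y: "\<forall>\<mu>\<in>ks G. y \<mu> \<in> K" "\<And>m. (\<Sum>\<mu>\<in>ks G. lk (monom_of \<mu> 1 * A) m * y \<mu>) = lk E m"
    using solution_descent[of "ks G" UNIV "\<lambda>m \<mu>. lk (monom_of \<mu> 1 * A) m" "lk E" "lk G"] AK E by auto
  define G' where "G' = (\<Sum>\<mu>\<in>ks G. monom_of \<mu> (y \<mu>))"
  have "E = A * G'"
    by (rule poly_mapping_eqI) (simp only: G'_def mult.commute[of A] lin y(2))
  moreover have "lk G' m \<in> K" for m using y(1) by (simp add: G'_def lookup_sum_mono)
  ultimately show ?thesis using that by blast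
qed

subsection \<open>The projective Nullstellensatz\<close>

text \<open>\<open>Qbar\<close> is algebraically closed. The coefficients of the minimal polynomial
  \<open>m\<close> lie in one simple extension generated by \<open>c\<close>; the products of powers
  of \<open>c\<close> and \<open>z\<close> below the degrees span a finite rational module stable
  under \<open>z\<close>.\<close>

lemma algebraic_root:
  assumes "poly_over Qbar p" "p \<noteq> 0" "poly p z = 0" shows "algebraic z"
proof -
  obtain m where "Qbar.is_min_poly z m" using Qbar.exists_min_poly[OF assms] by blast
  then have m: "poly_over Qbar m" "lead_coeff m = 1" "poly m z = 0" and m0: "degree m > 0"
    using Qbar.min_poly_degree_pos by (auto simp: Qbar.is_min_poly_def)
  have "\<exists>c\<in>Qbar. coeff m ` {..degree m} \<subseteq> adjoin c"
    using m(1) by (intro primitive_element_finite cfield_Qbar) (auto simp: poly_over_def)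
  then obtain c where c: "algebraic c" and mc: "\<And>i. i \<le> degree m \<Longrightarrow> coeff m i \<in> adjoin c" by auto
  interpret F: cfield "adjoin c" by (rule cfield_adjoin[OF c])
  obtain g where g: "Rats.is_min_poly c g" using algebraic_min_poly[OF c] by blast
  define B where "B = (\<lambda>(i, j). c ^ i * z ^ j) ` ({..<degree g} \<times> {..<degree m})"
  have span: "w * z ^ j \<in> RR.rspan B" if w: "w \<in> adjoin c" and j: "j < degree m" for w j
  proof -
    obtain q where q: "poly_over \<rat> q" "w = poly q c" using w by (auto simp: adjoin_def)
    obtain s r where sr: "poly_over \<rat> r" "q = g * s + r" "r = 0 \<or> degree r < degree g"
      using Rats.poly_over_division[of g q] g q by (auto simp: Rats.is_min_poly_def)
    have "w = poly r c" using g sr q by (simp add: Rats.is_min_poly_def)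
    then have "w * z ^ j = (\<Sum>i\<le>degree r. coeff r i * (c ^ i * z ^ j))"
      by (simp add: poly_altdef sum_distrib_right mult.assoc)
    also have "\<dots> \<in> RR.rspan B"
    proof (cases "r = 0")
      case True
      then show ?thesis by (simp add: RR.rspan_0)
    next
      case False
      then show ?thesis using sr j unfolding poly_over_def
        by (intro RR.rspan_sum RR.rspan_smult RR.rspan_base) (auto simp: B_def)
    qed
    finally show ?thesis .
  qed
  have cp: "c ^ i \<in> adjoin c" for i by (intro F.power adjoin_self)
  have "RR.integral z"
  proof (rule RR.integral_if_rspan_stable)
    show "finite B" by (simp add: B_def)
    show "1 \<in> B" using m0 Rats.min_poly_degree_pos[OF g] by (force simp: B_def)
    fix b assume "b \<in> B"
    then obtain i j where b: "b = c ^ i * z ^ j" "j < degree m" by (auto simp: B_def)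
    show "z * b \<in> RR.rspan B"
    proof (cases "Suc j < degree m")
      case True
      then show ?thesis using span[OF cp True, of i] b by (simp add: mult_ac)
    next
      case False
      then have sj: "Suc j = degree m" using b by simp
      have "0 = (\<Sum>l<degree m. coeff m l * z ^ l) + z ^ degree m"
        using m by (simp add: poly_altdef lessThan_Suc_atMost[symmetric])
      then have "z ^ degree m = (\<Sum>l<degree m. - (coeff m l * z ^ l))"
        by (simp add: sum_negf eq_neg_iff_add_eq_0 add.commute)
      moreover have "z * b = c ^ i * z ^ degree m" unfolding b sj[symmetric] by (simp add: mult_ac)
      ultimately have "z * b = c ^ i * (\<Sum>l<degree m. - (coeff m l * z ^ l))" by simp
      also have "\<dots> = (\<Sum>l<degree m. (c ^ i * - coeff m l) * z ^ l)"
        unfolding sum_distrib_left by (rule sum.cong) simp_all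
      also have "\<dots> \<in> RR.rspan B" using mc
        by (intro RR.rspan_sum span F.mult cp F.uminus) auto
      finally show ?thesis .
    qed
  qed
  then show ?thesis by (simp add: algebraic_iff_integral)
qed

lemma mons_Suc:
  assumes "m \<in> mons N (Suc e)"
  obtains i m' where "i \<le> N" "m' \<in> mons N e" "m = Poly_Mapping.single i 1 + m'"
proof -
  have "ks m \<noteq> {}" using assms by (auto simp: mons_def mdeg_def)
  then obtain i where i: "i \<in> ks m" by blast
  define m' where "m' = m - Poly_Mapping.single i 1"
  have m: "m = Poly_Mapping.single i 1 + m'"
    by (rule poly_mapping_eqI) (use i in \<open>auto simp: m'_def lookup_add lookup_minus lookup_single when_def in_keys_iff\<close>)
  have "ks m' \<subseteq> ks m" by (auto simp: m'_def lookup_minus in_keys_iff)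
  moreover have "mdeg m = 1 + mdeg m'" by (subst m) (simp add: mdeg_add)
  ultimately have "m' \<in> mons N e" using assms by (auto simp: mons_def)
  then show ?thesis using that i assms m by (auto simp: mons_def)
qed

lemma monom_of_Suc: "monom_of (Poly_Mapping.single i 1 + m) c = poly_var i * monom_of m c"
  by (simp add: poly_var_def mult_single)

lemma mons_0: "mons N 0 = {0}"
proof -
  have "m = 0" if "m \<in> mons N 0" for m
  proof -
    have "lk m i = 0" for i using that by (cases "i \<in> ks m") (auto simp: mons_def mdeg_def in_keys_iff)
    then show ?thesis by (intro poly_mapping_eqI) simp
  qed
  then show ?thesis by (auto simp: mons_def)
qed

text \<open>A homogeneous ideal is a set of pairs of a degree and a form of that degree.\<close>

locale form_ideal =
  fixes N :: nat and I :: "(nat \<times> mpoly) set"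
  assumes mem_forms: "\<And>e F. (e, F) \<in> I \<Longrightarrow> F \<in> forms N Qbar e"
    and zero: "\<And>e. (e, 0) \<in> I"
    and add: "\<And>e F G. (e, F) \<in> I \<Longrightarrow> (e, G) \<in> I \<Longrightarrow> (e, F + G) \<in> I"
    and mult: "\<And>a b F G. (a, F) \<in> I \<Longrightarrow> G \<in> forms N Qbar b \<Longrightarrow> (b + a, G * F) \<in> I"
begin

text \<open>For homogeneous ideals this takes the place of being the unit ideal: it means containing
  a power of the ideal generated by all variables, so that there is no common zero in projective
  space.\<close>

definition big :: bool where "big \<longleftrightarrow> (\<exists>e. \<forall>F\<in>forms N Qbar e. (e, F) \<in> I)"

lemma smult: "(e, F) \<in> I \<Longrightarrow> c \<in> Qbar \<Longrightarrow> (e, poly_const c * F) \<in> I"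
  using mult[OF _ Qbar.forms_const, of e F c] by simp

lemma uminus: "(e, F) \<in> I \<Longrightarrow> (e, - F) \<in> I"
proof -
  have "poly_const (- 1) = - 1" by (simp add: poly_const_def single_uminus flip: single_one)
  then show "(e, F) \<in> I \<Longrightarrow> (e, - F) \<in> I" using smult[of e F "-1"] by simp
qed

lemma diff: "(e, F) \<in> I \<Longrightarrow> (e, G) \<in> I \<Longrightarrow> (e, F - G) \<in> I"
  using add[OF _ uminus, of e F G] by simp

lemma sum: "(\<And>i. i \<in> A \<Longrightarrow> (e, g i) \<in> I) \<Longrightarrow> (e, \<Sum>i\<in>A. g i) \<in> I"
  by (induction A rule: infinite_finite_induct) (simp_all add: add zero)

lemma one_imp_big: "(0, 1) \<in> I \<Longrightarrow> big"
  unfolding big_def using mult[of 0 1 _ 0] by fastforce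

lemma forms_Suc_mem:
  assumes "\<And>F. F \<in> forms N Qbar e \<Longrightarrow> (e, F) \<in> I" and F: "F \<in> forms N Qbar (Suc e)"
  shows "(Suc e, F) \<in> I"
proof -
  have "(Suc e, monom_of m (lk F m)) \<in> I" if mS: "m \<in> mons N (Suc e)" for m
  proof -
    obtain i m' where m: "i \<le> N" "m' \<in> mons N e" "m = Poly_Mapping.single i 1 + m'" using mons_Suc[OF mS] .
    have "(1 + e, poly_var i * monom_of m' (lk F m)) \<in> I"
      by (intro mult assms(1) mono_forms m Qbar.forms_var forms_lookup[OF _ F]) simp
    then show ?thesis using monom_of_Suc[of i m' "lk F m"] m(3) by simp
  qed
  then have "(Suc e, \<Sum>m\<in>mons N (Suc e). monom_of m (lk F m)) \<in> I" by (rule sum)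
  then show ?thesis using forms_expand[OF F] by simp
qed

lemma forms_ge_mem:
  assumes "\<And>F. F \<in> forms N Qbar e \<Longrightarrow> (e, F) \<in> I" "e \<le> e'" "F \<in> forms N Qbar e'"
  shows "(e', F) \<in> I"
  using assms(2,3)
proof (induction e' arbitrary: F rule: dec_induct)
  case base
  then show ?case using assms(1) by blast
next
  case (step j)
  then show ?case by (intro forms_Suc_mem)
qed

text \<open>The colon ideal of \<open>I\<close> by \<open>l\<close>, graded by the degree of the
  cofactor; it will measure zero divisors modulo \<open>I\<close>.\<close>

lemma colon_form_ideal:
  assumes l: "l \<in> forms N Qbar 1"
  shows "form_ideal N {(e, F). F \<in> forms N Qbar e \<and> (1 + e, l * F) \<in> I}"
proof
  fix a b F G
  assume F: "(a, F) \<in> {(e, F). F \<in> forms N Qbar e \<and> (1 + e, l * F) \<in> I}" and G: "G \<in> forms N Qbar b"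
  have F1: "F \<in> forms N Qbar a" "(1 + a, l * F) \<in> I" using F by auto
  have "(b + (1 + a), G * (l * F)) \<in> I" using mult[OF F1(2) G] .
  then have "(1 + (b + a), l * (G * F)) \<in> I" by (simp add: mult.left_commute)
  then show "(b + a, G * F) \<in> {(e, F). F \<in> forms N Qbar e \<and> (1 + e, l * F) \<in> I}"
    using Qbar.forms_mult[OF G F1(1)] by simp
next
  fix e F G
  assume "(e, F) \<in> {(e, F). F \<in> forms N Qbar e \<and> (1 + e, l * F) \<in> I}"
    "(e, G) \<in> {(e, F). F \<in> forms N Qbar e \<and> (1 + e, l * F) \<in> I}"
  then show "(e, F + G) \<in> {(e, F). F \<in> forms N Qbar e \<and> (1 + e, l * F) \<in> I}"
    using add[of "1 + e" "l * F" "l * G"] by (auto simp: Qbar.forms_add distrib_left)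
qed (auto simp: zero)

text \<open>In degree 0 the ideal generated by \<open>l\<close> adds nothing, which is why
  \<open>I\<close> itself is a member of the union.\<close>

lemma sum_form_ideal:
  assumes l: "l \<in> forms N Qbar 1"
  shows "form_ideal N (I \<union> {(e + 1, G + A * l) | e G A. (e + 1, G) \<in> I \<and> A \<in> forms N Qbar e})" (is "form_ideal N ?J")
proof
  fix e F assume "(e, F) \<in> ?J"
  then show "F \<in> forms N Qbar e" using mem_forms Qbar.forms_add Qbar.forms_mult[OF _ l] by auto
next
  fix e show "(e, 0) \<in> ?J" using zero by blast
next
  fix e F G assume F: "(e, F) \<in> ?J" and G: "(e, G) \<in> ?J"
  have ex: "(\<exists>H A e'. e = e' + 1 \<and> F' = H + A * l \<and> (e, H) \<in> I \<and> A \<in> forms N Qbar e') \<or> (e = 0 \<and> (0, F') \<in> I)"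
    if "(e, F') \<in> ?J" for F'
  proof (cases e)
    case 0 then show ?thesis using that by auto
  next
    case (Suc e')
    show ?thesis
    proof (cases "(e, F') \<in> I")
      case True
      then have "F' = F' + 0 * l \<and> (e, F') \<in> I \<and> 0 \<in> forms N Qbar e'" by simp
      then show ?thesis using Suc by (metis Suc_eq_plus1)
    next
      case False
      then show ?thesis using that by auto
    qed
  qed
  show "(e, F + G) \<in> ?J"
    using ex[OF F]
  proof
    assume "e = 0 \<and> (0, F) \<in> I"
    then show ?thesis using ex[OF G] add by auto
  next
    assume "\<exists>H A e'. e = e' + 1 \<and> F = H + A * l \<and> (e, H) \<in> I \<and> A \<in> forms N Qbar e'"
    then obtain H A e' where 1: "e = e' + 1" "F = H + A * l" "(e, H) \<in> I" "A \<in> forms N Qbar e'" by blast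
    then obtain H' A' where 2: "G = H' + A' * l" "(e, H') \<in> I" "A' \<in> forms N Qbar e'" using ex[OF G] by auto
    have "F + G = (H + H') + (A + A') * l" using 1 2 by (simp add: algebra_simps)
    moreover have "(e' + 1, H + H') \<in> I" using add 1 2 by blast
    moreover have "A + A' \<in> forms N Qbar e'" using 1 2 Qbar.forms_add by blast
    ultimately show ?thesis using 1(1) by blast
  qed
next
  fix a b F G assume F: "(a, F) \<in> ?J" and G: "G \<in> forms N Qbar b"
  show "(b + a, G * F) \<in> ?J"
  proof (cases "(a, F) \<in> I")
    case True then show ?thesis using mult G by blast
  next
    case False
    then obtain e H A where 1: "a = e + 1" "F = H + A * l" "(e + 1, H) \<in> I" "A \<in> forms N Qbar e" using F by auto
    have "(b + e + 1, G * H) \<in> I" using mult[OF 1(3) G] by (simp add: add.assoc)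
    moreover have "G * A \<in> forms N Qbar (b + e)" using Qbar.forms_mult[OF G 1(4)] .
    moreover have "G * F = G * H + (G * A) * l" using 1 by (simp add: algebra_simps)
    moreover have "b + a = (b + e) + 1" using 1 by simp
    ultimately show ?thesis by blast
  qed
qed

end

text \<open>The analogue of a maximal ideal. The quotient by it is shown to look like a polynomial
  ring in one linear form \<open>l\<close>, and this produces a point.\<close>

locale maximal_form_ideal = form_ideal +
  assumes not_big: "\<not> big"
    and maximal: "\<And>J. form_ideal N J \<Longrightarrow> \<not> form_ideal.big N J \<Longrightarrow> I \<subseteq> J \<Longrightarrow> J = I"
begin

text \<open>By maximality, adding a linear form \<open>l\<close> outside \<open>I\<close> makes the
  ideal big. So in large degrees every form is a multiple of \<open>l\<close> modulo
  \<open>I\<close>.\<close>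

lemma sum_big:
  assumes l: "l \<in> forms N Qbar 1" and lI: "(1, l) \<notin> I"
  obtains e0 where "\<And>e F. e0 \<le> e \<Longrightarrow> F \<in> forms N Qbar (e + 1) \<Longrightarrow> \<exists>A\<in>forms N Qbar e. (e + 1, F - A * l) \<in> I"
proof -
  define J where "J = I \<union> {(e + 1, G + A * l) | e G A. (e + 1, G) \<in> I \<and> A \<in> forms N Qbar e}"
  interpret J: form_ideal N J unfolding J_def by (rule sum_form_ideal[OF l])
  have "(0 + 1, 0 + 1 * l) \<in> J" unfolding J_def using zero Qbar.forms_1[of N] by blast
  then have "J \<noteq> I" using lI by auto
  then have "J.big" using maximal[OF J.form_ideal_axioms] unfolding J_def by blast
  then obtain e0 where e0: "\<And>F. F \<in> forms N Qbar e0 \<Longrightarrow> (e0, F) \<in> J" unfolding J.big_def by blast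
  have "\<exists>A\<in>forms N Qbar e. (e + 1, F - A * l) \<in> I" if "e0 \<le> e" and F: "F \<in> forms N Qbar (e + 1)" for e F
  proof -
    have "(e + 1, F) \<in> J" using J.forms_ge_mem[OF e0 _ F] that by simp
    then consider "(e + 1, F) \<in> I" | G A where "F = G + A * l" "(e + 1, G) \<in> I" "A \<in> forms N Qbar e"
      unfolding J_def by auto
    then show ?thesis
    proof cases
      case 1
      then have "(e + 1, F - 0 * l) \<in> I" by simp
      then show ?thesis using forms_0 by blast
    next
      case 2
      then have "(e + 1, F - A * l) \<in> I" by simp
      then show ?thesis using 2 by blast
    qed
  qed
  then show ?thesis using that by blast
qed

text \<open>If \<open>l\<close> annihilated something nonzero modulo \<open>I\<close>, the colon
  ideal would be strictly larger, hence big. In large degrees every form is \<open>A * l\<close>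
  modulo \<open>I\<close>, and \<open>A\<close> lies in the colon ideal, so \<open>I\<close> itself
  would be big.\<close>

lemma cancel:
  assumes l: "l \<in> forms N Qbar 1" and lI: "(1, l) \<notin> I" and F: "F \<in> forms N Qbar b" "(1 + b, l * F) \<in> I"
  shows "(b, F) \<in> I"
proof (rule ccontr)
  assume FI: "(b, F) \<notin> I"
  define J where "J = {(e, F). F \<in> forms N Qbar e \<and> (1 + e, l * F) \<in> I}"
  interpret J: form_ideal N J unfolding J_def by (rule colon_form_ideal[OF l])
  have "I \<subseteq> J" unfolding J_def using mem_forms mult[OF _ l] by auto
  moreover have "(b, F) \<in> J" using F by (simp add: J_def)
  ultimately have "J.big" using maximal[OF J.form_ideal_axioms] FI by blast
  then obtain e1 where e1: "\<And>F. F \<in> forms N Qbar e1 \<Longrightarrow> (e1, F) \<in> J" unfolding J.big_def by blast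
  obtain e0 where e0: "\<And>e F. e0 \<le> e \<Longrightarrow> F \<in> forms N Qbar (e + 1) \<Longrightarrow> \<exists>A\<in>forms N Qbar e. (e + 1, F - A * l) \<in> I"
    using sum_big[OF l lI] by blast
  define e where "e = max e0 e1"
  have "(e + 1, G) \<in> I" if G: "G \<in> forms N Qbar (e + 1)" for G
  proof -
    obtain A where A: "A \<in> forms N Qbar e" "(e + 1, G - A * l) \<in> I" using e0[OF _ G] by (auto simp: e_def)
    have "(e, A) \<in> J" using J.forms_ge_mem[OF e1 _ A(1)] by (simp add: e_def)
    then have "(e + 1, A * l) \<in> I" by (simp add: J_def mult.commute)
    from add[OF A(2) this] show ?thesis by simp
  qed
  then show False using not_big unfolding big_def by blast
qed

lemma cancel_power:
  assumes l: "l \<in> forms N Qbar 1" and lI: "(1, l) \<notin> I" and F: "F \<in> forms N Qbar b" "(j + b, l ^ j * F) \<in> I"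
  shows "(b, F) \<in> I"
  using F(2)
proof (induction j)
  case 0
  then show ?case by simp
next
  case (Suc j)
  have "l ^ j * F \<in> forms N Qbar (j + b)" using Qbar.forms_mult[OF Qbar.forms_power[OF l] F(1), of j] by simp
  then have "(j + b, l ^ j * F) \<in> I" using cancel[OF l lI, of "l ^ j * F" "j + b"] Suc.prems by (simp add: mult.assoc)
  then show ?case by (rule Suc.IH)
qed

lemma power_notin:
  assumes "l \<in> forms N Qbar 1" and "(1, l) \<notin> I" shows "(j, l ^ j) \<notin> I"
  using cancel_power[OF assms Qbar.forms_1, of j] one_imp_big not_big by auto

text \<open>The homogenization of \<open>p\<close> with respect to two linear forms; the total
  degree \<open>e\<close> may exceed the degree of \<open>p\<close>.\<close>

definition hom_poly :: "mpoly \<Rightarrow> mpoly \<Rightarrow> nat \<Rightarrow> complex poly \<Rightarrow> mpoly" where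
  "hom_poly l' l e p = (\<Sum>j\<le>e. poly_const (coeff p j) * (l' ^ j * l ^ (e - j)))"

lemma hom_poly_forms:
  assumes "l \<in> forms N Qbar 1" "l' \<in> forms N Qbar 1" "poly_over Qbar p"
  shows "hom_poly l' l e p \<in> forms N Qbar e"
proof -
  have "l' ^ j * l ^ (e - j) \<in> forms N Qbar e" if "j \<le> e" for j
    using Qbar.forms_mult[OF Qbar.forms_power[OF assms(2)] Qbar.forms_power[OF assms(1)], of j "e - j"] that by simp
  then show ?thesis unfolding hom_poly_def using assms(3)
    by (intro Qbar.forms_sum Qbar.forms_smult) (auto simp: poly_over_def)
qed

lemma poly_const_add: "poly_const (a + b) = poly_const a + poly_const b"
  by (simp add: poly_const_def single_add)

lemma hom_poly_linear_factor:
  assumes "degree q \<le> e"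
  shows "hom_poly l' l (Suc e) ([:- r, 1:] * q) = (l' + poly_const (- r) * l) * hom_poly l' l e q"
proof -
  have a: "hom_poly l' l (Suc e) (pCons 0 q) = l' * hom_poly l' l e q"
    unfolding hom_poly_def by (subst sum.atMost_Suc_shift) (simp add: sum_distrib_left mult_ac poly_const_def)
  have "hom_poly l' l (Suc e) q = (\<Sum>j\<le>e. poly_const (coeff q j) * (l' ^ j * l ^ (Suc e - j)))"
    unfolding hom_poly_def using assms by (simp add: coeff_eq_0 poly_const_def)
  also have "\<dots> = l * hom_poly l' l e q" unfolding hom_poly_def sum_distrib_left
    by (intro sum.cong refl) (simp add: Suc_diff_le mult_ac)
  finally have b: "hom_poly l' l (Suc e) q = l * hom_poly l' l e q" .
  have "poly_const (coeff ([:- r, 1:] * q) j) =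
      poly_const (- r) * poly_const (coeff q j) + poly_const (coeff (pCons 0 q) j)" for j
    by (simp add: poly_const_mult poly_const_add[symmetric])
  then have "hom_poly l' l (Suc e) ([:- r, 1:] * q) =
      poly_const (- r) * hom_poly l' l (Suc e) q + hom_poly l' l (Suc e) (pCons 0 q)"
    unfolding hom_poly_def by (simp only: distrib_right sum.distrib sum_distrib_left mult.assoc)
  then show ?thesis unfolding a b by (simp add: algebra_simps)
qed

text \<open>Over \<open>Qbar\<close> the polynomial splits off a linear factor, and the
  corresponding form either lies in \<open>I\<close> or can be cancelled. A constant would leave a
  power of \<open>l\<close> in \<open>I\<close>, which \<open>power_notin\<close> excludes.\<close>

lemma linear_factor_mem:
  assumes l: "l \<in> forms N Qbar 1" and lI: "(1, l) \<notin> I" and l': "l' \<in> forms N Qbar 1"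
  shows "poly_over Qbar p \<Longrightarrow> p \<noteq> 0 \<Longrightarrow> degree p \<le> e \<Longrightarrow> (e, hom_poly l' l e p) \<in> I \<Longrightarrow>
     \<exists>r\<in>Qbar. (1, l' + poly_const (- r) * l) \<in> I"
proof (induction "degree p" arbitrary: p e)
  case 0
  then obtain c where p: "p = [:c:]" by (metis degree_eq_zeroE)
  have "hom_poly l' l e p = (\<Sum>j\<le>e. if j = 0 then poly_const c * l ^ e else 0)"
    unfolding hom_poly_def by (intro sum.cong refl) (auto simp: p poly_const_def coeff_pCons split: nat.split)
  then have "(e, poly_const c * l ^ e) \<in> I" using 0 by (simp add: p)
  moreover have "c = coeff p 0" "c \<noteq> 0" using 0 p by auto
  moreover from this have "c \<in> Qbar" using 0 unfolding poly_over_def by blast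
  ultimately have "(e, poly_const (inverse c) * (poly_const c * l ^ e)) \<in> I"
    using smult Qbar.inverse by blast
  then have "(e, l ^ e) \<in> I" using \<open>c \<noteq> 0\<close> by (simp add: mult.assoc[symmetric] poly_const_mult)
  then show ?case using power_notin[OF l lI] by blast
next
  case (Suc n p e)
  obtain r where r: "poly p r = 0"
    using fundamental_theorem_of_algebra[of p] Suc(2) constant_degree[of p] by auto
  have alg: "r \<in> Qbar" using algebraic_root[OF Suc.prems(1,2) r] by simp
  have "Qbar.is_min_poly r [:- r, 1:]" unfolding Qbar.is_min_poly_def
  proof (intro conjI allI impI)
    show "poly_over Qbar [:- r, 1:]" using Qbar.uminus[OF alg]
      by (auto simp: poly_over_def coeff_pCons split: nat.split)
    fix q assume q: "poly_over Qbar q \<and> poly q r = 0 \<and> q \<noteq> 0"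
    then have "degree q \<noteq> 0" by (metis degree_eq_zeroE mult_zero_right add.right_neutral poly_0 poly_pCons pCons_0_0)
    then show "degree [:- r, 1:] \<le> degree q" by simp
  qed simp_all
  then obtain q where q: "poly_over Qbar q" "p = [:- r, 1:] * q"
    using Qbar.min_poly_dvd[OF _ Suc.prems(1) r] by blast
  have q0: "q \<noteq> 0" using q Suc.prems by auto
  then have deg: "degree p = Suc (degree q)" unfolding q(2) by (subst degree_mult_eq) auto
  obtain e' where e: "e = Suc e'" using deg Suc.prems(3) by (cases e) auto
  have "(e, (l' + poly_const (- r) * l) * hom_poly l' l e' q) \<in> I"
    using Suc.prems(3,4) hom_poly_linear_factor[of q e' l' l r, folded q(2)] deg by (simp add: e)
  moreover have "l' + poly_const (- r) * l \<in> forms N Qbar 1"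
    using l l' Qbar.uminus[OF alg] by (intro Qbar.forms_add Qbar.forms_smult) auto
  ultimately have "(1, l' + poly_const (- r) * l) \<in> I \<or> (e', hom_poly l' l e' q) \<in> I"
    using cancel[OF _ _ hom_poly_forms[OF l l' q(1)], of "l' + poly_const (- r) * l" e'] by (auto simp: e)
  then show ?case using Suc.hyps(1)[of q e'] alg q q0 deg Suc.prems(3) Suc(2) e by auto
qed

text \<open>Iterating the reduction bounds the dimension of the quotient in every degree from
  \<open>e0\<close> on by the number of monomials of degree \<open>e0\<close>.\<close>

lemma power_reduction:
  assumes l: "l \<in> forms N Qbar 1"
    and e0: "\<And>e F. e0 \<le> e \<Longrightarrow> F \<in> forms N Qbar (e + 1) \<Longrightarrow> \<exists>A\<in>forms N Qbar e. (e + 1, F - A * l) \<in> I"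
  shows "F \<in> forms N Qbar (e0 + j) \<Longrightarrow> \<exists>A\<in>forms N Qbar e0. (e0 + j, F - A * l ^ j) \<in> I"
proof (induction j arbitrary: F)
  case 0
  then show ?case using zero[of e0] by (intro bexI[of _ F]) auto
next
  case (Suc j)
  obtain A where A: "A \<in> forms N Qbar (e0 + j)" "(e0 + j + 1, F - A * l) \<in> I" using e0[of "e0 + j" F] Suc.prems by auto
  obtain B where B: "B \<in> forms N Qbar e0" "(e0 + j, A - B * l ^ j) \<in> I" using Suc.IH[OF A(1)] by blast
  have "(1 + (e0 + j), l * (A - B * l ^ j)) \<in> I" using mult[OF B(2) l] .
  then have "(e0 + j + 1, (F - A * l) + l * (A - B * l ^ j)) \<in> I" using add[OF A(2)] by simp
  moreover have "(F - A * l) + l * (A - B * l ^ j) = F - B * l ^ Suc j" by (simp add: algebra_simps)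
  ultimately show ?case using B(1) by auto
qed

text \<open>The \<open>m + 1\<close> products \<open>W j\<close> are, modulo \<open>I\<close>,
  multiples of the same power of \<open>l\<close> with cofactors in a space of dimension
  \<open>m\<close>. A linear relation among the cofactors gives a binary form in \<open>l'\<close>
  and \<open>l\<close> inside \<open>I\<close>, and one of its linear factors is then in
  \<open>I\<close>.\<close>

lemma linear_mod:
  assumes l: "l \<in> forms N Qbar 1" and lI: "(1, l) \<notin> I" and l': "l' \<in> forms N Qbar 1"
  shows "\<exists>r\<in>Qbar. (1, l' + poly_const (- r) * l) \<in> I"
proof -
  obtain e0 where e0: "\<And>e F. e0 \<le> e \<Longrightarrow> F \<in> forms N Qbar (e + 1) \<Longrightarrow> \<exists>A\<in>forms N Qbar e. (e + 1, F - A * l) \<in> I"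
    using sum_big[OF l lI] by blast
  define m where "m = card (mons N e0)"
  define W where "W = (\<lambda>j. l' ^ j * l ^ (e0 + m - j))"
  have W: "W j \<in> forms N Qbar (e0 + m)" if "j \<le> m" for j
    using Qbar.forms_mult[OF Qbar.forms_power[OF l'] Qbar.forms_power[OF l], of j "e0 + m - j"] that by (simp add: W_def)
  have "\<forall>j\<in>{..m}. \<exists>A\<in>forms N Qbar e0. (e0 + m, W j - A * l ^ m) \<in> I"
    using power_reduction[OF l e0 W] by blast
  then obtain A where A: "\<And>j. j \<le> m \<Longrightarrow> A j \<in> forms N Qbar e0" "\<And>j. j \<le> m \<Longrightarrow> (e0 + m, W j - A j * l ^ m) \<in> I"
    by (metis atMost_iff)
  have AQ: "lk (A j) \<mu> \<in> Qbar" if "j \<le> m" for j \<mu> by (rule forms_lookup[OF _ A(1)[OF that]]) simp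
  have "\<exists>y. (\<forall>j\<in>{..m}. y j \<in> Qbar) \<and> (\<exists>j\<in>{..m}. y j \<noteq> 0) \<and> (\<forall>\<mu>\<in>mons N e0. (\<Sum>j\<in>{..m}. lk (A j) \<mu> * y j) = 0)"
    using AQ by (intro Qbar.homogeneous_solution) (auto simp: m_def[symmetric])
  then obtain y where y: "\<And>j. j \<le> m \<Longrightarrow> y j \<in> Qbar" "\<exists>j\<le>m. y j \<noteq> 0"
    "\<And>\<mu>. \<mu> \<in> mons N e0 \<Longrightarrow> (\<Sum>j\<le>m. lk (A j) \<mu> * y j) = 0" by auto
  have A0: "(\<Sum>j\<le>m. poly_const (y j) * A j) = 0"
  proof (rule poly_mapping_eqI)
    fix \<mu>
    show "lk (\<Sum>j\<le>m. poly_const (y j) * A j) \<mu> = lk 0 \<mu>"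
    proof (cases "\<mu> \<in> mons N e0")
      case True
      then show ?thesis unfolding lookup_sum lookup_const_mult using y(3)[OF True] by (simp add: mult.commute)
    next
      case False
      then have "lk (A j) \<mu> = 0" if "j \<le> m" for j using forms_keys[OF A(1)[OF that]] by (auto simp: in_keys_iff)
      then show ?thesis by (simp add: lookup_sum lookup_const_mult)
    qed
  qed
  have "(e0 + m, \<Sum>j\<le>m. poly_const (y j) * (W j - A j * l ^ m)) \<in> I"
    using A(2) y(1) by (intro sum smult) auto
  also have "(\<Sum>j\<le>m. poly_const (y j) * (W j - A j * l ^ m)) =
      (\<Sum>j\<le>m. poly_const (y j) * W j) - (\<Sum>j\<le>m. poly_const (y j) * A j) * l ^ m"
    by (simp add: right_diff_distrib sum_subtractf sum_distrib_right mult.assoc)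
  finally have mem: "(e0 + m, \<Sum>j\<le>m. poly_const (y j) * W j) \<in> I" by (simp add: A0)
  define p where "p = (\<Sum>j\<le>m. monom (y j) j)"
  have coeff: "coeff p j = (if j \<le> m then y j else 0)" for j
    by (simp add: p_def coeff_sum)
  have "hom_poly l' l (e0 + m) p = (\<Sum>j\<le>m. poly_const (y j) * W j)"
    unfolding hom_poly_def W_def by (rule sum.mono_neutral_cong_right) (auto simp: coeff poly_const_def)
  moreover have "poly_over Qbar p" using y(1) by (auto simp: poly_over_def coeff)
  moreover have "p \<noteq> 0" using y(2) coeff by (metis coeff_0)
  moreover have "degree p \<le> e0 + m" by (rule degree_le) (simp add: coeff)
  ultimately show ?thesis using linear_factor_mem[OF l lI l', of p "e0 + m"] mem by simp
qed

text \<open>Some variable \<open>l\<close> is outside \<open>I\<close>, and every variable is a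
  multiple of \<open>l\<close> modulo \<open>I\<close>. These multiples are the coordinates of
  \<open>a\<close>, and every form \<open>F\<close> of degree \<open>e\<close> is congruent to
  \<open>poly_eval F a\<close> times \<open>l ^ e\<close>. For a form in \<open>I\<close> the value
  must vanish, since no power of \<open>l\<close> lies in \<open>I\<close>.\<close>

lemma exists_zero: "\<exists>a\<in>cone N Qbar. \<forall>e F. (e, F) \<in> I \<longrightarrow> poly_eval F a = 0"
proof -
  have "\<exists>i\<le>N. (1, poly_var i) \<notin> I"
  proof (rule ccontr)
    assume *: "\<not> (\<exists>i\<le>N. (1, poly_var i) \<notin> I)"
    have "(1, F) \<in> I" if F: "F \<in> forms N Qbar 1" for F
    proof -
      have "(1, monom_of m (lk F m)) \<in> I" if m: "m \<in> mons N 1" for m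
      proof -
        obtain i m' where i: "i \<le> N" "m' \<in> mons N 0" "m = Poly_Mapping.single i 1 + m'" using mons_Suc m by (metis One_nat_def)
        then have "monom_of m (lk F m) = poly_const (lk F m) * poly_var i"
          by (simp add: mons_0 poly_const_def poly_var_def mult_single)
        then show ?thesis using * i forms_lookup[OF _ F, of m] by (auto intro!: smult)
      qed
      then have "(1, \<Sum>m\<in>mons N 1. monom_of m (lk F m)) \<in> I" by (rule sum)
      then show ?thesis using forms_expand[OF F] by simp
    qed
    then show False using not_big unfolding big_def by blast
  qed
  then obtain i0 where i0: "i0 \<le> N" "(1, poly_var i0) \<notin> I" by blast
  define l where "l = poly_var i0"
  have l: "l \<in> forms N Qbar 1" "(1, l) \<notin> I" using i0 Qbar.forms_var by (auto simp: l_def)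
  have "\<forall>i\<in>{..N}. \<exists>r. r \<in> Qbar \<and> (1, poly_var i + poly_const (- r) * l) \<in> I"
    using linear_mod[OF l Qbar.forms_var] by blast
  from bchoice[OF this] obtain b where b: "\<And>i. i \<le> N \<Longrightarrow> b i \<in> Qbar"
    "\<And>i. i \<le> N \<Longrightarrow> (1, poly_var i + poly_const (- b i) * l) \<in> I" by auto
  \<comment> \<open>The coordinate at \<open>i0\<close> is set to 1, which keeps the vector nonzero;
    above \<open>N\<close> it is 0, as membership in \<open>cone\<close> demands.\<close>
  define a where "a = (\<lambda>i. if i > N then 0 else if i = i0 then 1 else b i)"
  have neg: "poly_const (- c) * F = - (poly_const c * F)" for c F
    by (simp add: poly_const_def single_uminus)
  have aI: "(1, poly_var i - poly_const (a i) * l) \<in> I" if "i \<le> N" for i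
    using that b(2)[OF that] zero by (auto simp: a_def neg l_def)
  have aQ: "a i \<in> Qbar" for i using b(1) by (auto simp: a_def)
  have "a i0 \<noteq> 0" "\<And>i. i > N \<Longrightarrow> a i = 0" using i0 by (simp_all add: a_def)
  then have a: "a \<in> cone N Qbar" using i0(1) aQ unfolding cone_def by blast
  have mon: "(e, monom_of m 1 - poly_const (mev m a) * l ^ e) \<in> I" if "m \<in> mons N e" for m e
    using that
  proof (induction e arbitrary: m)
    case 0
    then show ?case using zero[of 0] by (simp add: mons_0)
  next
    case (Suc e)
    obtain i m' where m: "i \<le> N" "m' \<in> mons N e" "m = Poly_Mapping.single i 1 + m'" using mons_Suc[OF Suc.prems] .
    have mv: "mev m' a \<in> Qbar" unfolding mev_def using aQ by (intro Qbar.prod Qbar.power)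
    have "(1 + e, poly_var i * (monom_of m' 1 - poly_const (mev m' a) * l ^ e)) \<in> I"
      by (intro mult Suc.IH m Qbar.forms_var)
    moreover have "l ^ e * (poly_const (mev m' a) * 1) \<in> forms N Qbar (e * 1 + 0)"
      using mv by (intro Qbar.forms_mult Qbar.forms_power l Qbar.forms_smult Qbar.forms_1)
    then have "(e * 1 + 0 + 1, l ^ e * (poly_const (mev m' a) * 1) * (poly_var i - poly_const (a i) * l)) \<in> I"
      by (rule mult[OF aI[OF m(1)]])
    ultimately have "(Suc e, poly_var i * (monom_of m' 1 - poly_const (mev m' a) * l ^ e) +
        l ^ e * (poly_const (mev m' a) * 1) * (poly_var i - poly_const (a i) * l)) \<in> I"
      by (intro add) simp_all
    moreover have "poly_const (mev m a) = poly_const (a i) * poly_const (mev m' a)"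
      by (simp add: m(3) mev_add poly_const_mult)
    ultimately show ?case unfolding m(3) monom_of_Suc by (simp add: algebra_simps)
  qed
  have "poly_eval F a = 0" if F: "(e, F) \<in> I" for e F
  proof (rule ccontr)
    assume nz: "poly_eval F a \<noteq> 0"
    have Ff: "F \<in> forms N Qbar e" using mem_forms[OF F] .
    have ev: "poly_eval F a = (\<Sum>m\<in>mons N e. lk F m * mev m a)"
      by (rule poly_eval_superset[OF finite_mons forms_keys[OF Ff]])
    have evQ: "poly_eval F a \<in> Qbar" unfolding ev mev_def using aQ
      by (intro Qbar.sum Qbar.mult Qbar.prod Qbar.power forms_lookup[OF _ Ff]) auto
    have "(e, \<Sum>m\<in>mons N e. poly_const (lk F m) * (monom_of m 1 - poly_const (mev m a) * l ^ e)) \<in> I"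
      using mon forms_lookup[OF _ Ff] by (intro sum smult) auto
    also have "(\<Sum>m\<in>mons N e. poly_const (lk F m) * (monom_of m 1 - poly_const (mev m a) * l ^ e)) =
        (\<Sum>m\<in>mons N e. monom_of m (lk F m)) - (\<Sum>m\<in>mons N e. poly_const (lk F m * mev m a)) * l ^ e"
      by (simp add: right_diff_distrib sum_subtractf sum_distrib_right mult.assoc[symmetric] poly_const_mult
          poly_const_mult_mono)
    also have "(\<Sum>m\<in>mons N e. monom_of m (lk F m)) = F" using forms_expand[OF Ff] by simp
    also have "(\<Sum>m\<in>mons N e. poly_const (lk F m * mev m a)) = poly_const (poly_eval F a)"
      unfolding ev poly_const_def by (rule poly_mapping_eqI) (simp add: lookup_sum lookup_single when_def)
    finally have "(e, F - (F - poly_const (poly_eval F a) * l ^ e)) \<in> I" using diff[OF F] by blast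
    then have "(e, poly_const (poly_eval F a) * l ^ e) \<in> I" by simp
    then have "(e, poly_const (inverse (poly_eval F a)) * (poly_const (poly_eval F a) * l ^ e)) \<in> I"
      using Qbar.inverse[OF evQ] by (rule smult)
    then have "(e, l ^ e) \<in> I" using nz by (simp add: mult.assoc[symmetric] poly_const_mult)
    then show False using power_notin[OF l] by blast
  qed
  then show ?thesis using a by blast
qed

end

text \<open>Being big is witnessed by the finitely many monomials of one degree, and a finite subset
  of the union of a chain lies in one member. So the union of a chain of ideals that are not big is
  again not big.\<close>

lemma exists_maximal_form_ideal:
  assumes I0: "form_ideal N I0" "\<not> form_ideal.big N I0"
  obtains I where "I0 \<subseteq> I" "maximal_form_ideal N I"
proof -
  define C where "C = {J. form_ideal N J \<and> \<not> form_ideal.big N J \<and> I0 \<subseteq> J}"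
  have "\<exists>M\<in>C. \<forall>J\<in>C. M \<subseteq> J \<longrightarrow> J = M"
  proof (rule subset_Zorn_nonempty)
    show "C \<noteq> {}" using I0 by (auto simp: C_def)
    fix T assume T: "T \<noteq> {}" "subset.chain C T"
    then have TC: "T \<subseteq> C" and lin: "\<And>A B. A \<in> T \<Longrightarrow> B \<in> T \<Longrightarrow> A \<subseteq> B \<or> B \<subseteq> A"
      by (auto simp: subset_chain_def)
    have id: "form_ideal N J" if "J \<in> T" for J using that TC by (auto simp: C_def)
    have U: "form_ideal N (\<Union>T)"
    proof
      fix e F G assume "(e, F) \<in> \<Union>T" "(e, G) \<in> \<Union>T"
      then obtain A B where AB: "A \<in> T" "B \<in> T" "(e, F) \<in> A" "(e, G) \<in> B" by blast
      then obtain J where J: "J \<in> T" "(e, F) \<in> J" "(e, G) \<in> J" using lin[of A B] by blast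
      have "(e, F + G) \<in> J" by (rule form_ideal.add[OF id[OF J(1)] J(2,3)])
      then show "(e, F + G) \<in> \<Union>T" using J(1) by blast
    next
      fix e F assume "(e, F) \<in> \<Union>T"
      then obtain J where "J \<in> T" "(e, F) \<in> J" by blast
      then show "F \<in> forms N Qbar e" using form_ideal.mem_forms[OF id] by blast
    next
      fix e
      obtain J where J: "J \<in> T" using T(1) by blast
      show "(e, 0) \<in> \<Union>T" using form_ideal.zero[OF id[OF J]] J by blast
    next
      fix a b F G assume "(a, F) \<in> \<Union>T" and G: "G \<in> forms N Qbar b"
      then obtain J where J: "J \<in> T" "(a, F) \<in> J" by blast
      show "(b + a, G * F) \<in> \<Union>T" using form_ideal.mult[OF id[OF J(1)] J(2) G] J by blast
    qed
    have "\<not> form_ideal.big N (\<Union>T)"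
    proof
      assume "form_ideal.big N (\<Union>T)"
      then obtain e where e: "\<And>F. F \<in> forms N Qbar e \<Longrightarrow> (e, F) \<in> \<Union>T" unfolding form_ideal.big_def[OF U] by blast
      have "(\<lambda>m. (e, monom_of m 1)) ` mons N e \<subseteq> \<Union>T" using e mono_forms[of _ N e 1 Qbar] by auto
      then obtain J where J: "J \<in> T" "(\<lambda>m. (e, monom_of m 1)) ` mons N e \<subseteq> J"
        using finite_subset_Union_chain[of "(\<lambda>m. (e, monom_of m 1)) ` mons N e" T C] T by auto
      interpret J: form_ideal N J by (rule id[OF J(1)])
      have "(e, F) \<in> J" if F: "F \<in> forms N Qbar e" for F
      proof -
        have "(e, \<Sum>m\<in>mons N e. poly_const (lk F m) * monom_of m 1) \<in> J"
          using J(2) forms_lookup[OF _ F] by (intro J.sum J.smult) auto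
        also have "(\<Sum>m\<in>mons N e. poly_const (lk F m) * monom_of m 1) = F"
          unfolding poly_const_mult_mono mult_1_right by (rule forms_expand[OF F, symmetric])
        finally show ?thesis .
      qed
      then have "J.big" unfolding J.big_def by blast
      then show False using J(1) TC by (auto simp: C_def)
    qed
    moreover have "I0 \<subseteq> \<Union>T" using T(1) TC by (auto simp: C_def)
    ultimately show "\<Union>T \<in> C" using U by (simp add: C_def)
  qed
  then obtain M where M: "M \<in> C" "\<And>J. J \<in> C \<Longrightarrow> M \<subseteq> J \<Longrightarrow> J = M" by blast
  have "maximal_form_ideal N M"
    unfolding maximal_form_ideal_def maximal_form_ideal_axioms_def using M by (auto simp: C_def)
  then show ?thesis using that M(1) by (auto simp: C_def)
qed

text \<open>If the ideal of the \<open>f i\<close> were not big, a maximal ideal above it would have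
  a zero, which is a common zero of the \<open>f i\<close>.\<close>

theorem projective_nullstellensatz:
  assumes f: "\<And>i. i \<le> N \<Longrightarrow> f i \<in> forms N Qbar d"
    and nz: "\<And>x. x \<in> cone N Qbar \<Longrightarrow> \<exists>i\<le>N. poly_eval (f i) x \<noteq> 0"
  shows "\<exists>e. \<forall>F\<in>forms N Qbar (e + d). \<exists>A. (\<forall>i\<le>N. A i \<in> forms N Qbar e) \<and> F = (\<Sum>i\<le>N. A i * f i)"
proof -
  \<comment> \<open>The pairs with form 0 provide the zero elements in degrees below
    \<open>d\<close>.\<close>
  define I where "I = range (\<lambda>e. (e, 0)) \<union> {(e + d, \<Sum>i\<le>N. A i * f i) | e A. \<forall>i\<le>N. A i \<in> forms N Qbar e}"
  have split: "F = 0 \<or> (\<exists>e' A. e = e' + d \<and> (\<forall>i\<le>N. A i \<in> forms N Qbar e') \<and> F = (\<Sum>i\<le>N. A i * f i))"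
    if "(e, F) \<in> I" for e F using that by (auto simp: I_def)
  have gen: "(e + d, \<Sum>i\<le>N. A i * f i) \<in> I" if "\<And>i. i \<le> N \<Longrightarrow> A i \<in> forms N Qbar e" for e A
    using that by (auto simp: I_def)
  interpret form_ideal N I
  proof
    fix e F assume "(e, F) \<in> I"
    from split[OF this] show "F \<in> forms N Qbar e"
      by (elim disjE exE conjE) (auto intro!: Qbar.forms_sum Qbar.forms_mult f)
  next
    fix e show "(e, 0) \<in> I" by (simp add: I_def)
  next
    fix e F G assume F: "(e, F) \<in> I" and G: "(e, G) \<in> I"
    show "(e, F + G) \<in> I"
    proof (cases "F = 0 \<or> G = 0")
      case True then show ?thesis using F G by auto
    next
      case False
      obtain e' A where A: "e = e' + d" "\<forall>i\<le>N. A i \<in> forms N Qbar e'" "F = (\<Sum>i\<le>N. A i * f i)" using split[OF F] False by blast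
      obtain e'' B where B: "e = e'' + d" "\<forall>i\<le>N. B i \<in> forms N Qbar e''" "G = (\<Sum>i\<le>N. B i * f i)" using split[OF G] False by blast
      have "e'' = e'" using A(1) B(1) by simp
      then have "(e' + d, \<Sum>i\<le>N. (A i + B i) * f i) \<in> I" using A B by (intro gen Qbar.forms_add) auto
      then show ?thesis using A B by (simp add: distrib_right sum.distrib)
    qed
  next
    fix a b F G assume F: "(a, F) \<in> I" and G: "G \<in> forms N Qbar b"
    show "(b + a, G * F) \<in> I"
    proof (cases "F = 0")
      case True then show ?thesis by (simp add: I_def)
    next
      case False
      obtain e' A where A: "a = e' + d" "\<forall>i\<le>N. A i \<in> forms N Qbar e'" "F = (\<Sum>i\<le>N. A i * f i)" using split[OF F] False by blast
      have "((b + e') + d, \<Sum>i\<le>N. (G * A i) * f i) \<in> I" using A G by (intro gen Qbar.forms_mult) auto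
      then show ?thesis using A by (simp add: sum_distrib_left mult.assoc add.assoc)
    qed
  qed
  have "big"
  proof (rule ccontr)
    assume "\<not> big"
    then obtain M where M: "I \<subseteq> M" "maximal_form_ideal N M" using exists_maximal_form_ideal form_ideal_axioms by blast
    obtain a where a: "a \<in> cone N Qbar" "\<And>e F. (e, F) \<in> M \<Longrightarrow> poly_eval F a = 0"
      using maximal_form_ideal.exists_zero[OF M(2)] by blast
    have "poly_eval (f i) a = 0" if i: "i \<le> N" for i
    proof -
      have "(0 + d, \<Sum>j\<le>N. (if j = i then 1 else 0) * f j) \<in> I" using Qbar.forms_1 by (intro gen) auto
      also have "(\<Sum>j\<le>N. (if j = i then 1 else 0) * f j) = (\<Sum>j\<le>N. if j = i then f j else 0)" by (rule sum.cong) auto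
      also have "\<dots> = f i" using i by simp
      finally show ?thesis using a(2) M(1) by auto
    qed
    then show False using nz[OF a(1)] by blast
  qed
  then obtain e where e: "\<And>F. F \<in> forms N Qbar e \<Longrightarrow> (e, F) \<in> I" unfolding big_def by blast
  have "\<exists>A. (\<forall>i\<le>N. A i \<in> forms N Qbar e) \<and> F = (\<Sum>i\<le>N. A i * f i)" if F: "F \<in> forms N Qbar (e + d)" for F
  proof (cases "F = 0")
    case True
    then show ?thesis by (intro exI[of _ "\<lambda>_. 0"]) simp
  next
    case False
    have "(e + d, F) \<in> I" using forms_ge_mem[OF e _ F] by simp
    from split[OF this] False obtain e' A where "e + d = e' + d"
      "\<forall>i\<le>N. A i \<in> forms N Qbar e'" "F = (\<Sum>i\<le>N. A i * f i)" by blast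
    then show ?thesis by auto
  qed
  then show ?thesis by (intro exI[of _ e] ballI)
qed

text \<open>Each identity is a linear system for the coefficients of the \<open>A j i\<close>,
  solvable over \<open>Qbar\<close> and therefore over \<open>k\<close>. Powers of the variables are
  what the height estimate needs, where the variable is a coordinate of maximal size.\<close>

lemma nullstellensatz_descent:
  assumes k: "cfield k" "k \<subseteq> Qbar" and f: "\<And>i. i \<le> N \<Longrightarrow> f i \<in> forms N k d"
    and nz: "\<And>x. x \<in> cone N Qbar \<Longrightarrow> \<exists>i\<le>N. poly_eval (f i) x \<noteq> 0"
  obtains e A where "\<And>i j. i \<le> N \<Longrightarrow> j \<le> N \<Longrightarrow> A j i \<in> forms N k e"
    "\<And>j. j \<le> N \<Longrightarrow> poly_var j ^ (e + d) = (\<Sum>i\<le>N. A j i * f i)"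
proof -
  interpret cfield k by fact
  obtain e where e: "\<forall>F\<in>forms N Qbar (e + d). \<exists>A. (\<forall>i\<le>N. A i \<in> forms N Qbar e) \<and> F = (\<Sum>i\<le>N. A i * f i)"
    using projective_nullstellensatz[of N f d, OF forms_mono_field[OF k(2) f] nz] ..
  have "\<exists>A. (\<forall>i\<le>N. A i \<in> forms N k e) \<and> poly_var j ^ (e + d) = (\<Sum>i\<le>N. A i * f i)" if j: "j \<le> N" for j
  proof -
    have xk: "poly_var j ^ (e + d) \<in> forms N k (e + d)" using forms_power[OF forms_var[OF j], of "e + d"] by simp
    obtain B where B: "\<And>i. i \<le> N \<Longrightarrow> B i \<in> forms N Qbar e" "poly_var j ^ (e + d) = (\<Sum>i\<le>N. B i * f i)"
      using bspec[OF e forms_mono_field[OF k(2) xk]] by blast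
    have lin: "lk (\<Sum>i\<le>N. (\<Sum>m\<in>mons N e. monom_of m (y (i, m))) * f i) \<mu> =
        (\<Sum>(i, m)\<in>{..N} \<times> mons N e. lk (monom_of m 1 * f i) \<mu> * y (i, m))" for y \<mu>
      unfolding sum_mono_times[OF finite_mons] sum.cartesian_product lookup_sum
      by (intro sum.cong refl) (auto simp: lookup_const_mult mult.commute)
    have eqB: "(\<Sum>j\<in>{..N} \<times> mons N e. lk (monom_of (snd j) 1 * f (fst j)) \<mu> * lk (B (fst j)) (snd j)) = lk (poly_var j ^ (e + d)) \<mu>" for \<mu>
    proof -
      have "(\<Sum>i\<le>N. (\<Sum>m\<in>mons N e. monom_of m (lk (B i) m)) * f i) = (\<Sum>i\<le>N. B i * f i)"
        by (rule sum.cong[OF refl], rule arg_cong[where f = "\<lambda>x. x * _"], rule forms_expand[OF B(1), symmetric]) auto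
      then show ?thesis using lin[of "\<lambda>(i, m). lk (B i) m" \<mu>] B(2) by (simp add: case_prod_unfold)
    qed
    have fk: "lk (monom_of m 1 * f i) \<mu> \<in> k" if "i \<le> N" "m \<in> mons N e" for i m \<mu>
      using forms_lookup[OF zero forms_mult[OF mono_forms f]] that by blast
    define a where "a = (\<lambda>\<mu> j. lk (monom_of (snd j) 1 * f (fst j)) \<mu>)"
    define z where "z = (\<lambda>j. lk (B (fst j)) (snd j))"
    have a: "\<And>\<mu> j. \<mu> \<in> UNIV \<Longrightarrow> j \<in> {..N} \<times> mons N e \<Longrightarrow> a \<mu> j \<in> k"
      unfolding a_def using fk by auto
    have x: "\<And>\<mu>. \<mu> \<in> UNIV \<Longrightarrow> lk (poly_var j ^ (e + d)) \<mu> \<in> k"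
      by (rule forms_lookup[OF zero xk])
    have z: "\<And>\<mu>. \<mu> \<in> UNIV \<Longrightarrow> (\<Sum>j\<in>{..N} \<times> mons N e. a \<mu> j * z j) = lk (poly_var j ^ (e + d)) \<mu>"
      unfolding a_def z_def by (rule eqB)
    have fin: "finite ({..N} \<times> mons N e)" by simp
    obtain y where y: "\<forall>j\<in>{..N} \<times> mons N e. y j \<in> k"
      "\<forall>\<mu>\<in>UNIV. (\<Sum>j\<in>{..N} \<times> mons N e. a \<mu> j * y j) = lk (poly_var j ^ (e + d)) \<mu>"
      using solution_descent[of "{..N} \<times> mons N e" UNIV a "lk (poly_var j ^ (e + d))" z, OF fin a x z] by blast
    have "poly_var j ^ (e + d) = (\<Sum>i\<le>N. (\<Sum>m\<in>mons N e. monom_of m (y (i, m))) * f i)"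
      by (rule poly_mapping_eqI) (use lin[of y] y(2) in \<open>simp add: case_prod_unfold a_def\<close>)
    moreover have "(\<Sum>m\<in>mons N e. monom_of m (y (i, m))) \<in> forms N k e" if "i \<le> N" for i
      using y(1) that by (intro sum_mono_forms) auto
    ultimately show ?thesis by (intro exI[of _ "\<lambda>i. \<Sum>m\<in>mons N e. monom_of m (y (i, m))"]) blast
  qed
  then obtain A where "\<And>j. j \<le> N \<Longrightarrow> (\<forall>i\<le>N. A j i \<in> forms N k e) \<and> poly_var j ^ (e + d) = (\<Sum>i\<le>N. A j i * f i)"
    by metis
  then show ?thesis using that by blast
qed

subsection \<open>Images of hypersurfaces\<close>

definition exponents_of :: "nat \<Rightarrow> (nat \<Rightarrow> nat) \<Rightarrow> exponents" where
  "exponents_of N h = (\<Sum>i\<le>N. Poly_Mapping.single i (h i))"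

lemma lookup_exponents_of: "lk (exponents_of N h) i = (if i \<le> N then h i else 0)"
  by (simp add: exponents_of_def lookup_sum lookup_single when_def)

lemma exponents_of_mons: "(\<Sum>i\<le>N. h i) = e \<Longrightarrow> exponents_of N h \<in> mons N e"
proof -
  assume e: "(\<Sum>i\<le>N. h i) = e"
  have sub: "ks (exponents_of N h) \<subseteq> {..N}" by (auto simp: in_keys_iff lookup_exponents_of split: if_splits)
  have "mdeg (exponents_of N h) = (\<Sum>i\<le>N. h i)"
    using mdeg_superset[OF _ sub] by (simp add: lookup_exponents_of)
  then show ?thesis using sub e by (simp add: mons_def)
qed

lemma mons_sum: "m \<in> mons N e \<Longrightarrow> (\<Sum>i\<le>N. lk m i) = e"
  using mdeg_superset[of "{..N}" m] by (simp add: mons_def)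

lemma mons_eqI:
  assumes "m \<in> mons N e" "m' \<in> mons N e" "\<And>i. i < N \<Longrightarrow> lk m i = lk m' i" shows "m = m'"
proof (rule poly_mapping_eqI)
  fix i
  have "(\<Sum>i<N. lk m i) + lk m N = (\<Sum>i<N. lk m' i) + lk m' N"
    using mons_sum[OF assms(1)] mons_sum[OF assms(2)] by (simp add: lessThan_Suc_atMost[symmetric])
  moreover have "(\<Sum>i<N. lk m i) = (\<Sum>i<N. lk m' i)" using assms(3) by simp
  ultimately have N: "lk m N = lk m' N" by simp
  have out: "lk m i = 0 \<and> lk m' i = 0" if "i > N"
  proof -
    have "i \<notin> ks m" "i \<notin> ks m'" using that assms(1,2) by (auto simp: mons_def)
    then show ?thesis by (simp add: in_keys_iff)
  qed
  consider "i < N" | "i = N" | "i > N" by linarith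
  then show "lk m i = lk m' i" using assms(3) N out by cases auto
qed

text \<open>The first \<open>N\<close> exponents range freely over 0, ..., t; the last one absorbs
  what is missing to the degree \<open>N * t\<close>.\<close>

lemma card_mons_ge: "(t + 1) ^ N \<le> card (mons N (N * t))"
proof -
  define g where "g = (\<lambda>h. exponents_of N (\<lambda>i. if i < N then h i else N * t - (\<Sum>i<N. h i)))"
  have img: "g h \<in> mons N (N * t)" if "h \<in> PiE {..<N} (\<lambda>_. {..t})" for h
  proof -
    have "(\<Sum>i<N. h i) \<le> (\<Sum>i<N. t)" using that by (intro sum_mono) auto
    then show ?thesis unfolding g_def
      by (intro exponents_of_mons) (simp add: lessThan_Suc_atMost[symmetric])
  qed
  have "inj_on g (PiE {..<N} (\<lambda>_. {..t}))"
  proof (rule inj_onI)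
    fix h h' assume h: "h \<in> PiE {..<N} (\<lambda>_. {..t})" "h' \<in> PiE {..<N} (\<lambda>_. {..t})" and eq: "g h = g h'"
    show "h = h'"
    proof (rule PiE_ext[OF h])
      fix i assume "i \<in> {..<N}"
      then show "h i = h' i" using arg_cong[OF eq, of "\<lambda>m. lk m i"] by (simp add: g_def lookup_exponents_of)
    qed
  qed
  then have "card (PiE {..<N} (\<lambda>_. {..t})) \<le> card (mons N (N * t))"
    using img by (intro card_inj_on_le[where f = g]) auto
  then show ?thesis by (simp add: card_PiE)
qed

text \<open>Monomials divisible by the b-th power of the variable with index 0 correspond to degree
  \<open>e - b\<close>. In the remaining ones that exponent is below \<open>b\<close>, the next
  \<open>N - 1\<close> are at most \<open>e\<close>, and the last is determined.\<close>

lemma card_mons_le: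
  assumes N: "N \<ge> 1" and b: "b \<le> e"
  shows "card (mons N e) \<le> card (mons N (e - b)) + b * (e + 1) ^ (N - 1)"
proof -
  define Lo where "Lo = {m \<in> mons N e. lk m 0 < b}"
  define Hi where "Hi = {m \<in> mons N e. b \<le> lk m 0}"
  have "card Lo \<le> card (PiE {..<N} (\<lambda>i. if i = 0 then {..<b} else {..e}))"
  proof (rule card_inj_on_le[where f = "\<lambda>m. restrict (lk m) {..<N}"])
    show "inj_on (\<lambda>m. restrict (lk m) {..<N}) Lo"
    proof (rule inj_onI)
      fix m m' assume m: "m \<in> Lo" "m' \<in> Lo" and eq: "restrict (lk m) {..<N} = restrict (lk m') {..<N}"
      have "lk m i = lk m' i" if "i < N" for i using fun_cong[OF eq, of i] that by simp
      then show "m = m'" using m mons_eqI[of m N e m'] by (auto simp: Lo_def)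
    qed
    have "lk m i \<le> e" if "m \<in> mons N e" "i < N" for m i
      using member_le_sum[of i "{..N}" "lk m"] that mons_sum[OF that(1)] by auto
    then show "(\<lambda>m. restrict (lk m) {..<N}) ` Lo \<subseteq> PiE {..<N} (\<lambda>i. if i = 0 then {..<b} else {..e})"
      by (intro image_subsetI) (simp add: Lo_def restrict_PiE_iff)
    show "finite (PiE {..<N} (\<lambda>i. if i = 0 then {..<b} else {..e}))" by (intro finite_PiE) auto
  qed
  also have "\<dots> = (\<Prod>i<N. if i = 0 then b else e + 1)" by (subst card_PiE) (auto intro!: prod.cong)
  also have "\<dots> = b * (e + 1) ^ (N - 1)"
  proof -
    obtain N' where "N = Suc N'" using N by (cases N) auto
    then show ?thesis by (simp only: prod.lessThan_Suc_shift) simp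
  qed
  finally have lo: "card Lo \<le> b * (e + 1) ^ (N - 1)" .
  have decomp: "m - Poly_Mapping.single 0 b \<in> mons N (e - b)" "m = Poly_Mapping.single 0 b + (m - Poly_Mapping.single 0 b)"
    if "m \<in> Hi" for m
  proof -
    have m: "m \<in> mons N e" "b \<le> lk m 0" using that by (auto simp: Hi_def)
    show eq: "m = Poly_Mapping.single 0 b + (m - Poly_Mapping.single 0 b)"
      by (rule poly_mapping_eqI) (use m in \<open>auto simp: lookup_add lookup_minus lookup_single when_def\<close>)
    have "mdeg m = b + mdeg (m - Poly_Mapping.single 0 b)" by (subst eq) (simp add: mdeg_add)
    moreover have "ks (m - Poly_Mapping.single 0 b) \<subseteq> ks m" by (auto simp: lookup_minus in_keys_iff)
    ultimately show "m - Poly_Mapping.single 0 b \<in> mons N (e - b)" using m by (auto simp: mons_def)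
  qed
  have "card Hi \<le> card (mons N (e - b))"
  proof (rule card_inj_on_le[where f = "\<lambda>m. m - Poly_Mapping.single 0 b"])
    show "inj_on (\<lambda>m. m - Poly_Mapping.single 0 b) Hi"
      by (rule inj_onI) (metis decomp(2))
  qed (use decomp(1) in auto)
  moreover have "mons N e = Lo \<union> Hi" by (auto simp: Lo_def Hi_def)
  then have "card (mons N e) \<le> card Lo + card Hi" by (simp add: card_Un_le)
  ultimately show ?thesis using lo by linarith
qed

text \<open>The excess in \<open>card_mons_le\<close> grows like the power \<open>N - 1\<close> of
  the degree, the number of monomials like the power \<open>N\<close>; so a large \<open>M\<close>
  works.\<close>

lemma card_mons_gt:
  assumes "N \<ge> 1" "D \<ge> 1" "b \<ge> 1"
  obtains M where "b \<le> D * M" "card (mons N (D * M)) < card (mons N M) + card (mons N (D * M - b))"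
proof -
  \<comment> \<open>Chosen so that \<open>b * (D * N * (t + 1)) ^ (N - 1)\<close> equals
    \<open>t * (t + 1) ^ (N - 1)\<close>, just below \<open>(t + 1) ^ N\<close>; the degree will be
    \<open>N * t\<close>.\<close>
  define t where "t = b * (D * N) ^ (N - 1)"
  have DN: "D * N \<ge> 1" using assms by simp
  then have "1 \<le> (D * N) ^ (N - 1)" by (rule one_le_power)
  then have bt: "b \<le> t" unfolding t_def by (simp add: assms)
  have "b * (D * (N * t) + 1) ^ (N - 1) \<le> b * (D * N * (t + 1)) ^ (N - 1)"
    using DN by (intro mult_left_mono power_mono) (simp_all add: mult.assoc)
  also have "\<dots> = t * (t + 1) ^ (N - 1)" unfolding t_def power_mult_distrib by simp
  also have "\<dots> < (t + 1) * (t + 1) ^ (N - 1)" by simp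
  also have "\<dots> = (t + 1) ^ N" using assms(1) by (metis power_eq_if not_one_le_zero)
  also have "\<dots> \<le> card (mons N (N * t))" by (rule card_mons_ge)
  finally have "b * (D * (N * t) + 1) ^ (N - 1) < card (mons N (N * t))" .
  moreover have le: "b \<le> D * (N * t)"
  proof -
    have "t \<le> D * N * t" using mult_le_mono1[OF DN, of t] by (simp only: mult_1)
    from order_trans[OF bt this] show ?thesis by (simp only: mult.assoc)
  qed
  ultimately show ?thesis using card_mons_le[OF assms(1) le] that[OF le] by linarith
qed

lemma poly_subst_superset:
  assumes "finite I" "ks F \<subseteq> I"
  shows "poly_subst F f = (\<Sum>m\<in>I. poly_const (lk F m) * mev m f)"
  unfolding poly_subst_eq using assms
  by (intro sum.mono_neutral_left) (auto simp: in_keys_iff poly_const_def)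

text \<open>Forms of large degree \<open>M\<close> outnumber the conditions for \<open>G(f)\<close> to be a multiple of \<open>H\<close>.\<close>

lemma image_of_hypersurface:
  assumes N: "N \<ge> 1" and D: "D \<ge> 1" and b: "b \<ge> 1" and H: "H \<in> forms N Qbar b" "H \<noteq> 0"
    and f: "\<And>i. i \<le> N \<Longrightarrow> f i \<in> forms N Qbar D"
  obtains M G B where "G \<in> forms N Qbar M" "G \<noteq> 0" "poly_subst G f = H * B"
proof -
  obtain M where M: "b \<le> D * M" "card (mons N (D * M)) < card (mons N M) + card (mons N (D * M - b))"
    using card_mons_gt[OF N D b] .
  \<comment> \<open>The unknowns are the coefficients of \<open>G\<close>, indexed by the left
    summand, and of the cofactor \<open>B\<close>, indexed by the right one.\<close>
  define J where "J = mons N M <+> mons N (D * M - b)"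
  define a where "a = case_sum (\<lambda>m. mev m f) (\<lambda>m. - (H * monom_of m 1))"
  have aforms: "a j \<in> forms N Qbar (D * M)" if "j \<in> J" for j
  proof (cases j)
    case (Inl m)
    then show ?thesis using that Qbar.mev_forms[of m N M f D] f by (auto simp: a_def J_def mult.commute)
  next
    case (Inr m)
    then have "H * monom_of m 1 \<in> forms N Qbar (b + (D * M - b))"
      using that by (intro Qbar.forms_mult H mono_forms) (auto simp: J_def)
    then show ?thesis using Inr M(1) Qbar.forms_uminus by (simp add: a_def)
  qed
  have "\<exists>y. (\<forall>j\<in>J. y j \<in> Qbar) \<and> (\<exists>j\<in>J. y j \<noteq> 0) \<and> (\<forall>\<mu>\<in>mons N (D * M). (\<Sum>j\<in>J. lk (a j) \<mu> * y j) = 0)"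
  proof (rule Qbar.homogeneous_solution)
    show "card (mons N (D * M)) < card J" unfolding J_def by (subst card_Plus) (use M(2) in auto)
    fix \<mu> j assume "j \<in> J"
    then show "lk (a j) \<mu> \<in> Qbar" using forms_lookup[OF _ aforms] by simp
  qed (simp_all add: J_def)
  then obtain y where y: "\<And>j. j \<in> J \<Longrightarrow> y j \<in> Qbar" "\<exists>j\<in>J. y j \<noteq> 0"
    "\<And>\<mu>. \<mu> \<in> mons N (D * M) \<Longrightarrow> (\<Sum>j\<in>J. lk (a j) \<mu> * y j) = 0" by blast
  define G where "G = (\<Sum>m\<in>mons N M. monom_of m (y (Inl m)))"
  define B where "B = (\<Sum>m\<in>mons N (D * M - b). monom_of m (y (Inr m)))"
  have G: "G \<in> forms N Qbar M" unfolding G_def using y(1) by (intro Qbar.sum_mono_forms) (auto simp: J_def)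
  have "(\<Sum>j\<in>J. poly_const (y j) * a j) = 0"
  proof (rule poly_mapping_eqI)
    fix \<mu>
    show "lk (\<Sum>j\<in>J. poly_const (y j) * a j) \<mu> = lk 0 \<mu>"
    proof (cases "\<mu> \<in> mons N (D * M)")
      case True
      then show ?thesis unfolding lookup_sum lookup_const_mult using y(3)[OF True] by (simp add: mult.commute)
    next
      case False
      then have "lk (a j) \<mu> = 0" if "j \<in> J" for j using forms_keys[OF aforms[OF that]] by (auto simp: in_keys_iff)
      then show ?thesis by (simp add: lookup_sum lookup_const_mult)
    qed
  qed
  moreover have "(\<Sum>j\<in>J. poly_const (y j) * a j) = poly_subst G f - H * B"
  proof -
    have "poly_subst G f = (\<Sum>m\<in>mons N M. poly_const (y (Inl m)) * mev m f)"
      unfolding poly_subst_superset[OF finite_mons forms_keys[OF G]]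
      by (intro sum.cong) (simp_all add: G_def lookup_sum_mono)
    moreover have "H * B = (\<Sum>m\<in>mons N (D * M - b). poly_const (y (Inr m)) * (H * monom_of m 1))"
      unfolding B_def sum_distrib_left
      by (intro sum.cong refl) (simp add: mult.left_commute poly_const_mult_mono)
    ultimately show ?thesis unfolding J_def by (subst sum.Plus) (simp_all add: a_def sum_negf)
  qed
  ultimately have eq: "poly_subst G f = H * B" by simp
  have "G \<noteq> 0"
  proof
    assume G0: "G = 0"
    then have "H * B = 0" using eq by (simp add: poly_subst_def)
    then have B0: "B = 0" using H(2) by simp
    have "y j = 0" if "j \<in> J" for j
    proof (cases j)
      case (Inl m)
      then have m: "m \<in> mons N M" using that by (auto simp: J_def)
      have "lk G m = y (Inl m)" unfolding G_def using m by (simp add: lookup_sum_mono)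
      then show ?thesis using Inl G0 by simp
    next
      case (Inr m)
      then have m: "m \<in> mons N (D * M - b)" using that by (auto simp: J_def)
      have "lk B m = y (Inr m)" unfolding B_def using m by (simp add: lookup_sum_mono)
      then show ?thesis using Inr B0 by simp
    qed
    then show False using y(2) by blast
  qed
  then show ?thesis using that G eq by blast
qed

subsection \<open>Sets contained in a hypersurface\<close>

lemma digits_lt: "(\<And>i. i < n \<Longrightarrow> a i < B) \<Longrightarrow> (\<Sum>i<n. a i * B ^ i) < (B :: nat) ^ n"
proof (induction n)
  case (Suc n)
  have "(\<Sum>i<n. a i * B ^ i) < B ^ n" using Suc by simp
  moreover have "(a n + 1) * B ^ n \<le> B * B ^ n" using Suc.prems[of n] by (intro mult_right_mono) auto
  ultimately show ?case by simp
qed simp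

lemma digits_inject:
  assumes "\<And>i. i < n \<Longrightarrow> a i < B" "\<And>i. i < n \<Longrightarrow> b i < B"
    and "(\<Sum>i<n. a i * B ^ i) = (\<Sum>i<n. b i * (B :: nat) ^ i)" "i < n"
  shows "a i = b i"
  using assms
proof (induction n arbitrary: i)
  case (Suc n)
  have lt: "(\<Sum>i<n. a i * B ^ i) < B ^ n" "(\<Sum>i<n. b i * B ^ i) < B ^ n" using Suc.prems by (auto intro!: digits_lt)
  have eq: "(\<Sum>i<n. a i * B ^ i) + a n * B ^ n = (\<Sum>i<n. b i * B ^ i) + b n * B ^ n" using Suc.prems(3) by simp
  have eq': "(\<Sum>i<n. a i * B ^ i) = (\<Sum>i<n. b i * B ^ i)"
    using arg_cong[OF eq, of "\<lambda>x. x mod B ^ n"] lt by simp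
  moreover have "B ^ n \<noteq> 0" using lt(1) by (metis not_less_zero)
  ultimately have "a n = b n" using eq by (metis add_left_cancel mult_right_cancel)
  moreover have "a i = b i" if "i < n" by (rule Suc.IH) (use Suc.prems eq' that in auto)
  ultimately show ?case using Suc.prems(4) by (cases "i = n") auto
qed simp

text \<open>Kronecker substitution turns \<open>F\<close> into a nonzero polynomial in one variable.\<close>

lemma form_nonzero_at:
  assumes F: "F \<in> forms N K e" "F \<noteq> 0"
  obtains x where "x \<in> cone N \<rat>" "poly_eval F x \<noteq> 0"
proof -
  \<comment> \<open>Exceeds every exponent that occurs, so that the exponents are the digits of
    \<open>code m\<close>.\<close>
  define B where "B = e + 1"
  define code where "code m = (\<Sum>i<Suc N. lk m i * B ^ i)" for m :: exponents
  define q where "q = (\<Sum>m\<in>mons N e. monom (lk F m) (code m))"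
  have lt: "lk m i < B" if "m \<in> mons N e" "i < Suc N" for m i
    using member_le_sum[of i "{..N}" "lk m"] that mons_sum[OF that(1)] by (auto simp: B_def)
  have inj: "inj_on code (mons N e)"
  proof (rule inj_onI)
    fix m m' assume m: "m \<in> mons N e" "m' \<in> mons N e" and "code m = code m'"
    then have "lk m i = lk m' i" if "i < Suc N" for i
      using digits_inject[of "Suc N" "lk m" B "lk m'" i] lt[OF m(1)] lt[OF m(2)] that unfolding code_def by blast
    then show "m = m'" using mons_eqI[OF m] by simp
  qed
  obtain m0 where m0: "lk F m0 \<noteq> 0" using F(2) by (metis poly_mapping_eqI lookup_zero)
  then have m0M: "m0 \<in> mons N e" using forms_keys[OF F(1)] by (auto simp: in_keys_iff)
  have "coeff q (code m0) = (\<Sum>m\<in>mons N e. if m = m0 then lk F m else 0)"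
    unfolding q_def coeff_sum using inj m0M by (intro sum.cong refl) (auto dest: inj_onD)
  also have "\<dots> = lk F m0" using m0M by simp
  finally have "q \<noteq> 0" using m0 by auto
  then have "finite {t. poly q t = 0}" by (rule poly_roots_finite)
  moreover have "infinite (range (of_nat :: nat \<Rightarrow> complex))" by (simp add: range_inj_infinite inj_of_nat)
  ultimately have "infinite (range (of_nat :: nat \<Rightarrow> complex) - insert 0 {t. poly q t = 0})" by (simp add: Diff_infinite_finite)
  then have "range (of_nat :: nat \<Rightarrow> complex) - insert 0 {t. poly q t = 0} \<noteq> {}" by (rule infinite_imp_nonempty)
  then obtain t where t: "t \<in> range (of_nat :: nat \<Rightarrow> complex)" "t \<noteq> 0" "poly q t \<noteq> 0" by blast
  define x where "x = (\<lambda>i. if i \<le> N then t ^ (B ^ i) else 0)"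
  have "mev m x = t ^ code m" if "m \<in> mons N e" for m
  proof -
    have "mev m x = (\<Prod>i\<le>N. x i ^ lk m i)" using that by (intro mev_superset) (auto simp: mons_def)
    also have "\<dots> = (\<Prod>i\<le>N. t ^ (lk m i * B ^ i))"
      by (intro prod.cong refl) (simp add: x_def power_mult[symmetric] mult.commute)
    also have "\<dots> = t ^ code m" by (simp add: code_def power_sum[symmetric] lessThan_Suc_atMost)
    finally show ?thesis .
  qed
  then have "poly_eval F x = poly q t"
    unfolding poly_eval_superset[OF finite_mons forms_keys[OF F(1)]] q_def by (simp add: poly_sum poly_monom)
  moreover have "t \<in> \<rat>" using t(1) by auto
  then have "x \<in> cone N \<rat>" using t(2) by (auto simp: cone_def x_def intro: exI[of _ 0])
  ultimately show ?thesis using that t(3) by simp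
qed

lemma cone_mono: "K \<subseteq> L \<Longrightarrow> cone N K \<subseteq> cone N L"
  by (auto simp: cone_def)

lemma proj_space_mono: "K \<subseteq> L \<Longrightarrow> proj_space N K \<subseteq> proj_space N L"
  unfolding proj_space_def using cone_mono by blast

lemma zero_locus_iff:
  assumes "F \<in> forms N K e" "x \<in> cone N Qbar"
  shows "proj_point x \<in> zero_locus N {F} \<longleftrightarrow> poly_eval F x = 0"
proof -
  have "x \<in> proj_point x" by (auto simp: proj_point_def intro!: exI[of _ 1])
  moreover have "proj_point x \<in> proj_space N Qbar" using assms(2) by (auto simp: proj_space_def)
  moreover have "poly_eval F z = 0" if "poly_eval F x = 0" "z \<in> proj_point x" for z
    using that poly_eval_scale[OF assms(1), of _ x] by (auto simp: proj_point_def)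
  ultimately show ?thesis by (auto simp: zero_locus_def)
qed

text \<open>The working substitute for non-density: it visibly passes to subsets and finite unions.
  Degree 0 is allowed, where a nonzero constant gives the empty set.\<close>

definition in_hypersurface :: "nat \<Rightarrow> point set \<Rightarrow> bool" where
  "in_hypersurface N A \<longleftrightarrow> (\<exists>e F. F \<in> forms N Qbar e \<and> F \<noteq> 0 \<and> A \<subseteq> zero_locus N {F})"

lemma in_hypersurface_not_dense:
  assumes "in_hypersurface N A" shows "\<not> zariski_dense N A"
proof
  assume dense: "zariski_dense N A"
  obtain e F where F: "F \<in> forms N Qbar e" "F \<noteq> 0" "A \<subseteq> zero_locus N {F}"
    using assms by (auto simp: in_hypersurface_def)
  have "zariski_closed N (zero_locus N {F})" unfolding zariski_closed_def
    by (intro exI[of _ "{F}"]) (use F(1) in blast)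
  then have eq: "zero_locus N {F} = proj_space N Qbar" using dense F(3) by (auto simp: zariski_dense_def)
  obtain x where x: "x \<in> cone N \<rat>" "poly_eval F x \<noteq> 0" using form_nonzero_at[OF F(1,2)] .
  have xQ: "x \<in> cone N Qbar" using x(1) cone_mono[OF Qbar.Rats_subset] by blast
  then have "proj_point x \<in> zero_locus N {F}" unfolding eq by (auto simp: proj_space_def)
  then show False using zero_locus_iff[OF F(1) xQ] x(2) by blast
qed

lemma in_hypersurface_subset: "in_hypersurface N B \<Longrightarrow> A \<subseteq> B \<Longrightarrow> in_hypersurface N A"
  unfolding in_hypersurface_def by (meson subset_trans)

lemma in_hypersurface_empty: "in_hypersurface N {}"
  unfolding in_hypersurface_def using Qbar.forms_1 by (intro exI[of _ 0] exI[of _ 1]) auto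

lemma in_hypersurface_Un:
  assumes "in_hypersurface N A" "in_hypersurface N B" shows "in_hypersurface N (A \<union> B)"
proof -
  obtain a F where F: "F \<in> forms N Qbar a" "F \<noteq> 0" "A \<subseteq> zero_locus N {F}" using assms(1) by (auto simp: in_hypersurface_def)
  obtain b G where G: "G \<in> forms N Qbar b" "G \<noteq> 0" "B \<subseteq> zero_locus N {G}" using assms(2) by (auto simp: in_hypersurface_def)
  have "F * G \<in> forms N Qbar (a + b)" "F * G \<noteq> 0" using Qbar.forms_mult F G by auto
  moreover have "A \<union> B \<subseteq> zero_locus N {F * G}" using F(3) G(3) by (auto simp: zero_locus_def poly_eval_mult)
  ultimately show ?thesis unfolding in_hypersurface_def by blast
qed

lemma in_hypersurface_Union:
  "finite \<A> \<Longrightarrow> (\<And>A. A \<in> \<A> \<Longrightarrow> in_hypersurface N A) \<Longrightarrow> in_hypersurface N (\<Union>\<A>)"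
  by (induction \<A> rule: finite_induct) (auto simp: in_hypersurface_empty intro: in_hypersurface_Un)

lemma in_hypersurface_point:
  assumes N: "N \<ge> 1" and Q: "Q \<in> proj_space N Qbar" shows "in_hypersurface N {Q}"
proof -
  obtain x where x: "x \<in> cone N Qbar" "Q = proj_point x" using Q by (auto simp: proj_space_def)
  \<comment> \<open>A linear form through the point in the first two variables, which exist because
    \<open>N \<ge> 1\<close>; the case distinction keeps it nonzero.\<close>
  define F where "F = (if x 0 = 0 then poly_var 0 else poly_const (x 1) * poly_var 0 - poly_const (x 0) * poly_var 1)"
  have xi: "x 0 \<in> Qbar" "x 1 \<in> Qbar" using x(1) N by (auto simp: cone_def)
  have F: "F \<in> forms N Qbar 1" unfolding F_def using N xi Qbar.forms_var
    by (auto intro!: Qbar.forms_diff Qbar.forms_smult)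
  have "F \<noteq> 0"
  proof (cases "x 0 = 0")
    case True
    have "lk (poly_var 0) (Poly_Mapping.single 0 1) = 1" by (simp add: poly_var_def)
    then show ?thesis using True by (auto simp: F_def)
  next
    case False
    have "poly_eval F (\<lambda>i. if i = 1 then 1 else 0) \<noteq> 0"
      using False by (simp add: F_def poly_eval_minus poly_eval_mult)
    then show ?thesis by auto
  qed
  moreover have "poly_eval F x = 0" by (simp add: F_def poly_eval_minus poly_eval_mult)
  ultimately show ?thesis unfolding in_hypersurface_def using F zero_locus_iff[OF F x(1)] x(2) by blast
qed

lemma in_hypersurface_finite:
  assumes "N \<ge> 1" "finite A" "A \<subseteq> proj_space N Qbar" shows "in_hypersurface N A"
  using in_hypersurface_Union[of "(\<lambda>Q. {Q}) ` A" N] in_hypersurface_point assms by auto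

lemma proj_map_point:
  assumes f: "\<And>i. i \<le> N \<Longrightarrow> f i \<in> forms N K d"
  shows "proj_map N f (proj_point x) = proj_point (\<lambda>i. if i \<le> N then poly_eval (f i) x else 0)"
proof (intro equalityI subsetI)
  fix y assume "y \<in> proj_map N f (proj_point x)"
  then obtain a b where y: "y = (\<lambda>i. if i \<le> N then a * poly_eval (f i) (\<lambda>i. b * x i) else 0)" "a \<noteq> 0" "b \<noteq> 0"
    by (auto simp: proj_map_def proj_point_def)
  have "y = (\<lambda>i. (a * b ^ d) * (if i \<le> N then poly_eval (f i) x else 0))"
    unfolding y(1) using poly_eval_scale[OF f] by auto
  then show "y \<in> proj_point (\<lambda>i. if i \<le> N then poly_eval (f i) x else 0)"
    using y(2,3) unfolding proj_point_def by (auto intro!: exI[of _ "a * b ^ d"])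
next
  fix y assume "y \<in> proj_point (\<lambda>i. if i \<le> N then poly_eval (f i) x else 0)"
  then obtain c where c: "c \<noteq> 0" "y = (\<lambda>i. c * (if i \<le> N then poly_eval (f i) x else 0))" by (auto simp: proj_point_def)
  have "x \<in> proj_point x" by (auto simp: proj_point_def intro!: exI[of _ 1])
  moreover have "y = (\<lambda>i. if i \<le> N then c * poly_eval (f i) x else 0)" using c(2) by auto
  ultimately show "y \<in> proj_map N f (proj_point x)" using c(1) unfolding proj_map_def by blast
qed

text \<open>The form \<open>G\<close> from \<open>image_of_hypersurface\<close> becomes a multiple
  of \<open>H\<close> after substitution, so it vanishes at the image of every zero of
  \<open>H\<close>.\<close>

lemma in_hypersurface_image:
  assumes N: "N \<ge> 1" and D: "D \<ge> 1" and b: "b \<ge> 1" and H: "H \<in> forms N Qbar b" "H \<noteq> 0"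
    and f: "\<And>i. i \<le> N \<Longrightarrow> f i \<in> forms N Qbar D"
    and nz: "\<And>x. x \<in> cone N Qbar \<Longrightarrow> \<exists>i\<le>N. poly_eval (f i) x \<noteq> 0"
  shows "in_hypersurface N (proj_map N f ` zero_locus N {H})"
proof -
  obtain M G B where G: "G \<in> forms N Qbar M" "G \<noteq> 0" "poly_subst G f = H * B"
    using image_of_hypersurface[OF N D b H f] .
  have "proj_map N f P \<in> zero_locus N {G}" if P: "P \<in> zero_locus N {H}" for P
  proof -
    obtain x where x: "x \<in> cone N Qbar" "P = proj_point x" using P by (auto simp: zero_locus_def proj_space_def)
    define y where "y = (\<lambda>i. if i \<le> N then poly_eval (f i) x else 0)"
    have "poly_eval (f i) x \<in> Qbar" if i: "i \<le> N" for i
      unfolding poly_eval_superset[OF finite_mons forms_keys[OF f[OF i]]] mev_def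
    proof (intro Qbar.sum Qbar.mult Qbar.prod Qbar.power)
      fix m j assume m: "m \<in> mons N D" and j: "j \<in> ks m"
      then have "j \<le> N" by (auto simp: mons_def)
      then show "x j \<in> Qbar" using x(1) by (auto simp: cone_def)
    qed (use forms_lookup[OF _ f[OF i]] in auto)
    then have y: "y \<in> cone N Qbar" using nz[OF x(1)] by (auto simp: cone_def y_def)
    have "poly_eval H x = 0" using P zero_locus_iff[OF H(1) x(1)] x(2) by simp
    then have "poly_eval G (\<lambda>i. poly_eval (f i) x) = 0"
      by (simp add: poly_eval_subst[symmetric] G(3) poly_eval_mult)
    also have "poly_eval G (\<lambda>i. poly_eval (f i) x) = poly_eval G y" by (rule poly_eval_cong[OF G(1)]) (simp add: y_def)
    finally have "poly_eval G y = 0" .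
    then show ?thesis using zero_locus_iff[OF G(1) y] proj_map_point[of N f Qbar D x, OF f] x(2) by (simp add: y_def)
  qed
  then show ?thesis unfolding in_hypersurface_def using G by blast
qed

subsection \<open>Heights\<close>

text \<open>Sums over places are sums over finitely many nonzero terms. This predicate supplies the
  summability that \<open>infsum\<close> needs for additivity and comparison.\<close>

definition finite_support :: "'a set \<Rightarrow> ('a \<Rightarrow> real) \<Rightarrow> bool" where
  "finite_support A g \<longleftrightarrow> finite {v \<in> A. g v \<noteq> 0}"

lemma finite_supportI: "finite T \<Longrightarrow> (\<And>v. v \<in> A \<Longrightarrow> v \<notin> T \<Longrightarrow> g v = 0) \<Longrightarrow> finite_support A g"
  unfolding finite_support_def by (rule finite_subset[of _ T]) auto

lemma finite_support_summable: "finite_support A g \<Longrightarrow> g summable_on A"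
  unfolding finite_support_def
  by (subst summable_on_cong_neutral[where T = "{v \<in> A. g v \<noteq> 0}" and g = g]) auto

lemma finite_support_subset: "finite_support A g \<Longrightarrow> B \<subseteq> A \<Longrightarrow> finite_support B g"
  unfolding finite_support_def by (erule finite_subset[rotated]) auto

lemma finite_support_add: "finite_support A g \<Longrightarrow> finite_support A h \<Longrightarrow> finite_support A (\<lambda>v. g v + h v)"
  unfolding finite_support_def
  by (rule finite_subset[of _ "{v \<in> A. g v \<noteq> 0} \<union> {v \<in> A. h v \<noteq> 0}"]) auto

lemma finite_support_cmult: "finite_support A g \<Longrightarrow> finite_support A (\<lambda>v. c v * g v)"
  unfolding finite_support_def by (rule finite_subset[of _ "{v \<in> A. g v \<noteq> 0}"]) auto

lemma finite_support_uminus: "finite_support A g \<Longrightarrow> finite_support A (\<lambda>v. - g v)"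
  unfolding finite_support_def by simp

lemma finite_support_diff: "finite_support A g \<Longrightarrow> finite_support A h \<Longrightarrow> finite_support A (\<lambda>v. g v - h v)"
  using finite_support_add[OF _ finite_support_uminus, of A g h] by simp

lemma infsum_ereal:
  assumes "finite_support A g" shows "(\<Sum>\<^sub>\<infinity>v\<in>A. ereal (g v)) = ereal (\<Sum>\<^sub>\<infinity>v\<in>A. g v)"
proof -
  define T where "T = {v \<in> A. g v \<noteq> 0}"
  have T: "finite T" "T \<subseteq> A" using assms by (auto simp: T_def finite_support_def)
  have "(\<Sum>\<^sub>\<infinity>v\<in>A. ereal (g v)) = (\<Sum>\<^sub>\<infinity>v\<in>T. ereal (g v))"
    by (rule infsum_cong_neutral) (auto simp: T_def)
  moreover have "(\<Sum>\<^sub>\<infinity>v\<in>A. g v) = (\<Sum>\<^sub>\<infinity>v\<in>T. g v)" by (rule infsum_cong_neutral) (auto simp: T_def)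
  ultimately show ?thesis using T(1) by simp
qed

lemma infsum_le:
  assumes "finite_support A g" "finite_support A h" "\<And>v. v \<in> A \<Longrightarrow> g v \<le> h v"
  shows "(\<Sum>\<^sub>\<infinity>v\<in>A. g v) \<le> (\<Sum>\<^sub>\<infinity>v\<in>A. (h v :: real))"
  using assms by (intro infsum_mono finite_support_summable)

lemma infsum_split_finite:
  assumes "finite_support A g" "finite S" "S \<subseteq> A"
  shows "(\<Sum>\<^sub>\<infinity>v\<in>A. g v) = (\<Sum>\<^sub>\<infinity>v\<in>A - S. g v) + (\<Sum>v\<in>S. g v)"
proof -
  have "(\<Sum>\<^sub>\<infinity>v\<in>(A - S) \<union> S. g v) = (\<Sum>\<^sub>\<infinity>v\<in>A - S. g v) + (\<Sum>\<^sub>\<infinity>v\<in>S. g v)"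
    using assms finite_support_subset[OF assms(1)]
    by (intro infsum_Un_disjoint finite_support_summable) auto
  then show ?thesis using assms(2,3) by (simp add: Un_absorb2)
qed

definition max_abs :: "nat \<Rightarrow> (complex \<Rightarrow> real) \<Rightarrow> (nat \<Rightarrow> complex) \<Rightarrow> real" where
  "max_abs N v x = Max ((\<lambda>i. v (x i)) ` {..N})"

lemma max_abs_ge: "i \<le> N \<Longrightarrow> v (x i) \<le> max_abs N v x"
  unfolding max_abs_def by (intro Max_ge) auto

lemma max_abs_attained: obtains i where "i \<le> N" "max_abs N v x = v (x i)"
proof -
  have "max_abs N v x \<in> (\<lambda>i. v (x i)) ` {..N}" unfolding max_abs_def by (intro Max_in) auto
  then show ?thesis using that by auto
qed

lemma max_abs_le: "(\<And>i. i \<le> N \<Longrightarrow> v (x i) \<le> B) \<Longrightarrow> max_abs N v x \<le> B"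
  by (metis max_abs_attained)

lemma max_abs_eqI: "i \<le> N \<Longrightarrow> v (x i) = B \<Longrightarrow> (\<And>i. i \<le> N \<Longrightarrow> v (x i) \<le> B) \<Longrightarrow> max_abs N v x = B"
  by (metis max_abs_ge max_abs_le order_antisym)

section \<open>Weil heights and local heights in real-valued form\<close>

context number_field_gen
begin

definition weight :: "(complex \<Rightarrow> real) \<Rightarrow> real" where
  "weight v = real (local_degree k v) / real (field_degree k)"

lemma weight_nonneg: "weight v \<ge> 0" by (simp add: weight_def)

lemma k_Qbar: "k \<subseteq> Qbar" using k_algebraic by auto

lemma places_finite_neq_1: assumes "x \<in> k" "x \<noteq> 0" shows "finite {v \<in> places k. v x \<noteq> 1}"
proof -
  obtain U :: "nat set" where U: "finite U" "\<And>p. p \<in> U \<Longrightarrow> Factorial_Ring.prime p"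
    "\<And>p v. Factorial_Ring.prime p \<Longrightarrow> p \<notin> U \<Longrightarrow> v \<in> finp p \<Longrightarrow> v x = 1" using finite_places_neq_1[OF assms] by blast
  have "{v \<in> places k. v x \<noteq> 1} \<subseteq> archp \<union> (\<Union>p\<in>U. finp p)" unfolding places_eq using U(3) by blast
  then show ?thesis using sum_places_finite(1)[OF U(1,2)] by (rule finite_subset)
qed

lemma support_ln: "x \<in> k \<Longrightarrow> x \<noteq> 0 \<Longrightarrow> finite_support (places k) (\<lambda>v. ln (v x))"
  by (rule finite_supportI[OF places_finite_neq_1[of x]]) auto

lemma product_formula_weight:
  assumes "x \<in> k" "x \<noteq> 0" shows "(\<Sum>\<^sub>\<infinity>v\<in>places k. weight v * ln (v x)) = 0"
proof -
  have "(\<Sum>\<^sub>\<infinity>v\<in>places k. weight v * ln (v x)) =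
      (\<Sum>\<^sub>\<infinity>v\<in>places k. inverse (real (field_degree k)) * (real (local_degree k v) * ln (v x)))"
    by (intro infsum_cong) (simp add: weight_def field_simps)
  also have "\<dots> = inverse (real (field_degree k)) * (\<Sum>\<^sub>\<infinity>v\<in>places k. real (local_degree k v) * ln (v x))"
    using finite_support_summable[OF finite_support_cmult[OF support_ln[OF assms]]] by (intro infsum_cmult_right)
  finally show ?thesis using product_formula[OF assms] by simp
qed

lemma coneD: assumes "x \<in> cone N k" shows "x i \<in> k" "i > N \<Longrightarrow> x i = 0"
  using assms zero by (cases "i \<le> N"; auto simp: cone_def)+

lemma scale_cone: "x \<in> cone N k \<Longrightarrow> c \<in> k \<Longrightarrow> c \<noteq> 0 \<Longrightarrow> (\<lambda>i. c * x i) \<in> cone N k"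
  by (auto simp: cone_def mult)

lemma max_abs_scale:
  assumes v: "v \<in> places k" and c: "c \<in> k" and x: "x \<in> cone N k"
  shows "max_abs N v (\<lambda>i. c * x i) = v c * max_abs N v x"
proof -
  interpret V: abs_val k v by (rule places_abs_val[OF v])
  obtain i where i: "i \<le> N" "max_abs N v x = v (x i)" by (rule max_abs_attained)
  show ?thesis
  proof (rule max_abs_eqI[OF i(1)])
    show "v (c * x i) = v c * max_abs N v x" using V.v_mult[OF c] coneD[OF x] i by simp
    show "v (c * x i) \<le> v c * max_abs N v x" if "i \<le> N" for i
      using V.v_mult[OF c] coneD[OF x] max_abs_ge[OF that, of v x] V.nonneg[OF c] by (simp add: mult_left_mono)
  qed
qed

lemma max_abs_pos: assumes v: "v \<in> places k" and x: "x \<in> cone N k" shows "max_abs N v x > 0"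
proof -
  interpret V: abs_val k v by (rule places_abs_val[OF v])
  obtain i where i: "i \<le> N" "x i \<noteq> 0" using x by (auto simp: cone_def)
  have "0 < v (x i)" using V.v_pos coneD[OF x] i by blast
  then show ?thesis using max_abs_ge[OF i(1), of v x] by simp
qed

lemma normalize:
  assumes v: "v \<in> places k" and x: "x \<in> cone N k"
  obtains c where "c \<in> k" "c \<noteq> 0" "max_abs N v (\<lambda>i. c * x i) = 1"
proof -
  interpret V: abs_val k v by (rule places_abs_val[OF v])
  obtain i where i: "i \<le> N" "max_abs N v x = v (x i)" by (rule max_abs_attained)
  have xi: "x i \<in> k" "x i \<noteq> 0" using coneD[OF x] max_abs_pos[OF v x] i V.v_0 by auto
  have "v (inverse (x i)) * v (x i) = 1" using V.v_inverse[OF xi(1)] V.v_pos[OF xi] by simp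
  then show ?thesis using that[of "inverse (x i)"] inverse[OF xi(1)] xi max_abs_scale[OF v _ x] i by simp
qed

lemma support_max_abs: assumes x: "x \<in> cone N k" shows "finite_support (places k) (\<lambda>v. ln (max_abs N v x))"
proof (rule finite_supportI)
  show "finite (\<Union>i\<in>{i. i \<le> N \<and> x i \<noteq> 0}. {v \<in> places k. v (x i) \<noteq> 1})"
    using places_finite_neq_1 coneD(1)[OF x] by auto
  fix v assume v: "v \<in> places k" "v \<notin> (\<Union>i\<in>{i. i \<le> N \<and> x i \<noteq> 0}. {v \<in> places k. v (x i) \<noteq> 1})"
  interpret V: abs_val k v by (rule places_abs_val[OF v(1)])
  obtain i where i: "i \<le> N" "x i \<noteq> 0" using x by (auto simp: cone_def)
  have le: "v (x j) \<le> 1" if "j \<le> N" for j using v that V.v_0 by (cases "x j = 0") auto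
  have "max_abs N v x = 1" using i v by (intro max_abs_eqI[OF i(1)] le) auto
  then show "ln (max_abs N v x) = 0" by simp
qed

definition height :: "nat \<Rightarrow> (nat \<Rightarrow> complex) \<Rightarrow> real" where
  "height N x = (\<Sum>\<^sub>\<infinity>v\<in>places k. weight v * ln (max_abs N v x))"

lemma support_weight_max_abs: "x \<in> cone N k \<Longrightarrow> finite_support (places k) (\<lambda>v. weight v * ln (max_abs N v x))"
  by (intro finite_support_cmult support_max_abs)

lemma height_scale:
  assumes x: "x \<in> cone N k" and c: "c \<in> k" "c \<noteq> 0"
  shows "height N (\<lambda>i. c * x i) = height N x"
proof -
  have "weight v * ln (max_abs N v (\<lambda>i. c * x i)) = weight v * ln (v c) + weight v * ln (max_abs N v x)"
    if v: "v \<in> places k" for v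
  proof -
    interpret V: abs_val k v by (rule places_abs_val[OF v])
    show ?thesis using max_abs_scale[OF v c(1) x] max_abs_pos[OF v x] V.v_pos[OF c]
      by (simp add: ln_mult distrib_left)
  qed
  then have "height N (\<lambda>i. c * x i) = (\<Sum>\<^sub>\<infinity>v\<in>places k. weight v * ln (v c) + weight v * ln (max_abs N v x))"
    unfolding height_def by (intro infsum_cong)
  also have "\<dots> = (\<Sum>\<^sub>\<infinity>v\<in>places k. weight v * ln (v c)) + (\<Sum>\<^sub>\<infinity>v\<in>places k. weight v * ln (max_abs N v x))"
    by (intro infsum_add finite_support_summable finite_support_cmult support_ln c support_max_abs x)
  finally show ?thesis using product_formula_weight[OF c] by (simp add: height_def)
qed

text \<open>\<open>hom_coords\<close> chooses some coordinate vector in \<open>k\<close>; comparing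
  it with \<open>x\<close> at a nonzero coordinate shows that the scaling factor lies in
  \<open>k\<close>, so that the product formula applies to it.\<close>

lemma proj_point_coords:
  assumes x: "x \<in> cone N k"
  obtains c where "c \<in> k" "c \<noteq> 0" "hom_coords N k (proj_point x) = (\<lambda>i. c * x i)"
proof -
  have "\<exists>y. y \<in> cone N k \<and> y \<in> proj_point x"
    using x by (intro exI[of _ x]) (auto simp: proj_point_def intro!: exI[of _ 1])
  then have y: "hom_coords N k (proj_point x) \<in> cone N k" "hom_coords N k (proj_point x) \<in> proj_point x"
    unfolding hom_coords_def by (metis (mono_tags, lifting) someI_ex)+
  then obtain c where c: "c \<noteq> 0" "hom_coords N k (proj_point x) = (\<lambda>i. c * x i)" by (auto simp: proj_point_def)
  obtain i where i: "x i \<noteq> 0" using x by (auto simp: cone_def)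
  have "c = (c * x i) / x i" using i by simp
  moreover have "c * x i \<in> k" using coneD(1)[OF y(1), of i] c(2) by simp
  ultimately have "c \<in> k" using divide coneD(1)[OF x] by metis
  then show ?thesis using that c by blast
qed

lemma weil_height_eq: assumes x: "x \<in> cone N k" shows "weil_height N k (proj_point x) = height N x"
proof -
  obtain c where c: "c \<in> k" "c \<noteq> 0" "hom_coords N k (proj_point x) = (\<lambda>i. c * x i)" using proj_point_coords[OF x] .
  define y where "y = (\<lambda>i. c * x i)"
  have y: "y \<in> cone N k" unfolding y_def by (rule scale_cone[OF x c(1,2)])
  have "ln (Max ((\<lambda>i. norm_abs k v (y i)) ` {..N})) = weight v * ln (max_abs N v y)" if v: "v \<in> places k" for v
  proof -
    interpret V: abs_val k v by (rule places_abs_val[OF v])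
    have w: "weight v \<ge> 0" by (simp add: weight_def)
    obtain i where i: "i \<le> N" "max_abs N v y = v (y i)" by (rule max_abs_attained)
    have "Max ((\<lambda>i. norm_abs k v (y i)) ` {..N}) = max_abs N v y powr weight v"
    proof (rule Max_eqI)
      show "finite ((\<lambda>i. norm_abs k v (y i)) ` {..N})" by simp
      show "max_abs N v y powr weight v \<in> (\<lambda>i. norm_abs k v (y i)) ` {..N}" using i
        by (auto simp: norm_abs_def weight_def)
      fix z assume "z \<in> (\<lambda>i. norm_abs k v (y i)) ` {..N}"
      then obtain j where j: "j \<le> N" "z = v (y j) powr weight v" by (auto simp: norm_abs_def weight_def)
      show "z \<le> max_abs N v y powr weight v" unfolding j(2)
        by (rule powr_mono2[OF w V.nonneg[OF coneD(1)[OF y]] max_abs_ge[OF j(1), of v y]])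
    qed
    then show ?thesis using max_abs_pos[OF v y] by (simp add: ln_powr)
  qed
  then have "weil_height N k (proj_point x) = height N y"
    unfolding weil_height_def height_def c(3) y_def[symmetric] by (intro infsum_cong)
  then show ?thesis using height_scale[OF x c(1,2)] by (simp add: y_def)
qed

lemma poly_eval_in:
  assumes "\<And>m. lk F m \<in> k" "\<And>i. x i \<in> k" shows "poly_eval F x \<in> k"
  unfolding poly_eval_superset[OF Poly_Mapping.finite_keys subset_refl] mev_def
  using assms by (intro sum mult prod power)

text \<open>The real-valued local height off the divisor, on coordinate vectors. The lemmas about it
  assume \<open>poly_eval F x \<noteq> 0\<close>, so the logarithm of 0 never enters.\<close>

definition local_height_at :: "nat \<Rightarrow> nat \<Rightarrow> mpoly \<Rightarrow> (complex \<Rightarrow> real) \<Rightarrow> (nat \<Rightarrow> complex) \<Rightarrow> real" where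
  "local_height_at N e F v x = weight v * (real e * ln (max_abs N v x) - ln (v (poly_eval F x)))"

lemma local_height_at_scale:
  assumes v: "v \<in> places k" and F: "F \<in> forms N k e" and x: "x \<in> cone N k" "poly_eval F x \<noteq> 0" and c: "c \<in> k" "c \<noteq> 0"
  shows "local_height_at N e F v (\<lambda>i. c * x i) = local_height_at N e F v x"
proof -
  interpret V: abs_val k v by (rule places_abs_val[OF v])
  have Fx: "poly_eval F x \<in> k" by (intro poly_eval_in forms_lookup[OF zero F] coneD(1)[OF x(1)])
  have "v (poly_eval F (\<lambda>i. c * x i)) = v c ^ e * v (poly_eval F x)"
    unfolding poly_eval_scale[OF F] using V.v_mult[OF power[OF c(1)] Fx] V.v_power[OF c(1)] by simp
  then have "ln (v (poly_eval F (\<lambda>i. c * x i))) = real e * ln (v c) + ln (v (poly_eval F x))"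
    using V.v_pos[OF c] V.v_pos[OF Fx x(2)] by (simp add: ln_mult ln_realpow)
  moreover have "ln (max_abs N v (\<lambda>i. c * x i)) = ln (v c) + ln (max_abs N v x)"
    using max_abs_scale[OF v c(1) x(1)] V.v_pos[OF c] max_abs_pos[OF v x(1)] by (simp add: ln_mult)
  ultimately show ?thesis by (simp add: local_height_at_def algebra_simps)
qed

lemma local_height_eq:
  assumes v: "v \<in> places k" and F: "F \<in> forms N k e" and x: "x \<in> cone N k" "poly_eval F x \<noteq> 0"
  shows "local_height N k e F v (proj_point x) = ereal (local_height_at N e F v x)"
proof -
  interpret V: abs_val k v by (rule places_abs_val[OF v])
  obtain c where c: "c \<in> k" "c \<noteq> 0" "hom_coords N k (proj_point x) = (\<lambda>i. c * x i)" using proj_point_coords[OF x(1)] .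
  define y where "y = (\<lambda>i. c * x i)"
  have y: "y \<in> cone N k" unfolding y_def by (rule scale_cone[OF x(1) c(1,2)])
  have Fy: "poly_eval F y \<noteq> 0" unfolding y_def poly_eval_scale[OF F] using x(2) c(2) by simp
  have Fyk: "poly_eval F y \<in> k" by (intro poly_eval_in forms_lookup[OF zero F] coneD(1)[OF y])
  have w: "weight v \<ge> 0" by (simp add: weight_def)
  have pv: "place_val k v z = ereal (- (weight v * ln (v z)))" if "z \<noteq> 0" "z \<in> k" for z
    using that V.v_pos[OF that(2,1)] by (simp add: place_val_def norm_abs_def weight_def ln_powr)
  obtain i where i: "i \<le> N" "max_abs N v y = v (y i)" by (rule max_abs_attained)
  have yi: "y i \<noteq> 0" using max_abs_pos[OF v y] i V.v_0 by auto
  have "Min ((\<lambda>i. place_val k v (y i)) ` {..N}) = ereal (- (weight v * ln (max_abs N v y)))"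
  proof (rule Min_eqI)
    show "finite ((\<lambda>i. place_val k v (y i)) ` {..N})" by simp
    show "ereal (- (weight v * ln (max_abs N v y))) \<in> (\<lambda>i. place_val k v (y i)) ` {..N}"
      by (rule image_eqI[of _ _ i]) (simp_all add: i pv[OF yi coneD(1)[OF y]])
    fix z assume "z \<in> (\<lambda>i. place_val k v (y i)) ` {..N}"
    then obtain j where j: "j \<le> N" "z = place_val k v (y j)" by auto
    show "ereal (- (weight v * ln (max_abs N v y))) \<le> z"
    proof (cases "y j = 0")
      case True then show ?thesis by (simp add: j(2) place_val_def)
    next
      case False
      have "ln (v (y j)) \<le> ln (max_abs N v y)"
        using max_abs_ge[OF j(1), of v y] V.v_pos[OF coneD(1)[OF y] False] by simp
      then show ?thesis unfolding j(2) pv[OF False coneD(1)[OF y]] using w by (simp add: mult_left_mono)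
    qed
  qed
  then have "local_height N k e F v (proj_point x) = ereal (local_height_at N e F v y)"
    unfolding local_height_def c(3) y_def[symmetric] pv[OF Fy Fyk] local_height_at_def by (simp add: algebra_simps)
  then show ?thesis unfolding y_def using local_height_at_scale[OF v F x c(1,2)] by simp
qed

lemma support_local_height_at:
  assumes F: "F \<in> forms N k e" and x: "x \<in> cone N k" "poly_eval F x \<noteq> 0"
  shows "finite_support (places k) (\<lambda>v. local_height_at N e F v x)"
  unfolding local_height_at_def
  by (intro finite_support_cmult finite_support_diff support_max_abs support_ln x poly_eval_in forms_lookup[OF zero F] coneD(1)[OF x(1)])

text \<open>By the product formula the values of the form cancel, and only the degree times the
  height remains.\<close>

lemma sum_local_height_at:
  assumes F: "F \<in> forms N k e" and x: "x \<in> cone N k" "poly_eval F x \<noteq> 0"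
  shows "(\<Sum>\<^sub>\<infinity>v\<in>places k. local_height_at N e F v x) = real e * height N x"
proof -
  have Fx: "poly_eval F x \<in> k" by (intro poly_eval_in forms_lookup[OF zero F] coneD(1)[OF x(1)])
  have "(\<Sum>\<^sub>\<infinity>v\<in>places k. local_height_at N e F v x) =
      (\<Sum>\<^sub>\<infinity>v\<in>places k. real e * (weight v * ln (max_abs N v x)) + - (weight v * ln (v (poly_eval F x))))"
    by (intro infsum_cong) (simp add: local_height_at_def algebra_simps)
  also have "\<dots> = (\<Sum>\<^sub>\<infinity>v\<in>places k. real e * (weight v * ln (max_abs N v x))) +
      (\<Sum>\<^sub>\<infinity>v\<in>places k. - (weight v * ln (v (poly_eval F x))))"
    by (intro infsum_add finite_support_summable finite_support_uminus finite_support_cmult support_ln support_max_abs x Fx)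
  also have "(\<Sum>\<^sub>\<infinity>v\<in>places k. real e * (weight v * ln (max_abs N v x))) = real e * height N x"
    unfolding height_def by (intro infsum_cmult_right finite_support_summable support_weight_max_abs x)
  also have "(\<Sum>\<^sub>\<infinity>v\<in>places k. - (weight v * ln (v (poly_eval F x)))) = 0"
    using product_formula_weight[OF Fx x(2)] by (simp add: infsum_uminus)
  finally show ?thesis by simp
qed

text \<open>Multiplicative error constants that are trivial at almost all places, so their
  logarithms sum to a finite total. The lower bound 1 makes a product of two such constants dominate
  each factor.\<close>

definition place_const :: "((complex \<Rightarrow> real) \<Rightarrow> real) \<Rightarrow> bool" where
  "place_const C \<longleftrightarrow> (\<forall>v\<in>places k. C v \<ge> 1) \<and> finite {v \<in> places k. C v \<noteq> 1}"

lemma place_const_mult: "place_const C \<Longrightarrow> place_const C' \<Longrightarrow> place_const (\<lambda>v. C v * C' v)"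
proof -
  assume *: "place_const C" "place_const C'"
  have "1 * 1 \<le> C v * C' v" if "v \<in> places k" for v
    using * that by (intro mult_mono) (auto simp: place_const_def)
  moreover have "finite {v \<in> places k. C v * C' v \<noteq> 1}"
    by (rule finite_subset[of _ "{v \<in> places k. C v \<noteq> 1} \<union> {v \<in> places k. C' v \<noteq> 1}"]) (use * in \<open>auto simp: place_const_def\<close>)
  ultimately show ?thesis by (simp add: place_const_def)
qed

lemma support_place_const: "place_const C \<Longrightarrow> finite_support (places k) (\<lambda>v. weight v * ln (C v))"
  unfolding place_const_def by (elim conjE, rule finite_support_cmult, rule finite_supportI) auto

lemma place_const_family:
  assumes "finite I" "\<And>i. i \<in> I \<Longrightarrow> place_const (C i)"
  obtains C' where "place_const C'" "\<And>i v. i \<in> I \<Longrightarrow> v \<in> places k \<Longrightarrow> C i v \<le> C' v"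
proof -
  have "\<exists>C'. place_const C' \<and> (\<forall>i\<in>I. \<forall>v\<in>places k. C i v \<le> C' v)"
    using assms
  proof (induction I rule: finite_induct)
    case empty
    then show ?case by (intro exI[of _ "\<lambda>_. 1"]) (simp add: place_const_def)
  next
    case (insert j I)
    then obtain C' where C': "place_const C'" "\<forall>i\<in>I. \<forall>v\<in>places k. C i v \<le> C' v" by auto
    have Cj: "place_const (C j)" using insert by simp
    have "C j v * 1 \<le> C j v * C' v" "1 * C' v \<le> C j v * C' v" if "v \<in> places k" for v
      using Cj C'(1) that unfolding place_const_def by (intro mult_left_mono mult_right_mono; force)+
    then have "\<forall>i\<in>insert j I. \<forall>v\<in>places k. C i v \<le> C j v * C' v" using C'(2) by fastforce
    then show ?case using place_const_mult[OF Cj C'(1)] by (intro exI[of _ "\<lambda>v. C j v * C' v"]) simp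
  qed
  then show ?thesis using that by blast
qed

text \<open>Only archimedean places pay for the number of terms. The extra 1 keeps the factor at
  least 1 even for an empty \<open>I\<close>, as \<open>place_const\<close> requires.\<close>

lemma sum_bound:
  assumes v: "v \<in> places k" and I: "finite I" and a: "\<And>i. i \<in> I \<Longrightarrow> a i \<in> k" "\<And>i. i \<in> I \<Longrightarrow> v (a i) \<le> B" and B: "B \<ge> 0"
  shows "v (\<Sum>i\<in>I. a i) \<le> (if v \<in> archp then 1 + real (card I) else 1) * B"
proof (cases "v \<in> archp")
  case True
  interpret V: abs_val k v by (rule places_abs_val[OF v])
  have "v (\<Sum>i\<in>I. a i) \<le> (\<Sum>i\<in>I. v (a i))" using V.v_sum[of I a] I a by simp
  also have "\<dots> \<le> (\<Sum>i\<in>I. B)" using a(2) by (rule sum_mono)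
  also have "\<dots> \<le> (1 + real (card I)) * B" using B by (simp add: algebra_simps)
  finally show ?thesis using True by simp
next
  case False
  have "v (\<Sum>i\<in>I. a i) \<le> B"
    by (rule ultrametric_sum_le[OF places_abs_val[OF v] nonarch_ultrametric]) (use v False a B I in auto)
  then show ?thesis using False by simp
qed

lemma place_const_arch: "place_const (\<lambda>v. if v \<in> archp then 1 + real c else 1)"
  unfolding place_const_def using finite_archp
  by (auto intro!: finite_subset[of "{v \<in> places k. _ v}" archp])

text \<open>The constant is uniform over coordinate vectors with entries of size at most 1, to which
  every point can be scaled at a given place.\<close>

lemma poly_eval_bound:
  assumes F: "\<And>m. lk F m \<in> k"
  obtains C where "place_const C"
    "\<And>v x. v \<in> places k \<Longrightarrow> (\<And>i. x i \<in> k) \<Longrightarrow> (\<And>i. v (x i) \<le> 1) \<Longrightarrow> v (poly_eval F x) \<le> C v"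
proof -
  have pc: "place_const (\<lambda>v. if v \<in> places k then max 1 (v (lk F m)) else 1)" if "m \<in> ks F" for m
    unfolding place_const_def
    by (auto intro!: finite_subset[OF _ places_finite_neq_1[of "lk F m"]] simp: F that in_keys_iff[symmetric])
  obtain C where C: "place_const C" "\<And>m v. m \<in> ks F \<Longrightarrow> v \<in> places k \<Longrightarrow> (if v \<in> places k then max 1 (v (lk F m)) else 1) \<le> C v"
    using place_const_family[of "ks F" "\<lambda>m v. if v \<in> places k then max 1 (v (lk F m)) else 1"] pc by auto
  define C' where "C' = (\<lambda>v. (if v \<in> archp then 1 + real (card (ks F)) else 1) * C v)"
  have "v (poly_eval F x) \<le> C' v" if v: "v \<in> places k" and x: "\<And>i. x i \<in> k" "\<And>i. v (x i) \<le> 1" for v x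
  proof -
    interpret V: abs_val k v by (rule places_abs_val[OF v])
    have mk: "mev m x \<in> k" for m unfolding mev_def using x(1) by (intro prod power)
    have "v (mev m x) \<le> 1" for m
      unfolding mev_def using x V.nonneg by (simp add: V.v_prod V.v_power power) (intro prod_le_1, auto intro: power_le_one)
    then have "v (lk F m * mev m x) \<le> C v" if "m \<in> ks F" for m
      using V.v_mult[OF F mk, of m m] C(2)[OF that v] v V.nonneg[OF F, of m] V.nonneg[OF mk, of m]
        mult_left_mono[of "v (mev m x)" 1 "v (lk F m)"] by fastforce
    moreover have "C v \<ge> 0" using C(1) v by (force simp: place_const_def)
    ultimately show ?thesis unfolding C'_def poly_eval_superset[OF Poly_Mapping.finite_keys subset_refl]
      by (intro sum_bound v mult F mk) auto
  qed
  moreover have "place_const C'" unfolding C'_def by (intro place_const_mult place_const_arch C)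
  ultimately show ?thesis using that by blast
qed

text \<open>After scaling at \<open>v\<close> to maximal coordinate 1, the local height is a
  weighted minus logarithm of the value of the form, which \<open>poly_eval_bound\<close>
  controls.\<close>

lemma local_height_at_lower:
  assumes F: "F \<in> forms N k e"
  obtains C where "place_const C"
    "\<And>v x. v \<in> places k \<Longrightarrow> x \<in> cone N k \<Longrightarrow> poly_eval F x \<noteq> 0 \<Longrightarrow> - (weight v * ln (C v)) \<le> local_height_at N e F v x"
proof -
  obtain C where C: "place_const C"
    "\<And>v x. v \<in> places k \<Longrightarrow> (\<And>i. x i \<in> k) \<Longrightarrow> (\<And>i. v (x i) \<le> 1) \<Longrightarrow> v (poly_eval F x) \<le> C v"
    using poly_eval_bound[of F] forms_lookup[OF zero F] by blast
  have "- (weight v * ln (C v)) \<le> local_height_at N e F v x"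
    if v: "v \<in> places k" and x: "x \<in> cone N k" "poly_eval F x \<noteq> 0" for v x
  proof -
    interpret V: abs_val k v by (rule places_abs_val[OF v])
    obtain c where c: "c \<in> k" "c \<noteq> 0" "max_abs N v (\<lambda>i. c * x i) = 1" using normalize[OF v x(1)] .
    define y where "y = (\<lambda>i. c * x i)"
    have y: "y \<in> cone N k" unfolding y_def by (rule scale_cone[OF x(1) c(1,2)])
    have Fy: "poly_eval F y \<noteq> 0" unfolding y_def poly_eval_scale[OF F] using x(2) c(2) by simp
    have Fyk: "poly_eval F y \<in> k" by (intro poly_eval_in forms_lookup[OF zero F] coneD(1)[OF y])
    have "v (y i) \<le> 1" for i
    proof (cases "i \<le> N")
      case True then show ?thesis using max_abs_ge[of i N v y] c(3) by (simp add: y_def)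
    next
      case False then show ?thesis using coneD(2)[OF y, of i] V.v_0 by simp
    qed
    then have "v (poly_eval F y) \<le> C v" using C(2) v coneD(1)[OF y] by blast
    then have "ln (v (poly_eval F y)) \<le> ln (C v)" using V.v_pos[OF Fyk Fy] by simp
    then have "weight v * ln (v (poly_eval F y)) \<le> weight v * ln (C v)" by (rule mult_left_mono[OF _ weight_nonneg])
    then have "- (weight v * ln (C v)) \<le> local_height_at N e F v y"
      using c(3) by (simp add: local_height_at_def y_def[symmetric])
    then show ?thesis unfolding y_def using local_height_at_scale[OF v F x c(1,2)] by simp
  qed
  then show ?thesis using that C(1) by blast
qed

text \<open>The difference of the two local heights is the local height of the cofactor
  \<open>G\<close>, bounded below by the same scaling as in
  \<open>local_height_at_lower\<close>.\<close>

lemma local_height_at_factor: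
  assumes E: "E \<in> forms N k e" and A: "A \<in> forms N k a" and G: "\<And>m. lk G m \<in> k" and eq: "E = A * G"
  obtains C where "place_const C"
    "\<And>v x. v \<in> places k \<Longrightarrow> x \<in> cone N k \<Longrightarrow> poly_eval E x \<noteq> 0 \<Longrightarrow>
       local_height_at N a A v x - weight v * ln (C v) \<le> local_height_at N e E v x"
proof -
  obtain C where C: "place_const C"
    "\<And>v x. v \<in> places k \<Longrightarrow> (\<And>i. x i \<in> k) \<Longrightarrow> (\<And>i. v (x i) \<le> 1) \<Longrightarrow> v (poly_eval G x) \<le> C v"
    using poly_eval_bound[of G] G by blast
  have "local_height_at N a A v x - weight v * ln (C v) \<le> local_height_at N e E v x"
    if v: "v \<in> places k" and x: "x \<in> cone N k" "poly_eval E x \<noteq> 0" for v x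
  proof -
    interpret V: abs_val k v by (rule places_abs_val[OF v])
    have Ax: "poly_eval A x \<noteq> 0" using x(2) by (auto simp: eq poly_eval_mult)
    obtain c where c: "c \<in> k" "c \<noteq> 0" "max_abs N v (\<lambda>i. c * x i) = 1" using normalize[OF v x(1)] .
    define y where "y = (\<lambda>i. c * x i)"
    have y: "y \<in> cone N k" unfolding y_def by (rule scale_cone[OF x(1) c(1,2)])
    have "poly_eval E y \<noteq> 0" unfolding y_def poly_eval_scale[OF E] using x(2) c(2) by simp
    then have nz: "poly_eval A y \<noteq> 0" "poly_eval G y \<noteq> 0" by (auto simp: eq poly_eval_mult)
    have Ay: "poly_eval A y \<in> k" by (intro poly_eval_in forms_lookup[OF zero A] coneD(1)[OF y])
    have Gy: "poly_eval G y \<in> k" by (intro poly_eval_in G coneD(1)[OF y])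
    have "v (y i) \<le> 1" for i
    proof (cases "i \<le> N")
      case True then show ?thesis using max_abs_ge[of i N v y] c(3) by (simp add: y_def)
    next
      case False then show ?thesis using coneD(2)[OF y, of i] V.v_0 by simp
    qed
    then have "v (poly_eval G y) \<le> C v" using C(2) v coneD(1)[OF y] by blast
    then have "ln (v (poly_eval G y)) \<le> ln (C v)" using V.v_pos[OF Gy nz(2)] by simp
    then have w: "weight v * ln (v (poly_eval G y)) \<le> weight v * ln (C v)"
      by (rule mult_left_mono[OF _ weight_nonneg])
    have "ln (v (poly_eval E y)) = ln (v (poly_eval A y)) + ln (v (poly_eval G y))"
      using V.v_mult[OF Ay Gy] V.v_pos[OF Ay nz(1)] V.v_pos[OF Gy nz(2)] by (simp add: eq poly_eval_mult ln_mult)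
    then have "local_height_at N a A v y - weight v * ln (C v) \<le> local_height_at N e E v y"
      using c(3) w by (simp add: local_height_at_def y_def[symmetric] algebra_simps)
    then show ?thesis unfolding y_def
      using local_height_at_scale[OF v E x c(1,2)] local_height_at_scale[OF v A x(1) Ax c(1,2)] by simp
  qed
  then show ?thesis using that C(1) by blast
qed

end

subsection \<open>Heights under morphisms\<close>

lemma proj_point_scale: "c \<noteq> 0 \<Longrightarrow> proj_point (\<lambda>i. c * x i) = proj_point x"
proof -
  assume c: "c \<noteq> 0"
  show ?thesis
  proof (intro equalityI subsetI)
    fix y assume "y \<in> proj_point (\<lambda>i. c * x i)"
    then obtain b where "b \<noteq> 0" "y = (\<lambda>i. (b * c) * x i)" by (auto simp: proj_point_def mult.assoc)
    then show "y \<in> proj_point x" using c unfolding proj_point_def by (intro CollectI exI[of _ "b * c"]) simp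
  next
    fix y assume "y \<in> proj_point x"
    then obtain b where "b \<noteq> 0" "y = (\<lambda>i. b * x i)" by (auto simp: proj_point_def)
    then show "y \<in> proj_point (\<lambda>i. c * x i)" using c unfolding proj_point_def
      by (intro CollectI exI[of _ "b / c"]) simp
  qed
qed

definition map_coords :: "nat \<Rightarrow> (nat \<Rightarrow> mpoly) \<Rightarrow> (nat \<Rightarrow> complex) \<Rightarrow> (nat \<Rightarrow> complex)" where
  "map_coords N g x = (\<lambda>i. if i \<le> N then poly_eval (g i) x else 0)"

lemma poly_eval_map_coords:
  "F \<in> forms N K e \<Longrightarrow> poly_eval F (map_coords N g x) = poly_eval (poly_subst F g) x"
  unfolding poly_eval_subst by (rule poly_eval_cong[of F N K e]) (simp_all add: map_coords_def)

lemma field_degree_pos: assumes "number_field k" shows "field_degree k > 0"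
proof (rule ccontr)
  assume "\<not> field_degree k > 0"
  then have d0: "CR.dim \<rat> k = 0" by (simp add: field_degree_def)
  have sq: "subfield \<rat> complex_ring" by (rule cfield_imp_subfield[OF cfield_Rats])
  have "CR.dimension (CR.dim \<rat> k) \<rat> k"
    using CR.finite_dimensionE[OF sq] assms unfolding number_field_def over_def by blast
  then have "k = {\<zero>\<^bsub>complex_ring\<^esub>}" unfolding d0 by (rule CR.dimension_zero[OF sq])
  moreover have "cfield k" by (rule subfield_imp_cfield) (use assms in \<open>simp add: number_field_def\<close>)
  then have "0 \<in> k" "1 \<in> k" using cfield.zero cfield.one by blast+
  ultimately show False by (metis singletonD zero_neq_one)
qed

context cfield
begin

lemma map_coords_cone:
  assumes g: "\<And>i. i \<le> N \<Longrightarrow> g i \<in> forms N K d" and x: "x \<in> cone N K"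
    and nz: "\<exists>i\<le>N. poly_eval (g i) x \<noteq> 0"
  shows "map_coords N g x \<in> cone N K"
proof -
  have "poly_eval (g i) x \<in> K" if i: "i \<le> N" for i
    unfolding poly_eval_superset[OF finite_mons forms_keys[OF g[OF i]]] mev_def
  proof (intro sum mult prod power)
    fix m j assume "m \<in> mons N d" "j \<in> ks m"
    then have "j \<le> N" by (auto simp: mons_def)
    then show "x j \<in> K" using x by (auto simp: cone_def)
  qed (rule forms_lookup[OF zero g[OF i]])
  then show ?thesis using nz by (auto simp: cone_def map_coords_def)
qed

lemma iterate_forms_in:
  assumes "\<And>i. i \<le> N \<Longrightarrow> \<phi> i \<in> forms N K d"
  shows "i \<le> N \<Longrightarrow> iterate_forms \<phi> n i \<in> forms N K (d ^ n)"
proof (induction n arbitrary: i)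
  case 0
  then show ?case using forms_var[of i N] by simp
next
  case (Suc n)
  then show ?case using forms_subst[OF assms Suc.IH, of i] by simp
qed

end

lemma map_coords_iterate:
  assumes "\<And>i. i \<le> N \<Longrightarrow> \<phi> i \<in> forms N K d" and x: "x \<in> cone N L"
  shows "map_coords N (iterate_forms \<phi> (Suc n)) x = map_coords N \<phi> (map_coords N (iterate_forms \<phi> n) x)"
proof (rule ext)
  fix i
  show "map_coords N (iterate_forms \<phi> (Suc n)) x i = map_coords N \<phi> (map_coords N (iterate_forms \<phi> n) x) i"
    using poly_eval_map_coords[OF assms(1), of i "iterate_forms \<phi> n" x] by (cases "i \<le> N") (simp_all add: map_coords_def)
qed

lemma map_coords_iterate_0: "x \<in> cone N L \<Longrightarrow> map_coords N (iterate_forms \<phi> 0) x = x"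
  by (auto simp: map_coords_def cone_def)

lemma iterate_nonzero:
  assumes \<phi>: "\<And>i. i \<le> N \<Longrightarrow> \<phi> i \<in> forms N Qbar d"
    and nz: "\<And>x. x \<in> cone N Qbar \<Longrightarrow> \<exists>i\<le>N. poly_eval (\<phi> i) x \<noteq> 0" and x: "x \<in> cone N Qbar"
  shows "map_coords N (iterate_forms \<phi> n) x \<in> cone N Qbar"
proof (induction n)
  case 0
  then show ?case using map_coords_iterate_0[OF x] x by simp
next
  case (Suc n)
  have eq: "map_coords N (iterate_forms \<phi> (Suc n)) x = map_coords N \<phi> (map_coords N (iterate_forms \<phi> n) x)"
    by (rule map_coords_iterate[of N \<phi> Qbar d, OF \<phi> x])
  show ?case unfolding eq by (rule Qbar.map_coords_cone[OF \<phi> Suc nz[OF Suc]])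
qed

lemma proj_map_iterate:
  assumes k: "k \<subseteq> Qbar" "cfield k" and \<phi>: "\<And>i. i \<le> N \<Longrightarrow> \<phi> i \<in> forms N k d"
    and nz: "\<And>x. x \<in> cone N Qbar \<Longrightarrow> \<exists>i\<le>N. poly_eval (\<phi> i) x \<noteq> 0" and R: "R \<in> proj_space N k"
  shows "(proj_map N \<phi> ^^ n) R = proj_map N (iterate_forms \<phi> n) R" "(proj_map N \<phi> ^^ n) R \<in> proj_space N k"
proof -
  interpret cfield k by fact
  obtain x where x: "x \<in> cone N k" "R = proj_point x" using R by (auto simp: proj_space_def)
  have pm: "proj_map N (iterate_forms \<phi> n) R = proj_point (map_coords N (iterate_forms \<phi> n) x)" for n
    unfolding x(2) map_coords_def by (rule proj_map_point[where d = "d ^ n"]) (rule iterate_forms_in[OF \<phi>])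
  have "map_coords N (iterate_forms \<phi> n) x \<in> cone N k \<and> (proj_map N \<phi> ^^ n) R = proj_point (map_coords N (iterate_forms \<phi> n) x)"
  proof (induction n)
    case 0
    then show ?case using map_coords_iterate_0[OF x(1), of \<phi>] x by simp
  next
    case (Suc n)
    define y where "y = map_coords N (iterate_forms \<phi> n) x"
    have y: "y \<in> cone N k" "(proj_map N \<phi> ^^ n) R = proj_point y" using Suc by (simp_all add: y_def)
    have eq: "map_coords N (iterate_forms \<phi> (Suc n)) x = map_coords N \<phi> y"
      unfolding y_def by (rule map_coords_iterate[of N \<phi> k d, OF \<phi> x(1)])
    have "map_coords N \<phi> y \<in> cone N k"
      using cone_mono[OF k(1)] y(1) by (intro map_coords_cone[of N \<phi> d] \<phi> nz) auto
    moreover have "(proj_map N \<phi> ^^ Suc n) R = proj_point (map_coords N \<phi> y)"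
      using proj_map_point[of N \<phi> k d y, OF \<phi>] y(2) by (simp add: map_coords_def)
    ultimately show ?case unfolding eq by blast
  qed
  then show "(proj_map N \<phi> ^^ n) R = proj_map N (iterate_forms \<phi> n) R" "(proj_map N \<phi> ^^ n) R \<in> proj_space N k"
    unfolding pm by (auto simp: proj_space_def)
qed

context number_field_gen
begin

text \<open>One coordinate is scaled to 1; then the height of every coordinate, as an element of
  \<open>k\<close>, is at most the height of the point.\<close>

theorem northcott_points:
  assumes nf: "number_field k" shows "finite {Q \<in> proj_space N k. weil_height N k Q \<le> B}"
proof -
  define fd where "fd = real (field_degree k)"
  have fd: "fd > 0" using field_degree_pos[OF nf] by (simp add: fd_def)
  define Y where "Y = {y \<in> k. (\<Sum>\<^sub>\<infinity>v\<in>places k. real (local_degree k v) * ln (max 1 (v y))) \<le> fd * B}"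
  have Y: "finite Y" unfolding Y_def by (rule northcott)
  define T where "T = {x. \<forall>i. (i \<in> {..N} \<longrightarrow> x i \<in> Y) \<and> (i \<notin> {..N} \<longrightarrow> x i = 0)}"
  have "finite T" unfolding T_def by (rule finite_set_of_finite_funs) (simp_all add: Y)
  moreover have "{Q \<in> proj_space N k. weil_height N k Q \<le> B} \<subseteq> proj_point ` T"
  proof
    fix Q assume "Q \<in> {Q \<in> proj_space N k. weil_height N k Q \<le> B}"
    then obtain x0 where x0: "x0 \<in> cone N k" "Q = proj_point x0" and hQ: "weil_height N k Q \<le> B" by (auto simp: proj_space_def)
    obtain i where i: "i \<le> N" "x0 i \<noteq> 0" using x0(1) by (auto simp: cone_def)
    define c where "c = inverse (x0 i)"
    have c: "c \<in> k" "c \<noteq> 0" using i inverse coneD(1)[OF x0(1)] by (auto simp: c_def)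
    define x where "x = (\<lambda>i. c * x0 i)"
    have x: "x \<in> cone N k" unfolding x_def by (rule scale_cone[OF x0(1) c])
    have xi: "x i = 1" using i by (simp add: x_def c_def)
    have Qx: "Q = proj_point x" unfolding x_def x0(2) by (rule proj_point_scale[OF c(2), symmetric])
    have "x j \<in> Y" if j: "j \<le> N" for j
    proof -
      have xj: "x j \<in> k" by (rule coneD(1)[OF x])
      have supp: "finite_support (places k) (\<lambda>v. ln (max 1 (v (x j))))"
      proof (cases "x j = 0")
        case True
        have "max 1 (v 0) = 1" if "v \<in> places k" for v using abs_val.v_0[OF places_abs_val[OF that]] by simp
        then show ?thesis using True by (intro finite_supportI[of "{}"]) auto
      next
        case False
        then show ?thesis by (intro finite_supportI[OF places_finite_neq_1[OF xj False]]) auto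
      qed
      have "(\<Sum>\<^sub>\<infinity>v\<in>places k. real (local_degree k v) * ln (max 1 (v (x j)))) =
          (\<Sum>\<^sub>\<infinity>v\<in>places k. fd * (weight v * ln (max 1 (v (x j)))))"
        using fd by (intro infsum_cong) (simp add: weight_def fd_def)
      also have "\<dots> = fd * (\<Sum>\<^sub>\<infinity>v\<in>places k. weight v * ln (max 1 (v (x j))))"
        by (intro infsum_cmult_right finite_support_summable finite_support_cmult supp)
      also have "\<dots> \<le> fd * height N x"
      proof -
        have "weight v * ln (max 1 (v (x j))) \<le> weight v * ln (max_abs N v x)" if v: "v \<in> places k" for v
        proof -
          interpret V: abs_val k v by (rule places_abs_val[OF v])
          have "max 1 (v (x j)) \<le> max_abs N v x"
            using max_abs_ge[OF i(1), of v x] max_abs_ge[OF j, of v x] xi V.v_1 by simp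
          then have "ln (max 1 (v (x j))) \<le> ln (max_abs N v x)" by simp
          then show ?thesis by (rule mult_left_mono[OF _ weight_nonneg])
        qed
        then have "(\<Sum>\<^sub>\<infinity>v\<in>places k. weight v * ln (max 1 (v (x j)))) \<le> height N x"
          unfolding height_def by (intro infsum_le finite_support_cmult supp support_max_abs x)
        then show ?thesis using fd by simp
      qed
      also have "\<dots> \<le> fd * B" using hQ fd weil_height_eq[OF x] Qx by simp
      finally show ?thesis using xj by (simp add: Y_def)
    qed
    then have "x \<in> T" using coneD(2)[OF x] by (simp add: T_def)
    then show "Q \<in> proj_point ` T" using Qx by blast
  qed
  ultimately show ?thesis by (meson finite_imageI finite_subset)
qed

text \<open>The upper bound comes from the size of the coefficients. For the lower one, a power of a
  coordinate of maximal size is expressed through the \<open>g i\<close> by the Nullstellensatz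
  identities, so the values of the \<open>g i\<close> cannot all be small.\<close>

lemma morphism_bound:
  assumes g: "\<And>i. i \<le> N \<Longrightarrow> g i \<in> forms N k d"
    and nz: "\<And>x. x \<in> cone N Qbar \<Longrightarrow> \<exists>i\<le>N. poly_eval (g i) x \<noteq> 0"
  obtains C where "place_const C"
    "\<And>v x. v \<in> places k \<Longrightarrow> x \<in> cone N k \<Longrightarrow>
       \<bar>ln (max_abs N v (map_coords N g x)) - real d * ln (max_abs N v x)\<bar> \<le> ln (C v)"
proof -
  obtain e A where A: "\<And>i j. i \<le> N \<Longrightarrow> j \<le> N \<Longrightarrow> A j i \<in> forms N k e"
    "\<And>j. j \<le> N \<Longrightarrow> poly_var j ^ (e + d) = (\<Sum>i\<le>N. A j i * g i)"
  proof (rule nullstellensatz_descent[OF cfield_axioms k_Qbar, of N g d])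
    show "g i \<in> forms N k d" if "i \<le> N" for i by (rule g[OF that])
    show "\<exists>i\<le>N. poly_eval (g i) x \<noteq> 0" if "x \<in> cone N Qbar" for x by (rule nz[OF that])
  qed (rule that; assumption)
  have pb: "\<exists>C. place_const C \<and> (\<forall>v\<in>places k. \<forall>x. (\<forall>i. x i \<in> k \<and> v (x i) \<le> 1) \<longrightarrow> v (poly_eval F x) \<le> C v)"
    if F: "F \<in> forms N k a" for F a
  proof -
    obtain C where C: "place_const C"
      "\<And>v x. v \<in> places k \<Longrightarrow> (\<And>i. x i \<in> k) \<Longrightarrow> (\<And>i. v (x i) \<le> 1) \<Longrightarrow> v (poly_eval F x) \<le> C v"
      using poly_eval_bound[of F] forms_lookup[OF zero F] by blast
    show ?thesis by (intro exI[of _ C] conjI C(1) ballI allI impI) (intro C(2); blast)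
  qed
  have "\<forall>i\<in>{..N}. \<exists>C. place_const C \<and> (\<forall>v\<in>places k. \<forall>x. (\<forall>i. x i \<in> k \<and> v (x i) \<le> 1) \<longrightarrow> v (poly_eval (g i) x) \<le> C v)"
    using pb[OF g] by simp
  from bchoice[OF this] obtain Cg where Cg0: "\<forall>i\<in>{..N}. place_const (Cg i) \<and>
    (\<forall>v\<in>places k. \<forall>x. (\<forall>i. x i \<in> k \<and> v (x i) \<le> 1) \<longrightarrow> v (poly_eval (g i) x) \<le> Cg i v)" ..
  have Cg: "i \<in> {..N} \<Longrightarrow> place_const (Cg i)"
    "i \<le> N \<Longrightarrow> v \<in> places k \<Longrightarrow> (\<forall>i. x i \<in> k \<and> v (x i) \<le> 1) \<Longrightarrow> v (poly_eval (g i) x) \<le> Cg i v" for i v x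
    using Cg0 by simp_all
  obtain C1 where C1: "place_const C1" "\<And>i v. i \<in> {..N} \<Longrightarrow> v \<in> places k \<Longrightarrow> Cg i v \<le> C1 v"
    using place_const_family[of "{..N}" Cg] Cg(1) by auto
  have "\<forall>p\<in>{..N} \<times> {..N}. \<exists>C. place_const C \<and>
      (\<forall>v\<in>places k. \<forall>x. (\<forall>i. x i \<in> k \<and> v (x i) \<le> 1) \<longrightarrow> v (poly_eval (A (fst p) (snd p)) x) \<le> C v)"
    using pb[OF A(1)] by simp
  from bchoice[OF this] obtain CA where CA0: "\<forall>p\<in>{..N} \<times> {..N}. place_const (CA p) \<and>
      (\<forall>v\<in>places k. \<forall>x. (\<forall>i. x i \<in> k \<and> v (x i) \<le> 1) \<longrightarrow> v (poly_eval (A (fst p) (snd p)) x) \<le> CA p v)" ..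
  have CA: "p \<in> {..N} \<times> {..N} \<Longrightarrow> place_const (CA p)"
    "i \<le> N \<Longrightarrow> j \<le> N \<Longrightarrow> v \<in> places k \<Longrightarrow> (\<forall>i. x i \<in> k \<and> v (x i) \<le> 1) \<Longrightarrow> v (poly_eval (A j i) x) \<le> CA (j, i) v" for p i j v x
    using bspec[OF CA0, of p] bspec[OF CA0, of "(j, i)"] by (blast, simp)
  obtain C2 where C2: "place_const C2" "\<And>p v. p \<in> {..N} \<times> {..N} \<Longrightarrow> v \<in> places k \<Longrightarrow> CA p v \<le> C2 v"
    using place_const_family[of "{..N} \<times> {..N}" CA] CA(1) by auto
  define ar where "ar = (\<lambda>v. if v \<in> archp then 1 + real (card {..N}) else 1)"
  \<comment> \<open>One constant for both directions: \<open>C1\<close> bounds the values of the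
    \<open>g i\<close>, the remaining factor those of the cofactors \<open>A j i\<close> and the
    number of terms.\<close>
  define C where "C = (\<lambda>v. C1 v * (ar v * C2 v))"
  have arC: "place_const (\<lambda>v. ar v * C2 v)" unfolding ar_def by (intro place_const_mult place_const_arch C2)
  have C: "place_const C" unfolding C_def by (intro place_const_mult arC C1)
  have "\<bar>ln (max_abs N v (map_coords N g x)) - real d * ln (max_abs N v x)\<bar> \<le> ln (C v)"
    if v: "v \<in> places k" and x: "x \<in> cone N k" for v x
  proof -
    interpret V: abs_val k v by (rule places_abs_val[OF v])
    have img: "map_coords N g z \<in> cone N k" if "z \<in> cone N k" for z
      using cone_mono[OF k_Qbar] that by (intro map_coords_cone[of N g d] g nz) auto
    obtain c where c: "c \<in> k" "c \<noteq> 0" "max_abs N v (\<lambda>i. c * x i) = 1" using normalize[OF v x] .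
    define y where "y = (\<lambda>i. c * x i)"
    have y: "y \<in> cone N k" unfolding y_def by (rule scale_cone[OF x c(1,2)])
    have y1: "max_abs N v y = 1" using c(3) by (simp add: y_def)
    have small: "\<forall>i. y i \<in> k \<and> v (y i) \<le> 1"
    proof
      fix i
      show "y i \<in> k \<and> v (y i) \<le> 1"
        using coneD[OF y, of i] max_abs_ge[of i N v y] y1 V.v_0 by (cases "i \<le> N") auto
    qed
    have gy: "map_coords N g y = (\<lambda>i. c ^ d * map_coords N g x i)"
      unfolding y_def using poly_eval_scale[OF g] by (auto simp: map_coords_def)
    have "max_abs N v (map_coords N g y) = v c ^ d * max_abs N v (map_coords N g x)"
      unfolding gy using max_abs_scale[OF v power[OF c(1)] img[OF x], of d] V.v_power[OF c(1)] by simp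
    then have lgy: "ln (max_abs N v (map_coords N g y)) = real d * ln (v c) + ln (max_abs N v (map_coords N g x))"
      using V.v_pos[OF c(1,2)] max_abs_pos[OF v img[OF x]] by (simp add: ln_mult ln_realpow)
    have "v c * max_abs N v x = 1" using max_abs_scale[OF v c(1) x] c(3) by simp
    then have "ln (v c) + ln (max_abs N v x) = 0"
      using V.v_pos[OF c(1,2)] max_abs_pos[OF v x] by (metis ln_mult ln_one less_numeral_extra(3))
    then have "real d * ln (v c) + real d * ln (max_abs N v x) = 0" by (simp add: distrib_left[symmetric])
    then have eq: "ln (max_abs N v (map_coords N g x)) - real d * ln (max_abs N v x) = ln (max_abs N v (map_coords N g y))"
      using lgy by linarith
    define M where "M = max_abs N v (map_coords N g y)"
    have Mpos: "M > 0" unfolding M_def by (rule max_abs_pos[OF v img[OF y]])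
    have ge1: "C1 v \<ge> 1" "ar v * C2 v \<ge> 1" using C1(1) arC v by (auto simp: place_const_def)
    have "M \<le> C1 v" unfolding M_def
    proof (rule max_abs_le)
      fix i assume i: "i \<le> N"
      have "v (poly_eval (g i) y) \<le> C1 v" using order_trans[OF Cg(2)[OF i v small] C1(2)] i v by simp
      then show "v (map_coords N g y i) \<le> C1 v" using i by (simp add: map_coords_def)
    qed
    moreover have "C1 v * 1 \<le> C v" unfolding C_def using ge1 by (intro mult_left_mono) auto
    ultimately have up: "M \<le> C v" by simp
    \<comment> \<open>At a coordinate of size 1 the identity for \<open>y j ^ (e + d)\<close> bounds
      \<open>M\<close> from below.\<close>
    obtain j where j: "j \<le> N" "v (y j) = 1" using y1 max_abs_attained by metis
    have "y j ^ (e + d) = (\<Sum>i\<le>N. poly_eval (A j i) y * poly_eval (g i) y)"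
      using arg_cong[OF A(2)[OF j(1)], of "\<lambda>F. poly_eval F y"] by (simp add: poly_eval_power poly_eval_sum poly_eval_mult)
    moreover have "v (y j ^ (e + d)) = 1" using V.v_power small j(2) by simp
    moreover have "v (\<Sum>i\<le>N. poly_eval (A j i) y * poly_eval (g i) y) \<le> ar v * (C2 v * M)"
      unfolding ar_def
    proof (rule sum_bound[OF v finite_atMost])
      fix i assume "i \<in> {..N}"
      then have i: "i \<le> N" by simp
      have Ak: "poly_eval (A j i) y \<in> k" using small by (intro poly_eval_in forms_lookup[OF zero A(1)[OF i j(1)]]) auto
      have gk: "poly_eval (g i) y \<in> k" using small by (intro poly_eval_in forms_lookup[OF zero g[OF i]]) auto
      show "poly_eval (A j i) y * poly_eval (g i) y \<in> k" by (rule mult[OF Ak gk])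
      have "v (poly_eval (A j i) y) \<le> C2 v" using order_trans[OF CA(2)[OF i j(1) v small] C2(2)] i j v by simp
      moreover have "v (poly_eval (g i) y) \<le> M"
        using max_abs_ge[OF i, of v "map_coords N g y"] i by (simp add: M_def map_coords_def)
      ultimately show "v (poly_eval (A j i) y * poly_eval (g i) y) \<le> C2 v * M"
        unfolding V.v_mult[OF Ak gk] using V.nonneg[OF Ak] V.nonneg[OF gk] by (intro mult_mono) auto
    next
      have "C2 v \<ge> 1" using C2(1) v by (auto simp: place_const_def)
      then show "0 \<le> C2 v * M" using Mpos by simp
    qed
    ultimately have "1 \<le> (ar v * C2 v) * M" by (simp add: mult.assoc)
    also have "\<dots> \<le> C v * M"
    proof (rule mult_right_mono)
      have "1 * (ar v * C2 v) \<le> C1 v * (ar v * C2 v)" using ge1 by (intro mult_right_mono) auto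
      then show "ar v * C2 v \<le> C v" by (simp add: C_def)
    qed (use Mpos in simp)
    finally have lo: "1 \<le> C v * M" .
    have Cpos: "C v > 0" using C v by (force simp: place_const_def)
    have "0 \<le> ln (C v * M)" using lo by simp
    then have "0 \<le> ln (C v) + ln M" using Cpos Mpos by (simp add: ln_mult)
    moreover have "ln M \<le> ln (C v)" using up Mpos Cpos by simp
    ultimately show ?thesis unfolding eq M_def[symmetric] by linarith
  qed
  then show ?thesis using that C by blast
qed

end

subsection \<open>Sums of local heights along an orbit\<close>

lemma ereal_divide_pos: "0 < r \<Longrightarrow> ereal x / ereal r = ereal (x / r)"
  by simp

context number_field_gen
begin

text \<open>\<open>E\<close> has coefficients in the ring of integers and so serves as its own
  \<open>E'\<close>. Away from the divisor the local heights are real, and the inequality can be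
  written without extended reals.\<close>

lemma vojta_bound:
  assumes nf: "number_field k" and vojta: "vojta_conjecture N e E"
    and E: "E \<in> forms N (ring_of_integers k) e" "E \<noteq> 0"
    and S: "finite S" "S \<subseteq> places k" and \<epsilon>: "\<epsilon> > 0"
  shows "\<exists>\<H> C. finite \<H> \<and> (\<forall>H\<in>\<H>. \<exists>b\<ge>1. H \<in> forms N Qbar b \<and> H \<noteq> 0) \<and>
    (\<forall>x\<in>cone N k. proj_point x \<notin> (\<Union>H\<in>\<H>. zero_locus N {H}) \<longrightarrow> poly_eval E x \<noteq> 0 \<longrightarrow>
       (\<Sum>v\<in>S. local_height_at N e E v x) < (real N + 1 + \<epsilon>) * height N x + C)"
proof -
  have Ek: "E \<in> forms N k e" by (rule forms_mono_field[OF _ E(1)]) (auto simp: ring_of_integers_def)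
  have "same_divisor E E" unfolding same_divisor_def by (intro exI[of _ 1]) simp
  then have prem: "number_field k \<and> div_form N (ring_of_integers k) e E \<and> same_divisor E E \<and>
      finite S \<and> S \<subseteq> places k \<and> \<epsilon> > 0"
    using nf E S \<epsilon> by (simp add: div_form_def)
  obtain \<H> C where H: "finite \<H>" "\<forall>H\<in>\<H>. \<exists>b\<ge>1. div_form N Qbar b H"
    and le: "\<forall>P\<in>proj_space N k - (\<Union>H\<in>\<H>. div_support N H).
       (\<Sum>v\<in>S. local_height N k e E v P) < ereal ((real N + 1 + \<epsilon>) * weil_height N k P + C)"
    using mp[OF spec[OF spec[OF spec[OF spec[OF vojta[unfolded vojta_conjecture_def], of k], of E], of S], of \<epsilon>] prem] by blast
  have "(\<Sum>v\<in>S. local_height_at N e E v x) < (real N + 1 + \<epsilon>) * height N x + C"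
    if x: "x \<in> cone N k" and nH: "proj_point x \<notin> (\<Union>H\<in>\<H>. zero_locus N {H})" and nz: "poly_eval E x \<noteq> 0" for x
  proof -
    have "proj_point x \<in> proj_space N k - (\<Union>H\<in>\<H>. div_support N H)"
      using x nH by (auto simp: proj_space_def div_support_def)
    from bspec[OF le this] have "(\<Sum>v\<in>S. local_height N k e E v (proj_point x)) < ereal ((real N + 1 + \<epsilon>) * height N x + C)"
      by (simp only: weil_height_eq[OF x])
    also have "(\<Sum>v\<in>S. local_height N k e E v (proj_point x)) = (\<Sum>v\<in>S. ereal (local_height_at N e E v x))"
      using S(2) by (intro sum.cong refl local_height_eq Ek x nz) auto
    finally show ?thesis by simp
  qed
  then show ?thesis using H unfolding div_form_def by (intro exI[of _ \<H>] exI[of _ C] conjI) auto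
qed

lemma infsum_local_height:
  assumes D: "D \<in> forms N k e" and y: "y \<in> cone N k" "poly_eval D y \<noteq> 0"
  shows "(\<Sum>\<^sub>\<infinity>v\<in>places k - S. local_height N k e D v (proj_point y)) =
     ereal (\<Sum>\<^sub>\<infinity>v\<in>places k - S. local_height_at N e D v y)"
proof -
  have "(\<Sum>\<^sub>\<infinity>v\<in>places k - S. local_height N k e D v (proj_point y)) = (\<Sum>\<^sub>\<infinity>v\<in>places k - S. ereal (local_height_at N e D v y))"
    by (intro infsum_cong local_height_eq D y) auto
  then show ?thesis using infsum_ereal[OF finite_support_subset[OF support_local_height_at[OF D y]], of "places k - S"] by simp
qed

lemma local_heights_bounded_below:
  assumes D: "D \<in> forms N k e"
  shows "\<exists>B. \<forall>y\<in>cone N k. poly_eval D y \<noteq> 0 \<longrightarrow> - B \<le> (\<Sum>\<^sub>\<infinity>v\<in>places k - S. local_height_at N e D v y)"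
proof -
  obtain C where C: "place_const C"
    "\<And>v x. v \<in> places k \<Longrightarrow> x \<in> cone N k \<Longrightarrow> poly_eval D x \<noteq> 0 \<Longrightarrow> - (weight v * ln (C v)) \<le> local_height_at N e D v x"
    using local_height_at_lower[OF D] by blast
  have "- (\<Sum>\<^sub>\<infinity>v\<in>places k - S. weight v * ln (C v)) \<le> (\<Sum>\<^sub>\<infinity>v\<in>places k - S. local_height_at N e D v y)"
    if y: "y \<in> cone N k" "poly_eval D y \<noteq> 0" for y
  proof -
    have "(\<Sum>\<^sub>\<infinity>v\<in>places k - S. - (weight v * ln (C v))) \<le> (\<Sum>\<^sub>\<infinity>v\<in>places k - S. local_height_at N e D v y)"
    proof (rule infsum_le)
      show "finite_support (places k - S) (\<lambda>v. - (weight v * ln (C v)))"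
        by (rule finite_support_subset[OF finite_support_uminus[OF support_place_const[OF C(1)]]]) auto
      show "finite_support (places k - S) (\<lambda>v. local_height_at N e D v y)"
        by (rule finite_support_subset[OF support_local_height_at[OF D y]]) auto
    qed (use C(2) y in auto)
    then show ?thesis by (simp add: infsum_uminus)
  qed
  then show ?thesis by blast
qed

lemma height_map_le:
  assumes g: "\<And>i. i \<le> N \<Longrightarrow> g i \<in> forms N k d"
    and nz: "\<And>x. x \<in> cone N Qbar \<Longrightarrow> \<exists>i\<le>N. poly_eval (g i) x \<noteq> 0"
  shows "\<exists>B. \<forall>x\<in>cone N k. height N (map_coords N g x) \<le> real d * height N x + B"
proof -
  obtain C where C: "place_const C"
    "\<And>v x. v \<in> places k \<Longrightarrow> x \<in> cone N k \<Longrightarrow>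
       \<bar>ln (max_abs N v (map_coords N g x)) - real d * ln (max_abs N v x)\<bar> \<le> ln (C v)"
    using morphism_bound[OF g nz] by blast
  have "height N (map_coords N g x) \<le> real d * height N x + (\<Sum>\<^sub>\<infinity>v\<in>places k. weight v * ln (C v))"
    if x: "x \<in> cone N k" for x
  proof -
    have "x \<in> cone N Qbar" using x cone_mono[OF k_Qbar] by blast
    then have gx: "map_coords N g x \<in> cone N k" by (intro map_coords_cone[of N g d] g x nz)
    have "height N (map_coords N g x) \<le> (\<Sum>\<^sub>\<infinity>v\<in>places k. real d * (weight v * ln (max_abs N v x)) + weight v * ln (C v))"
      unfolding height_def
    proof (rule infsum_le)
      show "finite_support (places k) (\<lambda>v. weight v * ln (max_abs N v (map_coords N g x)))"
        by (rule support_weight_max_abs[OF gx])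
      show "finite_support (places k) (\<lambda>v. real d * (weight v * ln (max_abs N v x)) + weight v * ln (C v))"
        by (rule finite_support_add[OF finite_support_cmult[OF support_weight_max_abs[OF x]] support_place_const[OF C(1)]])
      fix v assume v: "v \<in> places k"
      have "ln (max_abs N v (map_coords N g x)) \<le> real d * ln (max_abs N v x) + ln (C v)" using C(2)[OF v x] by linarith
      from mult_left_mono[OF this weight_nonneg, of v]
      show "weight v * ln (max_abs N v (map_coords N g x)) \<le> real d * (weight v * ln (max_abs N v x)) + weight v * ln (C v)"
        by (simp add: algebra_simps)
    qed
    also have "\<dots> = (\<Sum>\<^sub>\<infinity>v\<in>places k. real d * (weight v * ln (max_abs N v x))) + (\<Sum>\<^sub>\<infinity>v\<in>places k. weight v * ln (C v))"
      by (rule infsum_add[OF finite_support_summable[OF finite_support_cmult[OF support_weight_max_abs[OF x]]]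
        finite_support_summable[OF support_place_const[OF C(1)]]])
    also have "(\<Sum>\<^sub>\<infinity>v\<in>places k. real d * (weight v * ln (max_abs N v x))) = real d * height N x"
      unfolding height_def by (intro infsum_cmult_right finite_support_summable support_weight_max_abs x)
    finally show ?thesis .
  qed
  then show ?thesis by blast
qed

text \<open>The lower bound in \<open>morphism_bound\<close> compares the local heights of
  \<open>D\<close> at the image with those of the pullback \<open>E\<close>. Passing from
  \<open>E\<close> to its factor \<open>A\<close> costs the local height of the cofactor, which is
  bounded below; for this the cofactor is first brought into \<open>k\<close>.\<close>

lemma local_heights_pullback:
  assumes g: "\<And>i. i \<le> N \<Longrightarrow> g i \<in> forms N k d"
    and nz: "\<And>x. x \<in> cone N Qbar \<Longrightarrow> \<exists>i\<le>N. poly_eval (g i) x \<noteq> 0"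
    and D: "D \<in> forms N k e" and A: "A \<in> forms N k a" and dvd: "A dvd poly_subst D g"
  shows "\<exists>B. \<forall>x\<in>cone N k. poly_eval D (map_coords N g x) \<noteq> 0 \<longrightarrow>
     (\<Sum>\<^sub>\<infinity>v\<in>places k - S. local_height_at N a A v x) - B \<le>
     (\<Sum>\<^sub>\<infinity>v\<in>places k - S. local_height_at N e D v (map_coords N g x))"
proof -
  define E where "E = poly_subst D g"
  have E: "E \<in> forms N k (e * d)" unfolding E_def by (rule forms_subst[OF D g])
  obtain G0 where G0: "E = A * G0" using dvd by (auto simp: E_def)
  obtain G where G: "E = A * G" "\<And>m. lk G m \<in> k"
    using division_descent[OF cfield_axioms G0 forms_lookup[OF zero E] forms_lookup[OF zero A]] by blast
  obtain C where C: "place_const C" "\<And>v x. v \<in> places k \<Longrightarrow> x \<in> cone N k \<Longrightarrow> poly_eval E x \<noteq> 0 \<Longrightarrow>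
       local_height_at N a A v x - weight v * ln (C v) \<le> local_height_at N (e * d) E v x"
    using local_height_at_factor[OF E A G(2,1)] by blast
  obtain C' where C': "place_const C'"
    "\<And>v x. v \<in> places k \<Longrightarrow> x \<in> cone N k \<Longrightarrow>
       \<bar>ln (max_abs N v (map_coords N g x)) - real d * ln (max_abs N v x)\<bar> \<le> ln (C' v)"
    using morphism_bound[OF g nz] by blast
  define b where "b = (\<lambda>v. weight v * ln (C v) + real e * (weight v * ln (C' v)))"
  have b: "finite_support (places k) b" unfolding b_def
    by (rule finite_support_add[OF support_place_const[OF C(1)] finite_support_cmult[OF support_place_const[OF C'(1)]]])
  have "(\<Sum>\<^sub>\<infinity>v\<in>places k - S. local_height_at N a A v x) - (\<Sum>\<^sub>\<infinity>v\<in>places k - S. b v) \<le>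
     (\<Sum>\<^sub>\<infinity>v\<in>places k - S. local_height_at N e D v (map_coords N g x))"
    if x: "x \<in> cone N k" and Dy: "poly_eval D (map_coords N g x) \<noteq> 0" for x
  proof -
    have "x \<in> cone N Qbar" using x cone_mono[OF k_Qbar] by blast
    then have gx: "map_coords N g x \<in> cone N k" by (intro map_coords_cone[of N g d] g x nz)
    have DE: "poly_eval D (map_coords N g x) = poly_eval E x" unfolding E_def by (rule poly_eval_map_coords[OF D])
    then have Ex: "poly_eval E x \<noteq> 0" using Dy by simp
    then have Ax: "poly_eval A x \<noteq> 0" by (auto simp: G(1) poly_eval_mult)
    have supp: "finite_support (places k - S) (\<lambda>v. local_height_at N a A v x)"
      "finite_support (places k - S) (\<lambda>v. local_height_at N e D v (map_coords N g x))" "finite_support (places k - S) b"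
      by (rule finite_support_subset[OF support_local_height_at[OF A x Ax]] finite_support_subset[OF support_local_height_at[OF D gx Dy]]
        finite_support_subset[OF b]; blast)+
    have le: "local_height_at N a A v x \<le> b v + local_height_at N e D v (map_coords N g x)" if v: "v \<in> places k - S" for v
    proof -
      have vk: "v \<in> places k" using v by simp
      have "real d * ln (max_abs N v x) \<le> ln (max_abs N v (map_coords N g x)) + ln (C' v)" using C'(2)[OF vk x] by linarith
      from mult_left_mono[OF mult_left_mono[OF this, of "real e"] weight_nonneg, of v]
      have "local_height_at N (e * d) E v x \<le> local_height_at N e D v (map_coords N g x) + real e * (weight v * ln (C' v))"
        by (simp add: local_height_at_def DE algebra_simps)
      then show ?thesis using C(2)[OF vk x Ex] by (simp add: b_def)
    qed
    have "(\<Sum>\<^sub>\<infinity>v\<in>places k - S. local_height_at N a A v x) \<le> (\<Sum>\<^sub>\<infinity>v\<in>places k - S. b v + local_height_at N e D v (map_coords N g x))"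
      by (rule infsum_le[OF supp(1) finite_support_add[OF supp(3,2)] le])
    also have "\<dots> = (\<Sum>\<^sub>\<infinity>v\<in>places k - S. b v) + (\<Sum>\<^sub>\<infinity>v\<in>places k - S. local_height_at N e D v (map_coords N g x))"
      by (rule infsum_add[OF finite_support_summable[OF supp(3)] finite_support_summable[OF supp(2)]])
    finally show ?thesis by simp
  qed
  then show ?thesis by blast
qed

text \<open>Four sets cover the exceptional points: \<open>X1\<close> holds the first n orbit
  points, which need not be images of orbit points under the n-th iterate; \<open>X2\<close> the
  images of points of bounded height; \<open>X3\<close> the images of the exceptional hypersurfaces
  in Vojta's conjecture; \<open>X4\<close> the points of bounded height for negative
  \<open>c - \<epsilon>\<close>.\<close>

theorem small_quotient_in_hypersurface:
  fixes n :: nat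
  assumes N: "N \<ge> 1" and d: "d \<ge> 2" and nf: "number_field k"
    and \<phi>: "proj_morphism N k d \<phi>"
    and D: "D \<in> forms N k e" and e: "e \<ge> 1"
    and A: "A \<in> forms N (ring_of_integers k) a" "A \<noteq> 0" "A dvd poly_subst D (iterate_forms \<phi> n)"
    and vojta: "vojta_conjecture N a A"
    and c: "c = (real a - (real N + 1)) / (real e * real d ^ n)"
    and P: "P \<in> proj_space N k" and S: "finite S" "S \<subseteq> places k" and \<epsilon>: "\<epsilon> > 0"
  shows "in_hypersurface N {Q \<in> orbit N \<phi> P. Q \<notin> div_support N D \<and> weil_height N k Q > 0 \<and>
      (\<Sum>\<^sub>\<infinity>v\<in>places k - S. local_height N k e D v Q) / ereal (real e * weil_height N k Q) \<le> ereal (c - \<epsilon>)}"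
    (is "in_hypersurface N ?X")
proof -
  define g where "g = iterate_forms \<phi> n"
  \<comment> \<open>The degree of the pullback of \<open>D\<close>, so that \<open>c * q\<close> is
    the coefficient of the height of \<open>x\<close> that remains after Vojta's inequality, apart
    from \<epsilon>'.\<close>
  define q where "q = real e * real d ^ n"
  have q: "q > 0" using d e by (simp add: q_def)
  have cq: "c * q = real a - (real N + 1)" using q by (simp add: c q_def[symmetric])
  have \<phi>k: "\<And>i. i \<le> N \<Longrightarrow> \<phi> i \<in> forms N k d" and \<phi>nz: "\<And>x. x \<in> cone N Qbar \<Longrightarrow> \<exists>i\<le>N. poly_eval (\<phi> i) x \<noteq> 0"
    using \<phi> by (auto simp: proj_morphism_def)
  have g: "\<And>i. i \<le> N \<Longrightarrow> g i \<in> forms N k (d ^ n)" unfolding g_def by (rule iterate_forms_in[OF \<phi>k])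
  have gnz: "\<exists>i\<le>N. poly_eval (g i) x \<noteq> 0" if "x \<in> cone N Qbar" for x
  proof -
    have "map_coords N g x \<in> cone N Qbar" unfolding g_def
      by (rule iterate_nonzero[OF forms_mono_field[OF k_Qbar \<phi>k] \<phi>nz that])
    then show ?thesis by (auto simp: cone_def map_coords_def)
  qed
  have Ak: "A \<in> forms N k a" by (rule forms_mono_field[OF _ A(1)]) (auto simp: ring_of_integers_def)
  \<comment> \<open>Half of what \<epsilon> becomes in terms of the height of \<open>x\<close>: the
    comparison below gains \<open>2 * \<epsilon>'\<close>, and Vojta's inequality uses up one
    \<open>\<epsilon>'\<close>.\<close>
  define \<epsilon>' where "\<epsilon>' = \<epsilon> * q / 2"
  have \<epsilon>': "\<epsilon>' > 0" using \<epsilon> q by (simp add: \<epsilon>'_def)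
  obtain \<H> B1 where \<H>: "finite \<H>" "\<And>H. H \<in> \<H> \<Longrightarrow> \<exists>b\<ge>1. H \<in> forms N Qbar b \<and> H \<noteq> 0"
    and B1: "\<And>x. x \<in> cone N k \<Longrightarrow> proj_point x \<notin> (\<Union>H\<in>\<H>. zero_locus N {H}) \<Longrightarrow> poly_eval A x \<noteq> 0 \<Longrightarrow>
       (\<Sum>v\<in>S. local_height_at N a A v x) < (real N + 1 + \<epsilon>') * height N x + B1"
    using vojta_bound[OF nf vojta A(1,2) S \<epsilon>'] by blast
  obtain B2 where B2: "\<And>y. y \<in> cone N k \<Longrightarrow> poly_eval D y \<noteq> 0 \<Longrightarrow> - B2 \<le> (\<Sum>\<^sub>\<infinity>v\<in>places k - S. local_height_at N e D v y)"
    using local_heights_bounded_below[OF D, of S] by blast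
  obtain B3 where B3: "\<And>x. x \<in> cone N k \<Longrightarrow> height N (map_coords N g x) \<le> real (d ^ n) * height N x + B3"
    using height_map_le[OF g gnz] by blast
  obtain B4 where B4: "\<And>x. x \<in> cone N k \<Longrightarrow> poly_eval D (map_coords N g x) \<noteq> 0 \<Longrightarrow>
     (\<Sum>\<^sub>\<infinity>v\<in>places k - S. local_height_at N a A v x) - B4 \<le>
     (\<Sum>\<^sub>\<infinity>v\<in>places k - S. local_height_at N e D v (map_coords N g x))"
    using local_heights_pullback[OF g gnz D Ak A(3)[folded g_def], of S] by blast
  \<comment> \<open>\<open>T\<close> and \<open>T'\<close> are the height bounds that come out of
    the two sign cases of \<open>c - \<epsilon>\<close>; the denominator of \<open>T'\<close> is
    positive in the case where it is used.\<close>
  define T where "T = (B1 + B4 + (c - \<epsilon>) * real e * B3) / \<epsilon>'"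
  define T' where "T' = B2 / (real e * (\<epsilon> - c))"
  define X1 where "X1 = (\<lambda>m. (proj_map N \<phi> ^^ m) P) ` {..<n}"
  define X2 where "X2 = proj_map N g ` {R \<in> proj_space N k. weil_height N k R \<le> T}"
  define X3 where "X3 = (\<Union>H\<in>\<H>. proj_map N g ` zero_locus N {H})"
  define X4 where "X4 = {Q \<in> proj_space N k. weil_height N k Q \<le> T'}"
  have "?X \<subseteq> X1 \<union> X2 \<union> X3 \<union> X4"
  proof
    fix Q assume QX: "Q \<in> ?X"
    then obtain m where m: "Q = (proj_map N \<phi> ^^ m) P" by (auto simp: orbit_def)
    show "Q \<in> X1 \<union> X2 \<union> X3 \<union> X4"
    proof (cases "m < n")
      case True
      then show ?thesis using m by (auto simp: X1_def)
    next
      case False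
      define R where "R = (proj_map N \<phi> ^^ (m - n)) P"
      have R: "R \<in> proj_space N k" unfolding R_def by (rule proj_map_iterate(2)[OF k_Qbar cfield_axioms \<phi>k \<phi>nz P])
      have "Q = (proj_map N \<phi> ^^ (n + (m - n))) P" using False m by simp
      then have "Q = (proj_map N \<phi> ^^ n) R" by (simp only: funpow_add o_apply R_def)
      then have QR: "Q = proj_map N g R" unfolding g_def by (simp only: proj_map_iterate(1)[OF k_Qbar cfield_axioms \<phi>k \<phi>nz R])
      obtain x where x: "x \<in> cone N k" "R = proj_point x" using R by (auto simp: proj_space_def)
      define y where "y = map_coords N g x"
      have "x \<in> cone N Qbar" using x(1) cone_mono[OF k_Qbar] by blast
      then have y: "y \<in> cone N k" unfolding y_def by (intro map_coords_cone[of N g "d ^ n"] g x gnz)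
      have Qy: "Q = proj_point y" unfolding QR x(2) y_def map_coords_def by (rule proj_map_point[OF g])
      have yQ: "y \<in> cone N Qbar" using y cone_mono[OF k_Qbar] by blast
      have Dy: "poly_eval D y \<noteq> 0"
        using QX zero_locus_iff[OF D yQ] by (simp add: Qy div_support_def)
      have Ax: "poly_eval A x \<noteq> 0"
      proof -
        have "poly_eval (poly_subst D g) x \<noteq> 0" using Dy poly_eval_map_coords[OF D, of g x] by (simp add: y_def)
        then show ?thesis using A(3) by (auto simp: g_def poly_eval_mult elim!: dvdE)
      qed
      define \<Lambda> where "\<Lambda> = (\<Sum>\<^sub>\<infinity>v\<in>places k - S. local_height_at N e D v y)"
      have hy: "height N y > 0" using QX weil_height_eq[OF y] by (simp add: Qy)
      have hy': "real e * height N y > 0" using hy e by simp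
      have "(\<Sum>\<^sub>\<infinity>v\<in>places k - S. local_height N k e D v Q) / ereal (real e * weil_height N k Q) \<le> ereal (c - \<epsilon>)"
        using QX by blast
      then have "ereal \<Lambda> / ereal (real e * height N y) \<le> ereal (c - \<epsilon>)"
        unfolding Qy \<Lambda>_def infsum_local_height[OF D y Dy] weil_height_eq[OF y] .
      moreover have "ereal \<Lambda> / ereal (real e * height N y) = ereal (\<Lambda> / (real e * height N y))"
        by (rule ereal_divide_pos[OF hy'])
      ultimately have "\<Lambda> / (real e * height N y) \<le> c - \<epsilon>" by (simp only: ereal_less_eq)
      then have up: "\<Lambda> \<le> (c - \<epsilon>) * (real e * height N y)" using hy' by (simp only: pos_divide_le_eq)
      show ?thesis
      \<comment> \<open>A negative \<open>c - \<epsilon>\<close> would reverse the inequality when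
        the bound for the height of the image is inserted. In that case the lower bound
        \<open>B2\<close> already limits the height of \<open>Q\<close>.\<close>
      proof (cases "c - \<epsilon> < 0")
        case True
        have "- B2 \<le> (c - \<epsilon>) * (real e * height N y)" using B2[OF y Dy] up by (simp add: \<Lambda>_def)
        then have "height N y * (real e * (\<epsilon> - c)) \<le> B2" by (simp add: algebra_simps)
        moreover have "real e * (\<epsilon> - c) > 0" using True e by simp
        ultimately have "height N y \<le> T'" unfolding T'_def by (simp add: pos_le_divide_eq)
        then have "Q \<in> X4" unfolding X4_def using y weil_height_eq[OF y] Qy by (auto simp: proj_space_def)
        then show ?thesis by blast
      next
        case False
        show ?thesis
        proof (cases "R \<in> (\<Union>H\<in>\<H>. zero_locus N {H})")
          case True
          then show ?thesis using QR by (auto simp: X3_def)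
        next
          case nR: False
          have "(\<Sum>\<^sub>\<infinity>v\<in>places k. local_height_at N a A v x) = (\<Sum>\<^sub>\<infinity>v\<in>places k - S. local_height_at N a A v x) + (\<Sum>v\<in>S. local_height_at N a A v x)"
            by (rule infsum_split_finite[OF support_local_height_at[OF Ak x(1) Ax] S])
          then have "real a * height N x = (\<Sum>\<^sub>\<infinity>v\<in>places k - S. local_height_at N a A v x) + (\<Sum>v\<in>S. local_height_at N a A v x)"
            using sum_local_height_at[OF Ak x(1) Ax] by simp
          moreover have "(\<Sum>v\<in>S. local_height_at N a A v x) < (real N + 1 + \<epsilon>') * height N x + B1"
            using B1[OF x(1) _ Ax] nR x(2) by simp
          moreover have "(\<Sum>\<^sub>\<infinity>v\<in>places k - S. local_height_at N a A v x) - B4 \<le> \<Lambda>"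
            using B4[OF x(1)] Dy by (simp add: y_def \<Lambda>_def)
          ultimately have "real a * height N x - ((real N + 1 + \<epsilon>') * height N x + B1) - B4 \<le> \<Lambda>" by linarith
          \<comment> \<open>All local heights of \<open>A\<close> sum to
            \<open>real a * height N x\<close>; after subtracting the part over \<open>S\<close>,
            the coefficient \<open>a - (N + 1)\<close> is \<open>c * q\<close>.\<close>
          then have lo: "(c * q - \<epsilon>') * height N x - B1 - B4 \<le> \<Lambda>" by (simp add: cq algebra_simps)
          have "(c - \<epsilon>) * (real e * height N y) \<le> (c - \<epsilon>) * (real e * (real (d ^ n) * height N x + B3))"
            using False B3[OF x(1)] by (intro mult_left_mono) (auto simp: y_def)
          also have "\<dots> = (c * q - \<epsilon> * q) * height N x + (c - \<epsilon>) * real e * B3"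
            by (simp add: q_def algebra_simps)
          finally have "(c * q - \<epsilon>') * height N x - B1 - B4 \<le> (c * q - \<epsilon> * q) * height N x + (c - \<epsilon>) * real e * B3"
            using lo up by linarith
          moreover have "\<epsilon> * q = 2 * \<epsilon>'" by (simp add: \<epsilon>'_def)
          ultimately have "height N x * \<epsilon>' \<le> B1 + B4 + (c - \<epsilon>) * real e * B3" by (simp add: algebra_simps)
          then have "height N x \<le> T" unfolding T_def using \<epsilon>' by (simp add: pos_le_divide_eq)
          then have "Q \<in> X2" unfolding X2_def QR using R weil_height_eq[OF x(1)] x(2) by auto
          then show ?thesis by blast
        qed
      qed
    qed
  qed
  moreover have sub: "proj_space N k \<subseteq> proj_space N Qbar" by (rule proj_space_mono[OF k_Qbar])
  have "X1 \<subseteq> proj_space N k" unfolding X1_def using proj_map_iterate(2)[OF k_Qbar cfield_axioms \<phi>k \<phi>nz P] by auto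
  then have "in_hypersurface N X1" using sub by (intro in_hypersurface_finite[OF N]) (auto simp: X1_def)
  moreover have "in_hypersurface N X2"
  proof (rule in_hypersurface_finite[OF N])
    show "finite X2" unfolding X2_def by (intro finite_imageI northcott_points nf)
    have "proj_map N g R \<in> proj_space N k" if "R \<in> proj_space N k" for R
      using proj_map_iterate[OF k_Qbar cfield_axioms \<phi>k \<phi>nz that, of n] by (simp add: g_def)
    then show "X2 \<subseteq> proj_space N Qbar" using sub by (auto simp: X2_def)
  qed
  moreover have "in_hypersurface N X3" unfolding X3_def
  proof (rule in_hypersurface_Union)
    show "finite ((\<lambda>H. proj_map N g ` zero_locus N {H}) ` \<H>)" using \<H>(1) by simp
    fix Y assume "Y \<in> (\<lambda>H. proj_map N g ` zero_locus N {H}) ` \<H>"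
    then obtain H where H: "H \<in> \<H>" "Y = proj_map N g ` zero_locus N {H}" by blast
    obtain b where b: "b \<ge> 1" "H \<in> forms N Qbar b" "H \<noteq> 0" using \<H>(2)[OF H(1)] by blast
    have "d ^ n \<ge> 1" using d by simp
    then show "in_hypersurface N Y" unfolding H(2)
      by (rule in_hypersurface_image[OF N _ b forms_mono_field[OF k_Qbar g] gnz])
  qed
  moreover have "in_hypersurface N X4"
    using sub by (intro in_hypersurface_finite[OF N]) (auto simp: X4_def northcott_points[OF nf])
  ultimately show ?thesis by (meson in_hypersurface_Un in_hypersurface_subset)
qed

text \<open>Almost all of the constants \<open>c v\<close> vanish, so the sum of the local heights
  outside \<open>S\<close> is bounded uniformly over the integral set.\<close>

lemma infsum_local_height_integral:
  fixes R :: "point set"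
  assumes D: "D \<in> forms N k e" and R: "integral_set N k S e D R"
  obtains B where "\<And>Q. Q \<in> R \<Longrightarrow> (\<Sum>\<^sub>\<infinity>v\<in>places k - S. local_height N k e D v Q) \<le> ereal B"
    "R \<subseteq> proj_space N k - div_support N D"
proof -
  obtain c where c: "finite {v \<in> places k - S. c v \<noteq> 0}"
    "R = {P \<in> proj_space N k - div_support N D. \<forall>v\<in>places k - S. local_height N k e D v P \<le> ereal (c v)}"
    using R unfolding integral_set_def by blast
  have "(\<Sum>\<^sub>\<infinity>v\<in>places k - S. local_height N k e D v Q) \<le> ereal (\<Sum>\<^sub>\<infinity>v\<in>places k - S. c v)" if Q: "Q \<in> R" for Q
  proof -
    obtain y where y: "y \<in> cone N k" "Q = proj_point y" using Q by (auto simp: c(2) proj_space_def)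
    have yQ: "y \<in> cone N Qbar" using y cone_mono[OF k_Qbar] by blast
    have Dy: "poly_eval D y \<noteq> 0" using Q zero_locus_iff[OF D yQ] by (simp add: c(2) y(2) div_support_def)
    have "(\<Sum>\<^sub>\<infinity>v\<in>places k - S. local_height_at N e D v y) \<le> (\<Sum>\<^sub>\<infinity>v\<in>places k - S. c v)"
    proof (rule infsum_le)
      show "finite_support (places k - S) (\<lambda>v. local_height_at N e D v y)"
        by (rule finite_support_subset[OF support_local_height_at[OF D y(1) Dy]]) auto
      show "finite_support (places k - S) c" using c(1) by (simp add: finite_support_def)
      fix v assume v: "v \<in> places k - S"
      then have "local_height N k e D v Q \<le> ereal (c v)" using Q by (simp add: c(2))
      then show "local_height_at N e D v y \<le> c v" using local_height_eq[OF _ D y(1) Dy, of v] v y(2) by simp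
    qed
    then show ?thesis unfolding y(2) infsum_local_height[OF D y(1) Dy] by simp
  qed
  then show ?thesis using that c(2) by blast
qed

end

theorem theorem4:
  fixes N d n deg_D deg_nc :: nat
    and k :: "complex set"
    and \<phi> :: "nat \<Rightarrow> mpoly"
    and D D_nc :: mpoly
    and c :: real
    and P :: point
    and S :: "(complex \<Rightarrow> real) set"
  assumes "N \<ge> 1" and "d \<ge> 2"
    and "number_field k"
    and "proj_morphism N k d \<phi>"
    and "div_form N (ring_of_integers k) deg_D D" and "deg_D \<ge> 1"
    and "nc_part N (div_pullback (iterate_forms \<phi> n) D) deg_nc D_nc"
    and "div_form N (ring_of_integers k) deg_nc D_nc"
    and "vojta_conjecture N deg_nc D_nc"
    and c_def: "c = (real deg_nc - (real N + 1)) / (real deg_D * real d ^ n)"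
    and "P \<in> proj_space N k"
    and "finite S" and "S \<subseteq> places k"
  shows "(\<forall>\<epsilon>>0. \<not> zariski_dense N
            {Q \<in> orbit N \<phi> P. Q \<notin> div_support N D \<and> weil_height N k Q > 0 \<and>
               (\<Sum>\<^sub>\<infinity>v\<in>places k - S. local_height N k deg_D D v Q)
                 / ereal (real deg_D * weil_height N k Q) \<le> ereal (c - \<epsilon>)})
       \<and> (c > 0 \<and> archimedean_places k \<subseteq> S \<longrightarrow>
            (\<forall>R. integral_set N k S deg_D D R \<longrightarrow> \<not> zariski_dense N (orbit N \<phi> P \<inter> R)))"
proof -
  obtain \<alpha> f where "number_field_gen k \<alpha> f" using number_field_gen_exists[OF assms(3)] by blast
  then interpret G: number_field_gen k \<alpha> f .
  have D: "D \<in> forms N k deg_D"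
    using assms(5) forms_mono_field[of "ring_of_integers k" k D N deg_D] by (auto simp: div_form_def ring_of_integers_def)
  have nc: "D_nc \<in> forms N (ring_of_integers k) deg_nc" "D_nc \<noteq> 0" "D_nc dvd poly_subst D (iterate_forms \<phi> n)"
    using assms(7,8) by (auto simp: div_form_def nc_part_def nc_subdivisor_def div_pullback_def)
  define small where "small = (\<lambda>\<epsilon>. {Q \<in> orbit N \<phi> P. Q \<notin> div_support N D \<and> weil_height N k Q > 0 \<and>
               (\<Sum>\<^sub>\<infinity>v\<in>places k - S. local_height N k deg_D D v Q)
                 / ereal (real deg_D * weil_height N k Q) \<le> ereal (c - \<epsilon>)})"
  have small: "in_hypersurface N (small \<epsilon>)" if "\<epsilon> > 0" for \<epsilon>
    unfolding small_def
    by (rule G.small_quotient_in_hypersurface[OF assms(1-4) D assms(6) nc assms(9) c_def assms(11-13) that])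
  have "in_hypersurface N (orbit N \<phi> P \<inter> R)" if c0: "c > 0" and R: "integral_set N k S deg_D D R" for R
  proof -
    obtain B where B: "\<And>Q. Q \<in> R \<Longrightarrow> (\<Sum>\<^sub>\<infinity>v\<in>places k - S. local_height N k deg_D D v Q) \<le> ereal B"
      "R \<subseteq> proj_space N k - div_support N D" using G.infsum_local_height_integral[OF D R] by blast
    \<comment> \<open>Above this height the uniform bound \<open>B\<close> makes the quotient at
      most \<open>c / 2\<close>, so the first part applies with \<epsilon> equal to
      \<open>c / 2\<close>; below it Northcott's theorem applies.\<close>
    define T where "T = max 0 (B / (real deg_D * (c / 2)))"
    define F where "F = {Q \<in> proj_space N k. weil_height N k Q \<le> T}"
    have "in_hypersurface N F" unfolding F_def using proj_space_mono[OF G.k_Qbar, of N]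
      by (intro in_hypersurface_finite[OF assms(1)] G.northcott_points assms(3)) auto
    then have "in_hypersurface N (small (c / 2) \<union> F)" using small[of "c / 2"] c0 by (simp add: in_hypersurface_Un)
    moreover have "orbit N \<phi> P \<inter> R \<subseteq> small (c / 2) \<union> F"
    proof
      fix Q assume Q: "Q \<in> orbit N \<phi> P \<inter> R"
      show "Q \<in> small (c / 2) \<union> F"
      proof (cases "weil_height N k Q \<le> T")
        case True
        then show ?thesis using Q B(2) by (auto simp: F_def)
      next
        case False
        then have h: "weil_height N k Q > 0" "B / (real deg_D * (c / 2)) < weil_height N k Q" by (auto simp: T_def)
        have dc: "real deg_D * (c / 2) > 0" "real deg_D * weil_height N k Q > 0" using assms(6) c0 h by auto
        have "B < weil_height N k Q * (real deg_D * (c / 2))" using h(2) dc(1) by (simp only: pos_divide_less_eq)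
        then have "B \<le> (c / 2) * (real deg_D * weil_height N k Q)" by (simp add: mult_ac)
        then have Bq: "B / (real deg_D * weil_height N k Q) \<le> c / 2" using dc(2) by (simp only: pos_divide_le_eq)
        have "(\<Sum>\<^sub>\<infinity>v\<in>places k - S. local_height N k deg_D D v Q) / ereal (real deg_D * weil_height N k Q) \<le>
            ereal B / ereal (real deg_D * weil_height N k Q)"
          using B(1) Q dc(2) by (intro ereal_divide_right_mono) auto
        also have "\<dots> = ereal (B / (real deg_D * weil_height N k Q))" by (rule ereal_divide_pos[OF dc(2)])
        also have "\<dots> \<le> ereal (c - c / 2)" using Bq by simp
        finally show ?thesis using Q B(2) h(1) by (auto simp: small_def)
      qed
    qed
    ultimately show ?thesis by (rule in_hypersurface_subset)
  qed
  note integral = this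
  show ?thesis
    by (intro conjI allI impI in_hypersurface_not_dense; (elim conjE)?;
        (rule small[unfolded small_def] | rule integral); assumption)
qed

end
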